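(* Let $G$ be a noncompact connected Lie group with a fixed left-invariant sub-Riemannian structure as described in the context. Let $w$ be a positive function on $G$ with $w,w^{-1}\in L^1_{\mathrm{loc}}$, and assume that \[ \nabla_{\mathcal H}w\in(\sqrt w\,L^2_{\mathcal H,\mathrm{loc}})\cap(w\,L^2_{\mathcal H,\mathrm{loc}}),\qquad \mathcal Lw\in L^1_{\mathrm{loc}}\cap(w\,L^1_{\mathrm{loc}}), \] and that the potential \[ V_w=-\frac{|\nabla_{\mathcal H}w|^2}{4w^2}-\frac{\mathcal Lw}{2w} \] satisfies $V_w\geq-m+1$ almost everywhere for some $m>0$. Then the map $f\mapsto fw^{1/2}$ induces an isometry of $\mathrm{Dom}(Q_w)$, endowed with the norm $f\mapsto\sqrt{m\|f\|^2_{L^2(\mu_w)}+Q_w(f)}$, onto $\mathrm{Dom}(Q_{V_w})$, endowed with the norm $f\mapsto\sqrt{m\|f\|_{L^2}^2+Q_{V_w}(f)}$. In particular, it intertwines $Q_w$ and $Q_{V_w}$, that is, $Q_{V_w}(fw^{1/2},gw^{1/2})=Q_w(f,g)$ for all $f,g\in\mathrm{Dom}(Q_w)$.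
   Context: Setting: $G$ is a noncompact connected Lie group with identity $e$; $\mu$ is a left Haar measure on $G$; $\delta_G$ is the modular function, with $\mu(Ax)=\delta_G(x)\mu(A)$; the Lie algebra $\mathfrak g$ is identified with the left-invariant vector fields and endowed with an inner product. $\mathcal{H}\subseteq\mathfrak g$ is a linear subspace generating $\mathfrak g$ as a Lie algebra, $(X_1,\dots,X_\nu)$ is an orthonormal basis of $\mathcal{H}$, and $\nabla_{\mathcal H} f=\sum_j (X_jf)X_j$ (derivatives in the distributional sense), so $|\nabla_{\mathcal H}f|^2=\sum_j|X_jf|^2$ and $\nabla_{\mathcal H}f\cdot\nabla_{\mathcal H}\overline g=\sum_j (X_jf)(X_j\overline g)$. $\mathcal L=\nabla_{\mathcal H}^*\nabla_{\mathcal H}=-\sum_j(X_j^2+c_jX_j)$ with $c_j=(X_j\delta_G)(e)$ (adjoint with respect to $\mu$). $L^p$, $L^p_{\mathrm{loc}}$ are taken with respect to $\mu$; $L^p_{\mathcal H}$, $L^p_{\mathcal H,\mathrm{loc}}$ are the spaces of sections $\sum_j f_jX_j$ of $\mathcal H$ with coefficients in $L^p$, $L^p_{\mathrm{loc}}$; $\mu_w$ is the measure with density $w$ with respect to $\mu$. The notation $\sqrt w\,L^2_{\mathcal H,\mathrm{loc}}$ means $\{\sqrt w\,F: F\in L^2_{\mathcal H,\mathrm{loc}}\}$, and similarly for the others. Forms: $\mathrm{Dom}(Q_w)=\{f\in L^2(\mu_w):\ \nabla_{\mathcal H}f\in L^2_{\mathcal H}(\mu_w)\}$, $Q_w(f,g)=\int_G\nabla_{\mathcal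 H}f\cdot\nabla_{\mathcal H}\overline g\,\mathrm{d}\mu_w$ (note that $L^2(\mu_w)\subseteq L^1_{\mathrm{loc}}$ since $w^{-1}\in L^1_{\mathrm{loc}}$). $\mathrm{Dom}(Q_{V_w})=\{f\in L^2:\ \nabla_{\mathcal H}f\in L^2_{\mathcal H},\ f\sqrt{V_w+m}\in L^2\}$, $Q_{V_w}(f,g)=\int_G(\nabla_{\mathcal H}f\cdot\nabla_{\mathcal H}\overline g+V_wf\overline g)\,\mathrm{d}\mu$. We write $Q(f)=Q(f,f)$ for a form $Q$. *)

theory Defs
  imports
    "HOL-Analysis.Analysis"
    "HOL-Algebra.Group"
    "HOL-Library.Function_Algebras"
begin

section \<open>Smooth functions and Lie groups\<close>

primrec ck_on :: "nat \<Rightarrow> 'a::real_normed_vector set \<Rightarrow> ('a \<Rightarrow> 'b::real_normed_vector) \<Rightarrow> bool" where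
  "ck_on 0 S f \<longleftrightarrow> continuous_on S f"
| "ck_on (Suc k) S f \<longleftrightarrow>
     (\<forall>x\<in>S. f differentiable (at x)) \<and> (\<forall>v. ck_on k S (\<lambda>x. frechet_derivative f (at x) v))"

text \<open>Only used for open sets in finite-dimensional spaces.\<close>

definition smooth_on :: "'a::real_normed_vector set \<Rightarrow> ('a \<Rightarrow> 'b::real_normed_vector) \<Rightarrow> bool" where
  "smooth_on S f \<longleftrightarrow> (\<forall>k. ck_on k S f)"

text \<open>A chart is a pair of its domain and the coordinate map. Atlases need not be maximal: all notions
  below depend on the atlas only through the smooth structure that it generates.\<close>

type_synonym ('g, 'e) chart = "'g set \<times> ('g \<Rightarrow> 'e)"

definition chart :: "('g::topological_space, 'e::euclidean_space) chart \<Rightarrow> bool" where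
  "chart c \<longleftrightarrow> (case c of (U, \<phi>) \<Rightarrow>
     open U \<and> open (\<phi> ` U) \<and> inj_on \<phi> U \<and> homeomorphism U (\<phi> ` U) \<phi> (inv_into U \<phi>))"

definition smooth_atlas :: "('g::topological_space, 'e::euclidean_space) chart set \<Rightarrow> bool" where
  "smooth_atlas A \<longleftrightarrow>
     (\<forall>c\<in>A. chart c) \<and> \<Union> (fst ` A) = UNIV \<and>
     (\<forall>(U, \<phi>)\<in>A. \<forall>(V, \<psi>)\<in>A. smooth_on (\<phi> ` (U \<inter> V)) (\<lambda>a. \<psi> (inv_into U \<phi> a)))"

text \<open>The group occupies the whole type, so that its topology and Borel sets are those of the type;
  the Hausdorff and second countability axioms are in the sort.\<close>

definition lie_group ::
    "('g::{t2_space, second_countable_topology}) monoid \<Rightarrow> ('g, 'e::euclidean_space) chart set \<Rightarrow> bool" where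
  "lie_group G A \<longleftrightarrow>
     Group.group G \<and> carrier G = UNIV \<and> smooth_atlas A \<and>
     continuous_on UNIV (\<lambda>(x, y). x \<otimes>\<^bsub>G\<^esub> y) \<and> continuous_on UNIV (\<lambda>x. inv\<^bsub>G\<^esub> x) \<and>
     (\<forall>(U, \<phi>)\<in>A. \<forall>(V, \<psi>)\<in>A. \<forall>(W, \<theta>)\<in>A.
        smooth_on {(a, b). a \<in> \<phi> ` U \<and> b \<in> \<psi> ` V \<and> inv_into U \<phi> a \<otimes>\<^bsub>G\<^esub> inv_into V \<psi> b \<in> W}
          (\<lambda>(a, b). \<theta> (inv_into U \<phi> a \<otimes>\<^bsub>G\<^esub> inv_into V \<psi> b))) \<and>
     (\<forall>(U, \<phi>)\<in>A. \<forall>(W, \<theta>)\<in>A.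
        smooth_on {a \<in> \<phi> ` U. inv\<^bsub>G\<^esub> (inv_into U \<phi> a) \<in> W}
          (\<lambda>a. \<theta> (inv\<^bsub>G\<^esub> (inv_into U \<phi> a))))"

definition smooth_funs :: "('g::topological_space, 'e::euclidean_space) chart set \<Rightarrow> ('g \<Rightarrow> real) set" where
  "smooth_funs A = {f. \<forall>(U, \<phi>)\<in>A. smooth_on (\<phi> ` U) (\<lambda>a. f (inv_into U \<phi> a))}"

definition test_funs :: "('g::topological_space, 'e::euclidean_space) chart set \<Rightarrow> ('g \<Rightarrow> real) set" where
  "test_funs A = {f \<in> smooth_funs A. compact (closure {x. f x \<noteq> 0})}"


section \<open>The Lie algebra and sub-Riemannian structures\<close>

text \<open>Smooth vector fields are the derivations of the algebra of real-valued smooth functions. They are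
  extended by zero to functions that are not smooth, so that equality of vector fields is equality in
  HOL. Sums and products of functions are pointwise.\<close>

type_synonym 'g vfield = "('g \<Rightarrow> real) \<Rightarrow> ('g \<Rightarrow> real)"

definition vf_scale :: "real \<Rightarrow> 'g vfield \<Rightarrow> 'g vfield" where
  "vf_scale c X = (\<lambda>f x. c * X f x)"

interpretation vf: vector_space "vf_scale :: real \<Rightarrow> 'g vfield \<Rightarrow> 'g vfield"
  by unfold_locales (auto simp: vf_scale_def fun_eq_iff algebra_simps)

definition vector_fields :: "('g::topological_space, 'e::euclidean_space) chart set \<Rightarrow> 'g vfield set" where
  "vector_fields A = {X.
     (\<forall>f. f \<notin> smooth_funs A \<longrightarrow> X f = 0) \<and>
     (\<forall>f\<in>smooth_funs A. X f \<in> smooth_funs A) \<and>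
     (\<forall>f\<in>smooth_funs A. \<forall>g\<in>smooth_funs A. X (f + g) = X f + X g) \<and>
     (\<forall>f\<in>smooth_funs A. \<forall>c. X (\<lambda>x. c * f x) = (\<lambda>x. c * X f x)) \<and>
     (\<forall>f\<in>smooth_funs A. \<forall>g\<in>smooth_funs A. X (f * g) = f * X g + X f * g)}"

definition lie_algebra ::
    "('g::topological_space) monoid \<Rightarrow> ('g, 'e::euclidean_space) chart set \<Rightarrow> 'g vfield set" where
  "lie_algebra G A = {X \<in> vector_fields A.
     \<forall>f\<in>smooth_funs A. \<forall>y. X (\<lambda>x. f (y \<otimes>\<^bsub>G\<^esub> x)) = (\<lambda>x. X f (y \<otimes>\<^bsub>G\<^esub> x))}"

definition lie_bracket :: "'g vfield \<Rightarrow> 'g vfield \<Rightarrow> 'g vfield" where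
  "lie_bracket X Y = (\<lambda>f. X (Y f) - Y (X f))"

definition lie_subalgebra ::
    "('g::topological_space) monoid \<Rightarrow> ('g, 'e::euclidean_space) chart set \<Rightarrow> 'g vfield set \<Rightarrow> bool" where
  "lie_subalgebra G A L \<longleftrightarrow>
     L \<subseteq> lie_algebra G A \<and> vf.subspace L \<and> (\<forall>X\<in>L. \<forall>Y\<in>L. lie_bracket X Y \<in> L)"

definition inner_product_on :: "'g vfield set \<Rightarrow> ('g vfield \<Rightarrow> 'g vfield \<Rightarrow> real) \<Rightarrow> bool" where
  "inner_product_on L ip \<longleftrightarrow>
     (\<forall>X\<in>L. \<forall>Y\<in>L. ip X Y = ip Y X) \<and>
     (\<forall>X\<in>L. \<forall>Y\<in>L. \<forall>Z\<in>L. ip (X + Y) Z = ip X Z + ip Y Z) \<and>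
     (\<forall>c. \<forall>X\<in>L. \<forall>Y\<in>L. ip (vf_scale c X) Y = c * ip X Y) \<and>
     (\<forall>X\<in>L. X \<noteq> 0 \<longrightarrow> ip X X > 0)"

text \<open>The orthonormal basis is indexed by \<open>0, \<dots>, \<nu> - 1\<close>.\<close>

definition sub_riemannian ::
    "('g::topological_space) monoid \<Rightarrow> ('g, 'e::euclidean_space) chart set \<Rightarrow>
     ('g vfield \<Rightarrow> 'g vfield \<Rightarrow> real) \<Rightarrow> 'g vfield set \<Rightarrow> nat \<Rightarrow> (nat \<Rightarrow> 'g vfield) \<Rightarrow> bool" where
  "sub_riemannian G A ip H \<nu> X \<longleftrightarrow>
     inner_product_on (lie_algebra G A) ip \<and>
     H \<subseteq> lie_algebra G A \<and> vf.subspace H \<and> lie_subalgebra G A hull H = lie_algebra G A \<and>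
     vf.span (X ` {..<\<nu>}) = H \<and>
     (\<forall>i<\<nu>. \<forall>j<\<nu>. ip (X i) (X j) = (if i = j then 1 else 0))"


section \<open>Haar measure and modular function\<close>

text \<open>On a second countable locally compact space, local finiteness already implies regularity.\<close>

definition left_haar_measure :: "('g::topological_space) monoid \<Rightarrow> 'g measure \<Rightarrow> bool" where
  "left_haar_measure G \<mu> \<longleftrightarrow>
     sets \<mu> = sets borel \<and> emeasure \<mu> UNIV \<noteq> 0 \<and>
     (\<forall>K. compact K \<longrightarrow> emeasure \<mu> K < \<infinity>) \<and>
     (\<forall>x. \<forall>B\<in>sets \<mu>. emeasure \<mu> ((\<lambda>y. x \<otimes>\<^bsub>G\<^esub> y) ` B) = emeasure \<mu> B)"

definition modular_function :: "('g::topological_space) monoid \<Rightarrow> 'g measure \<Rightarrow> ('g \<Rightarrow> real) \<Rightarrow> bool" where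
  "modular_function G \<mu> \<delta> \<longleftrightarrow>
     (\<forall>x. \<delta> x > 0 \<and>
       (\<forall>B\<in>sets \<mu>. emeasure \<mu> ((\<lambda>y. y \<otimes>\<^bsub>G\<^esub> x) ` B) = ennreal (\<delta> x) * emeasure \<mu> B))"


section \<open>Lebesgue spaces and distributional derivatives\<close>

text \<open>Elements of these spaces are functions; equality almost everywhere is treated explicitly.\<close>

definition Lp :: "nat \<Rightarrow> 'g measure \<Rightarrow> ('g \<Rightarrow> 'b::{banach, second_countable_topology}) set" where
  "Lp p M = {f \<in> borel_measurable M. integrable M (\<lambda>x. norm (f x) ^ p)}"

definition Lp_loc ::
    "nat \<Rightarrow> ('g::topological_space) measure \<Rightarrow> ('g \<Rightarrow> 'b::{banach, second_countable_topology}) set" where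
  "Lp_loc p M = {f \<in> borel_measurable M. \<forall>K. compact K \<longrightarrow> set_integrable M K (\<lambda>x. norm (f x) ^ p)}"

text \<open>\<open>dist_rep A \<mu> T f h\<close>: if \<open>T\<close> is the formal transpose (with respect to \<open>\<mu>\<close>) of a differential
  operator \<open>P\<close> with real smooth coefficients, then the distribution \<open>P f\<close> is represented by the locally
  integrable function \<open>h\<close>. As \<open>P\<close> is real, real-valued test functions suffice also for complex \<open>f\<close>.\<close>

definition dist_rep ::
    "('g::topological_space, 'e::euclidean_space) chart set \<Rightarrow> 'g measure \<Rightarrow>
     (('g \<Rightarrow> real) \<Rightarrow> ('g \<Rightarrow> real)) \<Rightarrow>
     ('g \<Rightarrow> 'b::{banach, second_countable_topology}) \<Rightarrow> ('g \<Rightarrow> 'b) \<Rightarrow> bool" where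
  "dist_rep A \<mu> T f h \<longleftrightarrow>
     f \<in> Lp_loc 1 \<mu> \<and> h \<in> Lp_loc 1 \<mu> \<and>
     (\<forall>\<phi>\<in>test_funs A. (\<integral>x. T \<phi> x *\<^sub>R f x \<partial>\<mu>) = (\<integral>x. \<phi> x *\<^sub>R h x \<partial>\<mu>))"

text \<open>The formal adjoint of \<open>X\<close> is \<open>-(X + c)\<close> with \<open>c = (X \<delta>)(e)\<close>: since \<open>X\<close> generates right
  translations, \<open>\<integral> X \<psi> d\<mu> = - c \<integral> \<psi> d\<mu>\<close> for test functions \<open>\<psi>\<close>.\<close>

definition vf_adjoint :: "'g monoid \<Rightarrow> ('g \<Rightarrow> real) \<Rightarrow> 'g vfield \<Rightarrow> 'g vfield" where
  "vf_adjoint G \<delta> X \<phi> = (\<lambda>x. - (X \<phi> x + X \<delta> \<one>\<^bsub>G\<^esub> * \<phi> x))"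

text \<open>\<open>\<L> = - \<Sum>\<^sub>j (X\<^sub>j\<^sup>2 + c\<^sub>j X\<^sub>j) = \<Sum>\<^sub>j X\<^sub>j\<^sup>* X\<^sub>j\<close>. It is formally symmetric, hence its own formal
  transpose.\<close>

definition sub_laplacian ::
    "'g monoid \<Rightarrow> ('g \<Rightarrow> real) \<Rightarrow> nat \<Rightarrow> (nat \<Rightarrow> 'g vfield) \<Rightarrow> ('g \<Rightarrow> real) \<Rightarrow> ('g \<Rightarrow> real)" where
  "sub_laplacian G \<delta> \<nu> X \<phi> =
     (\<lambda>x. - (\<Sum>j<\<nu>. X j (X j \<phi>) x + X j \<delta> \<one>\<^bsub>G\<^esub> * X j \<phi> x))"

definition has_weak_deriv ::
    "('g::topological_space) monoid \<Rightarrow> ('g, 'e::euclidean_space) chart set \<Rightarrow> 'g measure \<Rightarrow>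
     ('g \<Rightarrow> real) \<Rightarrow> 'g vfield \<Rightarrow> ('g \<Rightarrow> 'b::{banach, second_countable_topology}) \<Rightarrow> ('g \<Rightarrow> 'b) \<Rightarrow> bool" where
  "has_weak_deriv G A \<mu> \<delta> X f h \<longleftrightarrow> dist_rep A \<mu> (vf_adjoint G \<delta> X) f h"

definition has_weak_laplacian ::
    "('g::topological_space) monoid \<Rightarrow> ('g, 'e::euclidean_space) chart set \<Rightarrow> 'g measure \<Rightarrow>
     ('g \<Rightarrow> real) \<Rightarrow> nat \<Rightarrow> (nat \<Rightarrow> 'g vfield) \<Rightarrow>
     ('g \<Rightarrow> 'b::{banach, second_countable_topology}) \<Rightarrow> ('g \<Rightarrow> 'b) \<Rightarrow> bool" where
  "has_weak_laplacian G A \<mu> \<delta> \<nu> X f h \<longleftrightarrow> dist_rep A \<mu> (sub_laplacian G \<delta> \<nu> X) f h"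

text \<open>The representing functions are unique up to null sets; the following pick a representative.
  They are only meaningful when one exists.\<close>

definition weak_deriv ::
    "('g::topological_space) monoid \<Rightarrow> ('g, 'e::euclidean_space) chart set \<Rightarrow> 'g measure \<Rightarrow>
     ('g \<Rightarrow> real) \<Rightarrow> 'g vfield \<Rightarrow> ('g \<Rightarrow> 'b::{banach, second_countable_topology}) \<Rightarrow> ('g \<Rightarrow> 'b)" where
  "weak_deriv G A \<mu> \<delta> X f = (SOME h. has_weak_deriv G A \<mu> \<delta> X f h)"

definition weak_laplacian ::
    "('g::topological_space) monoid \<Rightarrow> ('g, 'e::euclidean_space) chart set \<Rightarrow> 'g measure \<Rightarrow>
     ('g \<Rightarrow> real) \<Rightarrow> nat \<Rightarrow> (nat \<Rightarrow> 'g vfield) \<Rightarrow>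
     ('g \<Rightarrow> 'b::{banach, second_countable_topology}) \<Rightarrow> ('g \<Rightarrow> 'b)" where
  "weak_laplacian G A \<mu> \<delta> \<nu> X f = (SOME h. has_weak_laplacian G A \<mu> \<delta> \<nu> X f h)"

definition times_space :: "('g \<Rightarrow> real) \<Rightarrow> ('g \<Rightarrow> real) set \<Rightarrow> ('g \<Rightarrow> real) set" where
  "times_space u S = {\<lambda>x. u x * F x | F. F \<in> S}"


section \<open>The potential and the two forms\<close>

definition potential ::
    "('g::topological_space) monoid \<Rightarrow> ('g, 'e::euclidean_space) chart set \<Rightarrow> 'g measure \<Rightarrow>
     ('g \<Rightarrow> real) \<Rightarrow> nat \<Rightarrow> (nat \<Rightarrow> 'g vfield) \<Rightarrow> ('g \<Rightarrow> real) \<Rightarrow> ('g \<Rightarrow> real)" where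
  "potential G A \<mu> \<delta> \<nu> X w = (\<lambda>x.
     - (\<Sum>j<\<nu>. \<bar>weak_deriv G A \<mu> \<delta> (X j) w x\<bar>\<^sup>2) / (4 * (w x)\<^sup>2)
     - weak_laplacian G A \<mu> \<delta> \<nu> X w x / (2 * w x))"

definition weighted :: "'g measure \<Rightarrow> ('g \<Rightarrow> real) \<Rightarrow> 'g measure" where
  "weighted \<mu> w = density \<mu> (\<lambda>x. ennreal (w x))"

definition grad_dot ::
    "('g::topological_space) monoid \<Rightarrow> ('g, 'e::euclidean_space) chart set \<Rightarrow> 'g measure \<Rightarrow>
     ('g \<Rightarrow> real) \<Rightarrow> nat \<Rightarrow> (nat \<Rightarrow> 'g vfield) \<Rightarrow>
     ('g \<Rightarrow> complex) \<Rightarrow> ('g \<Rightarrow> complex) \<Rightarrow> 'g \<Rightarrow> complex" where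
  "grad_dot G A \<mu> \<delta> \<nu> X f g x =
     (\<Sum>j<\<nu>. weak_deriv G A \<mu> \<delta> (X j) f x * weak_deriv G A \<mu> \<delta> (X j) g x)"

definition Dom_w ::
    "('g::topological_space) monoid \<Rightarrow> ('g, 'e::euclidean_space) chart set \<Rightarrow> 'g measure \<Rightarrow>
     ('g \<Rightarrow> real) \<Rightarrow> nat \<Rightarrow> (nat \<Rightarrow> 'g vfield) \<Rightarrow> ('g \<Rightarrow> real) \<Rightarrow> ('g \<Rightarrow> complex) set" where
  "Dom_w G A \<mu> \<delta> \<nu> X w = {f \<in> Lp 2 (weighted \<mu> w).
     \<forall>j<\<nu>. \<exists>h. has_weak_deriv G A \<mu> \<delta> (X j) f h \<and> h \<in> Lp 2 (weighted \<mu> w)}"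

definition Q_w ::
    "('g::topological_space) monoid \<Rightarrow> ('g, 'e::euclidean_space) chart set \<Rightarrow> 'g measure \<Rightarrow>
     ('g \<Rightarrow> real) \<Rightarrow> nat \<Rightarrow> (nat \<Rightarrow> 'g vfield) \<Rightarrow> ('g \<Rightarrow> real) \<Rightarrow>
     ('g \<Rightarrow> complex) \<Rightarrow> ('g \<Rightarrow> complex) \<Rightarrow> complex" where
  "Q_w G A \<mu> \<delta> \<nu> X w f g =
     (\<integral>x. grad_dot G A \<mu> \<delta> \<nu> X f (\<lambda>y. cnj (g y)) x \<partial>(weighted \<mu> w))"

definition Dom_V ::
    "('g::topological_space) monoid \<Rightarrow> ('g, 'e::euclidean_space) chart set \<Rightarrow> 'g measure \<Rightarrow>
     ('g \<Rightarrow> real) \<Rightarrow> nat \<Rightarrow> (nat \<Rightarrow> 'g vfield) \<Rightarrow> ('g \<Rightarrow> real) \<Rightarrow> real \<Rightarrow> ('g \<Rightarrow> complex) set" where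
  "Dom_V G A \<mu> \<delta> \<nu> X V m = {f \<in> Lp 2 \<mu>.
     (\<forall>j<\<nu>. \<exists>h. has_weak_deriv G A \<mu> \<delta> (X j) f h \<and> h \<in> Lp 2 \<mu>) \<and>
     (\<lambda>x. f x * of_real (sqrt (V x + m))) \<in> Lp 2 \<mu>}"

definition Q_V ::
    "('g::topological_space) monoid \<Rightarrow> ('g, 'e::euclidean_space) chart set \<Rightarrow> 'g measure \<Rightarrow>
     ('g \<Rightarrow> real) \<Rightarrow> nat \<Rightarrow> (nat \<Rightarrow> 'g vfield) \<Rightarrow> ('g \<Rightarrow> real) \<Rightarrow>
     ('g \<Rightarrow> complex) \<Rightarrow> ('g \<Rightarrow> complex) \<Rightarrow> complex" where
  "Q_V G A \<mu> \<delta> \<nu> X V f g =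
     (\<integral>x. grad_dot G A \<mu> \<delta> \<nu> X f (\<lambda>y. cnj (g y)) x + of_real (V x) * f x * cnj (g x) \<partial>\<mu>)"

text \<open>\<open>Q f f\<close> is real for the forms above.\<close>

definition form_norm ::
    "real \<Rightarrow> 'g measure \<Rightarrow> (('g \<Rightarrow> complex) \<Rightarrow> ('g \<Rightarrow> complex) \<Rightarrow> complex) \<Rightarrow> ('g \<Rightarrow> complex) \<Rightarrow> real" where
  "form_norm m M Q f = sqrt (m * (\<integral>x. (norm (f x))\<^sup>2 \<partial>M) + Re (Q f f))"

definition mult_sqrt :: "('g \<Rightarrow> real) \<Rightarrow> ('g \<Rightarrow> complex) \<Rightarrow> ('g \<Rightarrow> complex)" where
  "mult_sqrt w f = (\<lambda>x. f x * of_real (sqrt (w x)))"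

end

theory Submission
  imports Defs
begin

text \<open>Put \<open>v = ln w\<close> and \<open>q = \<nabla>w / w\<close>. Convolution from the left commutes with left-invariant operators, so the
  equation for \<open>w\<close> can be mollified as a whole; the classical chain rule, \<open>\<bar>\<nabla>w\<^sub>n\<bar>\<^sup>2 \<le> w\<^sub>n (\<bar>\<nabla>w\<bar>\<^sup>2/w)\<^sub>n\<close> and
  dominated convergence then show that, weakly, \<open>\<nabla>v = q\<close> and \<open>\<L>v = \<L>w / w + \<bar>q\<bar>\<^sup>2\<close>. Hence
  \<open>V\<^sub>w = \<bar>q\<bar>\<^sup>2/4 - \<L>v/2\<close>, and testing the equation for \<open>v\<close> with \<open>F\<^sup>2\<close> gives, for \<open>F\<close> of compact support,
  \<open>\<integral> \<bar>\<nabla>F\<bar>\<^sup>2 + V\<^sub>w F\<^sup>2 = \<integral> \<bar>\<nabla>F - F q/2\<bar>\<^sup>2\<close>. For \<open>F = f \<surd>w\<close> the right-hand side is \<open>\<integral> \<bar>\<nabla>f\<bar>\<^sup>2 w\<close>. Truncating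
  and cutting off \<open>f\<close>, respectively \<open>F\<close>, reduces both inclusions of the domains to this case: since
  \<open>V\<^sub>w + m\<close> is positive, Fatou's lemma bounds the limiting energies and dominated convergence identifies
  them. The sesquilinear identity follows by polarization.\<close>

subsection \<open>Smooth functions on open sets\<close>

text \<open>The obstacle is the low regularity of \<open>w\<close>: no product rule known beforehand
  covers multiplication by its square root, and its equation holds only against smooth test
  functions. Passing to \<open>ln w\<close> turns the weight into an exponential factor, whose
  regularizations have bounded derivatives. Each pair of assumptions on \<open>w\<close> serves two
  directions. If \<open>f\<close> is bounded with compact support, then \<open>F q\<close> is
  controlled by the gradient of \<open>w\<close> over \<open>sqrt w\<close>, and
  \<open>F\<^sup>2\<close> times the Laplacian of \<open>ln w\<close> by the Laplacian of
  \<open>w\<close> and the squared gradient over \<open>w\<close>. If \<open>F\<close> is bounded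
  with compact support, the same terms are controlled by the gradient over \<open>w\<close> and the
  Laplacian over \<open>w\<close>. Hence the truncation acts on \<open>f\<close> in one direction
  and on \<open>F\<close> in the other. Local integrability of \<open>1 / w\<close> dominates the
  regularized logarithms and embeds the weighted L2 space into the locally integrable functions. All
  regularization is by global convolution; charts serve mainly to show that derivations see
  first-order jets, that bumps exist and that integrals of smooth kernels are smooth.\<close>

lemma ck_on_cong:
  assumes "open S" "\<And>x. x \<in> S \<Longrightarrow> f x = g x"
  shows "ck_on k S f \<longleftrightarrow> ck_on k S g"
  using assms(2)
proof (induction k arbitrary: f g)
  case 0
  then show ?case using continuous_on_cong[of S S f g] by simp
next
  case (Suc k)
  have d: "(f has_derivative D) (at x) \<longleftrightarrow> (g has_derivative D) (at x)" if "x \<in> S" for x D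
    using has_derivative_transform_within_open[OF _ assms(1) that] Suc.prems by metis
  have fd: "frechet_derivative f (at x) = frechet_derivative g (at x)" if "x \<in> S" for x
    unfolding frechet_derivative_def using d[OF that] by simp
  have df: "f differentiable (at x) \<longleftrightarrow> g differentiable (at x)" if "x \<in> S" for x
    unfolding differentiable_def using d[OF that] by simp
  have "ck_on k S (\<lambda>x. frechet_derivative f (at x) v) \<longleftrightarrow> ck_on k S (\<lambda>x. frechet_derivative g (at x) v)" for v
    by (rule Suc.IH) (simp add: fd)
  then show ?case using df by simp
qed

lemma ck_on_subset: "ck_on k S f \<Longrightarrow> T \<subseteq> S \<Longrightarrow> ck_on k T f"
proof (induction k arbitrary: f)
  case 0
  then show ?case by (auto intro: continuous_on_subset)
next
  case (Suc k)
  then show ?case by auto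
qed

text \<open>\<open>S\<close> need not be open: \<open>ck_on\<close> differentiates with
  \<open>at x\<close>, not \<open>at x within S\<close>, so the neighbourhood \<open>T\<close> of
  each point decides everything.\<close>

lemma ck_on_local:
  assumes "\<And>x. x \<in> S \<Longrightarrow> \<exists>T. open T \<and> x \<in> T \<and> ck_on k T f"
  shows "ck_on k S f"
  using assms
proof (induction k arbitrary: f)
  case 0
  have "isCont f x" if "x \<in> S" for x
    using 0[OF that] by (auto simp: continuous_on_eq_continuous_at)
  then show ?case by (simp add: continuous_at_imp_continuous_on)
next
  case (Suc k)
  have "ck_on k S (\<lambda>x. frechet_derivative f (at x) v)" for v
    by (rule Suc.IH) (use Suc.prems in \<open>metis ck_on.simps(2)\<close>)
  moreover have "f differentiable (at x)" if "x \<in> S" for x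
    using Suc.prems[OF that] by auto
  ultimately show ?case by simp
qed

lemma ck_on_continuous: "ck_on k S f \<Longrightarrow> continuous_on S f"
  by (cases k) (auto intro!: continuous_at_imp_continuous_on differentiable_imp_continuous_within)

lemma ck_on_Suc_imp: "ck_on (Suc k) S f \<Longrightarrow> ck_on k S f"
proof (induction k arbitrary: f)
  case 0
  then show ?case using ck_on_continuous by fastforce
next
  case (Suc k)
  then show ?case by (metis ck_on.simps(2))
qed

text \<open>Lets the inductions below work with an explicit derivative \<open>D\<close> in place of
  the chosen \<open>frechet_derivative\<close>; the two agree on \<open>S\<close>, and openness
  carries the agreement over to higher orders.\<close>

lemma ck_on_SucI:
  assumes "open S" "\<And>x. x \<in> S \<Longrightarrow> (f has_derivative D x) (at x)" "\<And>v. ck_on k S (\<lambda>x. D x v)"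
  shows "ck_on (Suc k) S f"
proof -
  have "frechet_derivative f (at x) = D x" if "x \<in> S" for x
    using frechet_derivative_at[OF assms(2)[OF that]] by simp
  then have "ck_on k S (\<lambda>x. frechet_derivative f (at x) v)" for v
    using assms(3)[of v] ck_on_cong[OF assms(1), of "\<lambda>x. frechet_derivative f (at x) v" "\<lambda>x. D x v"] by auto
  then show ?thesis using assms(2) by (auto simp: differentiable_def)
qed

lemma ck_on_SucD:
  assumes "ck_on (Suc k) S f" "x \<in> S"
  shows "(f has_derivative frechet_derivative f (at x)) (at x)"
  using assms frechet_derivative_works by auto

lemma ck_on_const: "open S \<Longrightarrow> ck_on k S (\<lambda>x. c)"
proof (induction k arbitrary: c)
  case (Suc k)
  show ?case by (rule ck_on_SucI[where D="\<lambda>_ _. 0"]) (use Suc in auto)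
qed simp

lemma ck_on_linear:
  assumes "open S" "bounded_linear f"
  shows "ck_on k S f"
proof (rule ck_on_Suc_imp, rule ck_on_SucI[where D="\<lambda>_. f"])
  show "(f has_derivative f) (at x)" for x
    by (rule bounded_linear_imp_has_derivative[OF assms(2)])
qed (use assms ck_on_const in auto)

lemma ck_on_bounded_linear:
  assumes "open S" "bounded_linear L" "ck_on k S f"
  shows "ck_on k S (\<lambda>x. L (f x))"
  using assms(3)
proof (induction k arbitrary: f)
  case 0
  then show ?case using assms(2) by (auto intro: continuous_intros bounded_linear.continuous_on)
next
  case (Suc k)
  show ?case
  proof (rule ck_on_SucI[OF assms(1), where D="\<lambda>x v. L (frechet_derivative f (at x) v)"])
    show "((\<lambda>x. L (f x)) has_derivative (\<lambda>v. L (frechet_derivative f (at x) v))) (at x)" if "x \<in> S" for x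
      using bounded_linear.has_derivative[OF assms(2) ck_on_SucD[OF Suc.prems that]] .
  qed (use Suc in auto)
qed

lemma ck_on_add:
  assumes "open S" "ck_on k S f" "ck_on k S g"
  shows "ck_on k S (\<lambda>x. f x + g x)"
  using assms(2,3)
proof (induction k arbitrary: f g)
  case 0
  then show ?case by (auto intro: continuous_intros)
next
  case (Suc k)
  show ?case
  proof (rule ck_on_SucI[OF assms(1), where D="\<lambda>x v. frechet_derivative f (at x) v + frechet_derivative g (at x) v"])
    show "((\<lambda>x. f x + g x) has_derivative (\<lambda>v. frechet_derivative f (at x) v + frechet_derivative g (at x) v)) (at x)" if "x \<in> S" for x
      by (intro has_derivative_add ck_on_SucD[OF Suc.prems(1) that] ck_on_SucD[OF Suc.prems(2) that])
  qed (use Suc in auto)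
qed

lemma ck_on_sum:
  assumes "open S" "\<And>i. i \<in> I \<Longrightarrow> ck_on k S (f i)"
  shows "ck_on k S (\<lambda>x. \<Sum>i\<in>I. f i x)"
  using assms(2)
  by (induction I rule: infinite_finite_induct) (auto intro!: ck_on_const ck_on_add assms(1))

text \<open>The Leibniz induction is done once for all bilinear maps; products, scalar multiples and
  inner products are instances.\<close>

lemma ck_on_bounded_bilinear:
  assumes "open S" "bounded_bilinear B" "ck_on k S f" "ck_on k S g"
  shows "ck_on k S (\<lambda>x. B (f x) (g x))"
  using assms(3,4)
proof (induction k arbitrary: f g)
  case 0
  then show ?case using assms(2) by (auto intro: bounded_bilinear.continuous_on)
next
  case (Suc k)
  show ?case
  proof (rule ck_on_SucI[OF assms(1), where
        D="\<lambda>x v. B (f x) (frechet_derivative g (at x) v) + B (frechet_derivative f (at x) v) (g x)"])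
    show "((\<lambda>x. B (f x) (g x)) has_derivative (\<lambda>v. B (f x) (frechet_derivative g (at x) v) + B (frechet_derivative f (at x) v) (g x))) (at x)" if "x \<in> S" for x
      by (intro bounded_bilinear.FDERIV[OF assms(2)] ck_on_SucD[OF Suc.prems(1) that] ck_on_SucD[OF Suc.prems(2) that])
    show "ck_on k S (\<lambda>x. B (f x) (frechet_derivative g (at x) v) + B (frechet_derivative f (at x) v) (g x))" for v
      by (intro ck_on_add assms(1) Suc.IH) (use Suc.prems ck_on_Suc_imp in auto)
  qed
qed

lemma ck_on_mult:
  fixes f g :: "'a::real_normed_vector \<Rightarrow> 'b::real_normed_algebra"
  assumes "open S" "ck_on k S f" "ck_on k S g"
  shows "ck_on k S (\<lambda>x. f x * g x)"
  by (rule ck_on_bounded_bilinear[OF assms(1) bounded_bilinear_mult assms(2,3)])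

lemma ck_on_scaleR:
  assumes "open S" "ck_on k S f" "ck_on k S g"
  shows "ck_on k S (\<lambda>x. f x *\<^sub>R g x)"
  by (rule ck_on_bounded_bilinear[OF assms(1) bounded_bilinear_scaleR assms(2,3)])

lemma ck_on_compose:
  fixes f :: "'a::real_normed_vector \<Rightarrow> 'b::euclidean_space"
  assumes "open S" "open T" "ck_on k S f" "ck_on k T g" "f ` S \<subseteq> T"
  shows "ck_on k S (\<lambda>x. g (f x))"
  using assms(3,4)
proof (induction k arbitrary: g)
  case 0
  then show ?case using continuous_on_compose2[of T g S f] assms(5) by simp
next
  case (Suc k)
  \<comment> \<open>In the chain rule the direction fed to the derivative of \<open>g\<close> varies
    with \<open>x\<close>, whereas \<open>ck_on\<close> controls derivatives in fixed directions
    only; expanding in the basis separates the two.\<close>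
  let ?D = "\<lambda>x v. \<Sum>b\<in>Basis. (frechet_derivative f (at x) v \<bullet> b) *\<^sub>R frechet_derivative g (at (f x)) b"
  show ?case
  proof (rule ck_on_SucI[OF assms(1), where D="?D"])
    fix x assume x: "x \<in> S"
    have dg: "(g has_derivative frechet_derivative g (at (f x))) (at (f x))"
      using ck_on_SucD[OF Suc.prems(2)] x assms(5) by auto
    have df: "(f has_derivative frechet_derivative f (at x)) (at x)"
      using ck_on_SucD[OF Suc.prems(1) x] .
    interpret bounded_linear "frechet_derivative g (at (f x))"
      using dg has_derivative_bounded_linear by blast
    have "frechet_derivative g (at (f x)) (frechet_derivative f (at x) v) = ?D x v" for v
    proof -
      have "frechet_derivative g (at (f x)) (frechet_derivative f (at x) v)
        = frechet_derivative g (at (f x)) (\<Sum>b\<in>Basis. (frechet_derivative f (at x) v \<bullet> b) *\<^sub>R b)"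
        by (simp add: euclidean_representation)
      then show ?thesis by (simp add: sum scaleR)
    qed
    then show "((\<lambda>x. g (f x)) has_derivative ?D x) (at x)"
      using has_derivative_compose[OF df dg] by simp
  next
    fix v
    have "ck_on k S (\<lambda>x. frechet_derivative f (at x) v \<bullet> b)" for b
      by (rule ck_on_bounded_linear[OF assms(1) bounded_linear_inner_left]) (use Suc.prems in simp)
    moreover have "ck_on k S (\<lambda>x. frechet_derivative g (at (f x)) b)" for b
      by (rule Suc.IH) (use Suc.prems ck_on_Suc_imp in auto)
    ultimately show "ck_on k S (\<lambda>x. ?D x v)"
      by (intro ck_on_sum ck_on_scaleR assms(1)) auto
  qed
qed

lemma ck_on_Pair:
  assumes "open S" "ck_on k S f" "ck_on k S g"
  shows "ck_on k S (\<lambda>x. (f x, g x))"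
proof -
  have l: "bounded_linear (\<lambda>x. (x, 0))" "bounded_linear (\<lambda>y. (0, y))"
    by (auto intro!: bounded_linear_Pair bounded_linear_ident bounded_linear_zero)
  have "ck_on k S (\<lambda>x. (f x, 0) + (0, g x))"
    by (intro ck_on_add assms(1) ck_on_bounded_linear[OF assms(1) l(1) assms(2)]
        ck_on_bounded_linear[OF assms(1) l(2) assms(3)])
  then show ?thesis by simp
qed

lemma ck_on_real_SucI:
  fixes f :: "real \<Rightarrow> real"
  assumes "open S" "\<And>x. x \<in> S \<Longrightarrow> (f has_real_derivative f' x) (at x)" "ck_on k S f'"
  shows "ck_on (Suc k) S f"
proof (rule ck_on_SucI[OF assms(1), where D="\<lambda>x v. f' x * v"])
  show "(f has_derivative (*) (f' x)) (at x)" if "x \<in> S" for x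
    using assms(2)[OF that] by (simp add: has_field_derivative_def)
  show "ck_on k S (\<lambda>x. f' x * v)" for v
    by (intro ck_on_mult ck_on_const assms)
qed

lemma smooth_onD: "smooth_on S f \<Longrightarrow> ck_on k S f"
  by (simp add: smooth_on_def)

lemma smooth_on_subset: "smooth_on S f \<Longrightarrow> T \<subseteq> S \<Longrightarrow> smooth_on T f"
  unfolding smooth_on_def using ck_on_subset by blast

lemma smooth_on_cong:
  assumes "open S" "\<And>x. x \<in> S \<Longrightarrow> f x = g x"
  shows "smooth_on S f \<longleftrightarrow> smooth_on S g"
  unfolding smooth_on_def using ck_on_cong[OF assms] by simp

lemma smooth_on_transform:
  assumes "smooth_on S f" "open S" "\<And>x. x \<in> S \<Longrightarrow> f x = g x"
  shows "smooth_on S g"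
  using smooth_on_cong[of S f g] assms by blast

lemma smooth_on_local:
  assumes "\<And>x. x \<in> S \<Longrightarrow> \<exists>T. open T \<and> x \<in> T \<and> smooth_on T f"
  shows "smooth_on S f"
  unfolding smooth_on_def by (meson assms ck_on_local smooth_onD)

lemma smooth_on_continuous: "smooth_on S f \<Longrightarrow> continuous_on S f"
  using ck_on_continuous smooth_onD by blast

lemma smooth_on_const: "open S \<Longrightarrow> smooth_on S (\<lambda>x. c)"
  by (simp add: smooth_on_def ck_on_const)

lemma smooth_on_linear: "open S \<Longrightarrow> bounded_linear f \<Longrightarrow> smooth_on S f"
  by (simp add: smooth_on_def ck_on_linear)

lemma smooth_on_id: "open S \<Longrightarrow> smooth_on S (\<lambda>x. x)"
  by (rule smooth_on_linear[OF _ bounded_linear_ident])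

lemma smooth_on_add: "open S \<Longrightarrow> smooth_on S f \<Longrightarrow> smooth_on S g \<Longrightarrow> smooth_on S (\<lambda>x. f x + g x)"
  by (simp add: smooth_on_def ck_on_add)

lemma smooth_on_bounded_linear:
  "open S \<Longrightarrow> bounded_linear L \<Longrightarrow> smooth_on S f \<Longrightarrow> smooth_on S (\<lambda>x. L (f x))"
  by (simp add: smooth_on_def ck_on_bounded_linear)

lemma smooth_on_uminus: "open S \<Longrightarrow> smooth_on S f \<Longrightarrow> smooth_on S (\<lambda>x. - f x)"
  by (rule smooth_on_bounded_linear[OF _ bounded_linear_minus[OF bounded_linear_ident]])

lemma smooth_on_diff: "open S \<Longrightarrow> smooth_on S f \<Longrightarrow> smooth_on S g \<Longrightarrow> smooth_on S (\<lambda>x. f x - g x)"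
  using smooth_on_add[of S f "\<lambda>x. - g x"] smooth_on_uminus[of S g] by simp

lemma smooth_on_mult:
  fixes f g :: "'a::real_normed_vector \<Rightarrow> 'b::real_normed_algebra"
  shows "open S \<Longrightarrow> smooth_on S f \<Longrightarrow> smooth_on S g \<Longrightarrow> smooth_on S (\<lambda>x. f x * g x)"
  by (simp add: smooth_on_def ck_on_mult)

lemma smooth_on_inner:
  "open S \<Longrightarrow> smooth_on S f \<Longrightarrow> smooth_on S g \<Longrightarrow> smooth_on S (\<lambda>x. f x \<bullet> g x)"
  by (simp add: smooth_on_def ck_on_bounded_bilinear[OF _ bounded_bilinear_inner])

lemma smooth_on_Pair:
  "open S \<Longrightarrow> smooth_on S f \<Longrightarrow> smooth_on S g \<Longrightarrow> smooth_on S (\<lambda>x. (f x, g x))"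
  by (simp add: smooth_on_def ck_on_Pair)

lemma smooth_on_compose:
  fixes f :: "'a::real_normed_vector \<Rightarrow> 'b::euclidean_space"
  shows "open S \<Longrightarrow> open T \<Longrightarrow> smooth_on S f \<Longrightarrow> smooth_on T g \<Longrightarrow> f ` S \<subseteq> T
    \<Longrightarrow> smooth_on S (\<lambda>x. g (f x))"
  by (simp add: smooth_on_def ck_on_compose)

lemma smooth_on_frechet:
  "smooth_on S f \<Longrightarrow> smooth_on S (\<lambda>x. frechet_derivative f (at x) v)"
  unfolding smooth_on_def using ck_on.simps(2) by blast

lemma smooth_on_has_derivative:
  "smooth_on S f \<Longrightarrow> x \<in> S \<Longrightarrow> (f has_derivative frechet_derivative f (at x)) (at x)"
  by (meson ck_on_SucD smooth_onD)

text \<open>Serves families closed under differentiation, where all orders have to be treated at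
  once: a constant sequence for \<open>exp\<close>, shifted sines, and the iterated polynomials of
  the flat function.\<close>

lemma smooth_on_real_seq:
  fixes F :: "nat \<Rightarrow> real \<Rightarrow> real"
  assumes "open S" "\<And>n x. x \<in> S \<Longrightarrow> (F n has_real_derivative F (Suc n) x) (at x)"
  shows "smooth_on S (F n)"
proof -
  have "ck_on k S (F n)" for k n
  proof (induction k arbitrary: n)
    case 0
    show ?case
      unfolding ck_on.simps using DERIV_isCont[OF assms(2)] by (blast intro: continuous_at_imp_continuous_on)
  next
    case (Suc k)
    show ?case by (rule ck_on_real_SucI[OF assms(1,2) Suc])
  qed
  then show ?thesis by (simp add: smooth_on_def)
qed

lemma smooth_on_real_deriv:
  fixes f :: "real \<Rightarrow> real"
  assumes "open S" "\<And>x. x \<in> S \<Longrightarrow> (f has_real_derivative f' x) (at x)" "smooth_on S f'"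
  shows "smooth_on S f"
  unfolding smooth_on_def
proof
  fix k
  show "ck_on k S f"
    by (rule ck_on_Suc_imp, rule ck_on_real_SucI[OF assms(1,2)]) (use assms(3) smooth_onD in auto)
qed

lemma smooth_on_exp: "smooth_on UNIV (exp :: real \<Rightarrow> real)"
  by (rule smooth_on_real_seq[where F="\<lambda>_. exp"]) (rule open_UNIV, rule DERIV_exp)

lemma smooth_on_sin: "smooth_on UNIV (sin :: real \<Rightarrow> real)"
proof -
  \<comment> \<open>A shift by a quarter period realizes differentiation of the sine.\<close>
  let ?F = "\<lambda>n x. sin (x + real n * pi / 2)"
  have "smooth_on UNIV (?F 0)"
  proof (rule smooth_on_real_seq)
    fix n x
    have "x + real (Suc n) * pi / 2 = (x + real n * pi / 2) + pi / 2"
      by (simp add: field_simps)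
    then have "cos (x + real n * pi / 2) = sin (x + real (Suc n) * pi / 2)"
      by (simp only: sin_add) simp
    then show "(?F n has_real_derivative ?F (Suc n) x) (at x)"
      by (auto intro!: derivative_eq_intros)
  qed auto
  then show ?thesis by simp
qed

text \<open>The derivative is minus the square of the function itself, so order \<open>k\<close>
  yields order \<open>Suc k\<close> by the product rule.\<close>

lemma smooth_on_inverse: "smooth_on (- {0}) (inverse :: real \<Rightarrow> real)"
proof -
  have "ck_on k (- {0}) (inverse :: real \<Rightarrow> real)" for k
  proof (induction k)
    case 0
    show ?case by (auto intro!: continuous_intros)
  next
    case (Suc k)
    show ?case
    proof (rule ck_on_real_SucI[where f'="\<lambda>x. (-1) * (inverse x * inverse x)"])
      show "ck_on k (- {0}) (\<lambda>x::real. (-1) * (inverse x * inverse x))"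
        by (intro ck_on_mult ck_on_const Suc) auto
    qed (auto intro!: derivative_eq_intros simp: power2_eq_square)
  qed
  then show ?thesis by (simp add: smooth_on_def)
qed

lemma smooth_on_inverse_fun:
  fixes f :: "'a::real_normed_vector \<Rightarrow> real"
  assumes "open S" "smooth_on S f" "\<And>x. x \<in> S \<Longrightarrow> f x \<noteq> 0"
  shows "smooth_on S (\<lambda>x. inverse (f x))"
  by (rule smooth_on_compose[OF assms(1) _ assms(2) smooth_on_inverse]) (use assms(3) in auto)

text \<open>The functions are P(1/x) exp(-1/x) on the positive half-line. With y = 1/x the
  derivative is y^2 (P(y) - P'(y)) exp(-y), which explains the polynomial
  \<open>[:0, 0, 1:] * (P - pderiv P)\<close>. At the origin the right difference quotient is y P(y)
  / exp y with y tending to infinity.\<close>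

lemma flat_function_deriv:
  fixes P :: "real poly"
  defines "F \<equiv> \<lambda>P x. if x > 0 then poly P (1/x) * exp (- (1/x)) else (0::real)"
  shows "(F P has_real_derivative F ([:0, 0, 1:] * (P - pderiv P)) x) (at x)"
proof (cases "x = 0")
  case True
  have lim: "((\<lambda>y. poly Q y / exp y) \<longlongrightarrow> 0) at_top" for Q :: "real poly"
  proof (induction Q)
    case 0
    then show ?case by simp
  next
    case (pCons a Q)
    have "((\<lambda>y. a * (y^0 / exp y) + (\<Sum>i\<le>degree Q. coeff Q i * (y^(Suc i) / exp y))) \<longlongrightarrow> a * 0 + (\<Sum>i\<le>degree Q. coeff Q i * 0)) at_top"
      by (intro tendsto_intros tendsto_power_div_exp_0)
    moreover have "a * (y^0 / exp y) + (\<Sum>i\<le>degree Q. coeff Q i * (y^(Suc i) / exp y)) = poly (pCons a Q) y / exp y" for y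
      by (simp add: poly_altdef[of Q] add_divide_distrib sum_divide_distrib sum_distrib_left algebra_simps)
    ultimately show ?case by simp
  qed
  have "((\<lambda>y. F P y / y) \<longlongrightarrow> 0) (at_right 0)"
  proof -
    have "((\<lambda>y. poly (pCons 0 P) (inverse y) / exp (inverse y)) \<longlongrightarrow> 0) (at_right 0)"
      by (rule filterlim_compose[OF lim filterlim_inverse_at_top_right])
    then show ?thesis
      by (rule Lim_transform_eventually)
        (auto simp: eventually_at_filter F_def exp_minus field_simps)
  qed
  moreover have "((\<lambda>y. F P y / y) \<longlongrightarrow> 0) (at_left 0)"
    by (rule Lim_transform_eventually[OF tendsto_const]) (auto simp: eventually_at_filter F_def)
  ultimately have "((\<lambda>y. F P y / y) \<longlongrightarrow> 0) (at 0)"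
    by (simp add: filterlim_split_at)
  then show ?thesis using True by (simp add: has_field_derivative_iff F_def)
next
  case False
  show ?thesis
  proof (cases "x > 0")
    case True
    have "((\<lambda>x. poly P (1/x) * exp (- (1/x))) has_real_derivative F ([:0, 0, 1:] * (P - pderiv P)) x) (at x)"
      using True unfolding F_def
      by (auto intro!: derivative_eq_intros simp: field_simps power2_eq_square)
    then show ?thesis
      by (rule has_field_derivative_transform_within_open[of _ _ _ "{0<..}"]) (auto simp: F_def True)
  next
    case neg: False
    have "((\<lambda>x. 0) has_real_derivative F ([:0, 0, 1:] * (P - pderiv P)) x) (at x)"
      using neg unfolding F_def by auto
    then show ?thesis
      by (rule has_field_derivative_transform_within_open[of _ _ _ "{..<0}"]) (use neg False in \<open>auto simp: F_def\<close>)
  qed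
qed

text \<open>Iterating the previous derivative formula from \<open>P = 1\<close>, that is from
  exp(-1/x), produces all derivatives.\<close>

lemma flat_function_exists:
  obtains \<beta> :: "real \<Rightarrow> real" where "smooth_on UNIV \<beta>" "\<And>x. x \<le> 0 \<Longrightarrow> \<beta> x = 0" "\<And>x. x > 0 \<Longrightarrow> \<beta> x > 0"
proof -
  let ?F = "\<lambda>P x. if x > 0 then poly P (1/x) * exp (- (1/x)) else (0::real)"
  let ?G = "\<lambda>P. [:0, 0, 1:] * (P - pderiv P) :: real poly"
  have "smooth_on UNIV (?F ((?G ^^ 0) (1::real poly)))"
  proof (rule smooth_on_real_seq[where F="\<lambda>n. ?F ((?G ^^ n) 1)"])
    show "(?F ((?G ^^ n) 1) has_real_derivative ?F ((?G ^^ Suc n) 1) x) (at x)" for n x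
      unfolding funpow.simps comp_def by (rule flat_function_deriv)
  qed simp
  then have "smooth_on UNIV (?F (1::real poly))"
    unfolding funpow.simps id_def .
  then show ?thesis by (intro that[of "?F (1::real poly)"]) auto
qed

subsection \<open>Integrals depending on a parameter\<close>

text \<open>The integration variable \<open>y\<close> lives in a mere topological space because
  later it runs through the group and not through a chart; therefore only the parameter
  \<open>a\<close> is differentiated, and \<open>y\<close> enters by joint continuity.\<close>

primrec jck :: "nat \<Rightarrow> 'a::euclidean_space set \<Rightarrow> 'y::topological_space set \<Rightarrow> ('a \<Rightarrow> 'y \<Rightarrow> real) \<Rightarrow> bool" where
  "jck 0 S C L \<longleftrightarrow> continuous_on (S \<times> C) (\<lambda>p. L (fst p) (snd p))"
| "jck (Suc k) S C L \<longleftrightarrow> continuous_on (S \<times> C) (\<lambda>p. L (fst p) (snd p)) \<and>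
     (\<forall>a\<in>S. \<forall>y\<in>C. (\<lambda>a. L a y) differentiable (at a)) \<and>
     (\<forall>v. jck k S C (\<lambda>a y. frechet_derivative (\<lambda>a. L a y) (at a) v))"

lemma jck_continuous: "jck k S C L \<Longrightarrow> continuous_on (S \<times> C) (\<lambda>p. L (fst p) (snd p))"
  by (cases k) auto

lemma continuous_on_Times_local:
  fixes F :: "'a::t2_space \<times> 'y::t2_space \<Rightarrow> real"
  assumes "\<And>y. y \<in> C \<Longrightarrow> \<exists>N. open N \<and> y \<in> N \<and> continuous_on (S \<times> (C \<inter> N)) F"
  shows "continuous_on (S \<times> C) F"
  unfolding continuous_on_eq_continuous_within
proof
  fix p assume p: "p \<in> S \<times> C"
  obtain N where N: "open N" "snd p \<in> N" "continuous_on (S \<times> (C \<inter> N)) F" using assms[of "snd p"] p by auto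
  have "at p within S \<times> C = at p within S \<times> (C \<inter> N)"
    by (rule at_within_nhd[of _ "UNIV \<times> N"]) (use N p in \<open>auto intro: open_Times simp: mem_Times_iff\<close>)
  moreover have "p \<in> S \<times> (C \<inter> N)" using N p by (auto simp: mem_Times_iff)
  ultimately show "continuous (at p within S \<times> C) F" using N(3) unfolding continuous_on_eq_continuous_within by metis
qed

text \<open>A compact set of integration variables may meet several charts; the regularity can be
  verified chart by chart in \<open>y\<close>.\<close>

lemma jck_local:
  fixes L :: "'a::euclidean_space \<Rightarrow> 'y::t2_space \<Rightarrow> real"
  assumes "\<And>y. y \<in> C \<Longrightarrow> \<exists>N. open N \<and> y \<in> N \<and> jck k S (C \<inter> N) L"
  shows "jck k S C L"
  using assms
proof (induction k arbitrary: L)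
  case 0
  then show ?case using continuous_on_Times_local[of C S "\<lambda>p. L (fst p) (snd p)"] by simp
next
  case (Suc k)
  have "continuous_on (S \<times> C) (\<lambda>p. L (fst p) (snd p))"
    by (rule continuous_on_Times_local) (metis Suc.prems jck_continuous)
  moreover have "(\<lambda>a. L a y) differentiable (at a)" if "a \<in> S" "y \<in> C" for a y
    using Suc.prems[OF that(2)] that by auto
  moreover have "jck k S C (\<lambda>a y. frechet_derivative (\<lambda>a. L a y) (at a) v)" for v
  proof (rule Suc.IH)
    fix y assume "y \<in> C"
    then show "\<exists>N. open N \<and> y \<in> N \<and> jck k S (C \<inter> N) (\<lambda>a y. frechet_derivative (\<lambda>a. L a y) (at a) v)"
      using Suc.prems[of y] by auto
  qed
  ultimately show ?case by simp
qed

lemma jck_cong: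
  assumes "open S" "\<And>a y. a \<in> S \<Longrightarrow> y \<in> C \<Longrightarrow> L a y = L' a y" "jck k S C L'"
  shows "jck k S C L"
  using assms(2,3)
proof (induction k arbitrary: L L')
  case 0
  have "continuous_on (S \<times> C) (\<lambda>p. L (fst p) (snd p)) \<longleftrightarrow> continuous_on (S \<times> C) (\<lambda>p. L' (fst p) (snd p))"
    by (rule continuous_on_cong) (use 0 in auto)
  then show ?case using 0 by simp
next
  case (Suc k)
  have "continuous_on (S \<times> C) (\<lambda>p. L (fst p) (snd p)) \<longleftrightarrow> continuous_on (S \<times> C) (\<lambda>p. L' (fst p) (snd p))"
    by (rule continuous_on_cong) (use Suc.prems in auto)
  moreover have d: "((\<lambda>a. L a y) has_derivative D) (at a) \<longleftrightarrow> ((\<lambda>a. L' a y) has_derivative D) (at a)"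
    if "a \<in> S" "y \<in> C" for a y D
  proof
    show "((\<lambda>a. L' a y) has_derivative D) (at a)" if "((\<lambda>a. L a y) has_derivative D) (at a)"
      by (rule has_derivative_transform_within_open[OF that assms(1) \<open>a \<in> S\<close>])
        (use Suc.prems(1) \<open>y \<in> C\<close> in auto)
    show "((\<lambda>a. L a y) has_derivative D) (at a)" if "((\<lambda>a. L' a y) has_derivative D) (at a)"
      by (rule has_derivative_transform_within_open[OF that assms(1) \<open>a \<in> S\<close>])
        (use Suc.prems(1) \<open>y \<in> C\<close> in auto)
  qed
  have fd: "frechet_derivative (\<lambda>a. L a y) (at a) = frechet_derivative (\<lambda>a. L' a y) (at a)" if "a \<in> S" "y \<in> C" for a y
    unfolding frechet_derivative_def using d[OF that] by simp
  have "jck k S C (\<lambda>a y. frechet_derivative (\<lambda>a. L a y) (at a) v)" for v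
    by (rule Suc.IH[where L'="\<lambda>a y. frechet_derivative (\<lambda>a. L' a y) (at a) v"]) (use Suc.prems fd in auto)
  moreover have "(\<lambda>a. L a y) differentiable (at a)" if "a \<in> S" "y \<in> C" for a y
    using Suc.prems(2) that d[OF that] by (auto simp: differentiable_def)
  ultimately show ?case using Suc.prems by simp
qed

text \<open>Differentiating in \<open>a\<close> alone means differentiating \<open>f\<close> in the
  direction \<open>(v, 0)\<close>, so the induction never differentiates \<psi>, which is only
  continuous on \<open>C\<close>.\<close>

lemma jck_smooth:
  fixes f :: "'a::euclidean_space \<times> 'b::euclidean_space \<Rightarrow> real"
  assumes "open T" "smooth_on T f" "continuous_on C \<psi>" "\<And>a y. a \<in> S \<Longrightarrow> y \<in> C \<Longrightarrow> (a, \<psi> y) \<in> T" "open S"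
  shows "jck k S C (\<lambda>a y. f (a, \<psi> y))"
  using assms(2)
proof (induction k arbitrary: f)
  have c: "continuous_on (S \<times> C) (\<lambda>p. f (fst p, \<psi> (snd p)))" if "smooth_on T f" for f :: "'a \<times> 'b \<Rightarrow> real"
    using assms(4)
    by (intro continuous_on_compose2[OF smooth_on_continuous[OF that]] continuous_intros
        continuous_on_compose2[OF assms(3)]) auto
  case 0
  show ?case using c[OF 0] by simp
next
  case (Suc k)
  have c: "continuous_on (S \<times> C) (\<lambda>p. f (fst p, \<psi> (snd p)))"
    using assms(4)
    by (intro continuous_on_compose2[OF smooth_on_continuous[OF Suc.prems]] continuous_intros
        continuous_on_compose2[OF assms(3)]) auto
  have d: "((\<lambda>a. f (a, \<psi> y)) has_derivative (\<lambda>v. frechet_derivative f (at (a, \<psi> y)) (v, 0))) (at a)"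
    if "a \<in> S" "y \<in> C" for a y
  proof -
    have "((\<lambda>a. (a, \<psi> y)) has_derivative (\<lambda>v. (v, 0))) (at a)"
      by (auto intro!: derivative_eq_intros)
    from has_derivative_compose[OF this smooth_on_has_derivative[OF Suc.prems assms(4)[OF that]]]
    show ?thesis .
  qed
  have "jck k S C (\<lambda>a y. frechet_derivative (\<lambda>a. f (a, \<psi> y)) (at a) v)" for v
  proof (rule jck_cong[OF assms(5)])
    show "jck k S C (\<lambda>a y. frechet_derivative f (at (a, \<psi> y)) (v, 0))"
      by (rule Suc.IH[OF smooth_on_frechet[OF Suc.prems]])
  qed (use frechet_derivative_at[OF d] in metis)
  moreover have "(\<lambda>a. f (a, \<psi> y)) differentiable (at a)" if "a \<in> S" "y \<in> C" for a y
    using d[OF that] differentiable_def by blast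
  ultimately show ?case using c by simp
qed

lemma integrable_on_compact:
  fixes k g :: "'y::t2_space \<Rightarrow> real"
  assumes "sets N = sets borel" "compact C" "set_integrable N C k" "continuous_on C g"
  shows "integrable N (\<lambda>y. indicator C y * g y * k y)"
proof -
  obtain B where B: "\<And>y. y \<in> C \<Longrightarrow> \<bar>g y\<bar> \<le> B"
    using compact_imp_bounded[OF compact_continuous_image[OF assms(4,2)]]
    by (auto simp: bounded_iff)
  have cl: "C \<in> sets borel" using compact_imp_closed[OF assms(2)] by auto
  have "(\<lambda>y. indicator C y *\<^sub>R g y) \<in> borel_measurable N"
    using borel_measurable_continuous_on_indicator[OF cl assms(4)] measurable_cong_sets[OF assms(1) refl] by blast
  then have m1: "(\<lambda>y. (indicator C y *\<^sub>R g y) * (indicator C y *\<^sub>R k y)) \<in> borel_measurable N"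
    using assms(3) unfolding set_integrable_def by (intro borel_measurable_times) auto
  have "(\<lambda>y. (indicator C y *\<^sub>R g y) * (indicator C y *\<^sub>R k y)) = (\<lambda>y. indicator C y * g y * k y)"
    by (auto simp: indicator_def fun_eq_iff)
  then have m: "(\<lambda>y. indicator C y * g y * k y) \<in> borel_measurable N"
    using m1 by simp
  have i: "integrable N (\<lambda>y. B * (indicator C y *\<^sub>R k y))"
    using assms(3) unfolding set_integrable_def by (intro integrable_mult_right) auto
  show ?thesis
  proof (rule Bochner_Integration.integrable_bound[OF i m])
    have "norm (indicator C y * g y * k y) \<le> norm (B * (indicator C y *\<^sub>R k y))" for y
      using B[of y] by (auto simp: indicator_def abs_mult intro!: mult_right_mono)
    then show "AE y in N. norm (indicator C y * g y * k y) \<le> norm (B * (indicator C y *\<^sub>R k y))" by simp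
  qed
qed

lemma continuous_on_section: "continuous_on (S \<times> C) (\<lambda>p. L (fst p) (snd p)) \<Longrightarrow> a \<in> S \<Longrightarrow> continuous_on C (L a)"
  using continuous_on_compose2[of "S \<times> C" "\<lambda>p. L (fst p) (snd p)" C "\<lambda>y. (a, y)"]
  by (simp add: continuous_on_Pair continuous_on_id continuous_on_const image_subset_iff)

lemma integral_param_diff_bound:
  fixes k :: "'y::t2_space \<Rightarrow> real"
  assumes N: "sets N = sets borel" "compact C" "set_integrable N C k"
    and g: "continuous_on C g" "\<And>y. y \<in> C \<Longrightarrow> \<bar>g y\<bar> \<le> e"
  shows "\<bar>\<integral>y. indicator C y * g y * k y \<partial>N\<bar> \<le> e * (\<integral>y. indicator C y * \<bar>k y\<bar> \<partial>N)"
proof -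
  have i: "integrable N (\<lambda>y. indicator C y * \<bar>k y\<bar>)"
    using set_integrable_abs[OF N(3)] by (simp add: set_integrable_def)
  have "norm (\<integral>y. indicator C y * g y * k y \<partial>N) \<le> (\<integral>y. e * (indicator C y * \<bar>k y\<bar>) \<partial>N)"
  proof (rule order_trans[OF integral_norm_bound], rule integral_mono)
    show "integrable N (\<lambda>y. norm (indicator C y * g y * k y))"
      by (rule integrable_norm[OF integrable_on_compact[OF N g(1)]])
    show "integrable N (\<lambda>y. e * (indicator C y * \<bar>k y\<bar>))" using i by simp
    show "norm (indicator C y * g y * k y) \<le> e * (indicator C y * \<bar>k y\<bar>)" for y
      using g(2)[of y] by (auto simp: indicator_def abs_mult intro!: mult_right_mono)
  qed
  then show ?thesis by simp
qed

text \<open>The weight \<open>k\<close> is only integrable on \<open>C\<close>, so estimates have to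
  be uniform in \<open>y\<close>. Compactness of \<open>C\<close> makes the derivatives continuous
  in \<open>a\<close> uniformly in \<open>y\<close>, and the mean value inequality turns this into a
  uniformly small linearization error.\<close>

lemma integral_param_has_derivative:
  fixes k :: "'y::t2_space \<Rightarrow> real" and L :: "'a::euclidean_space \<Rightarrow> 'y \<Rightarrow> real"
  assumes N: "sets N = sets borel" "compact C" "set_integrable N C k"
    and L: "jck (Suc n) S C L" and S: "open S" and a: "a \<in> S"
  shows "((\<lambda>a. \<integral>y. indicator C y * L a y * k y \<partial>N) has_derivative
     (\<lambda>v. \<integral>y. indicator C y * frechet_derivative (\<lambda>a. L a y) (at a) v * k y \<partial>N)) (at a)"
proof -
  define D where "D a y = frechet_derivative (\<lambda>a. L a y) (at a)" for a y
  have hd: "((\<lambda>a. L a y) has_derivative D a y) (at a)" if "a \<in> S" "y \<in> C" for a y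
    using L that unfolding D_def by (auto simp: frechet_derivative_works[symmetric])
  have lin: "linear (D a y)" if "a \<in> S" "y \<in> C" for a y
    using has_derivative_linear[OF hd[OF that]] .
  have cD: "continuous_on (S \<times> C) (\<lambda>p. D (fst p) (snd p) v)" for v
  proof -
    have "jck n S C (\<lambda>a y. D a y v)" using L by (simp add: D_def)
    then show ?thesis by (rule jck_continuous)
  qed
  have iD: "integrable N (\<lambda>y. indicator C y * D a y v * k y)" if "a \<in> S" for a v
    using integrable_on_compact[OF N continuous_on_section[OF cD that]] .
  have cL: "continuous_on C (L a)" if "a \<in> S" for a
    using continuous_on_section[OF jck_continuous[OF L] that] .
  define K where "K = (\<integral>y. indicator C y * \<bar>k y\<bar> \<partial>N)"
  have K0: "K \<ge> 0" unfolding K_def by simp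
  let ?F = "\<lambda>a. \<integral>y. indicator C y * L a y * k y \<partial>N"
  let ?D = "\<lambda>v. \<integral>y. indicator C y * D a y v * k y \<partial>N"
  have "linear ?D"
  proof (rule linearI)
    fix v w
    have "?D (v + w) = (\<integral>y. indicator C y * D a y v * k y + indicator C y * D a y w * k y \<partial>N)"
      by (rule Bochner_Integration.integral_cong)
        (auto simp: indicator_def linear_add[OF lin[OF a]] algebra_simps)
    then show "?D (v + w) = ?D v + ?D w" using iD[OF a] by simp
  next
    fix r v
    have "?D (r *\<^sub>R v) = (\<integral>y. r * (indicator C y * D a y v * k y) \<partial>N)"
      by (rule Bochner_Integration.integral_cong)
        (auto simp: indicator_def linear_cmul[OF lin[OF a]] algebra_simps)
    then show "?D (r *\<^sub>R v) = r *\<^sub>R ?D v" by simp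
  qed
  then have bl: "bounded_linear ?D" by (simp add: linear_linear)
  have main: "\<exists>d>0. \<forall>b. norm (b - a) < d \<longrightarrow> norm (?F b - ?F a - ?D (b - a)) \<le> e * norm (b - a)" if e: "e > 0" for e
  proof -
    \<comment> \<open>The added 1 keeps the quotient meaningful when the mass \<open>K\<close> of
      \<open>k\<close> vanishes.\<close>
    define e' where "e' = e / (K + 1)"
    have e': "e' > 0" "e' * K \<le> e" using e K0 by (auto simp: e'_def field_simps)
    \<comment> \<open>The derivatives are compared on basis vectors only, and each of the
      \<open>DIM('a)\<close> components contributes at most \<open>e''\<close> times the norm of
      \<open>v\<close>.\<close>
    define e'' where "e'' = e' / DIM('a)"
    have e'': "e'' > 0" using e' by (simp add: e''_def)
    have "\<forall>b. \<exists>X0. a \<in> X0 \<and> open X0 \<and> (\<forall>x\<in>X0 \<inter> S. \<forall>t\<in>C. dist (D x t b) (D a t b) \<le> e'')"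
      using continuous_on_prod_compactE[OF cD N(2) a e''] by (metis fst_conv snd_conv)
    then obtain X0 where X0: "\<And>b. a \<in> X0 b" "\<And>b. open (X0 b)"
       "\<And>b x t. x \<in> X0 b \<inter> S \<Longrightarrow> t \<in> C \<Longrightarrow> dist (D x t b) (D a t b) \<le> e''" by metis
    have "open (S \<inter> (\<Inter>b\<in>Basis. X0 b))" using S X0 by (intro open_Int open_INT) auto
    moreover have "a \<in> S \<inter> (\<Inter>b\<in>Basis. X0 b)" using a X0 by auto
    ultimately obtain d where d: "d > 0" "ball a d \<subseteq> S \<inter> (\<Inter>b\<in>Basis. X0 b)"
      using open_contains_ball_eq by metis
    have on: "onorm (\<lambda>v. D x y v - D a y v) \<le> e'" if x: "x \<in> ball a d" and y: "y \<in> C" for x y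
    proof (rule onorm_le)
      fix v
      have xS: "x \<in> S" using x d by auto
      have ex: "D z y v = (\<Sum>b\<in>Basis. (v \<bullet> b) * D z y b)" if "z \<in> S" for z
      proof -
        have "D z y v = D z y (\<Sum>b\<in>Basis. (v \<bullet> b) *\<^sub>R b)" by (simp add: euclidean_representation)
        then show ?thesis by (simp add: linear_sum[OF lin[OF that y]] linear_cmul[OF lin[OF that y]])
      qed
      have "norm (D x y v - D a y v) = norm (\<Sum>b\<in>Basis. (v \<bullet> b) * (D x y b - D a y b))"
        by (simp add: ex[OF xS] ex[OF a] sum_subtractf[symmetric] right_diff_distrib)
      also have "\<dots> \<le> (\<Sum>b\<in>(Basis::'a set). norm v * e'')"
      proof (rule order_trans[OF norm_sum], rule sum_mono)
        fix b :: 'a assume b: "b \<in> Basis"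
        have "x \<in> X0 b \<inter> S" using x d b by blast
        then have "\<bar>D x y b - D a y b\<bar> \<le> e''" using X0(3)[of x b y] y by (simp add: dist_real_def)
        then show "norm ((v \<bullet> b) * (D x y b - D a y b)) \<le> norm v * e''"
          using Basis_le_norm[OF b, of v] by (auto simp: abs_mult intro!: mult_mono)
      qed
      also have "\<dots> = e' * norm v" by (simp add: e''_def)
      finally show "norm (D x y v - D a y v) \<le> e' * norm v" .
    qed
    have "norm (?F b - ?F a - ?D (b - a)) \<le> e * norm (b - a)" if b: "norm (b - a) < d" for b
    proof -
      have bS: "b \<in> S" using b d by (auto simp: dist_norm norm_minus_commute subset_iff)
      have est: "\<bar>L b y - L a y - D a y (b - a)\<bar> \<le> norm (b - a) * e'" if y: "y \<in> C" for y
      proof -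
        have "norm (L b y - L a y - D a y (b - a)) \<le> norm (b - a) * e'"
        proof (rule differentiable_bound_linearization[where S="ball a d" and f'="\<lambda>x. D x y"])
          fix t :: real assume t: "t \<in> {0..1}"
          have "norm (t *\<^sub>R (b - a)) \<le> norm (b - a)" using t by (simp add: mult_left_le_one_le)
          then show "a + t *\<^sub>R (b - a) \<in> ball a d" using b by (simp add: dist_norm)
        next
          show "((\<lambda>a. L a y) has_derivative D x y) (at x within ball a d)" if "x \<in> ball a d" for x
            using hd[OF _ y, of x] that d has_derivative_at_withinI by blast
          show "onorm (D x y - D a y) \<le> e'" if "x \<in> ball a d" for x
            using on[OF that y] by (simp add: fun_diff_def)
        qed (use d in auto)
        then show ?thesis by simp
      qed
      have "?F b - ?F a - ?D (b - a) = (\<integral>y. indicator C y * (L b y - L a y - D a y (b - a)) * k y \<partial>N)"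
      proof -
        have "(\<integral>y. indicator C y * (L b y - L a y - D a y (b - a)) * k y \<partial>N) =
          (\<integral>y. indicator C y * L b y * k y - indicator C y * L a y * k y - indicator C y * D a y (b - a) * k y \<partial>N)"
          by (rule Bochner_Integration.integral_cong) (auto simp: algebra_simps)
        then show ?thesis using integrable_on_compact[OF N cL[OF bS]] integrable_on_compact[OF N cL[OF a]] iD[OF a] by simp
      qed
      also have "\<bar>\<dots>\<bar> \<le> (norm (b - a) * e') * K"
        unfolding K_def
        by (rule integral_param_diff_bound[OF N _ est])
          (intro continuous_intros cL bS a continuous_on_section[OF cD])
      also have "\<dots> \<le> norm (b - a) * e"
        using mult_left_mono[OF e'(2), of "norm (b - a)"] by (simp add: mult.assoc)
      finally show ?thesis by (simp add: mult.commute)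
    qed
    then show ?thesis using d by blast
  qed
  show ?thesis
    unfolding has_derivative_at_alt D_def[symmetric] using bl main by blast
qed

lemma integral_param_ck:
  fixes k :: "'y::t2_space \<Rightarrow> real" and L :: "'a::euclidean_space \<Rightarrow> 'y \<Rightarrow> real"
  assumes N: "sets N = sets borel" "compact C" "set_integrable N C k"
    and "jck n S C L" and S: "open S"
  shows "ck_on n S (\<lambda>a. \<integral>y. indicator C y * L a y * k y \<partial>N)"
  using assms(4)
proof (induction n arbitrary: L)
  case 0
  then have c: "continuous_on (S \<times> C) (\<lambda>p. L (fst p) (snd p))" by simp
  define K where "K = (\<integral>y. indicator C y * \<bar>k y\<bar> \<partial>N)"
  have K0: "K \<ge> 0" unfolding K_def by simp
  let ?F = "\<lambda>a. \<integral>y. indicator C y * L a y * k y \<partial>N"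
  have "continuous_on S ?F"
    unfolding continuous_on_iff
  proof (intro ballI allI impI)
    fix a and e :: real assume a: "a \<in> S" and e: "e > 0"
    define e' where "e' = e / (K + 1)"
    have e': "e' > 0" "e' * K < e" using e K0 by (auto simp: e'_def field_simps)
    obtain X0 where X0: "a \<in> X0" "open X0" "\<forall>x\<in>X0 \<inter> S. \<forall>t\<in>C. dist (L x t) (L a t) \<le> e'"
      using continuous_on_prod_compactE[OF c N(2) a e'(1)] by (metis fst_conv snd_conv)
    obtain d where d: "d > 0" "ball a d \<subseteq> X0" using X0 open_contains_ball by blast
    have "dist (?F b) (?F a) < e" if b: "b \<in> S" "dist b a < d" for b
    proof -
      have "?F b - ?F a = (\<integral>y. indicator C y * (L b y - L a y) * k y \<partial>N)"
      proof -
        have "(\<integral>y. indicator C y * (L b y - L a y) * k y \<partial>N) =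
          (\<integral>y. indicator C y * L b y * k y - indicator C y * L a y * k y \<partial>N)"
          by (rule Bochner_Integration.integral_cong) (auto simp: algebra_simps)
        then show ?thesis using integrable_on_compact[OF N continuous_on_section[OF c b(1)]]
           integrable_on_compact[OF N continuous_on_section[OF c a]] by simp
      qed
      also have "\<bar>\<dots>\<bar> \<le> e' * K"
        unfolding K_def
      proof (rule integral_param_diff_bound[OF N])
        show "continuous_on C (\<lambda>y. L b y - L a y)"
          by (intro continuous_intros continuous_on_section[OF c] a b)
        show "\<bar>L b y - L a y\<bar> \<le> e'" if "y \<in> C" for y
          using X0(3) b d that by (auto simp: dist_real_def dist_commute subset_iff)
      qed
      finally show ?thesis using e' by (simp add: dist_real_def)
    qed
    then show "\<exists>d>0. \<forall>x'\<in>S. dist x' a < d \<longrightarrow> dist (?F x') (?F a) < e" using d by blast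
  qed
  then show ?case by simp
next
  case (Suc n)
  show ?case
  proof (rule ck_on_SucI[OF S integral_param_has_derivative[OF N Suc.prems S]])
    show "ck_on n S (\<lambda>a. \<integral>y. indicator C y * frechet_derivative (\<lambda>a. L a y) (at a) v * k y \<partial>N)" for v
      by (rule Suc.IH) (use Suc.prems in simp)
  qed
qed

text \<open>The fundamental theorem of calculus along the segment from \<open>p\<close> to
  \<open>a\<close> gives the factorization, with \<open>g b a\<close> the integral over t in [0,1]
  of the partial derivative at p + t (a - p); differentiation under the integral makes
  \<open>g b\<close> smooth.\<close>

lemma Hadamard_factor:
  fixes f :: "'a::euclidean_space \<Rightarrow> real"
  assumes "smooth_on (ball p r) f" "r > 0"
  shows "\<exists>g. (\<forall>b\<in>Basis. smooth_on (ball p r) (g b) \<and> g b p = frechet_derivative f (at p) b) \<and>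
    (\<forall>a\<in>ball p r. f a - f p = (\<Sum>b\<in>Basis. ((a - p) \<bullet> b) * g b a))"
proof -
  define L where "L b a t = frechet_derivative f (at (p + t *\<^sub>R (a - p))) b" for a b and t :: real
  define g where "g b a = (\<integral>t. indicator {0..1} t * L b a t * 1 \<partial>lborel)" for b a
  have inb: "p + t *\<^sub>R (a - p) \<in> ball p r" if "a \<in> ball p r" "t \<in> {0..1}" for a t
  proof -
    have "norm (t *\<^sub>R (a - p)) \<le> norm (a - p)" using that by (simp add: mult_left_le_one_le)
    then show ?thesis using that by (simp add: dist_norm norm_minus_commute)
  qed
  have j: "jck k (ball p r) {0..1} (L b)" for k b
  proof -
    \<comment> \<open>The segment map is smooth jointly in the endpoint and the time, so the
      integrand is smooth on an open set \<open>T\<close> of the product and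
      \<open>jck_smooth\<close> applies.\<close>
    define h :: "'a \<times> real \<Rightarrow> 'a" where "h q = p + snd q *\<^sub>R (fst q - p)" for q
    define T where "T = h -` ball p r"
    have hs: "smooth_on UNIV h"
    proof -
      have "ck_on k UNIV (\<lambda>q :: 'a \<times> real. p + snd q *\<^sub>R (fst q + - p))" for k
        by (intro ck_on_add ck_on_scaleR ck_on_const ck_on_linear[OF _ bounded_linear_fst]
            ck_on_linear[OF _ bounded_linear_snd] open_UNIV)
      then show ?thesis
        by (simp add: h_def[abs_def] smooth_on_def)
    qed
    have oT: "open T" unfolding T_def
      by (rule open_vimage) (use smooth_on_continuous[OF hs] in auto)
    have s: "smooth_on T (\<lambda>q. frechet_derivative f (at (h q)) b)"
      by (rule smooth_on_compose[OF oT open_ball smooth_on_subset[OF hs] smooth_on_frechet[OF assms(1)]])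
        (auto simp: T_def)
    have "jck k (ball p r) {0..1} (\<lambda>a t. (\<lambda>q. frechet_derivative f (at (h q)) b) (a, (\<lambda>t. t) t))"
    proof (rule jck_smooth[OF oT s])
      show "(a, t) \<in> T" if "a \<in> ball p r" "t \<in> {0..1}" for a t
        using inb[OF that] by (simp add: T_def h_def)
    qed (auto intro: continuous_intros)
    then show ?thesis by (simp add: L_def[abs_def] h_def)
  qed
  have sg: "smooth_on (ball p r) (g b)" for b
    unfolding smooth_on_def g_def
  proof
    fix k
    have "set_integrable lborel {0..1::real} (\<lambda>_. 1::real)" by (simp add: set_integrable_def)
    from integral_param_ck[OF sets_lborel compact_Icc this j open_ball]
    show "ck_on k (ball p r) (\<lambda>a. \<integral>t. indicator {0..1} t * L b a t * 1 \<partial>lborel)" .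
  qed
  have gp: "g b p = frechet_derivative f (at p) b" for b
    by (simp add: g_def L_def)
  have "f a - f p = (\<Sum>b\<in>Basis. ((a - p) \<bullet> b) * g b a)" if a: "a \<in> ball p r" for a
  proof -
    have cont: "continuous_on {0..1} (L b a)" for b
      using continuous_on_section[OF jck_continuous[OF j[of 0]] a] .
    have hi: "(L b a has_integral g b a) {0..1}" for b
    proof -
      have "integrable lborel (\<lambda>t. indicator {0..1} t *\<^sub>R L b a t)"
        by (rule borel_integrable_compact) (use cont in auto)
      then have "set_integrable lborel {0..1} (L b a)" by (simp add: set_integrable_def)
      from set_borel_integral_eq_integral[OF this] show ?thesis
        by (simp add: g_def set_lebesgue_integral_def has_integral_iff)
    qed
    have "((\<lambda>t. \<Sum>b\<in>Basis. ((a - p) \<bullet> b) * L b a t) has_integral (\<Sum>b\<in>Basis. ((a - p) \<bullet> b) * g b a)) {0..1}"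
      by (intro has_integral_sum has_integral_mult_right hi) auto
    moreover have "((\<lambda>t. \<Sum>b\<in>Basis. ((a - p) \<bullet> b) * L b a t) has_integral (f (p + 1 *\<^sub>R (a - p)) - f (p + 0 *\<^sub>R (a - p)))) {0..1}"
    proof (rule fundamental_theorem_of_calculus)
      fix t :: real assume t: "t \<in> {0..1}"
      let ?D = "frechet_derivative f (at (p + t *\<^sub>R (a - p)))"
      have d: "(f has_derivative ?D) (at (p + t *\<^sub>R (a - p)))"
        by (rule smooth_on_has_derivative[OF assms(1) inb[OF a t]])
      have l: "((\<lambda>t. p + t *\<^sub>R (a - p)) has_derivative (\<lambda>s. s *\<^sub>R (a - p))) (at t)"
        by (auto intro!: derivative_eq_intros)
      have "((\<lambda>t. f (p + t *\<^sub>R (a - p))) has_derivative (\<lambda>s. ?D (s *\<^sub>R (a - p)))) (at t)"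
        using has_derivative_compose[where f="\<lambda>t. p + t *\<^sub>R (a - p)" and g=f, OF l d] .
      then have "((\<lambda>t. f (p + t *\<^sub>R (a - p))) has_vector_derivative ?D (a - p)) (at t)"
        by (simp add: has_vector_derivative_def linear_cmul[OF has_derivative_linear[OF d]])
      moreover have "?D (a - p) = (\<Sum>b\<in>Basis. ((a - p) \<bullet> b) * L b a t)"
      proof -
        have "?D (a - p) = ?D (\<Sum>b\<in>Basis. ((a - p) \<bullet> b) *\<^sub>R b)" by (simp add: euclidean_representation)
        then show ?thesis
          by (simp add: L_def linear_sum[OF has_derivative_linear[OF d]] linear_cmul[OF has_derivative_linear[OF d]])
      qed
      ultimately show "((\<lambda>t. f (p + t *\<^sub>R (a - p))) has_vector_derivative (\<Sum>b\<in>Basis. ((a - p) \<bullet> b) * L b a t)) (at t within {0..1})"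
        by (simp add: has_vector_derivative_at_within)
    qed simp
    ultimately have "f (p + 1 *\<^sub>R (a - p)) - f (p + 0 *\<^sub>R (a - p)) = (\<Sum>b\<in>Basis. ((a - p) \<bullet> b) * g b a)"
      by (rule has_integral_unique[rotated])
    then show ?thesis by simp
  qed
  then show ?thesis using sg gp by blast
qed

subsection \<open>Smooth functions and vector fields on a manifold\<close>

locale smooth_manifold =
  fixes A :: "('g::{t2_space, second_countable_topology}, 'e::euclidean_space) chart set"
  assumes atlas: "smooth_atlas A"
begin

lemma chartD:
  assumes "(U, \<phi>) \<in> A"
  shows "open U" "open (\<phi> ` U)" "inj_on \<phi> U" "continuous_on U \<phi>" "continuous_on (\<phi> ` U) (inv_into U \<phi>)"
proof -
  have "chart (U, \<phi>)" using atlas assms by (auto simp: smooth_atlas_def)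
  then show "open U" "open (\<phi> ` U)" "inj_on \<phi> U" "continuous_on U \<phi>" "continuous_on (\<phi> ` U) (inv_into U \<phi>)"
    by (auto simp: chart_def homeomorphism_def)
qed

lemma chart_at:
  obtains U \<phi> where "(U, \<phi>) \<in> A" "p \<in> U"
proof -
  have "p \<in> \<Union> (fst ` A)" using atlas by (auto simp: smooth_atlas_def)
  then show ?thesis using that by auto
qed

lemma chart_inv: "(U, \<phi>) \<in> A \<Longrightarrow> x \<in> U \<Longrightarrow> inv_into U \<phi> (\<phi> x) = x"
  using chartD(3) inv_into_f_f by metis

lemma chart_image_eq: "(U, \<phi>) \<in> A \<Longrightarrow> N \<subseteq> U \<Longrightarrow> \<phi> ` N = inv_into U \<phi> -` N \<inter> \<phi> ` U"
  using chart_inv by (auto simp: image_iff subset_iff)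

lemma chart_open_image:
  assumes "(U, \<phi>) \<in> A" "open N" "N \<subseteq> U"
  shows "open (\<phi> ` N)"
  using chartD(2,5)[OF assms(1)] assms(2) chart_image_eq[OF assms(1,3)]
  by (metis continuous_on_open_vimage)

lemma transition_smooth:
  "(U, \<phi>) \<in> A \<Longrightarrow> (V, \<psi>) \<in> A \<Longrightarrow> smooth_on (\<phi> ` (U \<inter> V)) (\<lambda>a. \<psi> (inv_into U \<phi> a))"
  using atlas unfolding smooth_atlas_def by fastforce

text \<open>The definition tests all charts of the atlas; one chart near each point is enough
  because the transition maps are smooth.\<close>

lemma smooth_funsI:
  assumes "\<And>p. \<exists>U \<phi> N. (U, \<phi>) \<in> A \<and> open N \<and> p \<in> N \<and> N \<subseteq> U \<and> smooth_on (\<phi> ` N) (\<lambda>a. f (inv_into U \<phi> a))"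
  shows "f \<in> smooth_funs A"
proof -
  have "smooth_on (\<psi> ` V) (\<lambda>a. f (inv_into V \<psi> a))" if V: "(V, \<psi>) \<in> A" for V \<psi>
  proof (rule smooth_on_local)
    fix b assume "b \<in> \<psi> ` V"
    then obtain p where p: "p \<in> V" "b = \<psi> p" by auto
    obtain U \<phi> N where U: "(U, \<phi>) \<in> A" "open N" "p \<in> N" "N \<subseteq> U" "smooth_on (\<phi> ` N) (\<lambda>a. f (inv_into U \<phi> a))"
      using assms by metis
    let ?T = "\<psi> ` (N \<inter> V)"
    have oT: "open ?T" by (rule chart_open_image[OF V]) (use U chartD(1)[OF V] in auto)
    have "smooth_on ?T (\<lambda>b. (\<lambda>a. f (inv_into U \<phi> a)) (\<phi> (inv_into V \<psi> b)))"
    proof (rule smooth_on_compose[OF oT chart_open_image[OF U(1,2,4)] _ U(5)])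
      show "smooth_on ?T (\<lambda>b. \<phi> (inv_into V \<psi> b))"
        by (rule smooth_on_subset[OF transition_smooth[OF V U(1)]]) (use U in auto)
    qed (auto simp: chart_inv[OF V])
    moreover have "f (inv_into U \<phi> (\<phi> (inv_into V \<psi> b))) = f (inv_into V \<psi> b)" if "b \<in> ?T" for b
      using that U by (auto simp: chart_inv[OF V] chart_inv[OF U(1)] subset_iff)
    ultimately have "smooth_on ?T (\<lambda>b. f (inv_into V \<psi> b))"
      using smooth_on_cong[OF oT, of "\<lambda>b. f (inv_into U \<phi> (\<phi> (inv_into V \<psi> b)))" "\<lambda>b. f (inv_into V \<psi> b)"] by blast
    then show "\<exists>T. open T \<and> b \<in> T \<and> smooth_on T (\<lambda>a. f (inv_into V \<psi> a))"
      using oT p U by blast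
  qed
  then show ?thesis by (auto simp: smooth_funs_def)
qed

lemma smooth_funsD: "f \<in> smooth_funs A \<Longrightarrow> (U, \<phi>) \<in> A \<Longrightarrow> smooth_on (\<phi> ` U) (\<lambda>a. f (inv_into U \<phi> a))"
  by (auto simp: smooth_funs_def)

lemma smooth_funsI2:
  assumes "\<And>U \<phi>. (U, \<phi>) \<in> A \<Longrightarrow> smooth_on (\<phi> ` U) (\<lambda>a. f (inv_into U \<phi> a))"
  shows "f \<in> smooth_funs A"
  using assms by (auto simp: smooth_funs_def)

lemma smooth_funs_continuous:
  assumes "f \<in> smooth_funs A"
  shows "continuous_on UNIV f"
proof -
  have "isCont f p" for p
  proof -
    obtain U \<phi> where U: "(U, \<phi>) \<in> A" "p \<in> U" by (rule chart_at)
    have "continuous_on U (\<lambda>x. (\<lambda>a. f (inv_into U \<phi> a)) (\<phi> x))"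
      by (rule continuous_on_compose2[OF smooth_on_continuous[OF smooth_funsD[OF assms U(1)]] chartD(4)[OF U(1)]]) auto
    moreover have "continuous_on U (\<lambda>x. f (inv_into U \<phi> (\<phi> x))) \<longleftrightarrow> continuous_on U f"
      by (rule continuous_on_cong) (auto simp: chart_inv[OF U(1)])
    ultimately show ?thesis using chartD(1)[OF U(1)] U(2) continuous_on_eq_continuous_at by blast
  qed
  then show ?thesis by (simp add: continuous_at_imp_continuous_on)
qed

lemma smooth_funs_const: "(\<lambda>x. c) \<in> smooth_funs A"
  by (rule smooth_funsI2) (auto intro: smooth_on_const chartD)

lemma smooth_funs_add: "f \<in> smooth_funs A \<Longrightarrow> g \<in> smooth_funs A \<Longrightarrow> (\<lambda>x. f x + g x) \<in> smooth_funs A"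
  by (rule smooth_funsI2, rule smooth_on_add) (simp_all add: chartD smooth_funsD)

lemma smooth_funs_mult: "f \<in> smooth_funs A \<Longrightarrow> g \<in> smooth_funs A \<Longrightarrow> (\<lambda>x. f x * g x) \<in> smooth_funs A"
  by (rule smooth_funsI2, rule smooth_on_mult) (simp_all add: chartD smooth_funsD)

lemma smooth_funs_cmult: "f \<in> smooth_funs A \<Longrightarrow> (\<lambda>x. c * f x) \<in> smooth_funs A"
  using smooth_funs_mult[OF smooth_funs_const] .

lemma smooth_funs_diff: "f \<in> smooth_funs A \<Longrightarrow> g \<in> smooth_funs A \<Longrightarrow> (\<lambda>x. f x - g x) \<in> smooth_funs A"
  by (rule smooth_funsI2, rule smooth_on_diff) (simp_all add: chartD smooth_funsD)

lemma smooth_funs_sum: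
  "(\<And>i. i \<in> I \<Longrightarrow> f i \<in> smooth_funs A) \<Longrightarrow> (\<lambda>x. \<Sum>i\<in>I. f i x) \<in> smooth_funs A"
  by (induction I rule: infinite_finite_induct) (auto intro: smooth_funs_const smooth_funs_add)

lemma smooth_funs_compose:
  assumes "f \<in> smooth_funs A" "open S" "smooth_on S T" "range f \<subseteq> S"
  shows "(\<lambda>x. T (f x)) \<in> smooth_funs A"
proof (rule smooth_funsI2)
  fix U \<phi> assume U: "(U, \<phi>) \<in> A"
  show "smooth_on (\<phi> ` U) (\<lambda>a. T (f (inv_into U \<phi> a)))"
    by (rule smooth_on_compose[OF chartD(2)[OF U] assms(2) smooth_funsD[OF assms(1) U] assms(3)])
      (use assms(4) in auto)
qed

text \<open>Every point outside \<open>N\<close> has a neighbourhood disjoint from the closed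
  support of \<eta>, and there the extension by zero vanishes. Smoothness is asked of the product
  only, so that \<open>g = 1\<close> can be used to show smoothness of a bump itself.\<close>

lemma smooth_extension:
  assumes U: "(U, \<phi>) \<in> A" "open N" "N \<subseteq> U" and \<eta>: "closure {x. \<eta> x \<noteq> 0} \<subseteq> N"
    and g: "smooth_on (\<phi> ` N) (\<lambda>a. \<eta> (inv_into U \<phi> a) * g a)"
  shows "(\<lambda>x. if x \<in> N then \<eta> x * g (\<phi> x) else (0::real)) \<in> smooth_funs A"
proof (rule smooth_funsI)
  fix p
  let ?f = "\<lambda>x. if x \<in> N then \<eta> x * g (\<phi> x) else 0"
  show "\<exists>U \<phi> N. (U, \<phi>) \<in> A \<and> open N \<and> p \<in> N \<and> N \<subseteq> U \<and> smooth_on (\<phi> ` N) (\<lambda>a. ?f (inv_into U \<phi> a))"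
  proof (cases "p \<in> N")
    case True
    have "smooth_on (\<phi> ` N) (\<lambda>a. \<eta> (inv_into U \<phi> a) * g a) \<longleftrightarrow> smooth_on (\<phi> ` N) (\<lambda>a. ?f (inv_into U \<phi> a))"
      by (rule smooth_on_cong[OF chart_open_image[OF U]]) (use U chart_inv[OF U(1)] in \<open>auto simp: subset_iff\<close>)
    then show ?thesis using True U g by blast
  next
    case False
    obtain V \<psi> where V: "(V, \<psi>) \<in> A" "p \<in> V" by (rule chart_at)
    let ?M = "V \<inter> - closure {x. \<eta> x \<noteq> 0}"
    have M: "open ?M" "p \<in> ?M" "?M \<subseteq> V" using V chartD(1)[OF V(1)] False \<eta> by auto
    have z: "?f x = 0" if "x \<in> ?M" for x
      using that closure_subset[of "{x. \<eta> x \<noteq> 0}"] by auto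
    have "smooth_on (\<psi> ` ?M) (\<lambda>a. 0::real) \<longleftrightarrow> smooth_on (\<psi> ` ?M) (\<lambda>a. ?f (inv_into V \<psi> a))"
    proof (rule smooth_on_cong[OF chart_open_image[OF V(1) M(1,3)]])
      fix a assume "a \<in> \<psi> ` ?M"
      then obtain x where x: "x \<in> ?M" "a = \<psi> x" by blast
      then have "inv_into V \<psi> a = x" using chart_inv[OF V(1)] by blast
      then show "0 = ?f (inv_into V \<psi> a)" using z[OF x(1)] by metis
    qed
    then show ?thesis using smooth_on_const[OF chart_open_image[OF V(1) M(1,3)]] V M by blast
  qed
qed

lemma bump_exists:
  assumes "open W" "p \<in> W"
  obtains \<eta> where "\<eta> \<in> test_funs A" "\<And>x. \<eta> x \<ge> 0" "\<eta> p > 0" "closure {x. \<eta> x \<noteq> 0} \<subseteq> W"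
proof -
  obtain U \<phi> where U: "(U, \<phi>) \<in> A" "p \<in> U" by (rule chart_at)
  let ?N = "W \<inter> U"
  have N: "open ?N" "?N \<subseteq> U" using assms chartD(1)[OF U(1)] by auto
  have "\<phi> p \<in> \<phi> ` ?N" using assms U by auto
  \<comment> \<open>The closed ball has to fit into the image: its preimage is the compact set that
    contains the support.\<close>
  then obtain r where r: "r > 0" "cball (\<phi> p) r \<subseteq> \<phi> ` ?N"
    using chart_open_image[OF U(1) N] open_contains_cball by blast
  obtain \<beta> :: "real \<Rightarrow> real" where \<beta>: "smooth_on UNIV \<beta>" "\<And>x. x \<le> 0 \<Longrightarrow> \<beta> x = 0" "\<And>x. x > 0 \<Longrightarrow> \<beta> x > 0"
    using flat_function_exists by metis
  define h where "h a = \<beta> (r\<^sup>2 - (a - \<phi> p) \<bullet> (a - \<phi> p))" for a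
  have h0: "h a = 0 \<longleftrightarrow> a \<notin> ball (\<phi> p) r" for a
  proof -
    have "norm (a - \<phi> p) < r \<longleftrightarrow> (norm (a - \<phi> p))\<^sup>2 < r\<^sup>2"
      using r(1) by (auto intro: power2_less_imp_less power_strict_mono)
    then have "a \<in> ball (\<phi> p) r \<longleftrightarrow> r\<^sup>2 - (a - \<phi> p) \<bullet> (a - \<phi> p) > 0"
      by (simp add: dist_norm norm_minus_commute power2_norm_eq_inner)
    then show ?thesis using \<beta>(2,3) unfolding h_def by (metis less_irrefl not_less)
  qed
  have hge: "h a \<ge> 0" for a unfolding h_def using \<beta>(2,3) by (metis linorder_not_less order_less_imp_le order_refl)
  have hs: "smooth_on UNIV h"
    unfolding h_def[abs_def]
  proof (rule smooth_on_compose[OF open_UNIV open_UNIV _ \<beta>(1)])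
    have d: "smooth_on UNIV (\<lambda>a. a - \<phi> p)"
      by (intro smooth_on_diff smooth_on_id smooth_on_const open_UNIV)
    show "smooth_on UNIV (\<lambda>a. r\<^sup>2 - (a - \<phi> p) \<bullet> (a - \<phi> p))"
      by (intro smooth_on_diff smooth_on_const smooth_on_inner d open_UNIV)
  qed auto
  define \<eta> where "\<eta> x = (if x \<in> ?N then h (\<phi> x) else 0)" for x
  let ?K = "inv_into U \<phi> ` cball (\<phi> p) r"
  have Kc: "compact ?K"
    by (rule compact_continuous_image[OF continuous_on_subset[OF chartD(5)[OF U(1)]] compact_cball]) (use r in auto)
  have supp: "{x. \<eta> x \<noteq> 0} \<subseteq> ?K"
  proof
    fix x assume "x \<in> {x. \<eta> x \<noteq> 0}"
    then have x: "x \<in> ?N" "\<phi> x \<in> cball (\<phi> p) r" using h0[of "\<phi> x"] by (auto simp: \<eta>_def split: if_splits)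
    have "x = inv_into U \<phi> (\<phi> x)" using chart_inv[OF U(1)] x by auto
    then show "x \<in> ?K" using x(2) by blast
  qed
  have KN: "?K \<subseteq> ?N" using r(2) chart_inv[OF U(1)] by (auto simp: subset_iff image_iff)
  have cl: "closure {x. \<eta> x \<noteq> 0} \<subseteq> ?K" by (rule closure_minimal[OF supp compact_imp_closed[OF Kc]])
  have cN: "closure {x. \<eta> x \<noteq> 0} \<subseteq> ?N" using cl KN by auto
  have "\<eta> \<in> smooth_funs A"
  proof -
    have "(\<lambda>x. if x \<in> ?N then \<eta> x * (\<lambda>_. 1) (\<phi> x) else 0) \<in> smooth_funs A"
    proof (rule smooth_extension[OF U(1) N cN])
      have "smooth_on (\<phi> ` ?N) h \<longleftrightarrow> smooth_on (\<phi> ` ?N) (\<lambda>a. \<eta> (inv_into U \<phi> a) * 1)"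
        by (rule smooth_on_cong[OF chart_open_image[OF U(1) N]]) (auto simp: \<eta>_def chart_inv[OF U(1)])
      then show "smooth_on (\<phi> ` ?N) (\<lambda>a. \<eta> (inv_into U \<phi> a) * 1)"
        using smooth_on_subset[OF hs] by blast
    qed
    moreover have "(\<lambda>x. if x \<in> ?N then \<eta> x * (\<lambda>_. 1) (\<phi> x) else 0) = \<eta>" by (auto simp: \<eta>_def)
    ultimately show ?thesis by simp
  qed
  moreover have "compact (closure {x. \<eta> x \<noteq> 0})"
    using compact_Int_closed[OF Kc closed_closure, of "{x. \<eta> x \<noteq> 0}"] cl by (simp add: Int_absorb1)
  moreover have "\<eta> p > 0"
    using hge[of "\<phi> p"] h0[of "\<phi> p"] r(1) U assms by (simp add: \<eta>_def less_le)
  moreover have "\<eta> x \<ge> 0" for x using hge by (simp add: \<eta>_def)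
  ultimately show ?thesis using that[of \<eta>] cN by (auto simp: test_funs_def)
qed

section \<open>Vector fields as derivations: tangent vectors, locality, chain rule\<close>

lemma vector_fieldsD:
  assumes "X \<in> vector_fields A" "f \<in> smooth_funs A" "g \<in> smooth_funs A"
  shows "X f \<in> smooth_funs A" "X (\<lambda>x. f x + g x) = (\<lambda>x. X f x + X g x)"
    "X (\<lambda>x. c * f x) = (\<lambda>x. c * X f x)" "X (\<lambda>x. f x * g x) = (\<lambda>x. f x * X g x + X f x * g x)"
  using assms unfolding vector_fields_def
  by (auto simp: plus_fun_def times_fun_def)

lemma vf_const:
  assumes "X \<in> vector_fields A"
  shows "X (\<lambda>x. c) = (\<lambda>x. 0)"
proof -
  have "X (\<lambda>x. 1 * 1) = (\<lambda>x. 1 * X (\<lambda>x. 1) x + X (\<lambda>x. 1) x * 1)"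
    by (rule vector_fieldsD(4)[OF assms smooth_funs_const smooth_funs_const])
  then have "X (\<lambda>x. 1) x = 0" for x by (simp add: fun_eq_iff)
  moreover have "X (\<lambda>x. c * 1) = (\<lambda>x. c * X (\<lambda>x. 1) x)"
    by (rule vector_fieldsD(3)[OF assms smooth_funs_const smooth_funs_const])
  ultimately show ?thesis by simp
qed

lemma vf_diff:
  assumes "X \<in> vector_fields A" "f \<in> smooth_funs A" "g \<in> smooth_funs A"
  shows "X (\<lambda>x. f x - g x) = (\<lambda>x. X f x - X g x)"
proof -
  have "X (\<lambda>x. f x + (-1) * g x) = (\<lambda>x. X f x + X (\<lambda>x. (-1) * g x) x)"
    by (rule vector_fieldsD(2)[OF assms(1,2) smooth_funs_cmult[OF assms(3)]])
  then show ?thesis using vector_fieldsD(3)[OF assms(1,3,3), of "-1"] by simp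
qed

lemma vf_sum:
  assumes "X \<in> vector_fields A" "\<And>i. i \<in> I \<Longrightarrow> f i \<in> smooth_funs A"
  shows "X (\<lambda>x. \<Sum>i\<in>I. f i x) = (\<lambda>x. \<Sum>i\<in>I. X (f i) x)"
  using assms(2)
  by (induction I rule: infinite_finite_induct)
    (simp_all add: vf_const[OF assms(1)] vector_fieldsD(2)[OF assms(1)] smooth_funs_sum)

text \<open>Hadamard's factorization shows that a derivation only sees the first-order jet of a function.\<close>

lemma vf_tangent:
  assumes X: "X \<in> vector_fields A" and U: "(U, \<phi>) \<in> A" "p \<in> U"
  obtains v where "\<And>f. f \<in> smooth_funs A \<Longrightarrow> X f p = frechet_derivative (\<lambda>a. f (inv_into U \<phi> a)) (at (\<phi> p)) v"
proof -
  obtain r where r: "r > 0" "ball (\<phi> p) r \<subseteq> \<phi> ` U"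
    using chartD(2)[OF U(1)] U(2) open_contains_ball by blast
  let ?B = "ball (\<phi> p) r"
  define N where "N = \<phi> -` ?B \<inter> U"
  have N: "open N" "N \<subseteq> U" "p \<in> N"
    using chartD(1,4)[OF U(1)] r U(2) unfolding N_def
    by (auto simp: continuous_on_open_vimage[OF chartD(1)[OF U(1)]])
  have im: "\<phi> ` N = ?B" using r unfolding N_def by auto
  obtain \<eta> where \<eta>: "\<eta> \<in> test_funs A" "\<And>x. \<eta> x \<ge> 0" "\<eta> p > 0" "closure {x. \<eta> x \<noteq> 0} \<subseteq> N"
    using bump_exists[OF N(1,3)] by blast
  have \<eta>s: "\<eta> \<in> smooth_funs A" using \<eta> by (simp add: test_funs_def)
  have ext: "(\<lambda>x. if x \<in> N then \<eta> x * g (\<phi> x) else 0) \<in> smooth_funs A" if "smooth_on ?B g" for g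
    by (rule smooth_extension[OF U(1) N(1,2) \<eta>(4)])
      (use that im r in \<open>auto intro!: smooth_on_mult smooth_on_subset[OF smooth_funsD[OF \<eta>s U(1)]]\<close>)
  \<comment> \<open>Coordinate functions cut off by \<eta>, so that they are global smooth functions
    on which \<open>X\<close> can be evaluated.\<close>
  define e where "e b x = (if x \<in> N then \<eta> x * ((\<phi> x - \<phi> p) \<bullet> b) else 0)" for b x
  have es: "e b \<in> smooth_funs A" for b
    unfolding e_def[abs_def]
    by (rule ext[of "\<lambda>a. (a - \<phi> p) \<bullet> b"])
     (auto intro!: smooth_on_inner smooth_on_diff smooth_on_id smooth_on_const)
  have ep: "e b p = 0" for b by (simp add: e_def)
  \<comment> \<open>The coordinate in \<open>e b\<close> vanishes at \<open>p\<close>, so the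
    Leibniz rule leaves its derivative times \<open>\<eta> p\<close>; dividing recovers the
    component of the tangent vector.\<close>
  define v where "v = (\<Sum>b\<in>Basis. (X (e b) p / \<eta> p) *\<^sub>R b)"
  have "X f p = frechet_derivative (\<lambda>a. f (inv_into U \<phi> a)) (at (\<phi> p)) v" if f: "f \<in> smooth_funs A" for f
  proof -
    let ?f = "\<lambda>a. f (inv_into U \<phi> a)"
    have fs: "smooth_on ?B ?f" by (rule smooth_on_subset[OF smooth_funsD[OF f U(1)] r(2)])
    from Hadamard_factor[OF fs r(1)]
    obtain g where g: "\<And>b. b \<in> Basis \<Longrightarrow> smooth_on ?B (g b)"
       "\<And>b. b \<in> Basis \<Longrightarrow> g b (\<phi> p) = frechet_derivative ?f (at (\<phi> p)) b"
       "\<And>a. a \<in> ?B \<Longrightarrow> ?f a - ?f (\<phi> p) = (\<Sum>b\<in>Basis. ((a - \<phi> p) \<bullet> b) * g b a)" by blast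
    define G where "G b x = (if x \<in> N then \<eta> x * g b (\<phi> x) else 0)" for b x
    have Gs: "G b \<in> smooth_funs A" if "b \<in> Basis" for b
      unfolding G_def[abs_def] by (rule ext[OF g(1)[OF that]])
    \<comment> \<open>The square of \<eta> appears because the coordinate and its coefficient
      \<open>g b\<close> each need a cutoff to become global. Both \<open>f x - f p\<close> and
      \<open>e b\<close> vanish at \<open>p\<close>, so the Leibniz rule leaves one term per
      product.\<close>
    have eq: "(\<lambda>x. (\<eta> x * \<eta> x) * (f x - f p)) = (\<lambda>x. \<Sum>b\<in>Basis. e b x * G b x)"
    proof
      fix x
      show "(\<eta> x * \<eta> x) * (f x - f p) = (\<Sum>b\<in>Basis. e b x * G b x)"
      proof (cases "x \<in> N")
        case True
        then have "\<phi> x \<in> ?B" "x \<in> U" using im N by auto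
        then have "f x - f p = (\<Sum>b\<in>Basis. ((\<phi> x - \<phi> p) \<bullet> b) * g b (\<phi> x))"
          using g(3)[of "\<phi> x"] chart_inv[OF U(1)] U(2) by simp
        then show ?thesis using True by (simp add: e_def G_def sum_distrib_left algebra_simps)
      next
        case False
        then have "\<eta> x = 0" using \<eta>(4) closure_subset[of "{x. \<eta> x \<noteq> 0}"] by auto
        then show ?thesis using False by (simp add: e_def)
      qed
    qed
    have s1: "(\<lambda>x. \<eta> x * \<eta> x) \<in> smooth_funs A" by (intro smooth_funs_mult \<eta>s)
    have s2: "(\<lambda>x. f x - f p) \<in> smooth_funs A" by (intro smooth_funs_diff smooth_funs_const f)
    have "X (\<lambda>x. (\<eta> x * \<eta> x) * (f x - f p)) p = \<eta> p * \<eta> p * X f p"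
      by (simp add: vector_fieldsD(4)[OF X s1 s2] vf_diff[OF X f smooth_funs_const] vf_const[OF X])
    moreover have "X (\<lambda>x. \<Sum>b\<in>Basis. e b x * G b x) p = (\<Sum>b\<in>Basis. X (e b) p * (\<eta> p * g b (\<phi> p)))"
    proof -
      have "X (\<lambda>x. \<Sum>b\<in>Basis. e b x * G b x) p = (\<Sum>b\<in>Basis. X (\<lambda>x. e b x * G b x) p)"
        using vf_sum[OF X, of Basis "\<lambda>b x. e b x * G b x"] smooth_funs_mult[OF es Gs] by simp
      also have "\<dots> = (\<Sum>b\<in>Basis. X (e b) p * (\<eta> p * g b (\<phi> p)))"
      proof (rule sum.cong)
        fix b :: 'e assume b: "b \<in> Basis"
        have "G b p = \<eta> p * g b (\<phi> p)" using N(3) by (simp add: G_def)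
        then show "X (\<lambda>x. e b x * G b x) p = X (e b) p * (\<eta> p * g b (\<phi> p))"
          by (simp add: vector_fieldsD(4)[OF X es Gs[OF b]] ep)
      qed simp
      finally show ?thesis .
    qed
    ultimately have "\<eta> p * \<eta> p * X f p = (\<Sum>b\<in>Basis. X (e b) p * (\<eta> p * g b (\<phi> p)))" using eq by simp
    also have "\<dots> = \<eta> p * \<eta> p * (\<Sum>b\<in>Basis. (X (e b) p / \<eta> p) * frechet_derivative ?f (at (\<phi> p)) b)"
      using \<eta>(3) by (simp add: sum_distrib_left g(2) field_simps)
    finally have "X f p = (\<Sum>b\<in>Basis. (X (e b) p / \<eta> p) * frechet_derivative ?f (at (\<phi> p)) b)"
      using \<eta>(3) by simp
    moreover have "linear (frechet_derivative ?f (at (\<phi> p)))"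
      using has_derivative_linear[OF smooth_on_has_derivative[OF fs]] r by simp
    ultimately show ?thesis by (simp add: v_def linear_sum linear_cmul)
  qed
  then show ?thesis by (rule that)
qed

text \<open>Equal germs have equal derivatives in a chart, and \<open>vf_tangent\<close> expresses
  \<open>X\<close> at \<open>p\<close> through that derivative.\<close>

lemma vf_local:
  assumes X: "X \<in> vector_fields A" and "f \<in> smooth_funs A" "g \<in> smooth_funs A"
    "open W" "p \<in> W" "\<And>x. x \<in> W \<Longrightarrow> f x = g x"
  shows "X f p = X g p"
proof -
  obtain U \<phi> where U: "(U, \<phi>) \<in> A" "p \<in> U" by (rule chart_at)
  obtain v where v: "\<And>f. f \<in> smooth_funs A \<Longrightarrow> X f p = frechet_derivative (\<lambda>a. f (inv_into U \<phi> a)) (at (\<phi> p)) v"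
    using vf_tangent[OF X U] by metis
  let ?N = "W \<inter> U"
  have N: "open ?N" "?N \<subseteq> U" using assms(4) chartD(1)[OF U(1)] by auto
  have hd: "((\<lambda>a. g (inv_into U \<phi> a)) has_derivative frechet_derivative (\<lambda>a. g (inv_into U \<phi> a)) (at (\<phi> p))) (at (\<phi> p))"
    by (rule smooth_on_has_derivative[OF smooth_funsD[OF assms(3) U(1)]]) (use U in auto)
  have "((\<lambda>a. f (inv_into U \<phi> a)) has_derivative frechet_derivative (\<lambda>a. g (inv_into U \<phi> a)) (at (\<phi> p))) (at (\<phi> p))"
    by (rule has_derivative_transform_within_open[OF hd chart_open_image[OF U(1) N]])
      (use assms(5,6) U chart_inv[OF U(1)] in auto)
  then show ?thesis using v[OF assms(2)] v[OF assms(3)] frechet_derivative_at by metis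
qed

lemma vf_chain:
  assumes X: "X \<in> vector_fields A" and f: "f \<in> smooth_funs A" and T: "smooth_on UNIV T"
    "\<And>t. (T has_real_derivative T' t) (at t)"
  shows "X (\<lambda>x. T (f x)) p = T' (f p) * X f p"
proof -
  obtain U \<phi> where U: "(U, \<phi>) \<in> A" "p \<in> U" by (rule chart_at)
  obtain v where v: "\<And>f. f \<in> smooth_funs A \<Longrightarrow> X f p = frechet_derivative (\<lambda>a. f (inv_into U \<phi> a)) (at (\<phi> p)) v"
    using vf_tangent[OF X U] by metis
  have hd: "((\<lambda>a. f (inv_into U \<phi> a)) has_derivative frechet_derivative (\<lambda>a. f (inv_into U \<phi> a)) (at (\<phi> p))) (at (\<phi> p))"
    by (rule smooth_on_has_derivative[OF smooth_funsD[OF f U(1)]]) (use U in auto)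
  have "(T has_derivative (*) (T' (f (inv_into U \<phi> (\<phi> p))))) (at (f (inv_into U \<phi> (\<phi> p))))"
    using T(2) by (simp add: has_field_derivative_def)
  from has_derivative_compose[OF hd this]
  have "frechet_derivative (\<lambda>a. T (f (inv_into U \<phi> a))) (at (\<phi> p)) v
    = T' (f p) * frechet_derivative (\<lambda>a. f (inv_into U \<phi> a)) (at (\<phi> p)) v"
    using frechet_derivative_at chart_inv[OF U] by metis
  then show ?thesis using v[OF f] v[OF smooth_funs_compose[OF f open_UNIV T(1)]] by simp
qed

text \<open>Smoothness on the product manifold is tested in products of charts; no atlas of the
  product is formed.\<close>

definition smooth_kernel :: "('g \<Rightarrow> 'g \<Rightarrow> real) \<Rightarrow> bool" where
  "smooth_kernel K \<longleftrightarrow> (\<forall>(U, \<phi>)\<in>A. \<forall>(V, \<psi>)\<in>A.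
     smooth_on (\<phi> ` U \<times> \<psi> ` V) (\<lambda>q. K (inv_into U \<phi> (fst q)) (inv_into V \<psi> (snd q))))"

lemma smooth_kernelD:
  "smooth_kernel K \<Longrightarrow> (U, \<phi>) \<in> A \<Longrightarrow> (V, \<psi>) \<in> A \<Longrightarrow>
     smooth_on (\<phi> ` U \<times> \<psi> ` V) (\<lambda>q. K (inv_into U \<phi> (fst q)) (inv_into V \<psi> (snd q)))"
  unfolding smooth_kernel_def by fastforce

lemma smooth_kernel_swap:
  assumes "smooth_kernel K"
  shows "smooth_kernel (\<lambda>x y. K y x)"
proof -
  have "smooth_on (\<phi> ` U \<times> \<psi> ` V) (\<lambda>q. K (inv_into V \<psi> (snd q)) (inv_into U \<phi> (fst q)))"
    if U: "(U, \<phi>) \<in> A" and V: "(V, \<psi>) \<in> A" for U \<phi> V \<psi>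
  proof -
    have o: "open (\<phi> ` U \<times> \<psi> ` V)" "open (\<psi> ` V \<times> \<phi> ` U)"
      using chartD(2)[OF U] chartD(2)[OF V] by (auto intro: open_Times)
    have sw: "smooth_on (\<phi> ` U \<times> \<psi> ` V) (\<lambda>q. (snd q, fst q))"
      by (intro smooth_on_Pair smooth_on_linear o bounded_linear_fst bounded_linear_snd)
    show ?thesis
      using smooth_on_compose[OF o sw smooth_kernelD[OF assms V U]] by (simp add: image_subset_iff mem_Times_iff)
  qed
  then show ?thesis unfolding smooth_kernel_def by fast
qed

lemma smooth_kernel_section:
  assumes "smooth_kernel K"
  shows "(\<lambda>x. K x y) \<in> smooth_funs A"
proof (rule smooth_funsI2)
  fix U \<phi> assume U: "(U, \<phi>) \<in> A"
  obtain V \<psi> where V: "(V, \<psi>) \<in> A" "y \<in> V" by (rule chart_at)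
  have o: "open (\<phi> ` U \<times> \<psi> ` V)"
      using chartD(2)[OF U] chartD(2)[OF V(1)] by (auto intro: open_Times)
  have "smooth_on (\<phi> ` U) (\<lambda>a. (a, \<psi> y))"
    by (intro smooth_on_Pair smooth_on_id smooth_on_const chartD(2)[OF U])
  from smooth_on_compose[OF chartD(2)[OF U] o this smooth_kernelD[OF assms U V(1)]]
  show "smooth_on (\<phi> ` U) (\<lambda>a. K (inv_into U \<phi> a) y)"
    using V chart_inv[OF V] by auto
qed

lemma smooth_kernel_jck:
  assumes K: "smooth_kernel K" and U: "(U, \<phi>) \<in> A" "S \<subseteq> \<phi> ` U" "open S"
  shows "jck k S C (\<lambda>a y. K (inv_into U \<phi> a) y)"
proof (rule jck_local)
  fix y assume "y \<in> C"
  obtain V \<psi> where V: "(V, \<psi>) \<in> A" "y \<in> V" by (rule chart_at)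
  have o: "open (\<phi> ` U \<times> \<psi> ` V)"
    using chartD(2)[OF U(1)] chartD(2)[OF V(1)] by (auto intro: open_Times)
  have "jck k S (C \<inter> V) (\<lambda>a y. (\<lambda>q. K (inv_into U \<phi> (fst q)) (inv_into V \<psi> (snd q))) (a, \<psi> y))"
    by (rule jck_smooth[OF o smooth_kernelD[OF K U(1) V(1)]])
      (use U continuous_on_subset[OF chartD(4)[OF V(1)]] in auto)
  then have "jck k S (C \<inter> V) (\<lambda>a y. K (inv_into U \<phi> a) y)"
    by (rule jck_cong[OF U(3), rotated]) (auto simp: chart_inv[OF V(1)])
  then show "\<exists>N. open N \<and> y \<in> N \<and> jck k S (C \<inter> N) (\<lambda>a y. K (inv_into U \<phi> a) y)"
    using V chartD(1)[OF V(1)] by blast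
qed

text \<open>The support condition makes all parameters near a given one share a compact domain of integration.\<close>

lemma kernel_integral:
  assumes K: "smooth_kernel K"
    and supp: "\<And>p. \<exists>W C. open W \<and> p \<in> W \<and> compact C \<and> (\<forall>x\<in>W. \<forall>y. y \<notin> C \<longrightarrow> K x y = 0)"
    and N: "sets N = sets borel" "\<And>C. compact C \<Longrightarrow> set_integrable N C k"
  shows "(\<lambda>x. \<integral>y. K x y * k y \<partial>N) \<in> smooth_funs A"
    and "X \<in> vector_fields A \<Longrightarrow> X (\<lambda>x. \<integral>y. K x y * k y \<partial>N) p = (\<integral>y. X (\<lambda>x. K x y) p * k y \<partial>N)"
proof -
  let ?F = "\<lambda>x. \<integral>y. K x y * k y \<partial>N"
  \<comment> \<open>Near \<open>p\<close> the integral runs over one fixed compact set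
    \<open>C\<close>, which is the form treated by the lemmas on parameter integrals.\<close>
  have loc: "\<exists>W C. open W \<and> p \<in> W \<and> W \<subseteq> U \<and> compact C \<and> (\<forall>x\<in>W. \<forall>y. y \<notin> C \<longrightarrow> K x y = 0) \<and>
     (\<forall>a\<in>\<phi> ` W. ?F (inv_into U \<phi> a) = (\<integral>y. indicator C y * K (inv_into U \<phi> a) y * k y \<partial>N))"
    if U: "(U, \<phi>) \<in> A" "p \<in> U" for p U \<phi>
  proof -
    obtain W C where W: "open W" "p \<in> W" "compact C" "\<forall>x\<in>W. \<forall>y. y \<notin> C \<longrightarrow> K x y = 0" using supp by metis
    have "?F (inv_into U \<phi> a) = (\<integral>y. indicator C y * K (inv_into U \<phi> a) y * k y \<partial>N)" if "a \<in> \<phi> ` (W \<inter> U)" for a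
      by (rule Bochner_Integration.integral_cong)
        (use that W(4) chart_inv[OF U(1)] in \<open>auto simp: indicator_def\<close>)
    then show ?thesis using W U chartD(1)[OF U(1)] by (intro exI[of _ "W \<inter> U"] exI[of _ C]) auto
  qed
  show s: "?F \<in> smooth_funs A"
  proof (rule smooth_funsI)
    fix p
    obtain U \<phi> where U: "(U, \<phi>) \<in> A" "p \<in> U" by (rule chart_at)
    obtain W C where W: "open W" "p \<in> W" "W \<subseteq> U" "compact C"
      "\<And>a. a\<in>\<phi> ` W \<Longrightarrow> ?F (inv_into U \<phi> a) = (\<integral>y. indicator C y * K (inv_into U \<phi> a) y * k y \<partial>N)"
      using loc[OF U] by metis
    note oW = chart_open_image[OF U(1) W(1,3)]
    have s: "smooth_on (\<phi> ` W) (\<lambda>a. \<integral>y. indicator C y * K (inv_into U \<phi> a) y * k y \<partial>N)"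
      unfolding smooth_on_def
      using integral_param_ck[OF N(1) W(4) N(2)[OF W(4)] smooth_kernel_jck[OF K U(1) _ oW] oW] W(3) by blast
    have "smooth_on (\<phi> ` W) (\<lambda>a. ?F (inv_into U \<phi> a))"
      by (rule smooth_on_cong[OF oW W(5), THEN iffD2, OF _ s])
    then show "\<exists>U \<phi> N. (U, \<phi>) \<in> A \<and> open N \<and> p \<in> N \<and> N \<subseteq> U \<and> smooth_on (\<phi> ` N) (\<lambda>a. ?F (inv_into U \<phi> a))"
      using U(1) W(1-3) by (intro exI conjI)
  qed
  assume X: "X \<in> vector_fields A"
  obtain U \<phi> where U: "(U, \<phi>) \<in> A" "p \<in> U" by (rule chart_at)
  obtain v where v: "\<And>f. f \<in> smooth_funs A \<Longrightarrow> X f p = frechet_derivative (\<lambda>a. f (inv_into U \<phi> a)) (at (\<phi> p)) v"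
    using vf_tangent[OF X U] by metis
  from loc[OF U] obtain W C where W': "open W" "p \<in> W" "W \<subseteq> U" "compact C" "\<forall>x\<in>W. \<forall>y. y \<notin> C \<longrightarrow> K x y = 0"
      "\<forall>a\<in>\<phi> ` W. ?F (inv_into U \<phi> a) = (\<integral>y. indicator C y * K (inv_into U \<phi> a) y * k y \<partial>N)"
    by (elim exE conjE) (rule that)
  note W = W'(1-4) W'(5)[rule_format] W'(6)[THEN bspec]
  note oW = chart_open_image[OF U(1) W(1,3)]
  have pW: "\<phi> p \<in> \<phi> ` W" using W by auto
  \<comment> \<open>For \<open>y\<close> outside \<open>C\<close> the kernel vanishes for all
    \<open>x\<close> in the neighbourhood \<open>W\<close> of \<open>p\<close>, hence so does its
    derivative at \<open>p\<close>; this allows removing the indicator of \<open>C\<close> at the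
    end.\<close>
  have z: "X (\<lambda>x. K x y) p = 0" if "y \<notin> C" for y
    using vf_local[OF X smooth_kernel_section[OF K] smooth_funs_const W(1,2), of y 0] W(5) that
    by (simp add: vf_const[OF X])
  have "((\<lambda>a. \<integral>y. indicator C y * K (inv_into U \<phi> a) y * k y \<partial>N) has_derivative
     (\<lambda>v. \<integral>y. indicator C y * frechet_derivative (\<lambda>a. K (inv_into U \<phi> a) y) (at (\<phi> p)) v * k y \<partial>N)) (at (\<phi> p))"
    by (rule integral_param_has_derivative[OF N(1) W(4) N(2)[OF W(4)] smooth_kernel_jck[OF K U(1) _ oW, of 1, simplified One_nat_def] oW pW])
      (use W in auto)
  then have "((\<lambda>a. ?F (inv_into U \<phi> a)) has_derivative
     (\<lambda>v. \<integral>y. indicator C y * frechet_derivative (\<lambda>a. K (inv_into U \<phi> a) y) (at (\<phi> p)) v * k y \<partial>N)) (at (\<phi> p))"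
    by (rule has_derivative_transform_within_open[OF _ oW pW]) (simp add: W(6))
  from fun_cong[OF frechet_derivative_at[OF this], of v]
  have "X ?F p = (\<integral>y. indicator C y * frechet_derivative (\<lambda>a. K (inv_into U \<phi> a) y) (at (\<phi> p)) v * k y \<partial>N)"
    unfolding v[OF s] by (rule sym)
  also have "\<dots> = (\<integral>y. X (\<lambda>x. K x y) p * k y \<partial>N)"
    by (rule Bochner_Integration.integral_cong)
      (auto simp: indicator_def z v[OF smooth_kernel_section[OF K], symmetric])
  finally show "X ?F p = (\<integral>y. X (\<lambda>x. K x y) p * k y \<partial>N)" .
qed

end

subsection \<open>Haar measure and integration by parts\<close>

locale lie_haar =
  fixes G :: "('g::{t2_space, second_countable_topology}) monoid" (structure)
    and A :: "('g, 'e::euclidean_space) chart set"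
    and \<mu> :: "'g measure" and \<delta> :: "'g \<Rightarrow> real"
  assumes lie: "lie_group G A" and haar: "left_haar_measure G \<mu>" and modular: "modular_function G \<mu> \<delta>"
begin

sublocale smooth_manifold A
  using lie by unfold_locales (simp add: lie_group_def)

sublocale group G
  using lie by (simp add: lie_group_def)

lemma carrier_UNIV [simp]: "carrier G = UNIV"
  using lie by (simp add: lie_group_def)

lemma mult_assoc: "x \<otimes> y \<otimes> z = x \<otimes> (y \<otimes> z)"
  by (simp add: m_assoc)

lemma inv_cancel [simp]: "inv x \<otimes> (x \<otimes> y) = y" "x \<otimes> (inv x \<otimes> y) = y" "x \<otimes> y \<otimes> inv y = x" "x \<otimes> inv y \<otimes> y = x"
proof -
  show "inv x \<otimes> (x \<otimes> y) = y" "x \<otimes> (inv x \<otimes> y) = y"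
    unfolding mult_assoc[symmetric] by simp_all
  show "x \<otimes> y \<otimes> inv y = x" "x \<otimes> inv y \<otimes> y = x" unfolding mult_assoc by simp_all
qed

lemma inv_prod: "inv (x \<otimes> y) = inv y \<otimes> inv x"
  by (simp add: inv_mult_group)

lemma continuous_on_mult [continuous_intros]:
  "continuous_on S f \<Longrightarrow> continuous_on S g \<Longrightarrow> continuous_on S (\<lambda>x. f x \<otimes> g x)"
proof -
  assume f: "continuous_on S f" and g: "continuous_on S g"
  have "continuous_on UNIV (\<lambda>(x, y). x \<otimes> y)" using lie by (simp add: lie_group_def)
  from continuous_on_compose2[OF this continuous_on_Pair[OF f g]] show ?thesis by simp
qed

lemma continuous_on_inv [continuous_intros]:
  "continuous_on S f \<Longrightarrow> continuous_on S (\<lambda>x. inv (f x))"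
proof -
  assume f: "continuous_on S f"
  have "continuous_on UNIV (\<lambda>x. inv x)" using lie by (simp add: lie_group_def)
  from continuous_on_compose2[OF this f] show ?thesis by simp
qed

lemma compact_mult: "compact K \<Longrightarrow> compact L \<Longrightarrow> compact ((\<lambda>q. fst q \<otimes> snd q) ` (K \<times> L))"
  by (intro compact_continuous_image compact_Times continuous_intros)

lemma compact_inv: "compact K \<Longrightarrow> compact ((\<lambda>x. inv x) ` K)"
  by (intro compact_continuous_image continuous_intros)

section \<open>Haar measure: translations, compact exhaustion, positivity on open sets\<close>

lemma sets_mu [simp, measurable_cong]: "sets \<mu> = sets borel"
  using haar by (simp add: left_haar_measure_def)

lemma space_mu [simp]: "space \<mu> = UNIV"
  using sets_eq_imp_space_eq[OF sets_mu] by simp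

lemma emeasure_compact: "compact K \<Longrightarrow> emeasure \<mu> K < \<infinity>"
  using haar by (simp add: left_haar_measure_def)

lemma continuous_measurable: "continuous_on UNIV f \<Longrightarrow> f \<in> borel_measurable \<mu>"
  using borel_measurable_continuous_onI measurable_cong_sets[OF sets_mu refl] by blast

lemma measurable_mult [measurable]:
  "f \<in> borel_measurable N \<Longrightarrow> g \<in> borel_measurable N \<Longrightarrow> (\<lambda>x. f x \<otimes> g x) \<in> borel_measurable N"
  by (rule borel_measurable_continuous_Pair)
    (auto intro!: continuous_on_mult continuous_on_fst continuous_on_snd continuous_on_id)

lemma measurable_inv [measurable]:
  "f \<in> borel_measurable N \<Longrightarrow> (\<lambda>x. inv (f x)) \<in> borel_measurable N"
  using borel_measurable_continuous_on[of "\<lambda>x. inv x" f N] continuous_on_inv[OF continuous_on_id] by auto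

lemma measurable_id_borel [measurable]: "(\<lambda>x. x) \<in> borel_measurable \<mu>"
  by (simp add: measurable_ident_sets)

lemma borel_measurable_mu_iff: "f \<in> borel_measurable \<mu> \<longleftrightarrow> f \<in> borel_measurable borel"
  using measurable_cong_sets[OF sets_mu refl] by blast

lemma left_image: "(\<lambda>y. x \<otimes> y) -` B = (\<lambda>y. inv x \<otimes> y) ` B"
  by (auto simp: image_iff intro!: bexI[of _ "x \<otimes> _"])

lemma right_image: "(\<lambda>y. y \<otimes> x) -` B = (\<lambda>y. y \<otimes> inv x) ` B"
  by (auto simp: image_iff intro!: bexI[of _ "_ \<otimes> x"])

lemma left_distr: "distr \<mu> \<mu> (\<lambda>y. x \<otimes> y) = \<mu>"
proof (rule measure_eqI)
  fix B assume "B \<in> sets (distr \<mu> \<mu> (\<lambda>y. x \<otimes> y))"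
  then have B: "B \<in> sets \<mu>" by simp
  have "emeasure (distr \<mu> \<mu> (\<lambda>y. x \<otimes> y)) B = emeasure \<mu> ((\<lambda>y. inv x \<otimes> y) ` B)"
    using B by (subst emeasure_distr) (auto simp: left_image measurable_cong_sets[OF refl sets_mu])
  also have "\<dots> = emeasure \<mu> B" using haar B unfolding left_haar_measure_def by blast
  finally show "emeasure (distr \<mu> \<mu> (\<lambda>y. x \<otimes> y)) B = emeasure \<mu> B" .
qed simp

lemma left_measurable: "(\<lambda>y. x \<otimes> y) \<in> measurable \<mu> \<mu>"
  by (subst measurable_cong_sets[OF refl sets_mu]) measurable

lemma left_integral: "f \<in> borel_measurable \<mu> \<Longrightarrow> (\<integral>y. f (x \<otimes> y) \<partial>\<mu>) = (\<integral>y. f y \<partial>\<mu>)" for f :: "'g \<Rightarrow> real"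
  using integral_distr[OF left_measurable, of f x] by (simp add: left_distr)

lemma left_integrable: "f \<in> borel_measurable \<mu> \<Longrightarrow> integrable \<mu> (\<lambda>y. f (x \<otimes> y)) \<longleftrightarrow> integrable \<mu> f" for f :: "'g \<Rightarrow> real"
  using integrable_distr_eq[OF left_measurable, of f x] by (simp add: left_distr)

text \<open>Local compactness comes from the charts, through the compact support of a bump
  function.\<close>

lemma compact_nbhd:
  fixes p :: 'g
  obtains K W where "compact K" "open W" "p \<in> W" "W \<subseteq> K"
proof -
  obtain \<eta> where \<eta>: "\<eta> \<in> test_funs A" "\<eta> p > 0"
    using bump_exists[OF open_UNIV, of p] by auto
  have "open {x. \<eta> x \<noteq> 0}"
    using open_vimage[of "- {0}" \<eta>] smooth_funs_continuous[of \<eta>] \<eta> by (auto simp: test_funs_def vimage_def)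
  then show ?thesis using \<eta> closure_subset[of "{x. \<eta> x \<noteq> 0}"]
    by (intro that[of "closure {x. \<eta> x \<noteq> 0}" "{x. \<eta> x \<noteq> 0}"]) (auto simp: test_funs_def)
qed

lemma exhaustion:
  obtains B :: "nat \<Rightarrow> 'g set" where "\<And>n. compact (B n)" "incseq B" "\<And>C. compact C \<Longrightarrow> \<exists>n. C \<subseteq> B n"
proof -
  define F where "F = {W :: 'g set. open W \<and> (\<exists>K. compact K \<and> W \<subseteq> K)}"
  obtain F' where F': "F' \<subseteq> F" "countable F'" "\<Union>F' = \<Union>F"
    using Lindelof[of F] by (auto simp: F_def)
  have UF: "\<Union>F = UNIV"
  proof -
    have "p \<in> \<Union>F" for p
      by (rule compact_nbhd[of p]) (auto simp: F_def)
    then show ?thesis by auto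
  qed
  have ne: "F' \<noteq> {}" using F' UF by auto
  define W where "W = from_nat_into F'"
  have W: "W n \<in> F" for n using from_nat_into[OF ne] F' by (auto simp: W_def)
  have "\<forall>n. \<exists>K. compact K \<and> W n \<subseteq> K" using W by (auto simp: F_def)
  then obtain K where K: "\<And>n. compact (K n)" "\<And>n. W n \<subseteq> K n" by metis
  have cov: "(\<Union>n. W n) = UNIV"
    using range_from_nat_into[OF ne F'(2)] F'(3) UF by (simp add: W_def)
  show ?thesis
  proof (rule that[of "\<lambda>n. \<Union>i\<le>n. K i"])
    show "compact (\<Union>i\<le>n. K i)" for n using K by (intro compact_UN) auto
    show "incseq (\<lambda>n. \<Union>i\<le>n. K i)" unfolding incseq_def by (intro allI impI UN_mono) auto
    fix C :: "'g set" assume C: "compact C"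
    have "\<exists>D\<subseteq>UNIV. finite D \<and> C \<subseteq> (\<Union>n\<in>D. W n)"
      using compactE_image[OF C, of UNIV W] W cov by (metis (no_types, lifting) F_def mem_Collect_eq subset_UNIV)
    then obtain D where D: "finite D" "C \<subseteq> (\<Union>n\<in>D. W n)" by auto
    have "C \<subseteq> (\<Union>i\<le>Max (insert 0 D). K i)"
    proof
      fix x assume "x \<in> C"
      then obtain n where n: "n \<in> D" "x \<in> W n" using D by auto
      then have "n \<le> Max (insert 0 D)" using D by (intro Max_ge) auto
      then show "x \<in> (\<Union>i\<le>Max (insert 0 D). K i)" using n K by auto
    qed
    then show "\<exists>n. C \<subseteq> (\<Union>i\<le>n. K i)" by blast
  qed
qed

lemma exhaustion_covers:
  assumes "\<And>C :: 'g set. compact C \<Longrightarrow> \<exists>n. C \<subseteq> B n"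
  shows "(\<Union>n. B n) = UNIV"
proof -
  have "p \<in> (\<Union>n. B n)" for p using assms[of "{p}"] by auto
  then show ?thesis by auto
qed

sublocale sigma_finite_measure \<mu>
proof
  obtain B :: "nat \<Rightarrow> 'g set" where B: "\<And>n. compact (B n)" "incseq B" "\<And>C. compact C \<Longrightarrow> \<exists>n. C \<subseteq> B n"
    using exhaustion by metis
  have "range B \<subseteq> sets \<mu>" using compact_imp_closed[OF B(1)] by auto
  moreover have "\<forall>a\<in>range B. emeasure \<mu> a \<noteq> \<infinity>"
    using emeasure_compact[OF B(1)] by (auto simp: less_top[symmetric] image_iff)
  ultimately show "\<exists>A. countable A \<and> A \<subseteq> sets \<mu> \<and> \<Union> A = space \<mu> \<and> (\<forall>a\<in>A. emeasure \<mu> a \<noteq> \<infinity>)"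
    using exhaustion_covers[OF B(3)] by (intro exI[of _ "range B"]) auto
qed

sublocale pair: pair_sigma_finite \<mu> \<mu> ..

text \<open>Second countability identifies the product of the Borel algebras with the Borel algebra
  of the product; this makes continuous functions of two group variables measurable in Fubini's
  theorem.\<close>

lemma sets_pair: "sets (\<mu> \<Otimes>\<^sub>M \<mu>) = sets (borel :: ('g \<times> 'g) measure)"
proof -
  have "sets (\<mu> \<Otimes>\<^sub>M \<mu>) = sets ((borel :: 'g measure) \<Otimes>\<^sub>M (borel :: 'g measure))"
    by (rule sets_pair_measure_cong) auto
  then show ?thesis using borel_prod[where 'a='g and 'b='g] by metis
qed

text \<open>If \<open>U\<close> were null, its left translates would be null sets covering the
  group; by the Lindelof property countably many suffice, and the whole measure would
  vanish.\<close>

lemma open_pos: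
  assumes "open U" "U \<noteq> {}"
  shows "emeasure \<mu> U \<noteq> 0"
proof
  assume z: "emeasure \<mu> U = 0"
  obtain p where p: "p \<in> U" using assms by auto
  define F where "F = range (\<lambda>q. (\<lambda>y. q \<otimes> inv p \<otimes> y) ` U)"
  have im: "(\<lambda>y. q \<otimes> y) ` U = (\<lambda>y. inv q \<otimes> y) -` U" for q
    using left_image[of "inv q" U] by simp
  have op: "open W" if "W \<in> F" for W
    using that unfolding F_def im by (auto intro!: open_vimage assms continuous_intros)
  obtain F' where F': "F' \<subseteq> F" "countable F'" "\<Union>F' = \<Union>F" using Lindelof[of F] op by blast
  have "q \<in> (\<lambda>y. q \<otimes> inv p \<otimes> y) ` U" for q using p by (auto intro!: image_eqI[of _ _ p])
  then have "\<Union>F = UNIV" unfolding F_def by blast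
  moreover have "W \<in> null_sets \<mu>" if "W \<in> F" for W
  proof -
    obtain q where q: "W = (\<lambda>y. q \<otimes> inv p \<otimes> y) ` U" using \<open>W \<in> F\<close> by (auto simp: F_def)
    have "emeasure \<mu> W = emeasure \<mu> U" using haar assms(1) unfolding q left_haar_measure_def by auto
    then show ?thesis using z op[OF that] by auto
  qed
  ultimately have "UNIV \<in> null_sets \<mu>"
    using null_sets_UN'[OF F'(2), of "\<lambda>W. W" \<mu>] F' by (auto simp: subset_iff)
  then show False using haar by (auto simp: left_haar_measure_def)
qed

section \<open>Locally integrable real functions\<close>

definition L1loc :: "('g \<Rightarrow> real) set" where "L1loc = Lp_loc 1 \<mu>"

lemma L1loc_iff:
  fixes f :: "'g \<Rightarrow> real"
  shows "f \<in> L1loc \<longleftrightarrow> f \<in> borel_measurable \<mu> \<and> (\<forall>K. compact K \<longrightarrow> set_integrable \<mu> K f)"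
proof -
  have "set_integrable \<mu> K f \<longleftrightarrow> set_integrable \<mu> K (\<lambda>x. \<bar>f x\<bar>)" if "f \<in> borel_measurable \<mu>" "compact K" for K
  proof -
    have [measurable]: "K \<in> sets borel" using compact_imp_closed[OF that(2)] by auto
    note [measurable] = that(1)
    show ?thesis
      by (rule set_integrable_abs_iff[symmetric]) (auto simp: set_borel_measurable_def)
  qed
  then show ?thesis by (auto simp: L1loc_def Lp_loc_def)
qed

lemma L1locD:
  fixes f :: "'g \<Rightarrow> real"
  assumes "f \<in> L1loc"
  shows "f \<in> borel_measurable \<mu>" "compact K \<Longrightarrow> set_integrable \<mu> K f"
  using assms L1loc_iff by auto

lemma L1loc_bound:
  fixes f g :: "'g \<Rightarrow> real"
  assumes "g \<in> L1loc" "f \<in> borel_measurable \<mu>" "AE x in \<mu>. \<bar>f x\<bar> \<le> \<bar>g x\<bar>"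
  shows "f \<in> L1loc"
  unfolding L1loc_iff
proof (intro conjI allI impI assms(2))
  fix K :: "'g set" assume K: "compact K"
  have [measurable]: "K \<in> sets borel" using compact_imp_closed[OF K] by auto
  note [measurable] = assms(2)
  show "set_integrable \<mu> K f"
    by (rule set_integrable_bound[OF L1locD(2)[OF assms(1) K]])
      (use assms(3) in \<open>auto simp: set_borel_measurable_def\<close>)
qed

lemma L1loc_add: "f \<in> L1loc \<Longrightarrow> g \<in> L1loc \<Longrightarrow> (\<lambda>x. f x + g x) \<in> L1loc"
  for f g :: "'g \<Rightarrow> real"
  unfolding L1loc_iff by (auto intro: borel_measurable_add set_integral_add)

lemma L1loc_cmult: "f \<in> L1loc \<Longrightarrow> (\<lambda>x. c * f x) \<in> L1loc" for f :: "'g \<Rightarrow> real"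
  unfolding L1loc_iff by auto

lemma L1loc_abs: "f \<in> L1loc \<Longrightarrow> (\<lambda>x. \<bar>f x\<bar>) \<in> L1loc" for f :: "'g \<Rightarrow> real"
  by (rule L1loc_bound) (auto intro: borel_measurable_abs L1locD(1))

lemma L1loc_sum: "(\<And>i. i \<in> I \<Longrightarrow> f i \<in> L1loc) \<Longrightarrow> (\<lambda>x. \<Sum>i\<in>I. f i x) \<in> L1loc" for f :: "_ \<Rightarrow> 'g \<Rightarrow> real"
proof (induction I rule: infinite_finite_induct)
  case (insert x F)
  then show ?case using L1loc_add by simp
qed (auto simp: L1loc_iff set_integrable_def)

lemma continuous_L1loc:
  fixes f :: "'g \<Rightarrow> real"
  assumes "continuous_on UNIV f"
  shows "f \<in> L1loc"
  unfolding L1loc_iff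
proof (intro conjI allI impI continuous_measurable assms)
  fix K :: "'g set" assume K: "compact K"
  have "set_integrable \<mu> K (\<lambda>_. 1::real)"
    using emeasure_compact[OF K] compact_imp_closed[OF K] by (auto simp: set_integrable_def)
  from integrable_on_compact[OF sets_mu K this continuous_on_subset[OF assms]]
  show "set_integrable \<mu> K f" by (simp add: set_integrable_def)
qed

lemma bounded_L1loc:
  fixes f :: "'g \<Rightarrow> real"
  assumes "f \<in> borel_measurable \<mu>" "AE x in \<mu>. \<bar>f x\<bar> \<le> C"
  shows "f \<in> L1loc"
  by (rule L1loc_bound[OF continuous_L1loc[OF continuous_on_const[of _ C]] assms(1)]) (use assms(2) in auto)

lemma L1loc_integrable:
  fixes f u :: "'g \<Rightarrow> real"
  assumes f: "f \<in> L1loc" and u: "u \<in> borel_measurable \<mu>" "compact K" "AE x in \<mu>. \<bar>u x\<bar> \<le> C * indicator K x * \<bar>f x\<bar>"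
  shows "integrable \<mu> u"
proof (rule Bochner_Integration.integrable_bound[OF _ u(1)])
  show "integrable \<mu> (\<lambda>x. C * (indicator K x *\<^sub>R \<bar>f x\<bar>))"
    using L1locD(2)[OF L1loc_abs[OF f] u(2)] by (intro integrable_mult_right) (simp add: set_integrable_def)
  show "AE x in \<mu>. norm (u x) \<le> norm (C * (indicator K x *\<^sub>R \<bar>f x\<bar>))"
    using u(3) by eventually_elim (auto simp: mult.assoc)
qed

section \<open>Test functions and smoothness of the group operations\<close>

lemma test_funs_iff: "\<psi> \<in> test_funs A \<longleftrightarrow> \<psi> \<in> smooth_funs A \<and> (\<exists>K. compact K \<and> (\<forall>x. x \<notin> K \<longrightarrow> \<psi> x = 0))"
proof
  assume "\<psi> \<in> test_funs A"
  then show "\<psi> \<in> smooth_funs A \<and> (\<exists>K. compact K \<and> (\<forall>x. x \<notin> K \<longrightarrow> \<psi> x = 0))"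
    using closure_subset[of "{x. \<psi> x \<noteq> 0}"] by (auto simp: test_funs_def intro!: exI[of _ "closure {x. \<psi> x \<noteq> 0}"])
next
  assume a: "\<psi> \<in> smooth_funs A \<and> (\<exists>K. compact K \<and> (\<forall>x. x \<notin> K \<longrightarrow> \<psi> x = 0))"
  then obtain K where K: "compact K" "\<forall>x. x \<notin> K \<longrightarrow> \<psi> x = 0" by auto
  have "closure {x. \<psi> x \<noteq> 0} \<subseteq> K" by (rule closure_minimal) (use K compact_imp_closed in auto)
  then have "compact (closure {x. \<psi> x \<noteq> 0})"
    using compact_Int_closed[OF K(1) closed_closure, of "{x. \<psi> x \<noteq> 0}"] by (simp add: Int_absorb1)
  then show "\<psi> \<in> test_funs A" using a by (simp add: test_funs_def)
qed

lemma test_smooth: "\<psi> \<in> test_funs A \<Longrightarrow> \<psi> \<in> smooth_funs A"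
  by (simp add: test_funs_iff)

lemma test_support: "\<psi> \<in> test_funs A \<Longrightarrow> \<exists>K. compact K \<and> (\<forall>x. x \<notin> K \<longrightarrow> \<psi> x = 0)"
  by (simp add: test_funs_iff)

lemma test_mult_left: "f \<in> smooth_funs A \<Longrightarrow> \<psi> \<in> test_funs A \<Longrightarrow> (\<lambda>x. f x * \<psi> x) \<in> test_funs A"
  unfolding test_funs_iff using smooth_funs_mult by auto

lemma test_add: "\<phi> \<in> test_funs A \<Longrightarrow> \<psi> \<in> test_funs A \<Longrightarrow> (\<lambda>x. \<phi> x + \<psi> x) \<in> test_funs A"
proof -
  assume a: "\<phi> \<in> test_funs A" "\<psi> \<in> test_funs A"
  then obtain K L where "compact K" "\<forall>x. x \<notin> K \<longrightarrow> \<phi> x = 0" "compact L" "\<forall>x. x \<notin> L \<longrightarrow> \<psi> x = 0"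
    unfolding test_funs_iff by blast
  then show ?thesis
    unfolding test_funs_iff using a by (intro conjI exI[of _ "K \<union> L"]) (auto intro: smooth_funs_add test_smooth)
qed

lemma test_cmult: "\<psi> \<in> test_funs A \<Longrightarrow> (\<lambda>x. c * \<psi> x) \<in> test_funs A"
  by (rule test_mult_left[OF smooth_funs_const])

lemma test_vf: "X \<in> vector_fields A \<Longrightarrow> \<psi> \<in> test_funs A \<Longrightarrow> X \<psi> \<in> test_funs A"
proof -
  assume X: "X \<in> vector_fields A" and p: "\<psi> \<in> test_funs A"
  obtain K where K: "compact K" "\<forall>x. x \<notin> K \<longrightarrow> \<psi> x = 0" using test_support[OF p] by blast
  have "X \<psi> x = 0" if "x \<notin> K" for x
    using vf_local[OF X test_smooth[OF p] smooth_funs_const, of "- K" x 0] K that compact_imp_closed[OF K(1)]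
    by (auto simp: vf_const[OF X])
  then show ?thesis unfolding test_funs_iff using K vector_fieldsD(1)[OF X test_smooth[OF p] test_smooth[OF p]] by blast
qed

lemma smooth_measurable [measurable_dest]: "f \<in> smooth_funs A \<Longrightarrow> f \<in> borel_measurable \<mu>"
  by (intro continuous_measurable smooth_funs_continuous)

lemma smooth_L1loc: "f \<in> smooth_funs A \<Longrightarrow> f \<in> L1loc"
  by (intro continuous_L1loc smooth_funs_continuous)

lemma test_bounded:
  assumes "\<psi> \<in> test_funs A"
  obtains K C where "compact K" "\<And>x. \<bar>\<psi> x\<bar> \<le> C * indicator K x" "C \<ge> 0"
proof -
  obtain K where K: "compact K" "\<forall>x. x \<notin> K \<longrightarrow> \<psi> x = 0" using test_support[OF assms] by blast
  have "bounded (\<psi> ` K)"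
    by (intro compact_imp_bounded compact_continuous_image K(1)
        continuous_on_subset[OF smooth_funs_continuous[OF test_smooth[OF assms]]]) auto
  then obtain C where C: "\<And>x. x \<in> K \<Longrightarrow> \<bar>\<psi> x\<bar> \<le> C" by (auto simp: bounded_iff)
  show ?thesis
    by (rule that[of K "max C 0"]) (use K C in \<open>auto simp: indicator_def le_max_iff_disj\<close>)
qed

lemma test_integrable_mult:
  assumes "\<psi> \<in> test_funs A" "f \<in> L1loc"
  shows "integrable \<mu> (\<lambda>x. \<psi> x * f x)"
proof -
  obtain K C where K: "compact K" "\<And>x. \<bar>\<psi> x\<bar> \<le> C * indicator K x" "C \<ge> 0"
    using test_bounded[OF assms(1)] by metis
  have [measurable]: "\<psi> \<in> borel_measurable \<mu>" "f \<in> borel_measurable \<mu>"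
    using smooth_measurable[OF test_smooth[OF assms(1)]] L1locD(1)[OF assms(2)] .
  show ?thesis
    by (rule L1loc_integrable[OF assms(2) _ K(1), where C=C]) (auto simp: abs_mult intro!: mult_right_mono K)
qed

lemma test_integrable: "\<psi> \<in> test_funs A \<Longrightarrow> integrable \<mu> \<psi>"
  using test_integrable_mult[of \<psi> "\<lambda>_. 1"] smooth_L1loc[OF smooth_funs_const] by simp

text \<open>The Lie group axiom describes products only in a third chart
  \<open>(W, \<theta>)\<close>. Near a given pair such a chart contains the products, and \<rho> is
  smooth in it.\<close>

lemma smooth_kernel_mult:
  assumes "\<rho> \<in> smooth_funs A"
  shows "smooth_kernel (\<lambda>x y. \<rho> (x \<otimes> y))"
proof -
  have "smooth_on (\<phi> ` U \<times> \<psi> ` V) (\<lambda>q. \<rho> (inv_into U \<phi> (fst q) \<otimes> inv_into V \<psi> (snd q)))"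
    if U: "(U, \<phi>) \<in> A" and V: "(V, \<psi>) \<in> A" for U \<phi> V \<psi>
  proof (rule smooth_on_local)
    fix q assume q: "q \<in> \<phi> ` U \<times> \<psi> ` V"
    let ?h = "\<lambda>q. inv_into U \<phi> (fst q) \<otimes> inv_into V \<psi> (snd q)"
    obtain W \<theta> where W: "(W, \<theta>) \<in> A" "?h q \<in> W" by (rule chart_at)
    define T where "T = ?h -` W \<inter> \<phi> ` U \<times> \<psi> ` V"
    have oUV: "open (\<phi> ` U \<times> \<psi> ` V)" using chartD(2)[OF U] chartD(2)[OF V] by (auto intro: open_Times)
    have ch: "continuous_on (\<phi> ` U \<times> \<psi> ` V) ?h"
      by (intro continuous_intros continuous_on_compose2[OF chartD(5)[OF U]] continuous_on_compose2[OF chartD(5)[OF V]]) auto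
    have oT: "open T" unfolding T_def
      using ch chartD(1)[OF W(1)] continuous_on_open_vimage[OF oUV] by blast
    have "\<forall>(U, \<phi>)\<in>A. \<forall>(V, \<psi>)\<in>A. \<forall>(W, \<theta>)\<in>A.
        smooth_on {(a, b). a \<in> \<phi> ` U \<and> b \<in> \<psi> ` V \<and> inv_into U \<phi> a \<otimes> inv_into V \<psi> b \<in> W}
          (\<lambda>(a, b). \<theta> (inv_into U \<phi> a \<otimes> inv_into V \<psi> b))"
      using lie unfolding lie_group_def by (elim conjE)
    then have "smooth_on {(a, b). a \<in> \<phi> ` U \<and> b \<in> \<psi> ` V \<and> inv_into U \<phi> a \<otimes> inv_into V \<psi> b \<in> W}
          (\<lambda>(a, b). \<theta> (inv_into U \<phi> a \<otimes> inv_into V \<psi> b))" using U V W(1) by blast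
    moreover have "{(a, b). a \<in> \<phi> ` U \<and> b \<in> \<psi> ` V \<and> inv_into U \<phi> a \<otimes> inv_into V \<psi> b \<in> W} = T"
      by (auto simp: T_def)
    moreover have "(\<lambda>(a, b). \<theta> (inv_into U \<phi> a \<otimes> inv_into V \<psi> b)) = (\<lambda>q. \<theta> (?h q))" by auto
    ultimately have hs: "smooth_on T (\<lambda>q. \<theta> (?h q))" by simp
    have s: "smooth_on T (\<lambda>q. \<rho> (inv_into W \<theta> (\<theta> (?h q))))"
      by (rule smooth_on_compose[OF oT chartD(2)[OF W(1)] hs smooth_funsD[OF assms W(1)]]) (auto simp: T_def)
    have "smooth_on T (\<lambda>q. \<rho> (?h q))"
    proof (rule smooth_on_transform[OF s oT])
      show "\<rho> (inv_into W \<theta> (\<theta> (?h q))) = \<rho> (?h q)" if "q \<in> T" for q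
        using that chart_inv[OF W(1), of "?h q"] by (simp add: T_def)
    qed
    then show "\<exists>T. open T \<and> q \<in> T \<and> smooth_on T (\<lambda>q. \<rho> (?h q))"
      using oT q W(2) by (auto simp: T_def)
  qed
  then show ?thesis unfolding smooth_kernel_def by fast
qed

lemma smooth_kernel_inv:
  assumes K: "smooth_kernel K"
  shows "smooth_kernel (\<lambda>x y. K x (inv y))"
proof -
  have "smooth_on (\<phi> ` U \<times> \<psi> ` V) (\<lambda>q. K (inv_into U \<phi> (fst q)) (inv (inv_into V \<psi> (snd q))))"
    if U: "(U, \<phi>) \<in> A" and V: "(V, \<psi>) \<in> A" for U \<phi> V \<psi>
  proof (rule smooth_on_local)
    fix q assume q: "q \<in> \<phi> ` U \<times> \<psi> ` V"
    let ?h = "\<lambda>b. inv (inv_into V \<psi> b)"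
    obtain W \<theta> where W: "(W, \<theta>) \<in> A" "?h (snd q) \<in> W" by (rule chart_at)
    define T where "T = ?h -` W \<inter> \<psi> ` V"
    have ch: "continuous_on (\<psi> ` V) ?h"
      by (intro continuous_intros chartD(5)[OF V])
    have oT: "open T" unfolding T_def
      using ch chartD(1)[OF W(1)] continuous_on_open_vimage[OF chartD(2)[OF V]] by blast
    have "\<forall>(U, \<phi>)\<in>A. \<forall>(W, \<theta>)\<in>A.
        smooth_on {a \<in> \<phi> ` U. inv (inv_into U \<phi> a) \<in> W} (\<lambda>a. \<theta> (inv (inv_into U \<phi> a)))"
      using lie unfolding lie_group_def by (elim conjE)
    then have "smooth_on {a \<in> \<psi> ` V. ?h a \<in> W} (\<lambda>a. \<theta> (?h a))" using V W(1) by blast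
    moreover have "{a \<in> \<psi> ` V. ?h a \<in> W} = T" by (auto simp: T_def)
    ultimately have hs: "smooth_on T (\<lambda>a. \<theta> (?h a))" by simp
    have oUT: "open (\<phi> ` U \<times> T)" using chartD(2)[OF U] oT by (rule open_Times)
    have oUW: "open (\<phi> ` U \<times> \<theta> ` W)" using chartD(2)[OF U] chartD(2)[OF W(1)] by (rule open_Times)
    have "smooth_on (\<phi> ` U \<times> T) (\<lambda>q. \<theta> (?h (snd q)))"
      by (rule smooth_on_compose[OF oUT oT smooth_on_linear[OF oUT bounded_linear_snd] hs]) auto
    then have pr: "smooth_on (\<phi> ` U \<times> T) (\<lambda>q. (fst q, \<theta> (?h (snd q))))"
      by (rule smooth_on_Pair[OF oUT smooth_on_linear[OF oUT bounded_linear_fst]])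
    have sub: "(\<lambda>q. (fst q, \<theta> (?h (snd q)))) ` (\<phi> ` U \<times> T) \<subseteq> \<phi> ` U \<times> \<theta> ` W"
      by (auto simp: T_def)
    have "smooth_on (\<phi> ` U \<times> T) (\<lambda>q. K (inv_into U \<phi> (fst q)) (?h (snd q)))"
    proof (rule smooth_on_transform[OF smooth_on_compose[OF oUT oUW pr smooth_kernelD[OF K U W(1)] sub] oUT])
      fix q assume "q \<in> \<phi> ` U \<times> T"
      then have "inv_into W \<theta> (\<theta> (?h (snd q))) = ?h (snd q)"
        using chart_inv[OF W(1), of "?h (snd q)"] by (auto simp: T_def)
      then show "K (inv_into U \<phi> (fst (fst q, \<theta> (?h (snd q))))) (inv_into W \<theta> (snd (fst q, \<theta> (?h (snd q)))))
        = K (inv_into U \<phi> (fst q)) (?h (snd q))" by simp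
    qed
    then show "\<exists>T. open T \<and> q \<in> T \<and> smooth_on T (\<lambda>q. K (inv_into U \<phi> (fst q)) (?h (snd q)))"
      using oUT q W(2) by (intro exI[of _ "\<phi> ` U \<times> T"]) (auto simp: T_def)
  qed
  then show ?thesis unfolding smooth_kernel_def by fast
qed

lemma smooth_left: "f \<in> smooth_funs A \<Longrightarrow> (\<lambda>x. f (y \<otimes> x)) \<in> smooth_funs A"
  using smooth_kernel_section[OF smooth_kernel_swap[OF smooth_kernel_mult]] .

lemma test_left:
  assumes "f \<in> test_funs A"
  shows "(\<lambda>x. f (y \<otimes> x)) \<in> test_funs A"
proof -
  obtain K where K: "compact K" "\<forall>x. x \<notin> K \<longrightarrow> f x = 0" using test_support[OF assms] by blast
  have "compact ((\<lambda>x. inv y \<otimes> x) ` K)" by (intro compact_continuous_image continuous_intros K)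
  moreover have "\<forall>x. x \<notin> (\<lambda>x. inv y \<otimes> x) ` K \<longrightarrow> f (y \<otimes> x) = 0"
    using K(2) by (auto simp: image_iff) (metis inv_cancel(1))
  ultimately show ?thesis unfolding test_funs_iff using smooth_left[OF test_smooth[OF assms]] by blast
qed

lemma lie_algebraD:
  assumes "X \<in> lie_algebra G A"
  shows "X \<in> vector_fields A" "f \<in> smooth_funs A \<Longrightarrow> X (\<lambda>x. f (y \<otimes> x)) = (\<lambda>x. X f (y \<otimes> x))"
  using assms by (auto simp: lie_algebra_def)

section \<open>The modular function\<close>

lemma delta_pos: "\<delta> x > 0"
  using modular by (simp add: modular_function_def)

lemma emeasure_right: "B \<in> sets \<mu> \<Longrightarrow> emeasure \<mu> ((\<lambda>y. y \<otimes> x) ` B) = ennreal (\<delta> x) * emeasure \<mu> B"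
  using modular by (simp add: modular_function_def)

text \<open>Right translation by \<open>x\<close> and then by \<open>y\<close> scales a measure by
  both factors; a neighbourhood of positive finite measure allows cancellation.\<close>

lemma delta_mult: "\<delta> (x \<otimes> y) = \<delta> x * \<delta> y"
proof -
  obtain K W where K: "compact K" "open W" "\<one> \<in> W" "W \<subseteq> K" by (rule compact_nbhd)
  have pos: "emeasure \<mu> W \<noteq> 0" using open_pos K by auto
  have fin: "emeasure \<mu> W < \<infinity>"
    using emeasure_mono[OF K(4), of \<mu>] emeasure_compact[OF K(1)] compact_imp_closed[OF K(1)] by (auto simp: order_le_less_trans)
  have W: "W \<in> sets \<mu>" using K by auto
  have im: "(\<lambda>z. z \<otimes> (x \<otimes> y)) ` W = (\<lambda>z. z \<otimes> y) ` ((\<lambda>z. z \<otimes> x) ` W)"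
    by (auto simp: image_image mult_assoc)
  have W2: "(\<lambda>z. z \<otimes> x) ` W \<in> sets \<mu>"
  proof -
    have "(\<lambda>z. z \<otimes> x) ` W = (\<lambda>z. z \<otimes> inv x) -` W" using right_image[of "inv x" W] by simp
    moreover have "open ((\<lambda>z. z \<otimes> inv x) -` W)" by (intro open_vimage K continuous_intros)
    ultimately show ?thesis by simp
  qed
  have "ennreal (\<delta> (x \<otimes> y)) * emeasure \<mu> W = ennreal (\<delta> y) * (ennreal (\<delta> x) * emeasure \<mu> W)"
    using emeasure_right[OF W, of "x \<otimes> y"] emeasure_right[OF W2, of y] emeasure_right[OF W, of x] im by simp
  then have "ennreal (\<delta> (x \<otimes> y)) * emeasure \<mu> W = ennreal (\<delta> x * \<delta> y) * emeasure \<mu> W"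
    using delta_pos by (simp add: ennreal_mult' less_imp_le mult.assoc mult.left_commute)
  then have "ennreal (\<delta> (x \<otimes> y)) = ennreal (\<delta> x * \<delta> y)"
    using pos fin by (auto simp: mult.commute[of _ "emeasure \<mu> W"] ennreal_mult_cancel_left)
  then show ?thesis using delta_pos by (simp add: less_imp_le)
qed

lemma delta_one: "\<delta> \<one> = 1"
  using delta_mult[of \<one> \<one>] delta_pos[of \<one>] by simp

lemma delta_inv: "\<delta> (inv x) = inverse (\<delta> x)"
  using delta_mult[of x "inv x"] delta_pos[of x] by (simp add: delta_one field_simps)

text \<open>The preimage of \<open>B\<close> under right translation by \<open>x\<close> is the
  translate of \<open>B\<close> by \<open>inv x\<close>; this is why the inverse of
  \<open>\<delta> x\<close> appears.\<close>

lemma right_integral: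
  fixes f :: "'g \<Rightarrow> real"
  assumes [measurable]: "f \<in> borel_measurable \<mu>"
  shows "(\<integral>y. f (y \<otimes> x) \<partial>\<mu>) = inverse (\<delta> x) * (\<integral>y. f y \<partial>\<mu>)"
proof -
  have m: "(\<lambda>y. y \<otimes> x) \<in> measurable \<mu> \<mu>"
    by (subst measurable_cong_sets[OF refl sets_mu]) measurable
  have "distr \<mu> \<mu> (\<lambda>y. y \<otimes> x) = density \<mu> (\<lambda>_. ennreal (inverse (\<delta> x)))"
  proof (rule measure_eqI)
    fix B assume "B \<in> sets (distr \<mu> \<mu> (\<lambda>y. y \<otimes> x))"
    then have B: "B \<in> sets \<mu>" by simp
    have "emeasure (distr \<mu> \<mu> (\<lambda>y. y \<otimes> x)) B = emeasure \<mu> ((\<lambda>y. y \<otimes> inv x) ` B)"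
      using B m by (subst emeasure_distr) (auto simp: right_image)
    also have "\<dots> = ennreal (inverse (\<delta> x)) * emeasure \<mu> B" using emeasure_right[OF B] delta_inv by simp
    finally show "emeasure (distr \<mu> \<mu> (\<lambda>y. y \<otimes> x)) B = emeasure (density \<mu> (\<lambda>_. ennreal (inverse (\<delta> x)))) B"
      using B by (simp add: emeasure_density_const)
  qed simp
  then have "(\<integral>y. f (y \<otimes> x) \<partial>\<mu>) = integral\<^sup>L (density \<mu> (\<lambda>_. ennreal (inverse (\<delta> x)))) f"
    using integral_distr[OF m assms] by simp
  also have "\<dots> = inverse (\<delta> x) * (\<integral>y. f y \<partial>\<mu>)"
    using delta_pos[of x] by (subst integral_density) (auto simp: less_imp_le)
  finally show ?thesis .
qed

text \<open>If \<open>x\<close> stays in the compact \<open>K\<close> and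
  \<open>y \<otimes> x\<close> in the support \<open>S\<close>, then \<open>y\<close> stays in the
  compact product of \<open>S\<close> with the inverses of \<open>K\<close>.\<close>

lemma right_kernel_support:
  assumes "\<psi> \<in> test_funs A"
  shows "\<exists>W C. open W \<and> p \<in> W \<and> compact C \<and> (\<forall>x\<in>W. \<forall>y. y \<notin> C \<longrightarrow> \<psi> (y \<otimes> x) = 0)"
proof -
  obtain S where S: "compact S" "\<forall>x. x \<notin> S \<longrightarrow> \<psi> x = 0" using test_support[OF assms] by blast
  obtain K W where K: "compact K" "open W" "p \<in> W" "W \<subseteq> K" by (rule compact_nbhd)
  let ?C = "(\<lambda>q. fst q \<otimes> snd q) ` (S \<times> (\<lambda>x. inv x) ` K)"
  have "compact ?C" by (intro compact_mult compact_inv S K)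
  moreover have "\<psi> (y \<otimes> x) = 0" if "x \<in> W" "y \<notin> ?C" for x y
  proof (rule ccontr)
    assume "\<psi> (y \<otimes> x) \<noteq> 0"
    then have "y \<otimes> x \<in> S" using S(2) by blast
    then have "y \<in> ?C" using that K by (intro image_eqI[of _ _ "(y \<otimes> x, inv x)"]) auto
    then show False using that by simp
  qed
  ultimately show ?thesis using K by blast
qed

lemma one_set_integrable: "compact C \<Longrightarrow> set_integrable \<mu> C (\<lambda>_. 1::real)"
  using L1locD(2)[OF continuous_L1loc[OF continuous_on_const[of UNIV "1::real"]]] .

text \<open>By \<open>right_integral\<close>, \<delta> is a positive constant divided by the
  integral of \<open>\<psi> (y \<otimes> x)\<close> over \<open>y\<close>; that integral is smooth
  in \<open>x\<close> as a kernel integral, and it never vanishes.\<close>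

lemma smooth_delta: "\<delta> \<in> smooth_funs A"
proof -
  obtain \<psi> where \<psi>: "\<psi> \<in> test_funs A" "\<And>x. \<psi> x \<ge> 0" "\<psi> \<one> > 0"
    using bump_exists[OF open_UNIV, of \<one>] by auto
  define D where "D x = (\<integral>y. \<psi> (y \<otimes> x) * 1 \<partial>\<mu>)" for x
  define I where "I = (\<integral>y. \<psi> y \<partial>\<mu>)"
  have [measurable]: "\<psi> \<in> borel_measurable \<mu>" using \<psi> smooth_measurable test_smooth by blast
  have D: "D x = inverse (\<delta> x) * I" for x by (simp add: D_def I_def right_integral)
  have "I \<noteq> 0"
  proof
    assume "I = 0"
    then have "AE x in \<mu>. \<psi> x = 0"
      using integral_nonneg_eq_0_iff_AE[OF test_integrable[OF \<psi>(1)]] \<psi>(2) by (simp add: I_def)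
    moreover have o: "open {x. \<psi> x \<noteq> 0}"
      using open_vimage[of "- {0}" \<psi>] smooth_funs_continuous[OF test_smooth[OF \<psi>(1)]] by (auto simp: vimage_def)
    ultimately have "emeasure \<mu> {x. \<psi> x \<noteq> 0} = 0"
      by (subst (asm) AE_iff_measurable[OF _ refl]) auto
    then show False using open_pos[OF o] \<psi>(3) by (metis (mono_tags, lifting) empty_iff less_irrefl mem_Collect_eq)
  qed
  then have I: "I > 0" using \<psi>(2) by (simp add: I_def less_le)
  have Dpos: "D x > 0" for x using I D delta_pos by simp
  have "D \<in> smooth_funs A"
    unfolding D_def[abs_def]
    by (rule kernel_integral(1)[OF smooth_kernel_swap[OF smooth_kernel_mult[OF test_smooth[OF \<psi>(1)]]]
          right_kernel_support[OF \<psi>(1)] sets_mu one_set_integrable])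
  then have "(\<lambda>x. inverse (D x)) \<in> smooth_funs A"
    by (rule smooth_funs_compose[OF _ _ smooth_on_inverse]) (use Dpos in \<open>auto simp: less_le\<close>)
  then have "(\<lambda>x. I * inverse (D x)) \<in> smooth_funs A" by (rule smooth_funs_cmult)
  moreover have "(\<lambda>x. I * inverse (D x)) = \<delta>" using I by (auto simp: D)
  ultimately show ?thesis by simp
qed

text \<open>Differentiating \<open>\<delta>(x) \<integral> \<psi>(y x) d\<mu>(y) = \<integral> \<psi> d\<mu>\<close> at the identity.\<close>

lemma integral_vf:
  assumes X: "X \<in> lie_algebra G A" and \<psi>: "\<psi> \<in> test_funs A"
  shows "(\<integral>y. X \<psi> y \<partial>\<mu>) = - X \<delta> \<one> * (\<integral>y. \<psi> y \<partial>\<mu>)"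
proof -
  note X' = lie_algebraD(1)[OF X]
  define D where "D x = (\<integral>y. \<psi> (y \<otimes> x) * 1 \<partial>\<mu>)" for x
  define I where "I = (\<integral>y. \<psi> y \<partial>\<mu>)"
  have [measurable]: "\<psi> \<in> borel_measurable \<mu>" using \<psi> smooth_measurable test_smooth by blast
  have D: "D x = inverse (\<delta> x) * I" for x by (simp add: D_def I_def right_integral)
  note ki = kernel_integral[OF smooth_kernel_swap[OF smooth_kernel_mult[OF test_smooth[OF \<psi>(1)]]]
          right_kernel_support[OF \<psi>(1)] sets_mu one_set_integrable]
  have Ds: "D \<in> smooth_funs A" unfolding D_def[abs_def] by (rule ki(1))
  have "X D \<one> = (\<integral>y. X (\<lambda>x. \<psi> (y \<otimes> x)) \<one> * 1 \<partial>\<mu>)"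
    unfolding D_def[abs_def] by (rule ki(2)[OF _ X'])
  then have XD: "X D \<one> = (\<integral>y. X \<psi> y \<partial>\<mu>)"
    by (simp add: lie_algebraD(2)[OF X test_smooth[OF \<psi>]])
  have "(\<lambda>x. D x * \<delta> x) = (\<lambda>x. I)" using delta_pos by (auto simp: D less_le)
  then have "X (\<lambda>x. D x * \<delta> x) \<one> = 0" by (simp add: vf_const[OF X'])
  moreover have "X (\<lambda>x. D x * \<delta> x) \<one> = D \<one> * X \<delta> \<one> + X D \<one> * \<delta> \<one>"
    by (simp add: vector_fieldsD(4)[OF X' Ds smooth_delta])
  moreover have "D \<one> = I" by (simp add: D delta_one)
  ultimately show ?thesis using XD by (simp add: delta_one I_def mult.commute)
qed

end

subsection \<open>Mollification by left convolution\<close>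

context lie_haar
begin

section \<open>Continuity of left translation in L1\<close>

definition tdist :: "('g \<Rightarrow> real) \<Rightarrow> 'g \<Rightarrow> real" where
  "tdist f y = (\<integral>x. \<bar>f (inv y \<otimes> x) - f x\<bar> \<partial>\<mu>)"

text \<open>Continuity is phrased with sequences because these suit dominated convergence;
  neighbourhoods of the identity are recovered in \<open>tcont_nbhd\<close> by first
  countability.\<close>

definition tcont :: "('g \<Rightarrow> real) \<Rightarrow> bool" where
  "tcont f \<longleftrightarrow> integrable \<mu> f \<and> (\<forall>s. s \<longlonglongrightarrow> \<one> \<longrightarrow> (\<lambda>n. tdist f (s n)) \<longlonglongrightarrow> 0)"

lemma integrable_left: "integrable \<mu> f \<Longrightarrow> integrable \<mu> (\<lambda>x. f (y \<otimes> x))" for f :: "'g \<Rightarrow> real"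
  using left_integrable[of f y] by auto

lemma tcont_zero: "tcont (\<lambda>x. 0)"
  by (simp add: tcont_def tdist_def)

lemma tendsto_zero_le:
  fixes X :: "nat \<Rightarrow> real"
  assumes "X \<longlonglongrightarrow> 0" "e > 0"
  shows "\<exists>N. X N \<le> e"
  using order_tendstoD(2)[OF assms] unfolding eventually_sequentially by (meson less_imp_le order_refl)

lemma pair_measurable:
  assumes "f \<in> borel_measurable \<mu>"
  shows "(\<lambda>q. f (inv (fst q) \<otimes> snd q)) \<in> borel_measurable (\<mu> \<Otimes>\<^sub>M \<mu>)"
proof -
  have "(\<lambda>q :: 'g \<times> 'g. inv (fst q) \<otimes> snd q) \<in> borel_measurable borel"
    by (intro borel_measurable_continuous_onI continuous_intros)
  from measurable_compose[OF this assms[unfolded borel_measurable_mu_iff]]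
  show ?thesis using measurable_cong_sets[OF sets_pair refl] by blast
qed

lemma tdist_nonneg: "tdist f y \<ge> 0"
  by (simp add: tdist_def)

text \<open>The factor 2 counts \<open>f - g\<close> and its translate, which have the same L1 norm
  by left invariance.\<close>

lemma tdist_triangle:
  assumes "integrable \<mu> f" "integrable \<mu> g"
  shows "tdist f y \<le> tdist g y + 2 * (\<integral>x. \<bar>f x - g x\<bar> \<partial>\<mu>)"
proof -
  note [simp] = assms integrable_left
  note [measurable] = assms[THEN borel_measurable_integrable]
  have m: "(\<lambda>x. \<bar>f x - g x\<bar>) \<in> borel_measurable \<mu>" by measurable
  have "tdist f y \<le> (\<integral>x. \<bar>g (inv y \<otimes> x) - g x\<bar> + (\<bar>f (inv y \<otimes> x) - g (inv y \<otimes> x)\<bar> + \<bar>f x - g x\<bar>) \<partial>\<mu>)"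
    unfolding tdist_def by (rule integral_mono) (auto intro!: Bochner_Integration.integrable_add integrable_abs Bochner_Integration.integrable_diff)
  also have "\<dots> = tdist g y + ((\<integral>x. \<bar>f (inv y \<otimes> x) - g (inv y \<otimes> x)\<bar> \<partial>\<mu>) + (\<integral>x. \<bar>f x - g x\<bar> \<partial>\<mu>))"
    by (simp add: tdist_def)
  also have "(\<integral>x. \<bar>f (inv y \<otimes> x) - g (inv y \<otimes> x)\<bar> \<partial>\<mu>) = (\<integral>x. \<bar>f x - g x\<bar> \<partial>\<mu>)"
    using left_integral[OF m] .
  finally show ?thesis by simp
qed

lemma tcont_approx:
  assumes f: "integrable \<mu> f" and a: "\<And>e. e > 0 \<Longrightarrow> \<exists>g. tcont g \<and> (\<integral>x. \<bar>f x - g x\<bar> \<partial>\<mu>) \<le> e"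
  shows "tcont f"
  unfolding tcont_def
proof (intro conjI f allI impI)
  fix s assume s: "s \<longlonglongrightarrow> \<one>"
  show "(\<lambda>n. tdist f (s n)) \<longlonglongrightarrow> 0"
  proof (rule LIMSEQ_I)
    fix e :: real assume e: "e > 0"
    obtain g where g: "tcont g" "(\<integral>x. \<bar>f x - g x\<bar> \<partial>\<mu>) \<le> e / 4" using a[of "e/4"] e by auto
    have gi: "integrable \<mu> g" using g by (simp add: tcont_def)
    have "(\<lambda>n. tdist g (s n)) \<longlonglongrightarrow> 0" using g s by (simp add: tcont_def)
    then obtain N where N: "\<And>n. n \<ge> N \<Longrightarrow> norm (tdist g (s n) - 0) < e / 2"
      using LIMSEQ_D[of _ 0 "e/2"] e by (metis half_gt_zero)
    have "norm (tdist f (s n) - 0) < e" if "n \<ge> N" for n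
      using N[OF that] tdist_triangle[OF f gi, of "s n"] g(2) tdist_nonneg[of f "s n"] by simp
    then show "\<exists>N. \<forall>n\<ge>N. norm (tdist f (s n) - 0) < e" by blast
  qed
qed

lemma tcont_add:
  assumes "tcont f" "tcont g"
  shows "tcont (\<lambda>x. f x + g x)"
proof -
  have i: "integrable \<mu> f" "integrable \<mu> g" using assms by (auto simp: tcont_def)
  note [simp] = i integrable_left
  have le: "tdist (\<lambda>x. f x + g x) y \<le> tdist f y + tdist g y" for y
  proof -
    have "tdist (\<lambda>x. f x + g x) y \<le> (\<integral>x. \<bar>f (inv y \<otimes> x) - f x\<bar> + \<bar>g (inv y \<otimes> x) - g x\<bar> \<partial>\<mu>)"
      unfolding tdist_def by (rule integral_mono) (auto intro!: Bochner_Integration.integrable_add integrable_abs Bochner_Integration.integrable_diff)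
    then show ?thesis by (simp add: tdist_def)
  qed
  have "(\<lambda>n. tdist (\<lambda>x. f x + g x) (s n)) \<longlonglongrightarrow> 0" if s: "s \<longlonglongrightarrow> \<one>" for s
  proof (rule tendsto_sandwich[OF _ _ tendsto_const])
    show "(\<lambda>n. tdist f (s n) + tdist g (s n)) \<longlonglongrightarrow> 0"
      using tendsto_add[of "\<lambda>n. tdist f (s n)" 0 _ "\<lambda>n. tdist g (s n)" 0] assms s by (auto simp: tcont_def)
  qed (auto simp: le tdist_nonneg)
  then show ?thesis by (simp add: tcont_def)
qed

lemma tcont_cmult:
  assumes "tcont f"
  shows "tcont (\<lambda>x. c * f x)"
proof -
  have "tdist (\<lambda>x. c * f x) y = \<bar>c\<bar> * tdist f y" for y
    by (simp add: tdist_def right_diff_distrib[symmetric] abs_mult)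
  then show ?thesis using assms by (auto simp: tcont_def intro!: tendsto_mult_right_zero)
qed

text \<open>The symmetric difference of \<open>U\<close> and its translate has twice the measure of
  \<open>U\<close> minus twice that of the intersection. Openness makes the translated indicators
  tend to 1 at each point of \<open>U\<close>, so the intersection regains full measure in the
  limit.\<close>

lemma tcont_open:
  assumes O: "open U" "emeasure \<mu> U < \<infinity>"
  shows "tcont (indicator U)"
  unfolding tcont_def
proof (intro conjI allI impI)
  have [measurable]: "U \<in> sets borel" using O by auto
  show i: "integrable \<mu> (indicator U :: 'g \<Rightarrow> real)" using O by auto
  note il = integrable_left[OF i]
  fix s assume s: "s \<longlonglongrightarrow> \<one>"
  have ip: "integrable \<mu> (\<lambda>x. indicator U (inv y \<otimes> x) * indicator U x :: real)" for y
    by (rule Bochner_Integration.integrable_bound[OF i]) (auto simp: indicator_def)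
  have t: "tdist (indicator U) y = 2 * (\<integral>x. indicator U x \<partial>\<mu>) - 2 * (\<integral>x. indicator U (inv y \<otimes> x) * indicator U x \<partial>\<mu>)" for y
  proof -
    have "tdist (indicator U) y = (\<integral>x. indicator U (inv y \<otimes> x) + indicator U x - 2 * (indicator U (inv y \<otimes> x) * indicator U x) \<partial>\<mu>)"
      unfolding tdist_def by (rule Bochner_Integration.integral_cong) (auto simp: indicator_def)
    also have "\<dots> = (\<integral>x. indicator U (inv y \<otimes> x) \<partial>\<mu>) + (\<integral>x. indicator U x \<partial>\<mu>) - 2 * (\<integral>x. indicator U (inv y \<otimes> x) * indicator U x \<partial>\<mu>)"
      using i il ip by simp
    also have "(\<integral>x. indicator U (inv y \<otimes> x) \<partial>\<mu>) = (\<integral>x. indicator U x \<partial>\<mu> :: real)"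
      by (rule left_integral) measurable
    finally show ?thesis by simp
  qed
  have "(\<lambda>n. \<integral>x. indicator U (inv (s n) \<otimes> x) * indicator U x \<partial>\<mu> :: real) \<longlonglongrightarrow> (\<integral>x. indicator U x \<partial>\<mu>)"
  proof (rule integral_dominated_convergence[OF _ _ i])
    show "AE x in \<mu>. (\<lambda>n. indicator U (inv (s n) \<otimes> x) * indicator U x :: real) \<longlonglongrightarrow> indicator U x"
    proof (rule AE_I2)
      fix x
      show "(\<lambda>n. indicator U (inv (s n) \<otimes> x) * indicator U x :: real) \<longlonglongrightarrow> indicator U x"
      proof (cases "x \<in> U")
        case True
        have "isCont (\<lambda>y. inv y \<otimes> x) \<one>"
          using continuous_on_mult[OF continuous_on_inv[OF continuous_on_id] continuous_on_const, of UNIV x]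
          by (simp add: continuous_on_eq_continuous_at)
        from isCont_tendsto_compose[OF this s] have "(\<lambda>n. inv (s n) \<otimes> x) \<longlonglongrightarrow> x" by simp
        then have "\<forall>\<^sub>F n in sequentially. inv (s n) \<otimes> x \<in> U" using O(1) True topological_tendstoD by blast
        then have "\<forall>\<^sub>F n in sequentially. indicator U (inv (s n) \<otimes> x) * indicator U x = (indicator U x :: real)"
          by eventually_elim auto
        then show ?thesis by (rule tendsto_eventually)
      qed simp
    qed
  qed (auto simp: indicator_def)
  then have "(\<lambda>n. 2 * (\<integral>x. indicator U x \<partial>\<mu>) - 2 * (\<integral>x. indicator U (inv (s n) \<otimes> x) * indicator U x \<partial>\<mu>) :: real)
     \<longlonglongrightarrow> 2 * (\<integral>x. indicator U x \<partial>\<mu>) - 2 * (\<integral>x. indicator U x \<partial>\<mu>)"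
    by (intro tendsto_intros)
  then show "(\<lambda>n. tdist (indicator U) (s n)) \<longlonglongrightarrow> 0" by (simp add: t)
qed

text \<open>Dynkin's argument on the Borel sets, generated by the open ones. Intersecting with
  \<open>U\<close> of finite measure keeps all indicators integrable, so that relative complements
  and countable disjoint unions are reached by subtraction and L1 approximation.\<close>

lemma tcont_set_in_open:
  assumes O: "open U" "emeasure \<mu> U < \<infinity>" and B: "B \<in> sets borel"
  shows "tcont (indicator (B \<inter> U))"
proof -
  have [measurable]: "U \<in> sets borel" using O by auto
  have fin: "emeasure \<mu> (C \<inter> U) < \<infinity>" if "C \<in> sets borel" for C
    using emeasure_mono[of "C \<inter> U" U \<mu>] O that by (auto simp: order_le_less_trans)
  have ist: "Int_stable {S :: 'g set. open S}" by (auto simp: Int_stable_def)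
  have "B \<in> sigma_sets UNIV {S. open S}" using B by (simp add: borel_def)
  have "{S :: 'g set. open S} \<subseteq> Pow UNIV" by simp
  with ist show ?thesis using \<open>B \<in> sigma_sets UNIV {S. open S}\<close>
  proof (induction rule: sigma_sets_induct_disjoint)
    case (basic A)
    then show ?case using fin[of A] by (intro tcont_open) (auto intro: O)
  next
    case empty
    show ?case using tcont_zero by simp
  next
    case (compl A)
    have "(\<lambda>x. indicator U x + (-1) * indicator (A \<inter> U) x :: real) = indicator ((UNIV - A) \<inter> U)"
      by (auto simp: indicator_def fun_eq_iff)
    then show ?case using tcont_add[OF tcont_open[OF O] tcont_cmult[OF compl.IH, of "-1"]] by simp
  next
    case (union A)
    have A: "A i \<in> sets borel" for i using union.hyps(2) by (auto simp: borel_def)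
    have [measurable]: "(\<Union>i. A i) \<in> sets borel" using A by auto
    have i: "integrable \<mu> (indicator ((\<Union>i. A i) \<inter> U) :: 'g \<Rightarrow> real)" using fin[of "\<Union>i. A i"] by auto
    have tc: "tcont (\<lambda>x. \<Sum>i<n. indicator (A i \<inter> U) x)" for n
    proof (induction n)
      case 0
      show ?case using tcont_zero by simp
    next
      case (Suc n)
      then show ?case using tcont_add[OF Suc union.IH[of n]] by simp
    qed
    have su: "(\<Sum>i<n. indicator (A i \<inter> U) x) = (indicator ((\<Union>i<n. A i) \<inter> U) x :: real)" for n x
    proof -
      have "(\<Sum>i<n. indicator (A i) x) = (indicator (\<Union>i<n. A i) x :: real)"
        by (rule indicator_UN_disjoint[symmetric]) (use union.hyps(1) in \<open>auto simp: disjoint_family_on_def\<close>)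
      then show ?thesis by (simp add: indicator_inter_arith sum_distrib_right[symmetric])
    qed
    show ?case
    proof (rule tcont_approx)
      show "integrable \<mu> (indicator (\<Union> (range A) \<inter> U) :: 'g \<Rightarrow> real)" using i by simp
      fix e :: real assume e: "e > 0"
      have "(\<lambda>n. \<integral>x. \<bar>indicator ((\<Union>i. A i) \<inter> U) x - (\<Sum>i<n. indicator (A i \<inter> U) x)\<bar> \<partial>\<mu>) \<longlonglongrightarrow> (\<integral>x. 0 \<partial>\<mu> :: real)"
      proof (rule integral_dominated_convergence[OF _ _ i])
        show "AE x in \<mu>. (\<lambda>n. \<bar>indicator ((\<Union>i. A i) \<inter> U) x - (\<Sum>i<n. indicator (A i \<inter> U) x)\<bar>) \<longlonglongrightarrow> (0::real)"
        proof (rule AE_I2)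
          fix x
          have "\<exists>N. \<forall>n\<ge>N. \<bar>indicator ((\<Union>i. A i) \<inter> U) x - (indicator ((\<Union>i<n. A i) \<inter> U) x :: real)\<bar> = 0"
          proof (cases "x \<in> (\<Union>i. A i)")
            case True
            then obtain k where "x \<in> A k" by auto
            then show ?thesis by (intro exI[of _ "Suc k"]) (auto simp: indicator_def)
          qed (auto simp: indicator_def)
          then show "(\<lambda>n. \<bar>indicator ((\<Union>i. A i) \<inter> U) x - (\<Sum>i<n. indicator (A i \<inter> U) x)\<bar>) \<longlonglongrightarrow> (0::real)"
            unfolding su by (intro tendsto_eventually) (auto simp: eventually_sequentially)
        qed
        show "AE x in \<mu>. norm \<bar>indicator ((\<Union>i. A i) \<inter> U) x - (\<Sum>i<n. indicator (A i \<inter> U) x) :: real\<bar> \<le> indicator ((\<Union>i. A i) \<inter> U) x" for n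
          unfolding su by (auto simp: indicator_def)
      qed (use A in measurable)
      then obtain N where "(\<integral>x. \<bar>indicator ((\<Union>i. A i) \<inter> U) x - (\<Sum>i<N. indicator (A i \<inter> U) x)\<bar> \<partial>\<mu>) \<le> e"
      using tendsto_zero_le[OF _ e] by auto
      then show "\<exists>g. tcont g \<and> (\<integral>x. \<bar>indicator (\<Union> (range A) \<inter> U) x - g x\<bar> \<partial>\<mu>) \<le> e"
        using tc[of N] by (intro exI[of _ "\<lambda>x. \<Sum>i<N. indicator (A i \<inter> U) x"]) auto
    qed
  qed
qed

lemma open_exhaustion:
  obtains U :: "nat \<Rightarrow> 'g set" where "\<And>n. open (U n)" "\<And>n. emeasure \<mu> (U n) < \<infinity>" "incseq U" "(\<Union>n. U n) = UNIV"
proof -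
  obtain B :: "nat \<Rightarrow> 'g set" where B: "\<And>n. compact (B n)" "incseq B" "\<And>C. compact C \<Longrightarrow> \<exists>n. C \<subseteq> B n"
    using exhaustion by metis
  show ?thesis
  proof (rule that[of "\<lambda>n. interior (B n)"])
    show "emeasure \<mu> (interior (B n)) < \<infinity>" for n
      using emeasure_mono[OF interior_subset[of "B n"], of \<mu>] emeasure_compact[OF B(1)] compact_imp_closed[OF B(1)]
      by (auto intro: order_le_less_trans)
    show "incseq (\<lambda>n. interior (B n))" using B(2) by (auto simp: incseq_def intro: interior_mono[THEN subsetD])
    have "p \<in> (\<Union>n. interior (B n))" for p
    proof -
      obtain K W where K: "compact K" "open W" "p \<in> W" "W \<subseteq> K" by (rule compact_nbhd)
      then obtain n where "K \<subseteq> B n" using B(3) by blast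
      then have "p \<in> interior (B n)" using K by (meson interiorI order_trans)
      then show ?thesis by auto
    qed
    then show "(\<Union>n. interior (B n)) = UNIV" by auto
  qed auto
qed

lemma tcont_set:
  assumes B: "B \<in> sets borel" "emeasure \<mu> B < \<infinity>"
  shows "tcont (indicator B)"
proof (rule tcont_approx)
  show i: "integrable \<mu> (indicator B :: 'g \<Rightarrow> real)" using B by auto
  obtain U :: "nat \<Rightarrow> 'g set" where U: "\<And>n. open (U n)" "\<And>n. emeasure \<mu> (U n) < \<infinity>" "incseq U" "(\<Union>n. U n) = UNIV"
    using open_exhaustion by metis
  have [measurable]: "U n \<in> sets borel" "B \<in> sets borel" for n using U(1) B by auto
  fix e :: real assume e: "e > 0"
  have "(\<lambda>n. \<integral>x. \<bar>indicator B x - indicator (B \<inter> U n) x\<bar> \<partial>\<mu>) \<longlonglongrightarrow> (\<integral>x. 0 \<partial>\<mu> :: real)"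
  proof (rule integral_dominated_convergence[OF _ _ i])
    show "AE x in \<mu>. (\<lambda>n. \<bar>indicator B x - indicator (B \<inter> U n) x\<bar>) \<longlonglongrightarrow> (0::real)"
    proof (rule AE_I2)
      fix x
      obtain k where k: "x \<in> U k" using U(4) by auto
      have "\<bar>indicator B x - indicator (B \<inter> U n) x\<bar> = (0::real)" if "n \<ge> k" for n
        using k incseqD[OF U(3) that] by (auto simp: indicator_def)
      then show "(\<lambda>n. \<bar>indicator B x - indicator (B \<inter> U n) x\<bar>) \<longlonglongrightarrow> (0::real)"
        by (intro tendsto_eventually) (auto simp: eventually_sequentially)
    qed
  qed (auto simp: indicator_def)
  then obtain N where "(\<integral>x. \<bar>indicator B x - indicator (B \<inter> U N) x\<bar> \<partial>\<mu>) \<le> e"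
      using tendsto_zero_le[OF _ e] by auto
  then show "\<exists>g. tcont g \<and> (\<integral>x. \<bar>indicator B x - g x\<bar> \<partial>\<mu>) \<le> e"
    using tcont_set_in_open[OF U(1,2) B(1), of N] by (intro exI[of _ "indicator (B \<inter> U N)"]) auto
qed

lemma integrable_tcont:
  assumes "integrable \<mu> f"
  shows "tcont f"
  using assms
proof (induction rule: integrable_induct)
  case (base A c)
  then show ?case using tcont_cmult[OF tcont_set[of A], of c] by (simp add: mult.commute)
next
  case (add f g)
  then show ?case using tcont_add by simp
next
  case (lim f s)
  note [measurable] = borel_measurable_integrable[OF lim(1)] borel_measurable_integrable[OF lim(4)]
  show ?case
  proof (rule tcont_approx[OF lim(4)])
    fix e :: real assume e: "e > 0"
    have "(\<lambda>n. \<integral>x. \<bar>f x - s n x\<bar> \<partial>\<mu>) \<longlonglongrightarrow> (\<integral>x. 0 \<partial>\<mu> :: real)"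
    proof (rule integral_dominated_convergence)
      \<comment> \<open>The simple approximants satisfy
        \<open>\<bar>s n x\<bar> \<le> 2 * \<bar>f x\<bar>\<close>, whence the 3.\<close>
      show "integrable \<mu> (\<lambda>x. 3 * \<bar>f x\<bar>)" using lim(4) by auto
      show "AE x in \<mu>. (\<lambda>n. \<bar>f x - s n x\<bar>) \<longlonglongrightarrow> 0"
      proof (rule AE_I2)
        fix x assume "x \<in> space \<mu>"
        from lim(2)[OF this] have "(\<lambda>n. \<bar>f x - s n x\<bar>) \<longlonglongrightarrow> \<bar>f x - f x\<bar>" by (intro tendsto_intros)
        then show "(\<lambda>n. \<bar>f x - s n x\<bar>) \<longlonglongrightarrow> 0" by simp
      qed
      show "AE x in \<mu>. norm \<bar>f x - s n x\<bar> \<le> 3 * \<bar>f x\<bar>" for n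
      proof (rule AE_I2)
        fix x assume "x \<in> space \<mu>"
        from lim(3)[OF this, of n] show "norm \<bar>f x - s n x\<bar> \<le> 3 * \<bar>f x\<bar>"
          unfolding real_norm_def by linarith
      qed
    qed measurable
    then obtain N where "(\<integral>x. \<bar>f x - s N x\<bar> \<partial>\<mu>) \<le> e"
      using tendsto_zero_le[OF _ e] by auto
    then show "\<exists>g. tcont g \<and> (\<integral>x. \<bar>f x - g x\<bar> \<partial>\<mu>) \<le> e"
      using lim.IH[of N] by (intro exI[of _ "s N"]) auto
  qed
qed

lemma tcont_nbhd:
  assumes "integrable \<mu> f" "e > 0"
  shows "\<exists>U. open U \<and> \<one> \<in> U \<and> (\<forall>y\<in>U. tdist f y < e)"
proof -
  have "eventually (\<lambda>y. tdist f y < e) (inf (nhds \<one>) (principal UNIV))"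
  proof (rule sequentially_imp_eventually_nhds_within, intro allI impI)
    fix s assume "(\<forall>n. s n \<in> UNIV) \<and> s \<longlonglongrightarrow> \<one>"
    then have "(\<lambda>n. tdist f (s n)) \<longlonglongrightarrow> 0" using integrable_tcont[OF assms(1)] by (simp add: tcont_def)
    then show "\<forall>\<^sub>F n in sequentially. tdist f (s n) < e" using order_tendstoD(2) assms(2) by blast
  qed
  then show ?thesis by (auto simp: eventually_nhds)
qed

lemma L1loc_modulus:
  assumes f: "f \<in> L1loc" and K: "compact K" and e: "e > 0"
  shows "\<exists>U. open U \<and> \<one> \<in> U \<and> (\<forall>y\<in>U. (\<integral>\<^sup>+x. ennreal (indicator K x * \<bar>f (inv y \<otimes> x) - f x\<bar>) \<partial>\<mu>) \<le> ennreal e)"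
proof -
  obtain K0 W where K0: "compact K0" "open W" "\<one> \<in> W" "W \<subseteq> K0" by (rule compact_nbhd)
  \<comment> \<open>\<open>?L\<close> contains \<open>K\<close> and all
    \<open>inv y \<otimes> x\<close> with \<open>x\<close> in \<open>K\<close> and \<open>y\<close>
    near the identity, so on \<open>K\<close> neither the cut-off function \<open>g\<close> nor its
    translate differs from what \<open>f\<close> gives.\<close>
  let ?L = "(\<lambda>q. fst q \<otimes> snd q) ` ((\<lambda>x. inv x) ` K0 \<times> K)"
  have L: "compact ?L" by (intro compact_mult compact_inv K0 K)
  define g where "g x = indicator ?L x *\<^sub>R f x" for x
  have g: "integrable \<mu> g" using L1locD(2)[OF f L] by (simp add: g_def[abs_def] set_integrable_def)
  obtain U where U: "open U" "\<one> \<in> U" "\<forall>y\<in>U. tdist g y < e" using tcont_nbhd[OF g e] by blast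
  have "(\<integral>\<^sup>+x. ennreal (indicator K x * \<bar>f (inv y \<otimes> x) - f x\<bar>) \<partial>\<mu>) \<le> ennreal e" if y: "y \<in> U \<inter> W" for y
  proof -
    have "(\<integral>\<^sup>+x. ennreal (indicator K x * \<bar>f (inv y \<otimes> x) - f x\<bar>) \<partial>\<mu>) \<le> (\<integral>\<^sup>+x. ennreal \<bar>g (inv y \<otimes> x) - g x\<bar> \<partial>\<mu>)"
    proof (rule nn_integral_mono, rule ennreal_leI)
      fix x
      show "indicator K x * \<bar>f (inv y \<otimes> x) - f x\<bar> \<le> \<bar>g (inv y \<otimes> x) - g x\<bar>"
      proof (cases "x \<in> K")
        case True
        have "inv \<one> \<in> (\<lambda>x. inv x) ` K0" using K0(3,4) by blast
        then have "x \<in> ?L" using True by (intro image_eqI[of _ _ "(inv \<one>, x)"]) auto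
        moreover have "inv y \<otimes> x \<in> ?L" using True y K0(4) by (intro image_eqI[of _ _ "(inv y, x)"]) auto
        ultimately show ?thesis using True by (simp add: g_def)
      qed simp
    qed
    also have "\<dots> = ennreal (tdist g y)"
      unfolding tdist_def using g integrable_left[OF g] by (intro nn_integral_eq_integral) auto
    also have "\<dots> \<le> ennreal e" using U(3) y by (intro ennreal_leI) auto
    finally show ?thesis .
  qed
  then show ?thesis using U K0 by (intro exI[of _ "U \<inter> W"]) auto
qed

section \<open>Convolution from the left and its compatibility with invariant operators\<close>

definition conv :: "('g \<Rightarrow> real) \<Rightarrow> ('g \<Rightarrow> real) \<Rightarrow> 'g \<Rightarrow> real" where
  "conv \<rho> f x = (\<integral>y. \<rho> y * f (inv y \<otimes> x) \<partial>\<mu>)"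

text \<open>The substitution moves \<open>x\<close> out of \<open>f\<close>, which cannot be
  differentiated, into the smooth \<rho>; the price is the composition of \<open>f\<close> with the
  inversion.\<close>

lemma conv_alt:
  assumes [measurable]: "\<rho> \<in> borel_measurable \<mu>" "f \<in> borel_measurable \<mu>"
  shows "conv \<rho> f x = (\<integral>y. \<rho> (x \<otimes> y) * f (inv y) \<partial>\<mu>)"
proof -
  have "(\<lambda>y. \<rho> y * f (inv y \<otimes> x)) \<in> borel_measurable \<mu>" by measurable
  from left_integral[OF this, of x] show ?thesis
    by (simp add: conv_def inv_prod mult_assoc)
qed

text \<open>Justifies the exchange of integrals: for \<open>y\<close> in \<open>L\<close> and
  \<open>x\<close> in \<open>K\<close> the argument \<open>inv y \<otimes> x\<close> lies in the
  compact set \<open>?J\<close>, and left invariance bounds the inner integral by one over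
  \<open>?J\<close>, uniformly in \<open>y\<close>.\<close>

lemma conv_integrable_pair:
  assumes f: "f \<in> L1loc"
    and a: "a \<in> borel_measurable \<mu>" "compact K" "\<And>x. \<bar>a x\<bar> \<le> Ca * indicator K x"
    and b: "b \<in> borel_measurable \<mu>" "compact L" "\<And>x. \<bar>b x\<bar> \<le> Cb * indicator L x"
  shows "integrable (\<mu> \<Otimes>\<^sub>M \<mu>) (\<lambda>(y, x). a x * (b y * f (inv y \<otimes> x)))"
proof -
  note [measurable] = a(1) b(1) L1locD(1)[OF f]
  \<comment> \<open>The sign of a constant is known only where the corresponding set is nonempty,
    hence the conditional form.\<close>
  have Ca: "Ca \<ge> 0" if "x \<in> K" for x using a(3)[of x] that by auto
  have Cb: "Cb \<ge> 0" if "x \<in> L" for x using b(3)[of x] that by auto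
  let ?J = "(\<lambda>q. fst q \<otimes> snd q) ` ((\<lambda>x. inv x) ` L \<times> K)"
  have J: "compact ?J" by (intro compact_mult compact_inv b(2) a(2))
  have int: "integrable \<mu> (\<lambda>x. a x * (b y * f (inv y \<otimes> x)))" for y
  proof -
    have "(\<lambda>x. a x * f (inv y \<otimes> x)) \<in> borel_measurable \<mu>" by measurable
    moreover have "integrable \<mu> (\<lambda>x. a (y \<otimes> x) * f x)"
    proof (rule L1loc_integrable[OF f])
      show "compact ((\<lambda>x. inv y \<otimes> x) ` K)"
        by (intro compact_continuous_image continuous_intros a(2))
      have "\<bar>a (y \<otimes> x) * f x\<bar> \<le> Ca * indicator ((\<lambda>x. inv y \<otimes> x) ` K) x * \<bar>f x\<bar>" for x
      proof (cases "y \<otimes> x \<in> K")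
        case True
        then have "x \<in> (\<lambda>x. inv y \<otimes> x) ` K" by (intro image_eqI[of _ _ "y \<otimes> x"]) auto
        then show ?thesis using a(3)[of "y \<otimes> x"] True by (simp add: abs_mult mult_right_mono)
      next
        case False
        then have "a (y \<otimes> x) = 0" using a(3)[of "y \<otimes> x"] by simp
        moreover have "x \<notin> (\<lambda>x. inv y \<otimes> x) ` K" using False by auto
        ultimately show ?thesis by simp
      qed
      then show "AE x in \<mu>. \<bar>a (y \<otimes> x) * f x\<bar> \<le> Ca * indicator ((\<lambda>x. inv y \<otimes> x) ` K) x * \<bar>f x\<bar>" by simp
    qed measurable
    ultimately have "integrable \<mu> (\<lambda>x. a x * f (inv y \<otimes> x))"
      using left_integrable[of "\<lambda>x. a x * f (inv y \<otimes> x)" y] by simp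
    from integrable_mult_right[OF this, of "b y"] show ?thesis by (simp add: mult.left_commute)
  qed
  define S where "S = (\<integral>x. indicator ?J x *\<^sub>R \<bar>f x\<bar> \<partial>\<mu>)"
  have Ji: "integrable \<mu> (\<lambda>x. indicator ?J x *\<^sub>R \<bar>f x\<bar>)"
    using L1locD(2)[OF L1loc_abs[OF f] J] by (simp add: set_integrable_def)
  have bound: "(\<integral>x. norm (a x * (b y * f (inv y \<otimes> x))) \<partial>\<mu>) \<le> (Ca * Cb * S) * indicator L y" for y
  proof (cases "y \<in> L")
    case False
    then have "b y = 0" using b(3)[of y] by simp
    then show ?thesis using False by simp
  next
    case y: True
    have "(\<lambda>x. norm (a x * (b y * f (inv y \<otimes> x)))) \<in> borel_measurable \<mu>" by measurable
    from left_integral[OF this, of y, symmetric]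
    have "(\<integral>x. norm (a x * (b y * f (inv y \<otimes> x))) \<partial>\<mu>) = (\<integral>x. norm (a (y \<otimes> x) * (b y * f x)) \<partial>\<mu>)"
      by simp
    also have "\<dots> \<le> (\<integral>x. Ca * Cb * (indicator ?J x *\<^sub>R \<bar>f x\<bar>) \<partial>\<mu>)"
    proof (rule integral_mono)
      show "integrable \<mu> (\<lambda>x. norm (a (y \<otimes> x) * (b y * f x)))"
        using integrable_left[OF int[of y], of y] by (intro integrable_norm) simp
      show "integrable \<mu> (\<lambda>x. Ca * Cb * (indicator ?J x *\<^sub>R \<bar>f x\<bar>))" using Ji by (rule integrable_mult_right)
      fix x
      show "norm (a (y \<otimes> x) * (b y * f x)) \<le> Ca * Cb * (indicator ?J x *\<^sub>R \<bar>f x\<bar>)"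
      proof (cases "y \<otimes> x \<in> K")
        case True
        then have "x \<in> ?J" using y by (intro image_eqI[of _ _ "(inv y, y \<otimes> x)"]) auto
        moreover have "\<bar>a (y \<otimes> x)\<bar> * \<bar>b y\<bar> \<le> Ca * Cb"
          using a(3)[of "y \<otimes> x"] b(3)[of y] True y Ca[OF True] by (intro mult_mono) auto
        ultimately show ?thesis by (simp add: abs_mult mult.assoc[symmetric] mult_right_mono)
      next
        case False
        then have "a (y \<otimes> x) = 0" using a(3)[of "y \<otimes> x"] by simp
        moreover have "Ca * Cb \<ge> 0 \<or> x \<notin> ?J"
          using Ca Cb[OF y] by (auto intro: mult_nonneg_nonneg)
        ultimately show ?thesis by auto
      qed
    qed
    also have "\<dots> = (Ca * Cb * S) * indicator L y" using y by (simp add: S_def)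
    finally show ?thesis .
  qed
  show ?thesis
  proof (rule pair.Fubini_integrable)
    have pm: "(\<lambda>q. a (snd q) * (b (fst q) * f (inv (fst q) \<otimes> snd q))) \<in> borel_measurable (\<mu> \<Otimes>\<^sub>M \<mu>)"
      by (intro borel_measurable_times pair_measurable L1locD(1)[OF f]
          measurable_compose[OF measurable_fst b(1)] measurable_compose[OF measurable_snd a(1)])
    then show "(\<lambda>(y, x). a x * (b y * f (inv y \<otimes> x))) \<in> borel_measurable (\<mu> \<Otimes>\<^sub>M \<mu>)"
      unfolding case_prod_beta' .
    show "AE y in \<mu>. integrable \<mu> (\<lambda>x. case (y, x) of (y, x) \<Rightarrow> a x * (b y * f (inv y \<otimes> x)))"
      using int by simp
    have [measurable]: "L \<in> sets borel" using compact_imp_closed[OF b(2)] by auto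
    have iL: "integrable \<mu> (\<lambda>y. (Ca * Cb * S) * indicator L y)"
      using emeasure_compact[OF b(2)] by (intro integrable_mult_right) auto
    show "integrable \<mu> (\<lambda>y. \<integral>x. norm (case (y, x) of (y, x) \<Rightarrow> a x * (b y * f (inv y \<otimes> x))) \<partial>\<mu>)"
    proof (rule Bochner_Integration.integrable_bound[OF iL])
      show "(\<lambda>y. \<integral>x. norm (case (y, x) of (y, x) \<Rightarrow> a x * (b y * f (inv y \<otimes> x))) \<partial>\<mu>) \<in> borel_measurable \<mu>"
        by (rule borel_measurable_lebesgue_integral) (use measurable_compose[OF pm borel_measurable_norm] in \<open>unfold case_prod_beta' fst_conv snd_conv, assumption\<close>)
      show "AE y in \<mu>. norm (\<integral>x. norm (case (y, x) of (y, x) \<Rightarrow> a x * (b y * f (inv y \<otimes> x))) \<partial>\<mu>) \<le> norm ((Ca * Cb * S) * indicator L y)"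
        using order_trans[OF bound abs_ge_self] by (intro AE_I2) simp
    qed
  qed
qed

text \<open>Inversion does not preserve \<open>\<mu>\<close>, but Fubini's theorem provides a left translate of \<open>f \<circ> inv\<close>
  that is integrable on a given compact set.\<close>

lemma L1loc_inv:
  assumes f: "f \<in> L1loc"
  shows "(\<lambda>y. f (inv y)) \<in> L1loc"
  unfolding L1loc_iff
proof (intro conjI allI impI)
  note [measurable] = L1locD(1)[OF f]
  show "(\<lambda>y. f (inv y)) \<in> borel_measurable \<mu>" by measurable
  fix K :: "'g set" assume K: "compact K"
  obtain K' W where K': "compact K'" "open W" "\<one> \<in> W" "W \<subseteq> K'" by (rule compact_nbhd)
  let ?L = "(\<lambda>q. fst q \<otimes> snd q) ` (K' \<times> K)"
  have L: "compact ?L" by (intro compact_mult K K')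
  have [measurable]: "?L \<in> sets borel" "K' \<in> sets borel" "K \<in> sets borel" "W \<in> sets borel"
    using L K' K compact_imp_closed by (auto intro: borel_closed)
  \<comment> \<open>Joint integrability for \<open>x\<close> near the identity and \<open>y\<close>
    in \<open>?L\<close> gives integrability in \<open>y\<close> for almost every
    \<open>x\<close>.\<close>
  have "integrable (\<mu> \<Otimes>\<^sub>M \<mu>) (\<lambda>(y, x). indicator K' x * (indicator ?L y * f (inv y \<otimes> x)))"
    by (rule conv_integrable_pair[OF f _ K'(1), where Ca=1 and Cb=1 and L="?L"]) (auto simp: L)
  from pair.AE_integrable_fst'[OF pair.integrable_product_swap[OF this]]
  have ae: "AE x in \<mu>. integrable \<mu> (\<lambda>y. indicator K' x * (indicator ?L y * f (inv y \<otimes> x)))"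
    by simp
  \<comment> \<open>A neighbourhood of the identity is not null, so one such \<open>x\<close> lies
    in \<open>W\<close>; replacing \<open>y\<close> by \<open>x \<otimes> y\<close> will turn
    \<open>f (inv y \<otimes> x)\<close> into \<open>f (inv y)\<close>.\<close>
  have "\<exists>x\<in>W. integrable \<mu> (\<lambda>y. indicator K' x * (indicator ?L y * f (inv y \<otimes> x)))"
  proof (rule ccontr)
    assume "\<not> ?thesis"
    then have "AE x in \<mu>. x \<notin> W" using ae by auto
    then have "emeasure \<mu> W = 0" by (subst (asm) AE_iff_measurable[OF _ refl]) auto
    then show False using open_pos[OF K'(2)] K'(3) by auto
  qed
  then obtain x where x: "x \<in> W" "integrable \<mu> (\<lambda>y. indicator K' x * (indicator ?L y * f (inv y \<otimes> x)))" by blast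
  then have i: "integrable \<mu> (\<lambda>y. indicator ?L y * f (inv y \<otimes> x))" using K' by (auto simp: subset_iff)
  from integrable_left[OF i, of x]
  have "integrable \<mu> (\<lambda>y. indicator ?L (x \<otimes> y) * f (inv y))" by (simp add: inv_prod mult_assoc)
  then show "set_integrable \<mu> K (\<lambda>y. f (inv y))"
    unfolding set_integrable_def
  proof (rule Bochner_Integration.integrable_bound)
    have "norm (indicator K y *\<^sub>R f (inv y)) \<le> norm (indicator ?L (x \<otimes> y) * f (inv y))" for y
    proof (cases "y \<in> K")
      case True
      then have "x \<otimes> y \<in> ?L" using x K' by (intro image_eqI[of _ _ "(x, y)"]) auto
      then show ?thesis by (simp add: indicator_def)
    qed simp
    then show "AE y in \<mu>. norm (indicator K y *\<^sub>R f (inv y)) \<le> norm (indicator ?L (x \<otimes> y) * f (inv y))" by simp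
  qed measurable
qed

lemma left_kernel_support:
  assumes "\<psi> \<in> test_funs A"
  shows "\<exists>W C. open W \<and> p \<in> W \<and> compact C \<and> (\<forall>x\<in>W. \<forall>y. y \<notin> C \<longrightarrow> \<psi> (x \<otimes> y) = 0)"
proof -
  obtain S where S: "compact S" "\<forall>x. x \<notin> S \<longrightarrow> \<psi> x = 0" using test_support[OF assms] by blast
  obtain K W where K: "compact K" "open W" "p \<in> W" "W \<subseteq> K" by (rule compact_nbhd)
  let ?C = "(\<lambda>q. fst q \<otimes> snd q) ` ((\<lambda>x. inv x) ` K \<times> S)"
  have "compact ?C" by (intro compact_mult compact_inv S K)
  moreover have "\<psi> (x \<otimes> y) = 0" if "x \<in> W" "y \<notin> ?C" for x y
  proof (rule ccontr)
    assume "\<psi> (x \<otimes> y) \<noteq> 0"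
    then have "x \<otimes> y \<in> S" using S(2) by blast
    then have "y \<in> ?C" using that K by (intro image_eqI[of _ _ "(inv x, x \<otimes> y)"]) auto
    then show False using that by simp
  qed
  ultimately show ?thesis using K by blast
qed

lemma conv_smooth:
  assumes f: "f \<in> L1loc" and \<rho>: "\<rho> \<in> test_funs A"
  shows "conv \<rho> f \<in> smooth_funs A"
proof -
  have "(\<lambda>x. \<integral>y. \<rho> (x \<otimes> y) * f (inv y) \<partial>\<mu>) \<in> smooth_funs A"
    by (rule kernel_integral(1)[OF smooth_kernel_mult[OF test_smooth[OF \<rho>]] left_kernel_support[OF \<rho>] sets_mu
       L1locD(2)[OF L1loc_inv[OF f]]])
  moreover have "conv \<rho> f = (\<lambda>x. \<integral>y. \<rho> (x \<otimes> y) * f (inv y) \<partial>\<mu>)"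
    using conv_alt[OF smooth_measurable[OF test_smooth[OF \<rho>]] L1locD(1)[OF f]] by auto
  ultimately show ?thesis by simp
qed

lemma conv_integrable:
  assumes f: "f \<in> L1loc" and \<rho>: "\<rho> \<in> test_funs A"
  shows "integrable \<mu> (\<lambda>y. \<rho> y * f (inv y \<otimes> x))"
proof -
  note [measurable] = L1locD(1)[OF f] smooth_measurable[OF test_smooth[OF \<rho>]]
  have "integrable \<mu> (\<lambda>y. \<rho> (x \<otimes> y) * f (inv y))"
    by (rule test_integrable_mult[OF test_left[OF \<rho>] L1loc_inv[OF f]])
  moreover have "(\<lambda>y. \<rho> y * f (inv y \<otimes> x)) \<in> borel_measurable \<mu>" by measurable
  ultimately show ?thesis
    using left_integrable[of "\<lambda>y. \<rho> y * f (inv y \<otimes> x)" x] by (simp add: inv_prod mult_assoc)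
qed

text \<open>The property shared by the identity, \<open>vf_adjoint\<close> and
  \<open>sub_laplacian\<close> that lets a distributional equation pass through a
  convolution.\<close>

definition left_invariant_op :: "(('g \<Rightarrow> real) \<Rightarrow> ('g \<Rightarrow> real)) \<Rightarrow> bool" where
  "left_invariant_op T \<longleftrightarrow> (\<forall>\<phi>\<in>test_funs A. T \<phi> \<in> test_funs A \<and> (\<forall>y. T (\<lambda>x. \<phi> (y \<otimes> x)) = (\<lambda>x. T \<phi> (y \<otimes> x))))"

text \<open>After Fubini's theorem, left invariance shifts the translation from \<open>f\<close> to
  the test function.\<close>

lemma conv_pairing:
  assumes f: "f \<in> L1loc" and \<rho>: "\<rho> \<in> test_funs A" and \<psi>: "\<psi> \<in> test_funs A"
  shows "(\<integral>x. \<psi> x * conv \<rho> f x \<partial>\<mu>) = (\<integral>y. \<rho> y * (\<integral>x. \<psi> (y \<otimes> x) * f x \<partial>\<mu>) \<partial>\<mu>)"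
proof -
  note [measurable] = L1locD(1)[OF f] smooth_measurable[OF test_smooth[OF \<rho>]] smooth_measurable[OF test_smooth[OF \<psi>]]
  obtain K C where K: "compact K" "\<And>x. \<bar>\<psi> x\<bar> \<le> C * indicator K x" using test_bounded[OF \<psi>] by metis
  obtain L D where L: "compact L" "\<And>x. \<bar>\<rho> x\<bar> \<le> D * indicator L x" using test_bounded[OF \<rho>] by metis
  have i: "integrable (\<mu> \<Otimes>\<^sub>M \<mu>) (\<lambda>(y, x). \<psi> x * (\<rho> y * f (inv y \<otimes> x)))"
    by (rule conv_integrable_pair[OF f _ K _ L]) measurable
  have "(\<integral>x. \<psi> x * conv \<rho> f x \<partial>\<mu>) = (\<integral>x. \<integral>y. \<psi> x * (\<rho> y * f (inv y \<otimes> x)) \<partial>\<mu> \<partial>\<mu>)"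
    by (simp add: conv_def)
  also have "\<dots> = (\<integral>y. \<integral>x. \<psi> x * (\<rho> y * f (inv y \<otimes> x)) \<partial>\<mu> \<partial>\<mu>)"
    by (rule pair.Fubini_integral[OF i])
  also have "\<dots> = (\<integral>y. \<rho> y * (\<integral>x. \<psi> (y \<otimes> x) * f x \<partial>\<mu>) \<partial>\<mu>)"
  proof (rule Bochner_Integration.integral_cong[OF refl])
    fix y
    have "(\<lambda>x. \<psi> x * f (inv y \<otimes> x)) \<in> borel_measurable \<mu>" by measurable
    from left_integral[OF this, of y]
    show "(\<integral>x. \<psi> x * (\<rho> y * f (inv y \<otimes> x)) \<partial>\<mu>) = \<rho> y * (\<integral>x. \<psi> (y \<otimes> x) * f x \<partial>\<mu>)"
      by (simp add: mult.left_commute[of _ "\<rho> y"])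
  qed
  finally show ?thesis .
qed

text \<open>By \<open>conv_pairing\<close> the equation is tested only with left translates of
  \<phi>; these are test functions again, and \<open>T\<close> commutes with the
  translation.\<close>

lemma conv_dist_rep:
  assumes T: "left_invariant_op T" and d: "\<And>\<phi>. \<phi> \<in> test_funs A \<Longrightarrow> (\<integral>x. T \<phi> x * f x \<partial>\<mu>) = (\<integral>x. \<phi> x * h x \<partial>\<mu>)"
    and f: "f \<in> L1loc" "h \<in> L1loc" and \<rho>: "\<rho> \<in> test_funs A" and \<phi>: "\<phi> \<in> test_funs A"
  shows "(\<integral>x. T \<phi> x * conv \<rho> f x \<partial>\<mu>) = (\<integral>x. \<phi> x * conv \<rho> h x \<partial>\<mu>)"
proof -
  have Tp: "T \<phi> \<in> test_funs A" "\<And>y. T (\<lambda>x. \<phi> (y \<otimes> x)) = (\<lambda>x. T \<phi> (y \<otimes> x))"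
    using T \<phi> by (auto simp: left_invariant_op_def)
  have "(\<integral>x. T \<phi> (y \<otimes> x) * f x \<partial>\<mu>) = (\<integral>x. \<phi> (y \<otimes> x) * h x \<partial>\<mu>)" for y
    using d[OF test_left[OF \<phi>, of y]] by (simp add: Tp(2))
  then show ?thesis using conv_pairing[OF f(1) \<rho> Tp(1)] conv_pairing[OF f(2) \<rho> \<phi>] by simp
qed

lemma conv_support:
  assumes "\<And>x. x \<notin> K \<Longrightarrow> f x = 0" "\<And>x. x \<notin> L \<Longrightarrow> \<rho> x = 0" "x \<notin> (\<lambda>q. fst q \<otimes> snd q) ` (L \<times> K)"
  shows "conv \<rho> f x = 0"
proof -
  have "\<rho> y * f (inv y \<otimes> x) = 0" for y
  proof (rule ccontr)
    assume "\<rho> y * f (inv y \<otimes> x) \<noteq> 0"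
    then have "y \<in> L" "inv y \<otimes> x \<in> K" using assms by auto
    then have "x \<in> (\<lambda>q. fst q \<otimes> snd q) ` (L \<times> K)" by (intro image_eqI[of _ _ "(y, inv y \<otimes> x)"]) auto
    then show False using assms(3) by simp
  qed
  then have "(\<lambda>y. \<rho> y * f (inv y \<otimes> x)) = (\<lambda>y. 0)" by blast
  then show ?thesis unfolding conv_def by simp
qed

lemma test_integral_zero:
  assumes "u \<in> smooth_funs A" "integrable \<mu> u" "\<And>x. u x \<ge> 0" "(\<integral>x. u x \<partial>\<mu>) = 0"
  shows "u x = 0"
proof (rule ccontr)
  assume "u x \<noteq> 0"
  have [measurable]: "u \<in> borel_measurable \<mu>" using assms smooth_measurable by blast
  have "AE x in \<mu>. u x = 0"
    using integral_nonneg_eq_0_iff_AE[OF assms(2)] assms(3,4) by simp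
  moreover have o: "open {x. u x \<noteq> 0}"
    using open_vimage[of "- {0}" u] smooth_funs_continuous[OF assms(1)] by (auto simp: vimage_def)
  ultimately have "emeasure \<mu> {x. u x \<noteq> 0} = 0"
    by (subst (asm) AE_iff_measurable[OF _ refl]) auto
  then have "{x. u x \<noteq> 0} = {}" using open_pos[OF o] by blast
  then show False using \<open>u x \<noteq> 0\<close> by auto
qed

text \<open>Testing with \<open>u\<close> times a bump makes the integral of \<open>u\<close>
  squared times the bump vanish, and this integrand is nonnegative and continuous.\<close>

lemma smooth_zero:
  assumes u: "u \<in> smooth_funs A" and z: "\<And>\<phi>. \<phi> \<in> test_funs A \<Longrightarrow> (\<integral>x. \<phi> x * u x \<partial>\<mu>) = 0"
  shows "u x = 0"
proof -
  obtain \<eta> where \<eta>: "\<eta> \<in> test_funs A" "\<And>x. \<eta> x \<ge> 0" "\<eta> x > 0"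
    using bump_exists[OF open_UNIV, of x] by auto
  have t: "(\<lambda>x. u x * \<eta> x) \<in> test_funs A" by (rule test_mult_left[OF u \<eta>(1)])
  have t2: "(\<lambda>x. u x * (u x * \<eta> x)) \<in> test_funs A" by (rule test_mult_left[OF u t])
  have "u x * (u x * \<eta> x) = 0"
  proof (rule test_integral_zero[OF test_smooth[OF t2] test_integrable[OF t2]])
    show "u x * (u x * \<eta> x) \<ge> 0" for x using \<eta>(2)[of x] by (simp add: mult.assoc[symmetric])
    show "(\<integral>x. u x * (u x * \<eta> x) \<partial>\<mu>) = 0" using z[OF t] by (simp add: mult.commute)
  qed
  then show ?thesis using \<eta>(3) by simp
qed

section \<open>Mollifiers and convergence of mollifications\<close>

definition mollifier :: "('g \<Rightarrow> real) \<Rightarrow> bool" where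
  "mollifier \<rho> \<longleftrightarrow> \<rho> \<in> test_funs A \<and> (\<forall>x. \<rho> x \<ge> 0) \<and> (\<integral>x. \<rho> x \<partial>\<mu>) = 1"

lemma mollifier_exists:
  assumes "open U" "\<one> \<in> U"
  obtains \<rho> where "mollifier \<rho>" "\<And>x. x \<notin> U \<Longrightarrow> \<rho> x = 0"
proof -
  obtain \<psi> where \<psi>: "\<psi> \<in> test_funs A" "\<And>x. \<psi> x \<ge> 0" "\<psi> \<one> > 0" "closure {x. \<psi> x \<noteq> 0} \<subseteq> U"
    using bump_exists[OF assms] by metis
  define I where "I = (\<integral>x. \<psi> x \<partial>\<mu>)"
  have "I \<noteq> 0" using test_integral_zero[OF test_smooth[OF \<psi>(1)] test_integrable[OF \<psi>(1)] \<psi>(2), of \<one>] \<psi>(3) by (auto simp: I_def)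
  moreover have "I \<ge> 0" using \<psi>(2) by (simp add: I_def)
  ultimately have I: "I > 0" by simp
  show ?thesis
  proof (rule that[of "\<lambda>x. inverse I * \<psi> x"])
    show "mollifier (\<lambda>x. inverse I * \<psi> x)"
      using I \<psi> test_cmult[OF \<psi>(1), of "inverse I"] by (auto simp: mollifier_def I_def[symmetric])
    show "inverse I * \<psi> x = 0" if "x \<notin> U" for x
      using \<psi>(4) closure_subset[of "{x. \<psi> x \<noteq> 0}"] that by auto
  qed
qed

text \<open>The error is a \<rho>-average of the errors made by single translations, each at most
  \<open>e\<close> where \<rho> does not vanish.\<close>

lemma conv_approx:
  assumes f: "f \<in> L1loc" and \<rho>: "mollifier \<rho>" "\<And>x. x \<notin> U \<Longrightarrow> \<rho> x = 0" and K: "K \<in> sets borel"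
    and U: "\<And>y. y \<in> U \<Longrightarrow> (\<integral>\<^sup>+x. ennreal (indicator K x * \<bar>f (inv y \<otimes> x) - f x\<bar>) \<partial>\<mu>) \<le> ennreal e"
  shows "(\<integral>\<^sup>+x. ennreal (indicator K x * \<bar>conv \<rho> f x - f x\<bar>) \<partial>\<mu>) \<le> ennreal e"
proof -
  have r: "\<rho> \<in> test_funs A" "\<And>x. \<rho> x \<ge> 0" "(\<integral>x. \<rho> x \<partial>\<mu>) = 1" using \<rho> by (auto simp: mollifier_def)
  note [measurable] = L1locD(1)[OF f] smooth_measurable[OF test_smooth[OF r(1)]] K
  note ri = test_integrable[OF r(1)]
  have pt: "ennreal (indicator K x * \<bar>conv \<rho> f x - f x\<bar>) \<le> (\<integral>\<^sup>+y. ennreal (indicator K x * (\<rho> y * \<bar>f (inv y \<otimes> x) - f x\<bar>)) \<partial>\<mu>)" for x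
  proof -
    have i: "integrable \<mu> (\<lambda>y. \<rho> y * f (inv y \<otimes> x) - \<rho> y * f x)"
      by (intro Bochner_Integration.integrable_diff conv_integrable[OF f r(1)] integrable_mult_left ri)
    have "conv \<rho> f x - f x = (\<integral>y. \<rho> y * f (inv y \<otimes> x) - \<rho> y * f x \<partial>\<mu>)"
      using conv_integrable[OF f r(1)] ri r(3) by (simp add: conv_def)
    then have "ennreal \<bar>conv \<rho> f x - f x\<bar> \<le> (\<integral>\<^sup>+y. ennreal (norm (\<rho> y * f (inv y \<otimes> x) - \<rho> y * f x)) \<partial>\<mu>)"
      using integral_norm_bound_ennreal[OF i] by simp
    also have "\<dots> = (\<integral>\<^sup>+y. ennreal (\<rho> y * \<bar>f (inv y \<otimes> x) - f x\<bar>) \<partial>\<mu>)"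
      using r(2) by (simp add: right_diff_distrib[symmetric] abs_mult)
    finally show ?thesis by (auto simp: indicator_def)
  qed
  have "(\<integral>\<^sup>+x. ennreal (indicator K x * \<bar>conv \<rho> f x - f x\<bar>) \<partial>\<mu>)
     \<le> (\<integral>\<^sup>+x. \<integral>\<^sup>+y. ennreal (indicator K x * (\<rho> y * \<bar>f (inv y \<otimes> x) - f x\<bar>)) \<partial>\<mu> \<partial>\<mu>)"
    by (rule nn_integral_mono) (rule pt)
  also have "\<dots> = (\<integral>\<^sup>+y. \<integral>\<^sup>+x. ennreal (indicator K x * (\<rho> y * \<bar>f (inv y \<otimes> x) - f x\<bar>)) \<partial>\<mu> \<partial>\<mu>)"
  proof (rule pair.Fubini')
    have "(\<lambda>q. ennreal (indicator K (snd q) * (\<rho> (fst q) * \<bar>f (inv (fst q) \<otimes> snd q) - f (snd q)\<bar>))) \<in> borel_measurable (\<mu> \<Otimes>\<^sub>M \<mu>)"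
      by (intro measurable_compose[OF _ measurable_ennreal] borel_measurable_times borel_measurable_abs borel_measurable_diff
         pair_measurable L1locD(1)[OF f] measurable_compose[OF measurable_snd L1locD(1)[OF f]]
         measurable_compose[OF measurable_fst smooth_measurable[OF test_smooth[OF r(1)]]]
         measurable_compose[OF measurable_snd borel_measurable_indicator]) (use K in auto)
    then show "(\<lambda>(y, x). ennreal (indicator K x * (\<rho> y * \<bar>f (inv y \<otimes> x) - f x\<bar>))) \<in> borel_measurable (\<mu> \<Otimes>\<^sub>M \<mu>)"
      unfolding case_prod_beta' .
  qed
  also have "\<dots> \<le> (\<integral>\<^sup>+y. ennreal (\<rho> y) * ennreal e \<partial>\<mu>)"
  proof (rule nn_integral_mono)
    fix y
    have "(\<integral>\<^sup>+x. ennreal (indicator K x * (\<rho> y * \<bar>f (inv y \<otimes> x) - f x\<bar>)) \<partial>\<mu>)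
      = ennreal (\<rho> y) * (\<integral>\<^sup>+x. ennreal (indicator K x * \<bar>f (inv y \<otimes> x) - f x\<bar>) \<partial>\<mu>)"
      using r(2) by (subst nn_integral_cmult[symmetric]) (auto simp: ennreal_mult'[symmetric] mult.left_commute)
    also have "\<dots> \<le> ennreal (\<rho> y) * ennreal e"
      using U[of y] \<rho>(2)[of y] by (cases "y \<in> U") (auto intro: mult_left_mono)
    finally show "(\<integral>\<^sup>+x. ennreal (indicator K x * (\<rho> y * \<bar>f (inv y \<otimes> x) - f x\<bar>)) \<partial>\<mu>) \<le> ennreal (\<rho> y) * ennreal e" .
  qed
  also have "\<dots> = ennreal e"
    using r ri by (simp add: nn_integral_multc nn_integral_eq_integral)
  finally show ?thesis .
qed

end

context lie_haar
begin

lemma mollifier_test: "mollifier \<rho> \<Longrightarrow> \<rho> \<in> test_funs A"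
  by (simp add: mollifier_def)

text \<open>All coefficients of an equation have to be smoothed by the same convolution, so one
  mollifier must work for finitely many functions; a finite intersection of neighbourhoods provides
  it.\<close>

lemma mollifier_step:
  assumes F: "finite F" "F \<subseteq> L1loc" and K: "compact K" and e: "e > 0" and W: "open W" "\<one> \<in> W"
  shows "\<exists>\<rho>. mollifier \<rho> \<and> (\<forall>x. x \<notin> W \<longrightarrow> \<rho> x = 0) \<and>
    (\<forall>f\<in>F. (\<integral>\<^sup>+x. ennreal (indicator K x * \<bar>conv \<rho> f x - f x\<bar>) \<partial>\<mu>) \<le> ennreal e)"
proof -
  have "\<forall>f\<in>F. \<exists>U. open U \<and> \<one> \<in> U \<and> (\<forall>y\<in>U. (\<integral>\<^sup>+x. ennreal (indicator K x * \<bar>f (inv y \<otimes> x) - f x\<bar>) \<partial>\<mu>) \<le> ennreal e)"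
    using L1loc_modulus[OF _ K e] F by blast
  then obtain U where U: "\<And>f. f \<in> F \<Longrightarrow> open (U f)" "\<And>f. f \<in> F \<Longrightarrow> \<one> \<in> U f"
    "\<And>f y. f \<in> F \<Longrightarrow> y \<in> U f \<Longrightarrow> (\<integral>\<^sup>+x. ennreal (indicator K x * \<bar>f (inv y \<otimes> x) - f x\<bar>) \<partial>\<mu>) \<le> ennreal e"
    by metis
  have o: "open (W \<inter> (\<Inter>f\<in>F. U f))" "\<one> \<in> W \<inter> (\<Inter>f\<in>F. U f)" using U W F by auto
  obtain \<rho> where \<rho>: "mollifier \<rho>" "\<And>x. x \<notin> W \<inter> (\<Inter>f\<in>F. U f) \<Longrightarrow> \<rho> x = 0"
    using mollifier_exists[OF o] by metis
  have "K \<in> sets borel" using compact_imp_closed[OF K] by auto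
  then have "(\<integral>\<^sup>+x. ennreal (indicator K x * \<bar>conv \<rho> f x - f x\<bar>) \<partial>\<mu>) \<le> ennreal e" if "f \<in> F" for f
    using conv_approx[of f \<rho> "W \<inter> (\<Inter>f\<in>F. U f)" K e, OF _ \<rho>] U(3)[OF that] that F(2) by auto
  then show ?thesis using \<rho> by blast
qed

text \<open>The approximation errors are made summable, which yields convergence almost everywhere together with
  a locally integrable majorant, so that the dominated convergence theorem applies directly.\<close>

lemma mollifier_sequence:
  assumes F: "finite F" "F \<subseteq> L1loc"
  shows "\<exists>\<rho> L. (\<forall>n. mollifier (\<rho> n)) \<and> compact L \<and> (\<forall>n x. x \<notin> L \<longrightarrow> \<rho> n x = 0) \<and>
    (\<forall>f\<in>F. AE x in \<mu>. (\<lambda>n. conv (\<rho> n) f x) \<longlonglongrightarrow> f x) \<and>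
    (\<forall>f\<in>F. \<exists>M\<in>L1loc. AE x in \<mu>. \<forall>n. \<bar>conv (\<rho> n) f x\<bar> \<le> M x)"
proof -
  obtain B :: "nat \<Rightarrow> 'g set" where B: "\<And>n. compact (B n)" "incseq B" "\<And>C. compact C \<Longrightarrow> \<exists>n. C \<subseteq> B n"
    using exhaustion by metis
  obtain L W where L: "compact L" "open W" "\<one> \<in> W" "W \<subseteq> L" by (rule compact_nbhd)
  have "\<forall>n. \<exists>\<rho>. mollifier \<rho> \<and> (\<forall>x. x \<notin> W \<longrightarrow> \<rho> x = 0) \<and>
    (\<forall>f\<in>F. (\<integral>\<^sup>+x. ennreal (indicator (B n) x * \<bar>conv \<rho> f x - f x\<bar>) \<partial>\<mu>) \<le> ennreal ((1/2)^n))"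
    using mollifier_step[OF F B(1) _ L(2,3)] by simp
  then obtain \<rho> where \<rho>: "\<And>n. mollifier (\<rho> n)" "\<And>n x. x \<notin> W \<Longrightarrow> \<rho> n x = 0"
    "\<And>n f. f \<in> F \<Longrightarrow> (\<integral>\<^sup>+x. ennreal (indicator (B n) x * \<bar>conv (\<rho> n) f x - f x\<bar>) \<partial>\<mu>) \<le> ennreal ((1/2)^n)" by metis
  have main: "(AE x in \<mu>. (\<lambda>n. conv (\<rho> n) f x) \<longlonglongrightarrow> f x) \<and> (\<exists>M\<in>L1loc. AE x in \<mu>. \<forall>n. \<bar>conv (\<rho> n) f x\<bar> \<le> M x)" if f: "f \<in> F" for f
  proof -
    have fL: "f \<in> L1loc" using f F by auto
    have cL: "conv (\<rho> n) f \<in> L1loc" for n by (rule smooth_L1loc[OF conv_smooth[OF fL mollifier_test[OF \<rho>(1)]]])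
    define d where "d n x = \<bar>conv (\<rho> n) f x - f x\<bar>" for n x
    have dL: "d n \<in> L1loc" for n
    proof -
      have "(\<lambda>x. conv (\<rho> n) f x + (-1) * f x) \<in> L1loc" by (intro L1loc_add L1loc_cmult cL fL)
      from L1loc_abs[OF this] show ?thesis by (simp add: d_def[abs_def])
    qed
    have [measurable]: "d n \<in> borel_measurable \<mu>" "B n \<in> sets borel" for n
      using L1locD(1)[OF dL] compact_imp_closed[OF B(1)] by auto
    define D where "D x = (\<Sum>n. ennreal (d n x))" for x
    have Dm [measurable]: "D \<in> borel_measurable \<mu>" unfolding D_def by measurable
    have Dfin: "(\<integral>\<^sup>+x. ennreal (indicator K x) * D x \<partial>\<mu>) < \<infinity>" if K: "compact K" for K
    proof -
      obtain k where k: "K \<subseteq> B k" using B(3)[OF K] by blast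
      have [measurable]: "K \<in> sets borel" using compact_imp_closed[OF K] by auto
      \<comment> \<open>\<open>K\<close> lies in \<open>B n\<close> only from the index
        \<open>k\<close> on; the finitely many earlier errors are merely finite.\<close>
      define c where "c n = (if n < k then (\<integral>x. indicator K x * d n x \<partial>\<mu>) else (1/2)^n)" for n
      have cs: "summable c"
        by (rule summable_comparison_test_ev[of _ "\<lambda>n. (1/2)^n"]) (auto simp: c_def eventually_sequentially intro!: exI[of _ k])
      have c0: "c n \<ge> 0" for n by (auto simp: c_def d_def intro!: Bochner_Integration.integral_nonneg)
      have le: "(\<integral>\<^sup>+x. ennreal (indicator K x * d n x) \<partial>\<mu>) \<le> ennreal (c n)" for n
      proof (cases "n < k")
        case True
        have "integrable \<mu> (\<lambda>x. indicator K x * d n x)"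
          using L1locD(2)[OF dL K] by (simp add: set_integrable_def)
        then have "(\<integral>\<^sup>+x. ennreal (indicator K x * d n x) \<partial>\<mu>) = ennreal (\<integral>x. indicator K x * d n x \<partial>\<mu>)"
          by (rule nn_integral_eq_integral) (auto simp: d_def)
        then show ?thesis using True by (simp add: c_def)
      next
        case False
        then have "K \<subseteq> B n" using k incseqD[OF B(2), of k n] by auto
        then have "(\<integral>\<^sup>+x. ennreal (indicator K x * d n x) \<partial>\<mu>) \<le> (\<integral>\<^sup>+x. ennreal (indicator (B n) x * d n x) \<partial>\<mu>)"
          by (intro nn_integral_mono ennreal_leI mult_right_mono) (auto simp: d_def indicator_def)
        also have "\<dots> \<le> ennreal ((1/2)^n)" using \<rho>(3)[OF f, of n] by (simp add: d_def)
        finally show ?thesis using False by (simp add: c_def)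
      qed
      have "(\<integral>\<^sup>+x. ennreal (indicator K x) * D x \<partial>\<mu>) = (\<integral>\<^sup>+x. (\<Sum>n. ennreal (indicator K x * d n x)) \<partial>\<mu>)"
        unfolding D_def by (simp add: ennreal_mult' ennreal_suminf_cmult)
      also have "\<dots> = (\<Sum>n. \<integral>\<^sup>+x. ennreal (indicator K x * d n x) \<partial>\<mu>)"
        by (rule nn_integral_suminf) measurable
      also have "\<dots> \<le> (\<Sum>n. ennreal (c n))" by (intro suminf_le le) auto
      also have "\<dots> = ennreal (\<Sum>n. c n)" by (rule suminf_ennreal2[OF c0 cs])
      finally show ?thesis by (simp add: order_le_less_trans)
    qed
    have "AE x in \<mu>. \<forall>k. ennreal (indicator (B k) x) * D x \<noteq> \<infinity>"
      unfolding AE_all_countable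
    proof
      fix k show "AE x in \<mu>. ennreal (indicator (B k) x) * D x \<noteq> \<infinity>"
        by (rule nn_integral_PInf_AE) (use Dfin[OF B(1), of k] in auto)
    qed
    then have AED: "AE x in \<mu>. D x \<noteq> \<infinity>"
    proof eventually_elim
      case (elim x)
      obtain k where "x \<in> B k" using exhaustion_covers[OF B(3)] by blast
      then show ?case using elim[rule_format, of k] by simp
    qed
    \<comment> \<open>The sum of all errors dominates each of them, so adding it to the absolute
      value of \<open>f\<close> bounds every convolution at once.\<close>
    define M where "M x = \<bar>f x\<bar> + enn2real (D x)" for x
    have eL: "(\<lambda>x. enn2real (D x)) \<in> L1loc"
      unfolding L1loc_iff
    proof (intro conjI allI impI)
      show "(\<lambda>x. enn2real (D x)) \<in> borel_measurable \<mu>" by measurable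
      fix K :: "'g set" assume K: "compact K"
      have [measurable]: "K \<in> sets borel" using compact_imp_closed[OF K] by auto
      show "set_integrable \<mu> K (\<lambda>x. enn2real (D x))"
        unfolding set_integrable_def
      proof (rule integrableI_bounded)
        have "(\<integral>\<^sup>+x. ennreal (norm (indicator K x *\<^sub>R enn2real (D x))) \<partial>\<mu>) \<le> (\<integral>\<^sup>+x. ennreal (indicator K x) * D x \<partial>\<mu>)"
        proof (rule nn_integral_mono)
          fix x
          have "ennreal (enn2real (D x)) \<le> D x" by (cases "D x" rule: ennreal_cases) auto
          then show "ennreal (norm (indicator K x *\<^sub>R enn2real (D x))) \<le> ennreal (indicator K x) * D x"
            by (simp add: indicator_def)
        qed
        then show "(\<integral>\<^sup>+x. ennreal (norm (indicator K x *\<^sub>R enn2real (D x))) \<partial>\<mu>) < \<infinity>"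
          using Dfin[OF K] by (rule order_le_less_trans)
      qed measurable
    qed
    have Mloc: "M \<in> L1loc" unfolding M_def[abs_def] by (intro L1loc_add L1loc_abs fL eL)
    have sm: "summable (\<lambda>n. d n x)" if "D x \<noteq> \<infinity>" for x
      by (rule summable_suminf_not_top) (use that in \<open>auto simp: D_def d_def\<close>)
    have "AE x in \<mu>. (\<lambda>n. conv (\<rho> n) f x) \<longlonglongrightarrow> f x"
      using AED
    proof eventually_elim
      case (elim x)
      have "(\<lambda>n. \<bar>conv (\<rho> n) f x - f x\<bar>) \<longlonglongrightarrow> 0" using summable_LIMSEQ_zero[OF sm[OF elim]] by (simp add: d_def)
      then show ?case using tendsto_rabs_zero_iff LIM_zero_iff by metis
    qed
    moreover have "AE x in \<mu>. \<forall>n. \<bar>conv (\<rho> n) f x\<bar> \<le> M x"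
      using AED
    proof eventually_elim
      case (elim x)
      show ?case
      proof
        fix n
        have d0: "d n x \<ge> 0" for n by (simp add: d_def)
        have "D x = ennreal (\<Sum>n. d n x)"
          unfolding D_def by (rule suminf_ennreal2[OF d0 sm[OF elim]])
        then have D: "enn2real (D x) = (\<Sum>n. d n x)"
          using suminf_nonneg[OF sm[OF elim] d0] by simp
        have "d n x \<le> enn2real (D x)"
          unfolding D using sum_le_suminf[OF sm[OF elim], of "{n}"] by (simp add: d_def)
        then show "\<bar>conv (\<rho> n) f x\<bar> \<le> M x" unfolding M_def d_def by linarith
      qed
    qed
    ultimately show ?thesis using Mloc by blast
  qed
  show ?thesis
    by (intro exI[of _ \<rho>] exI[of _ L] conjI) (use \<rho> L(1) main L(4)[THEN subsetD] in blast)+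
qed

lemma conv_bound:
  assumes f: "f \<in> L1loc" "\<And>x. \<bar>f x\<bar> \<le> C" and \<rho>: "mollifier \<rho>"
  shows "\<bar>conv \<rho> f x\<bar> \<le> C"
proof -
  have r: "\<rho> \<in> test_funs A" "\<And>x. \<rho> x \<ge> 0" "(\<integral>x. \<rho> x \<partial>\<mu>) = 1" using \<rho> by (auto simp: mollifier_def)
  note i = conv_integrable[OF f(1) r(1)]
  have "norm (conv \<rho> f x) \<le> (\<integral>y. C * \<rho> y \<partial>\<mu>)"
    unfolding conv_def
  proof (rule order_trans[OF integral_norm_bound], rule integral_mono)
    show "norm (\<rho> y * f (inv y \<otimes> x)) \<le> C * \<rho> y" for y
      using mult_left_mono[OF f(2) r(2)] r(2)[of y] by (simp add: abs_mult mult.commute)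
  qed (use i test_integrable[OF r(1)] in auto)
  then show ?thesis by (simp add: r(3))
qed

lemma conv_nonneg:
  assumes "\<And>x. f x \<ge> 0" and \<rho>: "mollifier \<rho>"
  shows "conv \<rho> f x \<ge> 0"
  unfolding conv_def using assms by (auto simp: mollifier_def intro!: Bochner_Integration.integral_nonneg)

text \<open>Discriminant form of Cauchy-Schwarz: bounds that are linear in \<open>P\<close> and
  \<open>Q\<close> can be integrated, and the best \<open>t\<close> is chosen afterwards.\<close>

lemma square_le_of_linear_bounds:
  fixes H P Q :: real
  assumes "\<And>t. t > 0 \<Longrightarrow> 2 * \<bar>H\<bar> \<le> t * P + Q / t" "P \<ge> 0" "Q \<ge> 0"
  shows "H\<^sup>2 \<le> P * Q"
proof (cases "P = 0")
  case True
  have "H = 0"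
  proof (rule ccontr)
    assume H: "H \<noteq> 0"
    \<comment> \<open>With \<open>P = 0\<close> the parameter can be taken large; this choice makes
      the remaining term at most \<open>\<bar>H\<bar>\<close>.\<close>
    have "2 * \<bar>H\<bar> \<le> Q / ((Q + 1) / \<bar>H\<bar>)"
      using assms(1)[of "(Q + 1) / \<bar>H\<bar>"] True H assms(3) by simp
    also have "\<dots> \<le> \<bar>H\<bar>" using H assms(3) by (simp add: field_simps)
    finally show False using H by simp
  qed
  then show ?thesis using True by simp
next
  case False
  then have P: "P > 0" using assms by simp
  show ?thesis
  proof (cases "H = 0")
    case True
    then show ?thesis using assms by simp
  next
    case False
    \<comment> \<open>The choice \<open>t = \<bar>H\<bar> / P\<close> makes the first term equal to
      \<open>\<bar>H\<bar>\<close>.\<close>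
    have "2 * \<bar>H\<bar> \<le> \<bar>H\<bar> / P * P + Q / (\<bar>H\<bar> / P)" using assms(1)[of "\<bar>H\<bar> / P"] P False by simp
    then have "\<bar>H\<bar> \<le> Q * P / \<bar>H\<bar>" using P by simp
    then show ?thesis using False by (simp add: field_simps power2_eq_square)
  qed
qed

text \<open>For fixed \<open>t\<close> the pointwise bound of 2|f| by t p + q/t is averaged against
  \<rho>. This is how squares of mollified gradients get dominated by mollified squares.\<close>

lemma conv_Cauchy_Schwarz:
  assumes f: "f \<in> L1loc" "p \<in> L1loc" "q \<in> L1loc" and \<rho>: "mollifier \<rho>"
    and h: "\<And>x. (f x)\<^sup>2 \<le> p x * q x" "\<And>x. p x \<ge> 0" "\<And>x. q x \<ge> 0"
  shows "(conv \<rho> f x)\<^sup>2 \<le> conv \<rho> p x * conv \<rho> q x"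
proof (rule square_le_of_linear_bounds)
  have r: "\<rho> \<in> test_funs A" "\<And>x. \<rho> x \<ge> 0" using \<rho> by (auto simp: mollifier_def)
  note i = conv_integrable[OF f(1) r(1)] conv_integrable[OF f(2) r(1)] conv_integrable[OF f(3) r(1)]
  show "conv \<rho> p x \<ge> 0" "conv \<rho> q x \<ge> 0" using conv_nonneg \<rho> h by auto
  fix t :: real assume t: "t > 0"
  have amgm: "2 * \<bar>f z\<bar> \<le> t * p z + q z / t" for z
  proof -
    have "0 \<le> (t * p z - q z / t)\<^sup>2" by simp
    then have "4 * (p z * q z) \<le> (t * p z + q z / t)\<^sup>2" using t by (simp add: power2_sum power2_diff)
    then have "(2 * \<bar>f z\<bar>)\<^sup>2 \<le> (t * p z + q z / t)\<^sup>2" using h(1)[of z] by (simp add: power_mult_distrib)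
    then show ?thesis by (rule power2_le_imp_le) (use t h in auto)
  qed
  have "2 * \<bar>conv \<rho> f x\<bar> \<le> (\<integral>y. 2 * \<bar>\<rho> y * f (inv y \<otimes> x)\<bar> \<partial>\<mu>)"
    using integral_norm_bound[of \<mu> "\<lambda>y. \<rho> y * f (inv y \<otimes> x)"] by (simp add: conv_def)
  also have "\<dots> \<le> (\<integral>y. t * (\<rho> y * p (inv y \<otimes> x)) + \<rho> y * q (inv y \<otimes> x) / t \<partial>\<mu>)"
  proof (rule integral_mono)
    fix y
    show "2 * \<bar>\<rho> y * f (inv y \<otimes> x)\<bar> \<le> t * (\<rho> y * p (inv y \<otimes> x)) + \<rho> y * q (inv y \<otimes> x) / t"
      using mult_left_mono[OF amgm[of "inv y \<otimes> x"] r(2)[of y]] r(2)[of y] by (simp add: abs_mult algebra_simps)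
  qed (use i in auto)
  also have "\<dots> = t * conv \<rho> p x + conv \<rho> q x / t"
    using i by (simp add: conv_def)
  finally show "2 * \<bar>conv \<rho> f x\<bar> \<le> t * conv \<rho> p x + conv \<rho> q x / t" .
qed

text \<open>The identity is a left-invariant operator, so every convolution of \<open>g\<close>
  pairs to zero with all test functions and vanishes, being smooth; convergence almost everywhere
  passes this on to \<open>g\<close>.\<close>

lemma L1loc_zero:
  assumes g: "g \<in> L1loc" and z: "\<And>\<phi>. \<phi> \<in> test_funs A \<Longrightarrow> (\<integral>x. \<phi> x * g x \<partial>\<mu>) = 0"
  shows "AE x in \<mu>. g x = 0"
proof -
  obtain \<rho> where \<rho>: "\<And>n. mollifier (\<rho> n)" "AE x in \<mu>. (\<lambda>n. conv (\<rho> n) g x) \<longlonglongrightarrow> g x"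
    using mollifier_sequence[of "{g}"] g by auto
  have "conv (\<rho> n) g x = 0" for n x
  proof (rule smooth_zero[OF conv_smooth[OF g mollifier_test[OF \<rho>(1)]]])
    fix \<phi> assume \<phi>: "\<phi> \<in> test_funs A"
    have "left_invariant_op (\<lambda>\<phi>. \<phi>)" by (simp add: left_invariant_op_def)
    from conv_dist_rep[OF this _ g smooth_L1loc[OF smooth_funs_const[of 0]] mollifier_test[OF \<rho>(1)] \<phi>, of n]
    show "(\<integral>x. \<phi> x * conv (\<rho> n) g x \<partial>\<mu>) = 0" using z by (simp add: conv_def)
  qed
  then show ?thesis using \<rho>(2) by (simp add: LIMSEQ_const_iff)
qed

lemma test_inv_integrable:
  assumes g: "g \<in> test_funs A"
  shows "integrable \<mu> (\<lambda>y. g (inv y \<otimes> x))"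
proof -
  obtain K C where K: "compact K" "\<And>x. \<bar>g x\<bar> \<le> C * indicator K x" using test_bounded[OF g] by metis
  note [measurable] = smooth_measurable[OF test_smooth[OF g]]
  show ?thesis
  proof (rule L1loc_integrable[OF smooth_L1loc[OF smooth_funs_const[of 1]]])
    show "compact ((\<lambda>q. fst q \<otimes> snd q) ` ({x} \<times> (\<lambda>x. inv x) ` K))" by (intro compact_mult compact_inv K) auto
    have "\<bar>g (inv y \<otimes> x)\<bar> \<le> C * indicator ((\<lambda>q. fst q \<otimes> snd q) ` ({x} \<times> (\<lambda>x. inv x) ` K)) y * \<bar>1\<bar>" for y
    proof (cases "inv y \<otimes> x \<in> K")
      case True
      then have "(x, inv (inv y \<otimes> x)) \<in> {x} \<times> (\<lambda>x. inv x) ` K" by blast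
      then have "y \<in> (\<lambda>q. fst q \<otimes> snd q) ` ({x} \<times> (\<lambda>x. inv x) ` K)"
        by (intro image_eqI[of _ _ "(x, inv (inv y \<otimes> x))"]) (simp_all add: inv_prod)
      then show ?thesis using K(2)[of "inv y \<otimes> x"] True by simp
    next
      case False
      have "y \<notin> (\<lambda>q. fst q \<otimes> snd q) ` ({x} \<times> (\<lambda>x. inv x) ` K)"
        using False by (auto simp: inv_prod mult_assoc)
      then show ?thesis using K(2)[of "inv y \<otimes> x"] False by simp
    qed
    then show "AE y in \<mu>. \<bar>g (inv y \<otimes> x)\<bar> \<le> C * indicator ((\<lambda>q. fst q \<otimes> snd q) ` ({x} \<times> (\<lambda>x. inv x) ` K)) y * \<bar>1\<bar>" by simp
  qed measurable
qed

text \<open>The value does not depend on \<open>x\<close>. For the cutoffs this gives both the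
  normalization to 1 and derivative bounds uniform in \<open>x\<close>.\<close>

lemma inv_left_integral:
  fixes g :: "'g \<Rightarrow> real"
  assumes [measurable]: "g \<in> borel_measurable \<mu>"
  shows "(\<integral>y. g (inv y \<otimes> x) \<partial>\<mu>) = (\<integral>y. g (inv y) \<partial>\<mu>)"
proof -
  have "(\<lambda>y. g (inv y \<otimes> x)) \<in> borel_measurable \<mu>" by measurable
  from left_integral[OF this, of x] show ?thesis by (simp add: inv_prod mult_assoc)
qed

text \<open>Convolving indicators of an exhaustion from the right with a fixed bump gives cutoffs whose
  left-invariant derivatives are uniformly bounded; no completeness of a distance is needed.\<close>

lemma cutoffs:
  fixes X :: "nat \<Rightarrow> 'g vfield"
  assumes X: "\<And>j. j < \<nu> \<Longrightarrow> X j \<in> lie_algebra G A"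
  shows "\<exists>\<eta> C. (\<forall>n. \<eta> n \<in> test_funs A) \<and> (\<forall>n x. 0 \<le> \<eta> n x) \<and> (\<forall>n x. \<eta> n x \<le> 1) \<and>
    (\<forall>n x. \<forall>j<\<nu>. \<bar>X j (\<eta> n) x\<bar> \<le> C) \<and>
    (\<forall>x. \<forall>\<^sub>F n in sequentially. \<eta> n x = 1 \<and> (\<forall>j<\<nu>. X j (\<eta> n) x = 0))"
proof -
  obtain B :: "nat \<Rightarrow> 'g set" where B: "\<And>n. compact (B n)" "incseq B" "\<And>C. compact C \<Longrightarrow> \<exists>n. C \<subseteq> B n"
    using exhaustion by metis
  obtain \<psi> where \<psi>: "\<psi> \<in> test_funs A" "\<And>x. \<psi> x \<ge> 0" "\<psi> \<one> > 0"
    using bump_exists[OF open_UNIV, of \<one>] by auto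
  have kern: "smooth_kernel (\<lambda>x y. \<rho> (inv y \<otimes> x))" if "\<rho> \<in> smooth_funs A" for \<rho>
    using smooth_kernel_inv[OF smooth_kernel_swap[OF smooth_kernel_mult[OF that]]] .
  \<comment> \<open>The bump enters through \<open>inv y \<otimes> x\<close> and inversion changes
    the measure, so the normalization uses the integral of \<open>\<psi> (inv y)\<close> and not
    that of \<psi>.\<close>
  define I where "I = (\<integral>y. \<psi> (inv y) \<partial>\<mu>)"
  have ii: "integrable \<mu> (\<lambda>y. \<psi> (inv y))" using test_inv_integrable[OF \<psi>(1), of \<one>] by simp
  have si: "(\<lambda>y. \<psi> (inv y)) \<in> smooth_funs A"
    using smooth_kernel_section[OF smooth_kernel_swap[OF kern[OF test_smooth[OF \<psi>(1)]]], of \<one>] by simp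
  have "I \<noteq> 0" using test_integral_zero[OF si ii \<psi>(2), of \<one>] \<psi>(3) by (auto simp: I_def)
  moreover have "I \<ge> 0" using \<psi>(2) by (simp add: I_def)
  ultimately have I: "I > 0" by simp
  define \<rho> where "\<rho> = (\<lambda>x. inverse I * \<psi> x)"
  have \<rho>: "\<rho> \<in> test_funs A" unfolding \<rho>_def by (rule test_cmult[OF \<psi>(1)])
  have \<rho>0: "\<rho> x \<ge> 0" for x using \<psi>(2) I by (simp add: \<rho>_def)
  note [measurable] = smooth_measurable[OF test_smooth[OF \<rho>]]
  have "(\<integral>y. \<rho> (inv y) \<partial>\<mu>) = 1" using I by (simp add: \<rho>_def I_def[symmetric])
  then have \<rho>1: "(\<integral>y. \<rho> (inv y \<otimes> x) \<partial>\<mu>) = 1" for x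
    using inv_left_integral[of \<rho> x] by simp
  obtain S where S: "compact S" "\<And>x. x \<notin> S \<Longrightarrow> \<rho> x = 0" using test_support[OF \<rho>] by blast
  note K = kern[OF test_smooth[OF \<rho>]]
  have mem: "y \<in> (\<lambda>q. fst q \<otimes> snd q) ` (K0 \<times> (\<lambda>x. inv x) ` S)" if "\<rho> (inv y \<otimes> x) \<noteq> 0" "x \<in> K0" for x y K0
  proof -
    have "inv y \<otimes> x \<in> S" using S(2) that by blast
    then have "(x, inv (inv y \<otimes> x)) \<in> K0 \<times> (\<lambda>x. inv x) ` S" using that by blast
    then show ?thesis by (intro image_eqI[of _ _ "(x, inv (inv y \<otimes> x))"]) (simp_all add: inv_prod)
  qed
  have supp: "\<exists>W C. open W \<and> p \<in> W \<and> compact C \<and> (\<forall>x\<in>W. \<forall>y. y \<notin> C \<longrightarrow> \<rho> (inv y \<otimes> x) = 0)" for p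
  proof -
    obtain K0 W where K0: "compact K0" "open W" "p \<in> W" "W \<subseteq> K0" by (rule compact_nbhd)
    let ?C = "(\<lambda>q. fst q \<otimes> snd q) ` (K0 \<times> (\<lambda>x. inv x) ` S)"
    have C: "compact ?C" by (intro compact_mult compact_inv S K0)
    have "\<rho> (inv y \<otimes> x) = 0" if "x \<in> W" "y \<notin> ?C" for x y
      using mem[of y x K0] that(2) subsetD[OF K0(4) that(1)] by metis
    then show ?thesis by (intro exI[of _ W] exI[of _ ?C] conjI K0 C ballI allI impI)
  qed
  define \<eta> where "\<eta> n x = (\<integral>y. \<rho> (inv y \<otimes> x) * indicator (B n) y \<partial>\<mu>)" for n x
  have bm [measurable]: "B n \<in> sets borel" for n using compact_imp_closed[OF B(1)] by auto
  have bi: "set_integrable \<mu> C (indicator (B n) :: 'g \<Rightarrow> real)" if "compact C" for C n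
    by (rule L1locD(2)[OF _ that], rule bounded_L1loc[where C=1]) (auto simp: indicator_def)
  have \<eta>s: "\<eta> n \<in> smooth_funs A" for n
    unfolding \<eta>_def[abs_def] by (rule kernel_integral(1)[OF K supp sets_mu bi])
  have ri: "integrable \<mu> (\<lambda>y. \<rho> (inv y \<otimes> x))" for x by (rule test_inv_integrable[OF \<rho>])
  have ib: "integrable \<mu> (\<lambda>y. g (inv y \<otimes> x) * indicator (B n) y)" if "g \<in> test_funs A" for g x n
  proof -
    note [measurable] = smooth_measurable[OF test_smooth[OF that]]
    show ?thesis
      by (rule Bochner_Integration.integrable_bound[OF test_inv_integrable[OF that]]) (auto simp: indicator_def)
  qed
  have \<eta>0: "\<eta> n x \<ge> 0" for n x unfolding \<eta>_def using \<rho>0 by (intro Bochner_Integration.integral_nonneg) auto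
  have \<eta>1: "\<eta> n x \<le> 1" for n x
  proof -
    have "\<eta> n x \<le> (\<integral>y. \<rho> (inv y \<otimes> x) \<partial>\<mu>)"
      unfolding \<eta>_def by (rule integral_mono[OF ib[OF \<rho>] ri]) (use \<rho>0 in \<open>auto simp: indicator_def\<close>)
    then show ?thesis by (simp add: \<rho>1)
  qed
  have \<eta>t: "\<eta> n \<in> test_funs A" for n
    unfolding test_funs_iff
  proof (intro conjI \<eta>s exI allI impI)
    show "compact ((\<lambda>q. fst q \<otimes> snd q) ` (B n \<times> S))" by (intro compact_mult B S)
    fix x assume x: "x \<notin> (\<lambda>q. fst q \<otimes> snd q) ` (B n \<times> S)"
    have "\<rho> (inv y \<otimes> x) * indicator (B n) y = 0" for y
    proof (rule ccontr)
      assume "\<rho> (inv y \<otimes> x) * indicator (B n) y \<noteq> 0"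
      then have "y \<in> B n" "inv y \<otimes> x \<in> S" using S(2) by (auto simp: indicator_def split: if_splits)
      then have "x \<in> (\<lambda>q. fst q \<otimes> snd q) ` (B n \<times> S)" by (intro image_eqI[of _ _ "(y, inv y \<otimes> x)"]) auto
      then show False using x by simp
    qed
    then have "(\<lambda>y. \<rho> (inv y \<otimes> x) * indicator (B n) y) = (\<lambda>y. 0)" by blast
    then show "\<eta> n x = 0" unfolding \<eta>_def by simp
  qed
  \<comment> \<open>Dropping the indicator of \<open>B n\<close> and using left invariance bounds
    the derivative by this number, for every \<open>n\<close> and every point.\<close>
  define D where "D j = (\<integral>y. \<bar>X j \<rho> (inv y)\<bar> \<partial>\<mu>)" for j
  have bound: "\<bar>X j (\<eta> n) x\<bar> \<le> (\<Sum>j<\<nu>. D j)" if j: "j < \<nu>" for n j x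
  proof -
    note Xv = lie_algebraD(1)[OF X[OF j]]
    have Xt: "X j \<rho> \<in> test_funs A" by (rule test_vf[OF Xv \<rho>])
    note [measurable] = smooth_measurable[OF test_smooth[OF Xt]]
    have "X j (\<eta> n) x = (\<integral>y. X j (\<lambda>x. \<rho> (inv y \<otimes> x)) x * indicator (B n) y \<partial>\<mu>)"
      unfolding \<eta>_def[abs_def] by (rule kernel_integral(2)[OF K supp sets_mu bi Xv])
    also have "\<dots> = (\<integral>y. X j \<rho> (inv y \<otimes> x) * indicator (B n) y \<partial>\<mu>)"
      by (simp add: lie_algebraD(2)[OF X[OF j] test_smooth[OF \<rho>]])
    finally have "\<bar>X j (\<eta> n) x\<bar> \<le> (\<integral>y. norm (X j \<rho> (inv y \<otimes> x) * indicator (B n) y) \<partial>\<mu>)"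
      using integral_norm_bound[of \<mu> "\<lambda>y. X j \<rho> (inv y \<otimes> x) * indicator (B n) y"] by simp
    also have "\<dots> \<le> (\<integral>y. \<bar>X j \<rho> (inv y \<otimes> x)\<bar> \<partial>\<mu>)"
      by (rule integral_mono[OF integrable_norm[OF ib[OF Xt]] integrable_abs[OF test_inv_integrable[OF Xt]]])
        (auto simp: indicator_def)
    also have "\<dots> = D j" using inv_left_integral[of "\<lambda>x. \<bar>X j \<rho> x\<bar>" x] by (simp add: D_def)
    also have "\<dots> \<le> (\<Sum>j<\<nu>. D j)"
      by (rule member_le_sum) (use j in \<open>auto simp: D_def\<close>)
    finally show ?thesis .
  qed
  have ev: "\<forall>\<^sub>F n in sequentially. \<eta> n p = 1 \<and> (\<forall>j<\<nu>. X j (\<eta> n) p = 0)" for p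
  proof -
    obtain K0 W where K0: "compact K0" "open W" "p \<in> W" "W \<subseteq> K0" by (rule compact_nbhd)
    let ?C = "(\<lambda>q. fst q \<otimes> snd q) ` (K0 \<times> (\<lambda>x. inv x) ` S)"
    have "compact ?C" by (intro compact_mult compact_inv S K0)
    then obtain N where N: "?C \<subseteq> B N" using B(3) by blast
    have "\<eta> n p = 1 \<and> (\<forall>j<\<nu>. X j (\<eta> n) p = 0)" if n: "n \<ge> N" for n
    proof -
      have C: "?C \<subseteq> B n" using N incseqD[OF B(2) n] by auto
      \<comment> \<open>For large \<open>n\<close> the set \<open>B n\<close> contains every
        \<open>y\<close> that contributes at points of the neighbourhood \<open>W\<close>; the
        cutoff is identically 1 there, so its derivatives at \<open>p\<close> vanish as
        well.\<close>
      have one: "\<eta> n x = 1" if x: "x \<in> W" for x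
      proof -
        have "\<rho> (inv y \<otimes> x) * indicator (B n) y = \<rho> (inv y \<otimes> x)" for y
        proof (cases "\<rho> (inv y \<otimes> x) = 0")
          case False
          have "y \<in> B n" by (rule subsetD[OF C mem[OF False subsetD[OF K0(4) x]]])
          then show ?thesis by simp
        qed simp
        then have "(\<lambda>y. \<rho> (inv y \<otimes> x) * indicator (B n) y) = (\<lambda>y. \<rho> (inv y \<otimes> x))" by blast
        then show ?thesis unfolding \<eta>_def using \<rho>1 by simp
      qed
      have "X j (\<eta> n) p = 0" if j: "j < \<nu>" for j
        using vf_local[OF lie_algebraD(1)[OF X[OF j]] \<eta>s smooth_funs_const K0(2,3) one]
          vf_const[OF lie_algebraD(1)[OF X[OF j]]] by metis
      then show ?thesis using one K0 by blast
    qed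
    then show ?thesis by (auto simp: eventually_sequentially)
  qed
  show ?thesis by (intro exI conjI allI impI) (rule \<eta>t \<eta>0 \<eta>1 bound ev; assumption?)+
qed

end

subsection \<open>Calculus of weak derivatives\<close>

context lie_haar
begin

abbreviation wd :: "'g vfield \<Rightarrow> ('g \<Rightarrow> real) \<Rightarrow> ('g \<Rightarrow> real) \<Rightarrow> bool" where
  "wd \<equiv> has_weak_deriv G A \<mu> \<delta>"

lemma wd_iff:
  "wd X f h \<longleftrightarrow> f \<in> L1loc \<and> h \<in> L1loc \<and>
    (\<forall>\<phi>\<in>test_funs A. (\<integral>x. vf_adjoint G \<delta> X \<phi> x * f x \<partial>\<mu>) = (\<integral>x. \<phi> x * h x \<partial>\<mu>))"
  by (simp add: has_weak_deriv_def dist_rep_def L1loc_def)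

lemma weak_laplacian_iff:
  "has_weak_laplacian G A \<mu> \<delta> \<nu> X f h \<longleftrightarrow> f \<in> L1loc \<and> h \<in> L1loc \<and>
    (\<forall>\<phi>\<in>test_funs A. (\<integral>x. sub_laplacian G \<delta> \<nu> X \<phi> x * f x \<partial>\<mu>) = (\<integral>x. \<phi> x * h x \<partial>\<mu>))"
  for f h :: "'g \<Rightarrow> real"
  by (simp add: has_weak_laplacian_def dist_rep_def L1loc_def)

lemma vf_adjoint_test:
  assumes X: "X \<in> vector_fields A" and \<phi>: "\<phi> \<in> test_funs A"
  shows "vf_adjoint G \<delta> X \<phi> \<in> test_funs A"
proof -
  have "(\<lambda>x. (-1) * (X \<phi> x + X \<delta> \<one> * \<phi> x)) \<in> test_funs A"
    by (rule test_cmult[OF test_add[OF test_vf[OF X \<phi>] test_cmult[OF \<phi>]]])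
  then show ?thesis by (simp add: vf_adjoint_def[abs_def])
qed

lemma left_invariant_adjoint:
  assumes X: "X \<in> lie_algebra G A"
  shows "left_invariant_op (vf_adjoint G \<delta> X)"
  unfolding left_invariant_op_def
  using vf_adjoint_test[OF lie_algebraD(1)[OF X]] lie_algebraD(2)[OF X test_smooth]
  by (auto simp: vf_adjoint_def fun_eq_iff)

lemma sub_laplacian_test:
  assumes X: "\<And>j. j < \<nu> \<Longrightarrow> X j \<in> vector_fields A" and \<phi>: "\<phi> \<in> test_funs A"
  shows "sub_laplacian G \<delta> \<nu> X \<phi> \<in> test_funs A"
proof -
  have t: "(\<lambda>x. X j (X j \<phi>) x + X j \<delta> \<one> * X j \<phi> x) \<in> test_funs A" if "j < \<nu>" for j
    by (rule test_add[OF test_vf[OF X[OF that] test_vf[OF X[OF that] \<phi>]] test_cmult[OF test_vf[OF X[OF that] \<phi>]]])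
  have "(\<lambda>x. \<Sum>j<n. X j (X j \<phi>) x + X j \<delta> \<one> * X j \<phi> x) \<in> test_funs A" if "n \<le> \<nu>" for n
    using that
  proof (induction n)
    case 0
    show ?case using test_cmult[OF \<phi>, of 0] by simp
  next
    case (Suc n)
    then show ?case using test_add[OF Suc.IH t[of n]] by simp
  qed
  from test_cmult[OF this[OF order_refl], of "-1"]
  show ?thesis by (simp add: sub_laplacian_def[abs_def])
qed

lemma left_invariant_laplacian:
  assumes X: "\<And>j. j < \<nu> \<Longrightarrow> X j \<in> lie_algebra G A"
  shows "left_invariant_op (sub_laplacian G \<delta> \<nu> X)"
  unfolding left_invariant_op_def
proof (intro ballI conjI allI)
  fix \<phi> y assume \<phi>: "\<phi> \<in> test_funs A"
  show "sub_laplacian G \<delta> \<nu> X \<phi> \<in> test_funs A"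
    by (rule sub_laplacian_test[OF lie_algebraD(1)[OF X] \<phi>])
  have "X j (X j (\<lambda>x. \<phi> (y \<otimes> x))) = (\<lambda>x. X j (X j \<phi>) (y \<otimes> x))" if j: "j < \<nu>" for j
    using lie_algebraD(2)[OF X[OF j] test_smooth[OF \<phi>]]
      lie_algebraD(2)[OF X[OF j] test_smooth[OF test_vf[OF lie_algebraD(1)[OF X[OF j]] \<phi>]]] by simp
  moreover have "X j (\<lambda>x. \<phi> (y \<otimes> x)) = (\<lambda>x. X j \<phi> (y \<otimes> x))" if j: "j < \<nu>" for j
    by (rule lie_algebraD(2)[OF X[OF j] test_smooth[OF \<phi>]])
  ultimately show "sub_laplacian G \<delta> \<nu> X (\<lambda>x. \<phi> (y \<otimes> x)) = (\<lambda>x. sub_laplacian G \<delta> \<nu> X \<phi> (y \<otimes> x))"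
    unfolding sub_laplacian_def by (intro ext arg_cong[where f=uminus] sum.cong refl) simp
qed

text \<open>Apply \<open>integral_vf\<close> to the product of \<open>f\<close> and \<phi>; the
  constant coming from the modular function is exactly the zero-order term of
  \<open>vf_adjoint\<close>.\<close>

lemma adjoint_smooth:
  assumes X: "X \<in> lie_algebra G A" and f: "f \<in> smooth_funs A" and \<phi>: "\<phi> \<in> test_funs A"
  shows "(\<integral>x. vf_adjoint G \<delta> X \<phi> x * f x \<partial>\<mu>) = (\<integral>x. \<phi> x * X f x \<partial>\<mu>)"
    "(\<integral>x. X \<phi> x * f x \<partial>\<mu>) = (\<integral>x. \<phi> x * vf_adjoint G \<delta> X f x \<partial>\<mu>)"
proof -
  note Xv = lie_algebraD(1)[OF X]
  note ps = test_smooth[OF \<phi>]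
  note Xf = vector_fieldsD(1)[OF Xv f f]
  have t: "(\<lambda>x. f x * \<phi> x) \<in> test_funs A" by (rule test_mult_left[OF f \<phi>])
  have i: "integrable \<mu> (\<lambda>x. X \<phi> x * f x)" "integrable \<mu> (\<lambda>x. \<phi> x * X f x)" "integrable \<mu> (\<lambda>x. \<phi> x * f x)"
    using test_integrable_mult[OF test_vf[OF Xv \<phi>] smooth_L1loc[OF f]]
      test_integrable_mult[OF \<phi> smooth_L1loc[OF Xf]] test_integrable_mult[OF \<phi> smooth_L1loc[OF f]] by auto
  have "(\<integral>x. \<phi> x * X f x + X \<phi> x * f x \<partial>\<mu>) = - X \<delta> \<one> * (\<integral>x. \<phi> x * f x \<partial>\<mu>)"
    using integral_vf[OF X t] unfolding vector_fieldsD(4)[OF Xv f ps] by (simp add: mult.commute add.commute)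
  then have e: "(\<integral>x. \<phi> x * X f x \<partial>\<mu>) + (\<integral>x. X \<phi> x * f x \<partial>\<mu>) = - X \<delta> \<one> * (\<integral>x. \<phi> x * f x \<partial>\<mu>)"
    using i by simp
  have "(\<integral>x. vf_adjoint G \<delta> X \<phi> x * f x \<partial>\<mu>) = (\<integral>x. - (X \<phi> x * f x) - X \<delta> \<one> * (\<phi> x * f x) \<partial>\<mu>)"
    by (rule Bochner_Integration.integral_cong) (auto simp: vf_adjoint_def algebra_simps)
  also have "\<dots> = - (\<integral>x. X \<phi> x * f x \<partial>\<mu>) - X \<delta> \<one> * (\<integral>x. \<phi> x * f x \<partial>\<mu>)" using i by simp
  finally show "(\<integral>x. vf_adjoint G \<delta> X \<phi> x * f x \<partial>\<mu>) = (\<integral>x. \<phi> x * X f x \<partial>\<mu>)" using e by simp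
  have "(\<integral>x. \<phi> x * vf_adjoint G \<delta> X f x \<partial>\<mu>) = (\<integral>x. - (\<phi> x * X f x) - X \<delta> \<one> * (\<phi> x * f x) \<partial>\<mu>)"
    by (rule Bochner_Integration.integral_cong) (auto simp: vf_adjoint_def algebra_simps)
  also have "\<dots> = - (\<integral>x. \<phi> x * X f x \<partial>\<mu>) - X \<delta> \<one> * (\<integral>x. \<phi> x * f x \<partial>\<mu>)" using i by simp
  finally show "(\<integral>x. X \<phi> x * f x \<partial>\<mu>) = (\<integral>x. \<phi> x * vf_adjoint G \<delta> X f x \<partial>\<mu>)" using e by simp
qed

lemma wd_smooth:
  assumes X: "X \<in> lie_algebra G A" and f: "f \<in> smooth_funs A"
  shows "wd X f (X f)"
  unfolding wd_iff using adjoint_smooth(1)[OF X f] smooth_L1loc[OF f]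
    smooth_L1loc[OF vector_fieldsD(1)[OF lie_algebraD(1)[OF X] f f]] by blast

lemma sub_laplacian_adjoint: "sub_laplacian G \<delta> \<nu> X f x = (\<Sum>j<\<nu>. vf_adjoint G \<delta> (X j) (X j f) x)"
  by (simp add: sub_laplacian_def vf_adjoint_def sum_negf[symmetric])

lemma vf_adjoint_smooth: "X \<in> vector_fields A \<Longrightarrow> f \<in> smooth_funs A \<Longrightarrow> vf_adjoint G \<delta> X f \<in> smooth_funs A"
proof -
  assume X: "X \<in> vector_fields A" and f: "f \<in> smooth_funs A"
  have "(\<lambda>x. (-1) * (X f x + X \<delta> \<one> * f x)) \<in> smooth_funs A"
    by (intro smooth_funs_cmult smooth_funs_add vector_fieldsD(1)[OF X f f] f)
  then show ?thesis by (simp add: vf_adjoint_def[abs_def])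
qed

lemma sub_laplacian_smooth:
  assumes X: "\<And>j. j < \<nu> \<Longrightarrow> X j \<in> lie_algebra G A" and f: "f \<in> smooth_funs A"
  shows "sub_laplacian G \<delta> \<nu> X f \<in> smooth_funs A"
proof -
  have "(\<lambda>x. \<Sum>j<\<nu>. vf_adjoint G \<delta> (X j) (X j f) x) \<in> smooth_funs A"
  proof (rule smooth_funs_sum)
    fix j assume "j \<in> {..<\<nu>}"
    then have v: "X j \<in> vector_fields A" using lie_algebraD(1)[OF X] by simp
    show "vf_adjoint G \<delta> (X j) (X j f) \<in> smooth_funs A"
      by (rule vf_adjoint_smooth[OF v vector_fieldsD(1)[OF v f f]])
  qed
  then show ?thesis by (simp add: sub_laplacian_adjoint[abs_def])
qed

lemma gradient_laplacian_smooth: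
  assumes X: "\<And>j. j < \<nu> \<Longrightarrow> X j \<in> lie_algebra G A" and f: "f \<in> smooth_funs A" and \<phi>: "\<phi> \<in> test_funs A"
  shows "(\<integral>x. (\<Sum>j<\<nu>. X j \<phi> x * X j f x) \<partial>\<mu>) = (\<integral>x. \<phi> x * sub_laplacian G \<delta> \<nu> X f x \<partial>\<mu>)"
    "(\<integral>x. sub_laplacian G \<delta> \<nu> X \<phi> x * f x \<partial>\<mu>) = (\<integral>x. \<phi> x * sub_laplacian G \<delta> \<nu> X f x \<partial>\<mu>)"
proof -
  note Xv = lie_algebraD(1)[OF X]
  have Xf: "X j f \<in> smooth_funs A" if "j < \<nu>" for j by (rule vector_fieldsD(1)[OF Xv[OF that] f f])
  have i1: "integrable \<mu> (\<lambda>x. X j \<phi> x * X j f x)" if "j < \<nu>" for j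
    by (rule test_integrable_mult[OF test_vf[OF Xv[OF that] \<phi>] smooth_L1loc[OF Xf[OF that]]])
  have i2: "integrable \<mu> (\<lambda>x. \<phi> x * vf_adjoint G \<delta> (X j) (X j f) x)" if "j < \<nu>" for j
    by (rule test_integrable_mult[OF \<phi> smooth_L1loc[OF vf_adjoint_smooth[OF Xv[OF that] Xf[OF that]]]])
  have i3: "integrable \<mu> (\<lambda>x. vf_adjoint G \<delta> (X j) (X j \<phi>) x * f x)" if "j < \<nu>" for j
    by (rule test_integrable_mult[OF vf_adjoint_test[OF Xv[OF that] test_vf[OF Xv[OF that] \<phi>]] smooth_L1loc[OF f]])
  show 1: "(\<integral>x. (\<Sum>j<\<nu>. X j \<phi> x * X j f x) \<partial>\<mu>) = (\<integral>x. \<phi> x * sub_laplacian G \<delta> \<nu> X f x \<partial>\<mu>)"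
    using i1 i2 adjoint_smooth(2)[OF X Xf \<phi>]
    by (simp add: sub_laplacian_adjoint sum_distrib_left)
  show "(\<integral>x. sub_laplacian G \<delta> \<nu> X \<phi> x * f x \<partial>\<mu>) = (\<integral>x. \<phi> x * sub_laplacian G \<delta> \<nu> X f x \<partial>\<mu>)"
    unfolding 1[symmetric] using i1 i3 adjoint_smooth(1)[OF X f test_vf[OF Xv \<phi>]]
    by (simp add: sub_laplacian_adjoint sum_distrib_right)
qed

text \<open>\<open>g\<close> is what the operator with formal transpose \<open>T\<close> gives
  classically on the smooth function \<open>conv \<rho> f\<close>. It represents the same
  distribution as \<open>conv \<rho> h\<close>, and smooth representatives agree everywhere.\<close>

lemma dist_rep_conv:
  assumes T: "left_invariant_op T" and d: "\<And>\<phi>. \<phi> \<in> test_funs A \<Longrightarrow> (\<integral>x. T \<phi> x * f x \<partial>\<mu>) = (\<integral>x. \<phi> x * h x \<partial>\<mu>)"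
    and f: "f \<in> L1loc" "h \<in> L1loc" and \<rho>: "\<rho> \<in> test_funs A"
    and g: "g \<in> smooth_funs A" "\<And>\<phi>. \<phi> \<in> test_funs A \<Longrightarrow> (\<integral>x. T \<phi> x * conv \<rho> f x \<partial>\<mu>) = (\<integral>x. \<phi> x * g x \<partial>\<mu>)"
  shows "g = conv \<rho> h"
proof
  fix x
  have s: "(\<lambda>x. g x - conv \<rho> h x) \<in> smooth_funs A" by (intro smooth_funs_diff g conv_smooth f \<rho>)
  have "g x - conv \<rho> h x = 0"
  proof (rule smooth_zero[OF s])
    fix \<phi> assume \<phi>: "\<phi> \<in> test_funs A"
    have i: "integrable \<mu> (\<lambda>x. \<phi> x * g x)" "integrable \<mu> (\<lambda>x. \<phi> x * conv \<rho> h x)"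
      by (intro test_integrable_mult \<phi> smooth_L1loc g conv_smooth f \<rho>)+
    have "(\<integral>x. \<phi> x * (g x - conv \<rho> h x) \<partial>\<mu>) = (\<integral>x. \<phi> x * g x \<partial>\<mu>) - (\<integral>x. \<phi> x * conv \<rho> h x \<partial>\<mu>)"
      using i by (simp add: right_diff_distrib)
    also have "\<dots> = 0" using conv_dist_rep[OF T d f \<rho> \<phi>] g(2)[OF \<phi>] by simp
    finally show "(\<integral>x. \<phi> x * (g x - conv \<rho> h x) \<partial>\<mu>) = 0" .
  qed
  then show "g x = conv \<rho> h x" by simp
qed

lemma wd_conv:
  assumes X: "X \<in> lie_algebra G A" and w: "wd X f h" and \<rho>: "\<rho> \<in> test_funs A"
  shows "X (conv \<rho> f) = conv \<rho> h"
proof -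
  have f: "f \<in> L1loc" "h \<in> L1loc" using w by (auto simp: wd_iff)
  note cs = conv_smooth[OF f(1) \<rho>]
  show ?thesis
    by (rule dist_rep_conv[OF left_invariant_adjoint[OF X] _ f \<rho> vector_fieldsD(1)[OF lie_algebraD(1)[OF X] cs cs]
        adjoint_smooth(1)[OF X cs]]) (use w in \<open>auto simp: wd_iff\<close>)
qed

lemma laplacian_conv:
  assumes X: "\<And>j. j < \<nu> \<Longrightarrow> X j \<in> lie_algebra G A" and w: "has_weak_laplacian G A \<mu> \<delta> \<nu> X f h" and \<rho>: "\<rho> \<in> test_funs A"
  shows "sub_laplacian G \<delta> \<nu> X (conv \<rho> f) = conv \<rho> h"
proof -
  have f: "f \<in> L1loc" "h \<in> L1loc" using w by (auto simp: weak_laplacian_iff)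
  note cs = conv_smooth[OF f(1) \<rho>]
  show ?thesis
    by (rule dist_rep_conv[OF left_invariant_laplacian[OF X] _ f \<rho> sub_laplacian_smooth[OF X cs]
        gradient_laplacian_smooth(2)[OF X cs]]) (use w in \<open>auto simp: weak_laplacian_iff\<close>)
qed

lemma dist_unique:
  assumes f: "f \<in> L1loc" "g \<in> L1loc" and e: "\<And>\<phi>. \<phi> \<in> test_funs A \<Longrightarrow> (\<integral>x. \<phi> x * f x \<partial>\<mu>) = (\<integral>x. \<phi> x * g x \<partial>\<mu>)"
  shows "AE x in \<mu>. f x = g x"
proof -
  have "AE x in \<mu>. f x + (-1) * g x = 0"
  proof (rule L1loc_zero)
    show "(\<lambda>x. f x + (-1) * g x) \<in> L1loc" by (intro L1loc_add L1loc_cmult f)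
    fix \<phi> assume \<phi>: "\<phi> \<in> test_funs A"
    have "(\<integral>x. \<phi> x * (f x + (-1) * g x) \<partial>\<mu>) = (\<integral>x. \<phi> x * f x - \<phi> x * g x \<partial>\<mu>)"
      by (simp add: algebra_simps)
    then show "(\<integral>x. \<phi> x * (f x + (-1) * g x) \<partial>\<mu>) = 0"
      using e[OF \<phi>] test_integrable_mult[OF \<phi> f(1)] test_integrable_mult[OF \<phi> f(2)] by simp
  qed
  then show ?thesis by eventually_elim simp
qed

lemma wd_unique: "wd X f h \<Longrightarrow> wd X f h' \<Longrightarrow> AE x in \<mu>. h x = h' x"
  by (rule dist_unique) (auto simp: wd_iff)

lemma weak_laplacian_unique:
  "has_weak_laplacian G A \<mu> \<delta> \<nu> X f h \<Longrightarrow> has_weak_laplacian G A \<mu> \<delta> \<nu> X f h' \<Longrightarrow> AE x in \<mu>. h x = (h' x :: real)"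
  by (rule dist_unique) (auto simp: weak_laplacian_iff)

lemma wd_add:
  assumes "wd X f h" "wd X g k" and X: "X \<in> vector_fields A"
  shows "wd X (\<lambda>x. f x + g x) (\<lambda>x. h x + k x)"
  using assms(1,2) test_integrable_mult vf_adjoint_test[OF X]
  unfolding wd_iff by (auto simp: distrib_left intro!: L1loc_add)

lemma wd_cmult:
  assumes "wd X f h"
  shows "wd X (\<lambda>x. c * f x) (\<lambda>x. c * h x)"
  using assms unfolding wd_iff by (auto simp: mult.left_commute[of _ c] intro!: L1loc_cmult)

section \<open>Limits, chain rule and product rule for weak derivatives\<close>

lemma L1loc_limit:
  assumes "f \<in> borel_measurable \<mu>" "AE x in \<mu>. (\<lambda>n. fn n x) \<longlonglongrightarrow> f x" "M \<in> L1loc" "AE x in \<mu>. \<forall>n. \<bar>fn n x\<bar> \<le> M x"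
  shows "f \<in> L1loc"
proof (rule L1loc_bound[OF assms(3,1)])
  show "AE x in \<mu>. \<bar>f x\<bar> \<le> \<bar>M x\<bar>"
    using assms(2,4)
  proof eventually_elim
    case (elim x)
    have "\<bar>f x\<bar> \<le> M x"
      by (rule tendsto_upperbound[OF tendsto_rabs[OF elim(1)]]) (use elim(2) in auto)
    then show ?case by simp
  qed
qed

lemma test_limit:
  assumes \<psi>: "\<psi> \<in> test_funs A" and "f \<in> borel_measurable \<mu>" "\<And>n. fn n \<in> borel_measurable \<mu>"
    "AE x in \<mu>. (\<lambda>n. fn n x) \<longlonglongrightarrow> f x" "M \<in> L1loc" "AE x in \<mu>. \<forall>n. \<bar>fn n x\<bar> \<le> M x"
  shows "(\<lambda>n. \<integral>x. \<psi> x * fn n x \<partial>\<mu>) \<longlonglongrightarrow> (\<integral>x. \<psi> x * f x \<partial>\<mu>)"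
proof (rule integral_dominated_convergence)
  note [measurable] = assms(2,3) smooth_measurable[OF test_smooth[OF \<psi>]]
  show "(\<lambda>x. \<psi> x * f x) \<in> borel_measurable \<mu>" "(\<lambda>x. \<psi> x * fn n x) \<in> borel_measurable \<mu>" for n by measurable
  show "integrable \<mu> (\<lambda>x. \<bar>\<psi> x * M x\<bar>)" by (intro integrable_abs test_integrable_mult \<psi> assms(5))
  show "AE x in \<mu>. (\<lambda>n. \<psi> x * fn n x) \<longlonglongrightarrow> \<psi> x * f x"
    using assms(4) by eventually_elim (intro tendsto_intros)
  show "AE x in \<mu>. norm (\<psi> x * fn n x) \<le> \<bar>\<psi> x * M x\<bar>" for n
    using assms(6)
  proof eventually_elim
    case (elim x)
    from elim[rule_format, of n] show ?case by (auto simp: abs_mult intro!: mult_left_mono)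
  qed
qed

text \<open>Each side of the defining identity passes to the limit by dominated convergence, the
  test function confining the majorants to a compact set. The rules with non-smooth factors below
  all end here.\<close>

lemma wd_limit:
  assumes X: "X \<in> vector_fields A" and w: "\<And>n. wd X (fn n) (hn n)"
    and f: "f \<in> borel_measurable \<mu>" "AE x in \<mu>. (\<lambda>n. fn n x) \<longlonglongrightarrow> f x" "M \<in> L1loc" "AE x in \<mu>. \<forall>n. \<bar>fn n x\<bar> \<le> M x"
    and h: "h \<in> borel_measurable \<mu>" "AE x in \<mu>. (\<lambda>n. hn n x) \<longlonglongrightarrow> h x" "M' \<in> L1loc" "AE x in \<mu>. \<forall>n. \<bar>hn n x\<bar> \<le> M' x"
  shows "wd X f h"
proof -
  have m: "fn n \<in> borel_measurable \<mu>" "hn n \<in> borel_measurable \<mu>" for n using w[of n] by (auto simp: wd_iff L1locD(1))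
  have "(\<integral>x. vf_adjoint G \<delta> X \<phi> x * f x \<partial>\<mu>) = (\<integral>x. \<phi> x * h x \<partial>\<mu>)" if \<phi>: "\<phi> \<in> test_funs A" for \<phi>
  proof (rule LIMSEQ_unique)
    show "(\<lambda>n. \<integral>x. vf_adjoint G \<delta> X \<phi> x * fn n x \<partial>\<mu>) \<longlonglongrightarrow> (\<integral>x. vf_adjoint G \<delta> X \<phi> x * f x \<partial>\<mu>)"
      by (rule test_limit[OF vf_adjoint_test[OF X \<phi>] f(1) m(1) f(2-4)])
    have "(\<lambda>n. \<integral>x. \<phi> x * hn n x \<partial>\<mu>) \<longlonglongrightarrow> (\<integral>x. \<phi> x * h x \<partial>\<mu>)"
      by (rule test_limit[OF \<phi> h(1) m(2) h(2-4)])
    then show "(\<lambda>n. \<integral>x. vf_adjoint G \<delta> X \<phi> x * fn n x \<partial>\<mu>) \<longlonglongrightarrow> (\<integral>x. \<phi> x * h x \<partial>\<mu>)"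
      using w \<phi> by (simp add: wd_iff)
  qed
  then show ?thesis using L1loc_limit[OF f] L1loc_limit[OF h] by (simp add: wd_iff)
qed

lemma smooth_mult_L1loc:
  assumes "u \<in> smooth_funs A" "f \<in> L1loc"
  shows "(\<lambda>x. u x * f x) \<in> L1loc"
  unfolding L1loc_iff
proof (intro conjI allI impI)
  show "(\<lambda>x. u x * f x) \<in> borel_measurable \<mu>"
    using smooth_measurable[OF assms(1)] L1locD(1)[OF assms(2)] by auto
  fix K :: "'g set" assume K: "compact K"
  from integrable_on_compact[OF sets_mu K L1locD(2)[OF assms(2) K] continuous_on_subset[OF smooth_funs_continuous[OF assms(1)]]]
  show "set_integrable \<mu> K (\<lambda>x. u x * f x)" by (simp add: set_integrable_def mult.assoc)
qed

text \<open>Absorbing \<open>u\<close> into the test function moves it through the adjoint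
  derivative; the Leibniz rule supplies the extra term with \<open>X u\<close>.\<close>

lemma wd_mult_smooth:
  assumes X: "X \<in> vector_fields A" and u: "u \<in> smooth_funs A" and w: "wd X f h"
  shows "wd X (\<lambda>x. u x * f x) (\<lambda>x. u x * h x + X u x * f x)"
proof -
  have f: "f \<in> L1loc" "h \<in> L1loc" using w by (auto simp: wd_iff)
  have Xu: "X u \<in> smooth_funs A" by (rule vector_fieldsD(1)[OF X u u])
  have "(\<integral>x. vf_adjoint G \<delta> X \<phi> x * (u x * f x) \<partial>\<mu>) = (\<integral>x. \<phi> x * (u x * h x + X u x * f x) \<partial>\<mu>)"
    if \<phi>: "\<phi> \<in> test_funs A" for \<phi>
  proof -
    have t: "(\<lambda>x. u x * \<phi> x) \<in> test_funs A" "(\<lambda>x. X u x * \<phi> x) \<in> test_funs A"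
      by (intro test_mult_left u Xu \<phi>)+
    have "vf_adjoint G \<delta> X \<phi> x * (u x * f x) = vf_adjoint G \<delta> X (\<lambda>x. u x * \<phi> x) x * f x + (X u x * \<phi> x) * f x" for x
      unfolding vf_adjoint_def vector_fieldsD(4)[OF X u test_smooth[OF \<phi>]] by (simp add: algebra_simps)
    then have "(\<integral>x. vf_adjoint G \<delta> X \<phi> x * (u x * f x) \<partial>\<mu>)
      = (\<integral>x. vf_adjoint G \<delta> X (\<lambda>x. u x * \<phi> x) x * f x \<partial>\<mu>) + (\<integral>x. (X u x * \<phi> x) * f x \<partial>\<mu>)"
      using test_integrable_mult[OF vf_adjoint_test[OF X t(1)] f(1)] test_integrable_mult[OF t(2) f(1)] by simp
    also have "\<dots> = (\<integral>x. (u x * \<phi> x) * h x \<partial>\<mu>) + (\<integral>x. (X u x * \<phi> x) * f x \<partial>\<mu>)"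
      using w t(1) by (simp add: wd_iff)
    also have "\<dots> = (\<integral>x. (u x * \<phi> x) * h x + (X u x * \<phi> x) * f x \<partial>\<mu>)"
      using test_integrable_mult[OF t(1) f(2)] test_integrable_mult[OF t(2) f(1)] by simp
    finally show ?thesis by (simp add: algebra_simps)
  qed
  then show ?thesis unfolding wd_iff
    by (intro conjI ballI L1loc_add smooth_mult_L1loc u Xu f)
qed

lemma wd_chain:
  fixes T T' :: "real \<Rightarrow> real"
  assumes X: "X \<in> lie_algebra G A" and w: "wd X f h"
    and T: "smooth_on UNIV T" "\<And>t. (T has_real_derivative T' t) (at t)" "continuous_on UNIV T'" "\<And>t. \<bar>T' t\<bar> \<le> C"
  shows "wd X (\<lambda>x. T (f x)) (\<lambda>x. T' (f x) * h x)"
proof -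
  have f: "f \<in> L1loc" "h \<in> L1loc" using w by (auto simp: wd_iff)
  note Xv = lie_algebraD(1)[OF X]
  obtain \<rho> where \<rho>: "\<And>n. mollifier (\<rho> n)"
    "\<And>u. u \<in> {f, h} \<Longrightarrow> AE x in \<mu>. (\<lambda>n. conv (\<rho> n) u x) \<longlonglongrightarrow> u x"
    "\<And>u. u \<in> {f, h} \<Longrightarrow> \<exists>M\<in>L1loc. AE x in \<mu>. \<forall>n. \<bar>conv (\<rho> n) u x\<bar> \<le> M x"
    using mollifier_sequence[of "{f, h}"] f by blast
  note \<rho>t = mollifier_test[OF \<rho>(1)]
  obtain M M' where M: "M \<in> L1loc" "AE x in \<mu>. \<forall>n. \<bar>conv (\<rho> n) f x\<bar> \<le> M x"
     "M' \<in> L1loc" "AE x in \<mu>. \<forall>n. \<bar>conv (\<rho> n) h x\<bar> \<le> M' x" using \<rho>(3) by blast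
  have C: "C \<ge> 0" using T(4)[of 0] by simp
  \<comment> \<open>\<open>T\<close> need not be bounded; its bounded derivative gives linear
    growth, which the majorant of the convolutions of \<open>f\<close> absorbs.\<close>
  have Tb: "\<bar>T t\<bar> \<le> \<bar>T 0\<bar> + C * \<bar>t\<bar>" for t
  proof -
    have "norm (T t - T 0) \<le> C * norm (t - 0)"
      by (rule field_differentiable_bound[of UNIV]) (use T(2,4) in auto)
    then show ?thesis by simp
  qed
  have Tc: "isCont T t" "isCont T' t" for t
    using T(2) DERIV_isCont T(3) by (auto simp: continuous_on_eq_continuous_at)
  have Tm: "T \<in> borel_measurable borel" "T' \<in> borel_measurable borel"
    using T(3) smooth_on_continuous[OF T(1)] by (auto intro: borel_measurable_continuous_onI)
  note [measurable] = Tm L1locD(1)[OF f(1)] L1locD(1)[OF f(2)]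
  show ?thesis
  proof (rule wd_limit[OF Xv])
    show "wd X (\<lambda>x. T (conv (\<rho> n) f x)) (\<lambda>x. T' (conv (\<rho> n) f x) * conv (\<rho> n) h x)" for n
    proof -
      have s: "conv (\<rho> n) f \<in> smooth_funs A" by (rule conv_smooth[OF f(1) \<rho>t])
      have "X (\<lambda>x. T (conv (\<rho> n) f x)) = (\<lambda>x. T' (conv (\<rho> n) f x) * conv (\<rho> n) h x)"
        using vf_chain[OF Xv s T(1,2)] wd_conv[OF X w \<rho>t] by auto
      then show ?thesis using wd_smooth[OF X smooth_funs_compose[OF s open_UNIV T(1)]] by simp
    qed
    show "(\<lambda>x. T (f x)) \<in> borel_measurable \<mu>" "(\<lambda>x. T' (f x) * h x) \<in> borel_measurable \<mu>" by measurable
    show "AE x in \<mu>. (\<lambda>n. T (conv (\<rho> n) f x)) \<longlonglongrightarrow> T (f x)"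
      using \<rho>(2)[of f] by (auto elim!: eventually_mono intro: isCont_tendsto_compose[OF Tc(1)])
    show "(\<lambda>x. \<bar>T 0\<bar> + C * M x) \<in> L1loc"
      by (intro L1loc_add L1loc_cmult M smooth_L1loc smooth_funs_const)
    show "AE x in \<mu>. \<forall>n. \<bar>T (conv (\<rho> n) f x)\<bar> \<le> \<bar>T 0\<bar> + C * M x"
      using M(2)
    proof eventually_elim
      case (elim x)
      show ?case
      proof
        fix n
        have "C * \<bar>conv (\<rho> n) f x\<bar> \<le> C * M x" using elim C by (intro mult_left_mono) auto
        then show "\<bar>T (conv (\<rho> n) f x)\<bar> \<le> \<bar>T 0\<bar> + C * M x" using Tb[of "conv (\<rho> n) f x"] by linarith
      qed
    qed
    show "AE x in \<mu>. (\<lambda>n. T' (conv (\<rho> n) f x) * conv (\<rho> n) h x) \<longlonglongrightarrow> T' (f x) * h x"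
      using \<rho>(2)[of f, simplified] \<rho>(2)[of h, simplified]
      by eventually_elim (intro tendsto_mult isCont_tendsto_compose[OF Tc(2)])
    show "(\<lambda>x. C * M' x) \<in> L1loc" by (intro L1loc_cmult M)
    show "AE x in \<mu>. \<forall>n. \<bar>T' (conv (\<rho> n) f x) * conv (\<rho> n) h x\<bar> \<le> C * M' x"
      using M(4) by eventually_elim (auto simp: abs_mult intro!: mult_mono T(4) C)
  qed
qed

text \<open>Mollifying \<open>f\<close> alone suffices to reach the smooth product rule. The bound
  of \<open>f\<close> survives the mollification, so the bounds on both functions dominate the two
  product terms.\<close>

lemma wd_prod:
  assumes X: "X \<in> lie_algebra G A" and w: "wd X f h" "wd X g k"
    and b: "\<And>x. \<bar>f x\<bar> \<le> C" "\<And>x. \<bar>g x\<bar> \<le> D"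
  shows "wd X (\<lambda>x. f x * g x) (\<lambda>x. f x * k x + h x * g x)"
proof -
  have f: "f \<in> L1loc" "h \<in> L1loc" "g \<in> L1loc" "k \<in> L1loc" using w by (auto simp: wd_iff)
  note Xv = lie_algebraD(1)[OF X]
  obtain \<rho> where \<rho>: "\<And>n. mollifier (\<rho> n)"
    "\<And>u. u \<in> {f, h} \<Longrightarrow> AE x in \<mu>. (\<lambda>n. conv (\<rho> n) u x) \<longlonglongrightarrow> u x"
    "\<And>u. u \<in> {f, h} \<Longrightarrow> \<exists>M\<in>L1loc. AE x in \<mu>. \<forall>n. \<bar>conv (\<rho> n) u x\<bar> \<le> M x"
    using mollifier_sequence[of "{f, h}"] f by blast
  note \<rho>t = mollifier_test[OF \<rho>(1)]
  obtain M' where M: "M' \<in> L1loc" "AE x in \<mu>. \<forall>n. \<bar>conv (\<rho> n) h x\<bar> \<le> M' x" using \<rho>(3) by blast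
  have CD: "C \<ge> 0" "D \<ge> 0" using b[of \<one>] by auto
  have cb: "\<bar>conv (\<rho> n) f x\<bar> \<le> C" for n x by (rule conv_bound[OF f(1) b(1) \<rho>(1)])
  note [measurable] = L1locD(1)[OF f(1)] L1locD(1)[OF f(2)] L1locD(1)[OF f(3)] L1locD(1)[OF f(4)]
  show ?thesis
  proof (rule wd_limit[OF Xv])
    show "wd X (\<lambda>x. conv (\<rho> n) f x * g x) (\<lambda>x. conv (\<rho> n) f x * k x + conv (\<rho> n) h x * g x)" for n
      using wd_mult_smooth[OF Xv conv_smooth[OF f(1) \<rho>t] w(2)] wd_conv[OF X w(1) \<rho>t] by simp
    show "(\<lambda>x. f x * g x) \<in> borel_measurable \<mu>" "(\<lambda>x. f x * k x + h x * g x) \<in> borel_measurable \<mu>" by measurable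
    show "AE x in \<mu>. (\<lambda>n. conv (\<rho> n) f x * g x) \<longlonglongrightarrow> f x * g x"
      using \<rho>(2)[of f, simplified] by eventually_elim (intro tendsto_intros)
    show "(\<lambda>x. C * D) \<in> L1loc" by (intro smooth_L1loc smooth_funs_const)
    show "AE x in \<mu>. \<forall>n. \<bar>conv (\<rho> n) f x * g x\<bar> \<le> C * D"
      using cb b CD by (auto simp: abs_mult intro!: mult_mono)
    show "AE x in \<mu>. (\<lambda>n. conv (\<rho> n) f x * k x + conv (\<rho> n) h x * g x) \<longlonglongrightarrow> f x * k x + h x * g x"
      using \<rho>(2)[of f, simplified] \<rho>(2)[of h, simplified] by eventually_elim (intro tendsto_intros)
    show "(\<lambda>x. C * \<bar>k x\<bar> + D * M' x) \<in> L1loc"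
      by (intro L1loc_add L1loc_cmult L1loc_abs M f)
    show "AE x in \<mu>. \<forall>n. \<bar>conv (\<rho> n) f x * k x + conv (\<rho> n) h x * g x\<bar> \<le> C * \<bar>k x\<bar> + D * M' x"
      using M(2)
    proof eventually_elim
      case (elim x)
      show ?case
      proof
        fix n
        have "\<bar>conv (\<rho> n) f x * k x\<bar> \<le> C * \<bar>k x\<bar>" using cb[of n x] by (simp add: abs_mult mult_right_mono)
        moreover have "\<bar>conv (\<rho> n) h x * g x\<bar> \<le> M' x * D"
          using elim[rule_format, of n] b(2)[of x] by (simp add: abs_mult mult_mono')
        ultimately show "\<bar>conv (\<rho> n) f x * k x + conv (\<rho> n) h x * g x\<bar> \<le> C * \<bar>k x\<bar> + D * M' x"
          by (simp add: mult.commute)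
      qed
    qed
  qed
qed

end

subsection \<open>The logarithm of the weight\<close>

text \<open>The mollified weight is only known to be nonnegative, so the logarithm is replaced by
  half of \<open>ln (t\<^sup>2 + e\<^sup>2)\<close>, which is smooth on the whole line with bounded
  derivative. The denominator in the last bound is what later compensates the quadratic gradient
  term.\<close>

lemma log_reg_derivs:
  fixes e t :: real
  assumes e: "e > 0"
  shows "((\<lambda>t. ln (t\<^sup>2 + e\<^sup>2) / 2) has_real_derivative t / (t\<^sup>2 + e\<^sup>2)) (at t)"
    "((\<lambda>t. t / (t\<^sup>2 + e\<^sup>2)) has_real_derivative (e\<^sup>2 - t\<^sup>2) / (t\<^sup>2 + e\<^sup>2)\<^sup>2) (at t)"
    "\<bar>t\<bar> / (t\<^sup>2 + e\<^sup>2) \<le> 1 / e"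
    "\<bar>(e\<^sup>2 - t\<^sup>2) / (t\<^sup>2 + e\<^sup>2)\<^sup>2\<bar> \<le> 1 / (t\<^sup>2 + e\<^sup>2)"
proof -
  have p: "t\<^sup>2 + e\<^sup>2 > 0" using e by (simp add: add_nonneg_pos)
  then have ne: "t\<^sup>2 + e\<^sup>2 \<noteq> 0" by linarith
  show "((\<lambda>t. ln (t\<^sup>2 + e\<^sup>2) / 2) has_real_derivative t / (t\<^sup>2 + e\<^sup>2)) (at t)"
  proof -
    have "((\<lambda>t. ln (t\<^sup>2 + e\<^sup>2)) has_real_derivative 1 / (t\<^sup>2 + e\<^sup>2) * (2 * t)) (at t)"
      by (rule DERIV_chain2[where f=ln and g="\<lambda>t. t\<^sup>2 + e\<^sup>2", OF DERIV_ln_divide[OF p]])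
        (auto intro!: derivative_eq_intros)
    from DERIV_cdivide[OF this, of 2] show ?thesis
    proof (rule DERIV_cong)
      have "1 / s * (2 * t) / 2 = t / s" for s :: real by simp
      then show "1 / (t\<^sup>2 + e\<^sup>2) * (2 * t) / 2 = t / (t\<^sup>2 + e\<^sup>2)" .
    qed
  qed
  show "((\<lambda>t. t / (t\<^sup>2 + e\<^sup>2)) has_real_derivative (e\<^sup>2 - t\<^sup>2) / (t\<^sup>2 + e\<^sup>2)\<^sup>2) (at t)"
    using ne by (auto intro!: derivative_eq_intros simp: power2_eq_square)
  have "0 \<le> (\<bar>t\<bar> - e)\<^sup>2" by simp
  then have "2 * (\<bar>t\<bar> * e) \<le> t\<^sup>2 + e\<^sup>2" by (simp add: power2_diff)
  moreover have "\<bar>t\<bar> * e \<ge> 0" using e by simp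
  ultimately have "\<bar>t\<bar> * e \<le> t\<^sup>2 + e\<^sup>2" by linarith
  then show "\<bar>t\<bar> / (t\<^sup>2 + e\<^sup>2) \<le> 1 / e" using p e by (simp add: field_simps)
  have "\<bar>e\<^sup>2 - t\<^sup>2\<bar> \<le> t\<^sup>2 + e\<^sup>2" by (simp add: abs_le_iff)
  then have "\<bar>e\<^sup>2 - t\<^sup>2\<bar> / (t\<^sup>2 + e\<^sup>2)\<^sup>2 \<le> (t\<^sup>2 + e\<^sup>2) / (t\<^sup>2 + e\<^sup>2)\<^sup>2" by (intro divide_right_mono) auto
  also have "\<dots> = 1 / (t\<^sup>2 + e\<^sup>2)" using ne by (simp add: power2_eq_square)
  finally show "\<bar>(e\<^sup>2 - t\<^sup>2) / (t\<^sup>2 + e\<^sup>2)\<^sup>2\<bar> \<le> 1 / (t\<^sup>2 + e\<^sup>2)" by (simp add: abs_divide)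
qed

lemma log_reg_smooth:
  fixes e :: real
  assumes e: "e > 0"
  shows "smooth_on UNIV (\<lambda>t. t / (t\<^sup>2 + e\<^sup>2))" "smooth_on UNIV (\<lambda>t. ln (t\<^sup>2 + e\<^sup>2) / 2)"
    "continuous_on UNIV (\<lambda>t. (e\<^sup>2 - t\<^sup>2) / (t\<^sup>2 + e\<^sup>2)\<^sup>2)"
proof -
  have ne: "t\<^sup>2 + e\<^sup>2 \<noteq> 0" for t :: real using e by (metis add_nonneg_pos less_irrefl zero_le_power2 zero_less_power)
  have "smooth_on UNIV (\<lambda>t. t * inverse (t * t + e\<^sup>2))"
    by (intro smooth_on_mult smooth_on_inverse_fun smooth_on_add smooth_on_id smooth_on_const open_UNIV)
      (use ne in \<open>simp add: power2_eq_square\<close>)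
  then show s: "smooth_on UNIV (\<lambda>t. t / (t\<^sup>2 + e\<^sup>2))" by (simp add: divide_inverse power2_eq_square)
  show "smooth_on UNIV (\<lambda>t. ln (t\<^sup>2 + e\<^sup>2) / 2)"
    by (rule smooth_on_real_deriv[OF open_UNIV log_reg_derivs(1)[OF e] s])
  show "continuous_on UNIV (\<lambda>t. (e\<^sup>2 - t\<^sup>2) / (t\<^sup>2 + e\<^sup>2)\<^sup>2)"
    by (intro continuous_intros) (use ne in auto)
qed

text \<open>Majorants independent of \<open>n\<close>, for the removal of the regularization. The
  bound \<open>t + inverse t\<close> combines ln(1 + t) <= t with -ln t <= 1/t; for
  \<open>t = w x\<close> it calls for local integrability of both \<open>w\<close> and
  \<open>1 / w\<close>.\<close>

lemma log_reg_limits: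
  fixes t :: real
  assumes t: "t > 0"
  defines "e \<equiv> \<lambda>n. 1 / real (Suc n)"
  shows "(\<lambda>n. ln (t\<^sup>2 + (e n)\<^sup>2) / 2) \<longlonglongrightarrow> ln t"
    "(\<lambda>n. t / (t\<^sup>2 + (e n)\<^sup>2)) \<longlonglongrightarrow> 1 / t"
    "(\<lambda>n. ((e n)\<^sup>2 - t\<^sup>2) / (t\<^sup>2 + (e n)\<^sup>2)\<^sup>2) \<longlonglongrightarrow> - 1 / t\<^sup>2"
    "\<bar>ln (t\<^sup>2 + (e n)\<^sup>2) / 2\<bar> \<le> t + inverse t"
    "\<bar>t / (t\<^sup>2 + (e n)\<^sup>2)\<bar> \<le> 1 / t"
    "\<bar>((e n)\<^sup>2 - t\<^sup>2) / (t\<^sup>2 + (e n)\<^sup>2)\<^sup>2\<bar> \<le> 1 / t\<^sup>2"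
proof -
  have e: "e n > 0" "e n \<le> 1" for n by (auto simp: e_def)
  have e0: "e \<longlonglongrightarrow> 0" unfolding e_def using LIMSEQ_inverse_real_of_nat by (simp add: inverse_eq_divide)
  have "(\<lambda>n. ln (t\<^sup>2 + (e n)\<^sup>2) / 2) \<longlonglongrightarrow> ln (t\<^sup>2 + 0\<^sup>2) / 2"
    by (intro tendsto_intros e0) (use t in auto)
  then show "(\<lambda>n. ln (t\<^sup>2 + (e n)\<^sup>2) / 2) \<longlonglongrightarrow> ln t" using t by (simp add: ln_realpow)
  have "(\<lambda>n. t / (t\<^sup>2 + (e n)\<^sup>2)) \<longlonglongrightarrow> t / (t\<^sup>2 + 0\<^sup>2)"
    by (intro tendsto_intros e0) (use t in auto)
  then show "(\<lambda>n. t / (t\<^sup>2 + (e n)\<^sup>2)) \<longlonglongrightarrow> 1 / t" using t by (simp add: power2_eq_square)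
  have "(\<lambda>n. ((e n)\<^sup>2 - t\<^sup>2) / (t\<^sup>2 + (e n)\<^sup>2)\<^sup>2) \<longlonglongrightarrow> (0\<^sup>2 - t\<^sup>2) / (t\<^sup>2 + 0\<^sup>2)\<^sup>2"
    by (intro tendsto_intros e0) (use t in auto)
  then show "(\<lambda>n. ((e n)\<^sup>2 - t\<^sup>2) / (t\<^sup>2 + (e n)\<^sup>2)\<^sup>2) \<longlonglongrightarrow> - 1 / t\<^sup>2" using t by (simp add: power2_eq_square)
  have p: "t\<^sup>2 + (e n)\<^sup>2 \<ge> t\<^sup>2" "t\<^sup>2 > 0" using t by auto
  have "ln t = ln (t\<^sup>2) / 2" using t by (simp add: ln_realpow)
  also have "\<dots> \<le> ln (t\<^sup>2 + (e n)\<^sup>2) / 2" using p by (simp add: ln_mono)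
  finally have lower: "ln t \<le> ln (t\<^sup>2 + (e n)\<^sup>2) / 2" .
  have "(e n)\<^sup>2 \<le> 1" using e[of n] by (simp add: power_le_one)
  then have "t\<^sup>2 + (e n)\<^sup>2 \<le> (1 + t)\<^sup>2" using t by (simp add: power2_sum)
  then have "ln (t\<^sup>2 + (e n)\<^sup>2) \<le> ln ((1 + t)\<^sup>2)" using p by (intro ln_mono) linarith+
  then have "ln (t\<^sup>2 + (e n)\<^sup>2) / 2 \<le> ln ((1 + t)\<^sup>2) / 2" by simp
  also have "\<dots> = ln (1 + t)" using t by (simp add: ln_realpow)
  also have "\<dots> \<le> t" using t by (simp add: ln_add_one_self_le_self)
  finally have upper: "ln (t\<^sup>2 + (e n)\<^sup>2) / 2 \<le> t" .
  have "- ln t = ln (inverse t)" using t by (simp add: ln_inverse)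
  also have "\<dots> \<le> inverse t" using t by (meson ln_le_minus_one le_diff_eq order_trans positive_imp_inverse_positive add_increasing2 zero_le_one order_refl less_imp_le diff_le_eq)
  finally have "- inverse t \<le> ln t" by simp
  then show "\<bar>ln (t\<^sup>2 + (e n)\<^sup>2) / 2\<bar> \<le> t + inverse t"
    using lower upper t by (simp add: abs_le_iff) (smt (verit) positive_imp_inverse_positive)
  have "t / (t\<^sup>2 + (e n)\<^sup>2) \<le> t / t\<^sup>2" by (intro divide_left_mono mult_pos_pos) (use p t in linarith)+
  also have "\<dots> = 1 / t" using t by (simp add: power2_eq_square)
  finally show "\<bar>t / (t\<^sup>2 + (e n)\<^sup>2)\<bar> \<le> 1 / t" using t p by simp
  show "\<bar>((e n)\<^sup>2 - t\<^sup>2) / (t\<^sup>2 + (e n)\<^sup>2)\<^sup>2\<bar> \<le> 1 / t\<^sup>2"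
    using log_reg_derivs(4)[OF e(1), of n t] p by (meson divide_left_mono order_trans zero_le_one mult_pos_pos less_le_trans)
qed

text \<open>\<open>h\<close> and \<open>l\<close> are fixed representatives of the gradient and the
  Laplacian of \<open>w\<close>. Membership in the weighted local spaces is restated as local
  integrability of quotients: \<open>h_sqrt\<close>, \<open>h_quot\<close> and
  \<open>l_quot\<close>.\<close>

locale weighted_lie = lie_haar G A \<mu> \<delta>
  for G :: "('g::{t2_space, second_countable_topology}) monoid" (structure)
    and A :: "('g, 'e::euclidean_space) chart set"
    and \<mu> :: "'g measure" and \<delta> :: "'g \<Rightarrow> real" +
  fixes \<nu> :: nat and X :: "nat \<Rightarrow> 'g vfield" and w l :: "'g \<Rightarrow> real" and h :: "nat \<Rightarrow> 'g \<Rightarrow> real"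
  assumes X: "\<And>j. j < \<nu> \<Longrightarrow> X j \<in> lie_algebra G A"
    and w_pos: "\<And>x. w x > 0"
    and w_inv: "(\<lambda>x. inverse (w x)) \<in> L1loc"
    and wd_w: "\<And>j. j < \<nu> \<Longrightarrow> wd (X j) w (h j)"
    and h_sqrt: "\<And>j. j < \<nu> \<Longrightarrow> (\<lambda>x. (h j x)\<^sup>2 / w x) \<in> L1loc"
    and h_quot: "\<And>j. j < \<nu> \<Longrightarrow> (\<lambda>x. (h j x / w x)\<^sup>2) \<in> L1loc"
    and lap_w: "has_weak_laplacian G A \<mu> \<delta> \<nu> X w l"
    and l_quot: "(\<lambda>x. l x / w x) \<in> L1loc"
begin

lemma Xv: "j < \<nu> \<Longrightarrow> X j \<in> vector_fields A"
  using lie_algebraD(1)[OF X] .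

lemma w_loc: "w \<in> L1loc" and l_loc: "l \<in> L1loc"
  using lap_w by (auto simp: weak_laplacian_iff)

lemma h_loc: "j < \<nu> \<Longrightarrow> h j \<in> L1loc"
  using wd_w by (simp add: wd_iff)

lemma w_meas [measurable]: "w \<in> borel_measurable \<mu>"
  and l_meas [measurable]: "l \<in> borel_measurable \<mu>"
  using L1locD(1) w_loc l_loc by auto

lemma h_meas: "j < \<nu> \<Longrightarrow> h j \<in> borel_measurable \<mu>"
  using L1locD(1) h_loc by auto

definition q :: "nat \<Rightarrow> 'g \<Rightarrow> real" where "q j x = h j x / w x"
definition v :: "'g \<Rightarrow> real" where "v x = ln (w x)"
definition qq :: "'g \<Rightarrow> real" where "qq x = (\<Sum>j<\<nu>. (q j x)\<^sup>2)"
definition lv :: "'g \<Rightarrow> real" where "lv x = l x / w x + qq x" \<comment> \<open>represents \<open>\<L>(ln w)\<close>\<close>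

lemma q_meas: "j < \<nu> \<Longrightarrow> q j \<in> borel_measurable \<mu>"
  using h_meas unfolding q_def[abs_def] by auto

lemma q_sq: "j < \<nu> \<Longrightarrow> (\<lambda>x. (q j x)\<^sup>2) \<in> L1loc"
  using h_quot by (simp add: q_def)

lemma qq_loc: "qq \<in> L1loc"
  unfolding qq_def[abs_def] by (rule L1loc_sum) (auto intro: q_sq)

lemma lv_loc: "lv \<in> L1loc"
  unfolding lv_def[abs_def] by (intro L1loc_add l_quot qq_loc)

lemma L1loc_of_sq:
  assumes "f \<in> borel_measurable \<mu>" "(\<lambda>x. (f x)\<^sup>2) \<in> L1loc"
  shows "f \<in> L1loc"
proof (rule L1loc_bound[OF L1loc_add[OF assms(2) smooth_L1loc[OF smooth_funs_const[of 1]]] assms(1)])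
  have "\<bar>f x\<bar> \<le> \<bar>(f x)\<^sup>2 + 1\<bar>" for x
  proof -
    have "0 \<le> (\<bar>f x\<bar> - 1)\<^sup>2" by simp
    then show ?thesis by (simp add: power2_diff)
  qed
  then show "AE x in \<mu>. \<bar>f x\<bar> \<le> \<bar>(f x)\<^sup>2 + 1\<bar>" by simp
qed

lemma L1loc_mult_sq:
  assumes "f \<in> borel_measurable \<mu>" "(\<lambda>x. (f x)\<^sup>2) \<in> L1loc" "g \<in> borel_measurable \<mu>" "(\<lambda>x. (g x)\<^sup>2) \<in> L1loc"
  shows "(\<lambda>x. f x * g x) \<in> L1loc"
proof (rule L1loc_bound[OF L1loc_add[OF assms(2,4)]])
  show "(\<lambda>x. f x * g x) \<in> borel_measurable \<mu>" using assms by auto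
  have "\<bar>f x * g x\<bar> \<le> \<bar>(f x)\<^sup>2 + (g x)\<^sup>2\<bar>" for x
  proof -
    have "0 \<le> (\<bar>f x\<bar> - \<bar>g x\<bar>)\<^sup>2" by simp
    then have "2 * \<bar>f x * g x\<bar> \<le> (f x)\<^sup>2 + (g x)\<^sup>2" by (simp add: power2_diff abs_mult)
    then show ?thesis by linarith
  qed
  then show "AE x in \<mu>. \<bar>f x * g x\<bar> \<le> \<bar>(f x)\<^sup>2 + (g x)\<^sup>2\<bar>" by simp
qed

lemma q_loc: "j < \<nu> \<Longrightarrow> q j \<in> L1loc"
  by (rule L1loc_of_sq[OF q_meas q_sq])

text \<open>The regularized logarithm has bounded derivative, so \<open>wd_chain\<close> applies;
  the limit is dominated by \<open>w + 1 / w\<close> for the functions and by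
  \<open>\<bar>q j x\<bar>\<close> for the derivatives.\<close>

lemma wd_v:
  assumes j: "j < \<nu>"
  shows "wd (X j) v (q j)"
proof -
  define e where "e n = 1 / real (Suc n)" for n
  have e: "e n > 0" for n by (simp add: e_def)
  note lim = log_reg_limits[OF w_pos, folded e_def]
  note [measurable] = h_meas[OF j]
  show ?thesis
  proof (rule wd_limit[OF Xv[OF j]])
    show "wd (X j) (\<lambda>x. ln ((w x)\<^sup>2 + (e n)\<^sup>2) / 2) (\<lambda>x. w x / ((w x)\<^sup>2 + (e n)\<^sup>2) * h j x)" for n
    proof (rule wd_chain[OF X[OF j] wd_w[OF j] log_reg_smooth(2)[OF e] log_reg_derivs(1)[OF e]])
      show "continuous_on UNIV (\<lambda>t. t / (t\<^sup>2 + (e n)\<^sup>2))" by (rule smooth_on_continuous[OF log_reg_smooth(1)[OF e]])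
      show "\<bar>t / (t\<^sup>2 + (e n)\<^sup>2)\<bar> \<le> 1 / e n" for t
        using log_reg_derivs(3)[OF e, of t n] by (simp add: abs_divide)
    qed
    show "v \<in> borel_measurable \<mu>" "q j \<in> borel_measurable \<mu>" using q_meas[OF j] unfolding v_def[abs_def] by auto
    show "AE x in \<mu>. (\<lambda>n. ln ((w x)\<^sup>2 + (e n)\<^sup>2) / 2) \<longlonglongrightarrow> v x" using lim(1) by (simp add: v_def)
    show "(\<lambda>x. w x + inverse (w x)) \<in> L1loc" by (intro L1loc_add w_loc w_inv)
    show "AE x in \<mu>. \<forall>n. \<bar>ln ((w x)\<^sup>2 + (e n)\<^sup>2) / 2\<bar> \<le> w x + inverse (w x)" using lim(4) by blast
    have "(\<lambda>n. w x / ((w x)\<^sup>2 + (e n)\<^sup>2) * h j x) \<longlonglongrightarrow> 1 / w x * h j x" for x by (intro tendsto_intros lim(2))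
    then show "AE x in \<mu>. (\<lambda>n. w x / ((w x)\<^sup>2 + (e n)\<^sup>2) * h j x) \<longlonglongrightarrow> q j x" by (simp add: q_def)
    show "(\<lambda>x. \<bar>q j x\<bar>) \<in> L1loc" by (intro L1loc_abs q_loc j)
    have "\<bar>w x / ((w x)\<^sup>2 + (e n)\<^sup>2) * h j x\<bar> \<le> \<bar>q j x\<bar>" for n x
    proof -
      have "\<bar>w x / ((w x)\<^sup>2 + (e n)\<^sup>2)\<bar> * \<bar>h j x\<bar> \<le> 1 / w x * \<bar>h j x\<bar>" by (intro mult_right_mono lim(5)) auto
      then show ?thesis using w_pos[of x] unfolding abs_mult by (simp add: q_def abs_divide)
    qed
    then show "AE x in \<mu>. \<forall>n. \<bar>w x / ((w x)\<^sup>2 + (e n)\<^sup>2) * h j x\<bar> \<le> \<bar>q j x\<bar>" by blast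
  qed
qed

text \<open>The Laplacian is taken with the sign that makes it nonnegative, so the second-order term
  of the chain rule enters with a minus.\<close>

lemma laplacian_compose:
  assumes u: "u \<in> smooth_funs A" and T: "smooth_on UNIV T" "\<And>t. (T has_real_derivative T' t) (at t)"
    "smooth_on UNIV T'" "\<And>t. (T' has_real_derivative T'' t) (at t)"
  shows "sub_laplacian G \<delta> \<nu> X (\<lambda>x. T (u x)) x = T' (u x) * sub_laplacian G \<delta> \<nu> X u x - T'' (u x) * (\<Sum>j<\<nu>. (X j u x)\<^sup>2)"
proof -
  have s: "X j (X j (\<lambda>x. T (u x))) x + X j \<delta> \<one> * X j (\<lambda>x. T (u x)) x =
     T' (u x) * (X j (X j u) x + X j \<delta> \<one> * X j u x) + T'' (u x) * (X j u x)\<^sup>2" if j: "j < \<nu>" for j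
  proof -
    have 1: "X j (\<lambda>x. T (u x)) = (\<lambda>x. T' (u x) * X j u x)"
      using vf_chain[OF Xv[OF j] u T(1,2)] by auto
    have 2: "X j (\<lambda>x. T' (u x) * X j u x) = (\<lambda>x. T' (u x) * X j (X j u) x + X j (\<lambda>x. T' (u x)) x * X j u x)"
      by (rule vector_fieldsD(4)[OF Xv[OF j] smooth_funs_compose[OF u open_UNIV T(3)] vector_fieldsD(1)[OF Xv[OF j] u u]]) simp
    have 3: "X j (\<lambda>x. T' (u x)) x = T'' (u x) * X j u x"
      by (rule vf_chain[OF Xv[OF j] u T(3,4)])
    show ?thesis unfolding 1 2 3 by (simp add: algebra_simps power2_eq_square)
  qed
  have "(\<Sum>j<\<nu>. X j (X j (\<lambda>x. T (u x))) x + X j \<delta> \<one> * X j (\<lambda>x. T (u x)) x)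
     = (\<Sum>j<\<nu>. T' (u x) * (X j (X j u) x + X j \<delta> \<one> * X j u x) + T'' (u x) * (X j u x)\<^sup>2)"
    by (rule sum.cong) (use s in auto)
  also have "\<dots> = T' (u x) * (\<Sum>j<\<nu>. X j (X j u) x + X j \<delta> \<one> * X j u x) + T'' (u x) * (\<Sum>j<\<nu>. (X j u x)\<^sup>2)"
    unfolding sum.distrib[of "\<lambda>j. T' (u x) * _ j"] sum_distrib_left ..
  finally show ?thesis unfolding sub_laplacian_def by simp
qed

text \<open>The equation for \<open>w\<close> cannot be tested with functions of \<open>w\<close>. Instead the whole equation is
  mollified and the classical chain rule applied to \<open>w\<^sub>n\<close>; the quadratic term is controlled by
  \<open>\<bar>\<nabla>w\<^sub>n\<bar>\<^sup>2 \<le> w\<^sub>n (\<bar>\<nabla>w\<bar>\<^sup>2/w)\<^sub>n\<close>.\<close>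

lemma renormalized_equation:
  fixes e :: real
  assumes e: "e > 0" and \<psi>: "\<psi> \<in> test_funs A"
  shows "(\<Sum>j<\<nu>. \<integral>x. X j \<psi> x * (w x / ((w x)\<^sup>2 + e\<^sup>2) * h j x) \<partial>\<mu>) =
    (\<integral>x. \<psi> x * (w x / ((w x)\<^sup>2 + e\<^sup>2) * l x - (e\<^sup>2 - (w x)\<^sup>2) / ((w x)\<^sup>2 + e\<^sup>2)\<^sup>2 * (\<Sum>j<\<nu>. (h j x)\<^sup>2)) \<partial>\<mu>)"
proof -
  define T where "T t = ln (t\<^sup>2 + e\<^sup>2) / 2" for t :: real
  define T1 where "T1 t = t / (t\<^sup>2 + e\<^sup>2)" for t :: real
  define T2 where "T2 t = (e\<^sup>2 - t\<^sup>2) / (t\<^sup>2 + e\<^sup>2)\<^sup>2" for t :: real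
  have dT: "(T has_real_derivative T1 t) (at t)" "(T1 has_real_derivative T2 t) (at t)" "\<bar>T1 t\<bar> \<le> 1 / e"
    "\<bar>T2 t\<bar> \<le> 1 / (t\<^sup>2 + e\<^sup>2)" for t
    using log_reg_derivs[OF e, of t] unfolding T_def[abs_def] T1_def[abs_def] T2_def[abs_def] by (simp_all add: abs_divide)
  have sT: "smooth_on UNIV T" "smooth_on UNIV T1" "continuous_on UNIV T2"
    using log_reg_smooth[OF e] unfolding T_def[abs_def] T1_def[abs_def] T2_def[abs_def] by simp_all
  have cT: "isCont T1 t" "isCont T2 t" for t
    using smooth_on_continuous[OF sT(2)] sT(3) by (auto simp: continuous_on_eq_continuous_at)
  \<comment> \<open>The functions \<open>k j\<close> are mollified together with the coefficients,
    because their convolutions, multiplied by that of \<open>w\<close>, bound the squared mollified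
    gradient.\<close>
  define k where "k j x = (h j x)\<^sup>2 / w x" for j x
  have kL: "k j \<in> L1loc" if "j < \<nu>" for j using h_sqrt[OF that] by (simp add: k_def[abs_def])
  have k0: "k j x \<ge> 0" for j x using w_pos[of x] by (simp add: k_def)
  define F where "F = insert w (insert l (h ` {..<\<nu>} \<union> k ` {..<\<nu>}))"
  have F: "finite F" "F \<subseteq> L1loc" using w_loc l_loc h_loc kL by (auto simp: F_def)
  obtain \<rho> where \<rho>: "\<And>n. mollifier (\<rho> n)"
    "\<And>u. u \<in> F \<Longrightarrow> AE x in \<mu>. (\<lambda>n. conv (\<rho> n) u x) \<longlonglongrightarrow> u x"
    "\<And>u. u \<in> F \<Longrightarrow> \<exists>M\<in>L1loc. AE x in \<mu>. \<forall>n. \<bar>conv (\<rho> n) u x\<bar> \<le> M x"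
    using mollifier_sequence[OF F] by blast
  have "\<exists>M. \<forall>u\<in>F. M u \<in> L1loc \<and> (AE x in \<mu>. \<forall>n. \<bar>conv (\<rho> n) u x\<bar> \<le> M u x)"
    by (rule bchoice) (use \<rho>(3) in blast)
  then obtain M where M: "\<And>u. u \<in> F \<Longrightarrow> M u \<in> L1loc" "\<And>u. u \<in> F \<Longrightarrow> AE x in \<mu>. \<forall>n. \<bar>conv (\<rho> n) u x\<bar> \<le> M u x"
    by blast
  note \<rho>t = mollifier_test[OF \<rho>(1)]
  let ?w = "\<lambda>n. conv (\<rho> n) w"
  have ws: "?w n \<in> smooth_funs A" for n by (rule conv_smooth[OF w_loc \<rho>t])
  have w0: "?w n x \<ge> 0" for n x by (rule conv_nonneg[OF less_imp_le[OF w_pos] \<rho>(1)])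
  have inF: "w \<in> F" "l \<in> F" "\<And>j. j < \<nu> \<Longrightarrow> h j \<in> F" "\<And>j. j < \<nu> \<Longrightarrow> k j \<in> F" by (auto simp: F_def)
  have cm: "conv (\<rho> n) u \<in> borel_measurable \<mu>" if "u \<in> F" for n u
    using smooth_measurable[OF conv_smooth[OF _ \<rho>t]] F(2) that by blast
  have Tm: "T1 \<in> borel_measurable borel" "T2 \<in> borel_measurable borel"
    using sT(3) smooth_on_continuous[OF sT(2)] by (auto intro: borel_measurable_continuous_onI)
  have T1w: "(\<lambda>x. T1 (u x)) \<in> borel_measurable \<mu>" "(\<lambda>x. T2 (u x)) \<in> borel_measurable \<mu>" if "u \<in> borel_measurable \<mu>" for u
    using measurable_compose[OF that Tm(1)] measurable_compose[OF that Tm(2)] by auto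
  have eqn: "(\<Sum>j<\<nu>. \<integral>x. X j \<psi> x * (T1 (?w n x) * conv (\<rho> n) (h j) x) \<partial>\<mu>) =
     (\<integral>x. \<psi> x * (T1 (?w n x) * conv (\<rho> n) l x - T2 (?w n x) * (\<Sum>j<\<nu>. (conv (\<rho> n) (h j) x)\<^sup>2)) \<partial>\<mu>)" for n
  proof -
    have Tw: "(\<lambda>x. T (?w n x)) \<in> smooth_funs A" by (rule smooth_funs_compose[OF ws open_UNIV sT(1)]) simp
    have XT: "X j (\<lambda>x. T (?w n x)) x = T1 (?w n x) * conv (\<rho> n) (h j) x" if j: "j < \<nu>" for j x
      using vf_chain[OF Xv[OF j] ws sT(1) dT(1)] wd_conv[OF X[OF j] wd_w[OF j] \<rho>t] by simp
    have i: "integrable \<mu> (\<lambda>x. X j \<psi> x * X j (\<lambda>x. T (?w n x)) x)" if j: "j < \<nu>" for j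
      by (rule test_integrable_mult[OF test_vf[OF Xv[OF j] \<psi>] smooth_L1loc[OF vector_fieldsD(1)[OF Xv[OF j] Tw Tw]]])
    have "(\<Sum>j<\<nu>. \<integral>x. X j \<psi> x * (T1 (?w n x) * conv (\<rho> n) (h j) x) \<partial>\<mu>) = (\<Sum>j<\<nu>. \<integral>x. X j \<psi> x * X j (\<lambda>x. T (?w n x)) x \<partial>\<mu>)"
      by (rule sum.cong) (auto simp: XT)
    also have "\<dots> = (\<integral>x. (\<Sum>j<\<nu>. X j \<psi> x * X j (\<lambda>x. T (?w n x)) x) \<partial>\<mu>)"
      by (rule Bochner_Integration.integral_sum[symmetric]) (use i in auto)
    also have "\<dots> = (\<integral>x. \<psi> x * sub_laplacian G \<delta> \<nu> X (\<lambda>x. T (?w n x)) x \<partial>\<mu>)"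
      by (rule gradient_laplacian_smooth(1)[OF X Tw \<psi>])
    also have "\<dots> = (\<integral>x. \<psi> x * (T1 (?w n x) * conv (\<rho> n) l x - T2 (?w n x) * (\<Sum>j<\<nu>. (conv (\<rho> n) (h j) x)\<^sup>2)) \<partial>\<mu>)"
    proof (rule Bochner_Integration.integral_cong[OF refl])
      fix x
      have "(\<Sum>j<\<nu>. (X j (?w n) x)\<^sup>2) = (\<Sum>j<\<nu>. (conv (\<rho> n) (h j) x)\<^sup>2)"
        by (rule sum.cong) (auto simp: wd_conv[OF X wd_w \<rho>t])
      moreover have "sub_laplacian G \<delta> \<nu> X (?w n) = conv (\<rho> n) l"
        by (rule laplacian_conv[OF X lap_w \<rho>t])
      ultimately show "\<psi> x * sub_laplacian G \<delta> \<nu> X (\<lambda>x. T (?w n x)) x = \<psi> x * (T1 (?w n x) * conv (\<rho> n) l x - T2 (?w n x) * (\<Sum>j<\<nu>. (conv (\<rho> n) (h j) x)\<^sup>2))"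
        unfolding laplacian_compose[OF ws sT(1) dT(1) sT(2) dT(2)] by simp
    qed
    finally show ?thesis .
  qed
  have lim1: "(\<lambda>n. \<Sum>j<\<nu>. \<integral>x. X j \<psi> x * (T1 (?w n x) * conv (\<rho> n) (h j) x) \<partial>\<mu>) \<longlonglongrightarrow> (\<Sum>j<\<nu>. \<integral>x. X j \<psi> x * (T1 (w x) * h j x) \<partial>\<mu>)"
  proof (rule tendsto_sum)
    fix j assume "j \<in> {..<\<nu>}"
    then have j: "j < \<nu>" by simp
    show "(\<lambda>n. \<integral>x. X j \<psi> x * (T1 (?w n x) * conv (\<rho> n) (h j) x) \<partial>\<mu>) \<longlonglongrightarrow> (\<integral>x. X j \<psi> x * (T1 (w x) * h j x) \<partial>\<mu>)"
    proof (rule test_limit[OF test_vf[OF Xv[OF j] \<psi>]])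
      show "(\<lambda>x. T1 (w x) * h j x) \<in> borel_measurable \<mu>" "(\<lambda>x. T1 (?w n x) * conv (\<rho> n) (h j) x) \<in> borel_measurable \<mu>" for n
        by (intro borel_measurable_times T1w w_meas h_meas j cm inF)+
      show "AE x in \<mu>. (\<lambda>n. T1 (?w n x) * conv (\<rho> n) (h j) x) \<longlonglongrightarrow> T1 (w x) * h j x"
        using \<rho>(2)[OF inF(1)] \<rho>(2)[OF inF(3)[OF j]]
        by eventually_elim (intro tendsto_mult isCont_tendsto_compose[OF cT(1)])
      show "(\<lambda>x. (1/e) * M (h j) x) \<in> L1loc" by (intro L1loc_cmult M inF j)
      show "AE x in \<mu>. \<forall>n. \<bar>T1 (?w n x) * conv (\<rho> n) (h j) x\<bar> \<le> (1/e) * M (h j) x"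
        using M(2)[OF inF(3)[OF j]]
      proof eventually_elim
        case (elim x)
        show ?case unfolding abs_mult using elim dT(3) e by (intro allI mult_mono) auto
      qed
    qed
  qed
  have lim2: "(\<lambda>n. \<integral>x. \<psi> x * (T1 (?w n x) * conv (\<rho> n) l x - T2 (?w n x) * (\<Sum>j<\<nu>. (conv (\<rho> n) (h j) x)\<^sup>2)) \<partial>\<mu>)
     \<longlonglongrightarrow> (\<integral>x. \<psi> x * (T1 (w x) * l x - T2 (w x) * (\<Sum>j<\<nu>. (h j x)\<^sup>2)) \<partial>\<mu>)"
  proof (rule test_limit[OF \<psi>])
    show "(\<lambda>x. T1 (w x) * l x - T2 (w x) * (\<Sum>j<\<nu>. (h j x)\<^sup>2)) \<in> borel_measurable \<mu>"
      "(\<lambda>x. T1 (?w n x) * conv (\<rho> n) l x - T2 (?w n x) * (\<Sum>j<\<nu>. (conv (\<rho> n) (h j) x)\<^sup>2)) \<in> borel_measurable \<mu>" for n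
      by (intro borel_measurable_diff borel_measurable_times T1w w_meas l_meas cm inF borel_measurable_sum borel_measurable_power; use h_meas cm inF in force)+
    have AEh: "AE x in \<mu>. \<forall>j\<in>{..<\<nu>}. (\<lambda>n. conv (\<rho> n) (h j) x) \<longlonglongrightarrow> h j x"
      by (rule AE_finite_allI) (use \<rho>(2) inF in auto)
    show "AE x in \<mu>. (\<lambda>n. T1 (?w n x) * conv (\<rho> n) l x - T2 (?w n x) * (\<Sum>j<\<nu>. (conv (\<rho> n) (h j) x)\<^sup>2))
       \<longlonglongrightarrow> T1 (w x) * l x - T2 (w x) * (\<Sum>j<\<nu>. (h j x)\<^sup>2)"
      using \<rho>(2)[OF inF(1)] \<rho>(2)[OF inF(2)] AEh
    proof eventually_elim
      case (elim x)
      show ?case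
        by (intro tendsto_diff tendsto_mult tendsto_sum tendsto_power isCont_tendsto_compose[OF cT(1)]
            isCont_tendsto_compose[OF cT(2)] elim(1,2)) (use elim(3) in auto)
    qed
    show "(\<lambda>x. (1/e) * M l x + (\<Sum>j<\<nu>. (1/e) * M (k j) x)) \<in> L1loc"
      by (intro L1loc_add L1loc_sum L1loc_cmult M inF) auto
    have AEk: "AE x in \<mu>. \<forall>j\<in>{..<\<nu>}. \<forall>n. \<bar>conv (\<rho> n) (k j) x\<bar> \<le> M (k j) x"
      by (rule AE_finite_allI) (use M(2) inF in auto)
    show "AE x in \<mu>. \<forall>n. \<bar>T1 (?w n x) * conv (\<rho> n) l x - T2 (?w n x) * (\<Sum>j<\<nu>. (conv (\<rho> n) (h j) x)\<^sup>2)\<bar>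
       \<le> (1/e) * M l x + (\<Sum>j<\<nu>. (1/e) * M (k j) x)"
      using M(2)[OF inF(2)] AEk
    proof eventually_elim
      case (elim x)
      show ?case
      proof
        fix n
        have 1: "\<bar>T1 (?w n x) * conv (\<rho> n) l x\<bar> \<le> (1/e) * M l x"
          unfolding abs_mult using elim(1) dT(3) e by (intro mult_mono) auto
        \<comment> \<open>The bound for \<open>T2\<close> has the denominator w_n^2 + e^2, and
          Cauchy-Schwarz leaves one factor w_n; their quotient is at most 1/e, so only a multiple of
          the majorant of \<open>k j\<close> remains.\<close>
        have 2: "\<bar>T2 (?w n x)\<bar> * (conv (\<rho> n) (h j) x)\<^sup>2 \<le> (1/e) * M (k j) x" if j: "j < \<nu>" for j
        proof -
          have pp: "(?w n x)\<^sup>2 + e\<^sup>2 > 0" using e by (simp add: add_nonneg_pos)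
          have "(conv (\<rho> n) (h j) x)\<^sup>2 \<le> ?w n x * conv (\<rho> n) (k j) x"
          proof (rule conv_Cauchy_Schwarz[OF h_loc[OF j] w_loc kL[OF j] \<rho>(1)])
            show "(h j x)\<^sup>2 \<le> w x * k j x" for x using w_pos[of x] by (simp add: k_def)
          qed (use k0 w_pos in \<open>auto simp: less_imp_le\<close>)
          then have "\<bar>T2 (?w n x)\<bar> * (conv (\<rho> n) (h j) x)\<^sup>2 \<le> 1 / ((?w n x)\<^sup>2 + e\<^sup>2) * (?w n x * conv (\<rho> n) (k j) x)"
            using dT(4) pp by (intro mult_mono) auto
          also have "\<dots> = (\<bar>?w n x\<bar> / ((?w n x)\<^sup>2 + e\<^sup>2)) * conv (\<rho> n) (k j) x" using w0[of n x] by simp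
          also have "\<dots> \<le> (1/e) * M (k j) x"
            using elim(2) j log_reg_derivs(3)[OF e, of "?w n x"] e conv_nonneg[OF k0 \<rho>(1)] by (intro mult_mono) auto
          finally show ?thesis .
        qed
        have "\<bar>T2 (?w n x) * (\<Sum>j<\<nu>. (conv (\<rho> n) (h j) x)\<^sup>2)\<bar> = (\<Sum>j<\<nu>. \<bar>T2 (?w n x)\<bar> * (conv (\<rho> n) (h j) x)\<^sup>2)"
          unfolding sum_distrib_left[symmetric] abs_mult by (simp add: sum_nonneg)
        also have "\<dots> \<le> (\<Sum>j<\<nu>. (1/e) * M (k j) x)" by (rule sum_mono) (use 2 in auto)
        finally show "\<bar>T1 (?w n x) * conv (\<rho> n) l x - T2 (?w n x) * (\<Sum>j<\<nu>. (conv (\<rho> n) (h j) x)\<^sup>2)\<bar>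
          \<le> (1/e) * M l x + (\<Sum>j<\<nu>. (1/e) * M (k j) x)" using 1 by linarith
      qed
    qed
  qed
  from LIMSEQ_unique[OF lim1 lim2[folded eqn]]
  show ?thesis by (simp add: T1_def T2_def)
qed

text \<open>As \<open>e\<close> tends to 0 the first-order coefficient becomes \<open>1 / w\<close>
  and the second-order one \<open>- 1 / w\<^sup>2\<close>, which adds \<open>qq\<close> to
  \<open>l / w\<close>. The majorants are built from \<open>q j\<close>, \<open>l / w\<close> and
  \<open>qq\<close> alone, hence do not depend on \<open>e\<close>.\<close>

lemma log_equation:
  assumes \<psi>: "\<psi> \<in> test_funs A"
  shows "(\<Sum>j<\<nu>. \<integral>x. X j \<psi> x * q j x \<partial>\<mu>) = (\<integral>x. \<psi> x * lv x \<partial>\<mu>)"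
proof -
  define e where "e n = 1 / real (Suc n)" for n
  have e: "e n > 0" for n by (simp add: e_def)
  note lim = log_reg_limits[OF w_pos, folded e_def]
  let ?a = "\<lambda>n x. w x / ((w x)\<^sup>2 + (e n)\<^sup>2)"
  let ?b = "\<lambda>n x. ((e n)\<^sup>2 - (w x)\<^sup>2) / ((w x)\<^sup>2 + (e n)\<^sup>2)\<^sup>2"
  have lim1: "(\<lambda>n. \<Sum>j<\<nu>. \<integral>x. X j \<psi> x * (?a n x * h j x) \<partial>\<mu>) \<longlonglongrightarrow> (\<Sum>j<\<nu>. \<integral>x. X j \<psi> x * q j x \<partial>\<mu>)"
  proof (rule tendsto_sum)
    fix j assume "j \<in> {..<\<nu>}"
    then have j: "j < \<nu>" by simp
    note [measurable] = h_meas[OF j]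
    show "(\<lambda>n. \<integral>x. X j \<psi> x * (?a n x * h j x) \<partial>\<mu>) \<longlonglongrightarrow> (\<integral>x. X j \<psi> x * q j x \<partial>\<mu>)"
    proof (rule test_limit[OF test_vf[OF Xv[OF j] \<psi>] q_meas[OF j]])
      show "(\<lambda>x. ?a n x * h j x) \<in> borel_measurable \<mu>" for n by measurable
      have "(\<lambda>n. ?a n x * h j x) \<longlonglongrightarrow> 1 / w x * h j x" for x by (intro tendsto_intros lim(2))
      then show "AE x in \<mu>. (\<lambda>n. ?a n x * h j x) \<longlonglongrightarrow> q j x" by (simp add: q_def)
      show "(\<lambda>x. \<bar>q j x\<bar>) \<in> L1loc" by (intro L1loc_abs q_loc j)
      have "\<bar>?a n x * h j x\<bar> \<le> \<bar>q j x\<bar>" for n x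
      proof -
        have "\<bar>?a n x\<bar> * \<bar>h j x\<bar> \<le> 1 / w x * \<bar>h j x\<bar>" by (intro mult_right_mono lim(5)) auto
        then show ?thesis using w_pos[of x] unfolding abs_mult by (simp add: q_def abs_divide)
      qed
      then show "AE x in \<mu>. \<forall>n. \<bar>?a n x * h j x\<bar> \<le> \<bar>q j x\<bar>" by blast
    qed
  qed
  have qqw: "(\<Sum>j<\<nu>. (h j x)\<^sup>2) = (w x)\<^sup>2 * qq x" for x
    using w_pos[of x] by (simp add: qq_def q_def sum_distrib_left power_divide)
  have lim2: "(\<lambda>n. \<integral>x. \<psi> x * (?a n x * l x - ?b n x * (\<Sum>j<\<nu>. (h j x)\<^sup>2)) \<partial>\<mu>) \<longlonglongrightarrow> (\<integral>x. \<psi> x * lv x \<partial>\<mu>)"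
  proof (rule test_limit[OF \<psi> L1locD(1)[OF lv_loc]])
    have [measurable]: "(\<lambda>x. \<Sum>j<\<nu>. (h j x)\<^sup>2) \<in> borel_measurable \<mu>"
      by (intro borel_measurable_sum borel_measurable_power) (use h_meas in auto)
    show "(\<lambda>x. ?a n x * l x - ?b n x * (\<Sum>j<\<nu>. (h j x)\<^sup>2)) \<in> borel_measurable \<mu>" for n by measurable
    have "(\<lambda>n. ?a n x * l x - ?b n x * (\<Sum>j<\<nu>. (h j x)\<^sup>2)) \<longlonglongrightarrow> 1 / w x * l x - (- 1 / (w x)\<^sup>2) * (\<Sum>j<\<nu>. (h j x)\<^sup>2)" for x
      by (intro tendsto_diff tendsto_mult tendsto_const lim(2,3))
    moreover have "1 / w x * l x - (- 1 / (w x)\<^sup>2) * (\<Sum>j<\<nu>. (h j x)\<^sup>2) = lv x" for x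
      using w_pos[of x] unfolding qqw lv_def by simp
    ultimately show "AE x in \<mu>. (\<lambda>n. ?a n x * l x - ?b n x * (\<Sum>j<\<nu>. (h j x)\<^sup>2)) \<longlonglongrightarrow> lv x" by simp
    show "(\<lambda>x. \<bar>l x / w x\<bar> + qq x) \<in> L1loc" by (intro L1loc_add L1loc_abs l_quot qq_loc)
    have "\<bar>?a n x * l x - ?b n x * (\<Sum>j<\<nu>. (h j x)\<^sup>2)\<bar> \<le> \<bar>l x / w x\<bar> + qq x" for n x
    proof -
      have "\<bar>?a n x\<bar> * \<bar>l x\<bar> \<le> 1 / w x * \<bar>l x\<bar>" by (intro mult_right_mono lim(5)) auto
      then have 1: "\<bar>?a n x * l x\<bar> \<le> \<bar>l x / w x\<bar>" using w_pos[of x] unfolding abs_mult by (simp add: abs_divide)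
      have "\<bar>?b n x\<bar> * \<bar>\<Sum>j<\<nu>. (h j x)\<^sup>2\<bar> \<le> 1 / (w x)\<^sup>2 * \<bar>\<Sum>j<\<nu>. (h j x)\<^sup>2\<bar>" by (intro mult_right_mono lim(6)) auto
      then have 2: "\<bar>?b n x * (\<Sum>j<\<nu>. (h j x)\<^sup>2)\<bar> \<le> 1 / (w x)\<^sup>2 * \<bar>\<Sum>j<\<nu>. (h j x)\<^sup>2\<bar>" by (simp only: abs_mult)
      have 3: "1 / (w x)\<^sup>2 * \<bar>\<Sum>j<\<nu>. (h j x)\<^sup>2\<bar> = qq x"
      proof -
        have "qq x \<ge> 0" by (simp add: qq_def sum_nonneg)
        then show ?thesis using w_pos[of x] unfolding qqw by (simp add: abs_mult)
      qed
      show ?thesis using 1 2 3 by linarith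
    qed
    then show "AE x in \<mu>. \<forall>n. \<bar>?a n x * l x - ?b n x * (\<Sum>j<\<nu>. (h j x)\<^sup>2)\<bar> \<le> \<bar>l x / w x\<bar> + qq x" by blast
  qed
  show ?thesis
    using LIMSEQ_unique[OF lim1 lim2[folded renormalized_equation[OF e \<psi>]]] .
qed

end

subsection \<open>The energy identity\<close>

text \<open>A rescaled sine is a truncation that is smooth and does not increase derivatives.\<close>

definition trunc :: "nat \<Rightarrow> real \<Rightarrow> real" where
  "trunc n t = real (Suc n) * sin (t / real (Suc n))"

definition trunc' :: "nat \<Rightarrow> real \<Rightarrow> real" where
  "trunc' n t = cos (t / real (Suc n))"

lemma trunc_deriv: "(trunc n has_real_derivative trunc' n t) (at t)"
proof -
  have "((\<lambda>t. sin (t / real (Suc n))) has_real_derivative cos (t / real (Suc n)) * (1 / real (Suc n))) (at t)"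
    by (rule DERIV_chain2[where f=sin and g="\<lambda>t. t / real (Suc n)", OF DERIV_sin])
      (rule DERIV_cdivide[OF DERIV_ident])
  from DERIV_cmult[OF this, of "real (Suc n)"]
  show ?thesis unfolding trunc_def[abs_def] trunc'_def by simp
qed

lemma trunc_smooth: "smooth_on UNIV (trunc n)"
proof -
  have "smooth_on UNIV (\<lambda>t. t / real (Suc n))"
    by (rule smooth_on_linear[OF open_UNIV bounded_linear_divide])
  from smooth_on_compose[OF open_UNIV open_UNIV this smooth_on_sin]
  have s: "smooth_on UNIV (\<lambda>t. sin (t / real (Suc n)))" by simp
  show ?thesis unfolding trunc_def[abs_def]
    by (rule smooth_on_mult[OF open_UNIV smooth_on_const[OF open_UNIV] s])
qed

lemma trunc'_continuous: "continuous_on UNIV (trunc' n)"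
  unfolding trunc'_def[abs_def] by (intro continuous_intros) auto

lemma trunc_bounds: "\<bar>trunc' n t\<bar> \<le> 1" "\<bar>trunc n t\<bar> \<le> \<bar>t\<bar>" "\<bar>trunc n t\<bar> \<le> real (Suc n)" "trunc n 0 = 0"
proof -
  show "\<bar>trunc' n t\<bar> \<le> 1" by (simp add: trunc'_def)
  have "\<bar>trunc n t\<bar> = real (Suc n) * \<bar>sin (t / real (Suc n))\<bar>" by (simp add: trunc_def abs_mult)
  also have "\<dots> \<le> real (Suc n) * \<bar>t / real (Suc n)\<bar>" by (intro mult_left_mono abs_sin_x_le_abs_x) auto
  finally show "\<bar>trunc n t\<bar> \<le> \<bar>t\<bar>" by (simp add: abs_divide)
  have "real (Suc n) * \<bar>sin (t / real (Suc n))\<bar> \<le> real (Suc n) * 1" by (intro mult_left_mono) auto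
  then show "\<bar>trunc n t\<bar> \<le> real (Suc n)" by (simp add: trunc_def abs_mult)
qed (simp add: trunc_def)

lemma trunc'_limit: "(\<lambda>n. trunc' n t) \<longlonglongrightarrow> 1"
proof -
  have "(\<lambda>n. t * inverse (real (Suc n))) \<longlonglongrightarrow> t * 0" by (intro tendsto_intros LIMSEQ_inverse_real_of_nat)
  then have "(\<lambda>n. cos (t * inverse (real (Suc n)))) \<longlonglongrightarrow> cos 0" by (intro tendsto_cos) simp
  then show ?thesis by (simp add: trunc'_def divide_inverse)
qed

lemma trunc_limit: "(\<lambda>n. trunc n t) \<longlonglongrightarrow> t"
proof (cases "t = 0")
  case True
  then show ?thesis by (simp add: trunc_def)
next
  case False
  have f: "filterlim (\<lambda>n. t / real (Suc n)) (at 0) sequentially"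
    unfolding filterlim_at
  proof
    have "(\<lambda>n. t * inverse (real (Suc n))) \<longlonglongrightarrow> t * 0" by (intro tendsto_intros LIMSEQ_inverse_real_of_nat)
    then show "(\<lambda>n. t / real (Suc n)) \<longlonglongrightarrow> 0" by (simp add: divide_inverse)
  qed (use False in auto)
  have "((\<lambda>y. sin y / y) \<longlongrightarrow> 1) (at (0::real))"
    using DERIV_sin[of 0] by (simp add: has_field_derivative_iff)
  from filterlim_compose[OF this f]
  have "(\<lambda>n. t * (sin (t / real (Suc n)) / (t / real (Suc n)))) \<longlonglongrightarrow> t * 1" by (intro tendsto_intros)
  then show ?thesis using False by (simp add: trunc_def mult.commute)
qed

lemma trunc_measurable [measurable]: "trunc n \<in> borel_measurable borel" "trunc' n \<in> borel_measurable borel"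
  using trunc'_continuous smooth_on_continuous[OF trunc_smooth] by (auto intro: borel_measurable_continuous_onI)

text \<open>Bounded energies along an approximation give integrability of the limit before any
  integrable majorant is known.\<close>

lemma fatou_integrable:
  fixes g :: "'a \<Rightarrow> real"
  assumes m: "g \<in> borel_measurable M" and i: "\<And>n. integrable M (gn n)"
    and nn: "\<And>n. AE x in M. gn n x \<ge> 0" and l: "AE x in M. (\<lambda>n. gn n x) \<longlonglongrightarrow> g x"
    and b: "\<And>n. (\<integral>x. gn n x \<partial>M) \<le> R"
  shows "integrable M g"
proof (rule integrableI_bounded[OF m])
  have "(\<integral>\<^sup>+x. ennreal (norm (g x)) \<partial>M) \<le> (\<integral>\<^sup>+x. liminf (\<lambda>n. ennreal (gn n x)) \<partial>M)"
  proof (rule nn_integral_mono_AE)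
    have "AE x in M. \<forall>n. gn n x \<ge> 0" using nn by (simp add: AE_all_countable)
    then show "AE x in M. ennreal (norm (g x)) \<le> liminf (\<lambda>n. ennreal (gn n x))"
      using l
    proof eventually_elim
      case (elim x)
      have "g x \<ge> 0" by (rule tendsto_lowerbound[OF elim(2)]) (use elim(1) in auto)
      moreover have "(\<lambda>n. ennreal (gn n x)) \<longlonglongrightarrow> ennreal (g x)" using elim(2) by (rule tendsto_ennrealI)
      then have "liminf (\<lambda>n. ennreal (gn n x)) = ennreal (g x)" by (intro lim_imp_Liminf) auto
      ultimately show ?case by simp
    qed
  qed
  also have "\<dots> \<le> liminf (\<lambda>n. \<integral>\<^sup>+x. ennreal (gn n x) \<partial>M)"
    by (rule nn_integral_liminf) (use borel_measurable_integrable[OF i] in measurable)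
  also have "\<dots> \<le> ennreal R"
  proof -
    have "(\<integral>\<^sup>+x. ennreal (gn n x) \<partial>M) \<le> ennreal R" for n
      using nn_integral_eq_integral[OF i nn] b[of n] by (simp add: ennreal_leI)
    then show ?thesis by (intro Liminf_le) auto
  qed
  finally show "(\<integral>\<^sup>+x. ennreal (norm (g x)) \<partial>M) < \<infinity>" by (simp add: order_le_less_trans)
qed

context lie_haar
begin

section \<open>Square-integrable real functions\<close>

definition L2 :: "('g \<Rightarrow> real) set" where
  "L2 = {f \<in> borel_measurable \<mu>. integrable \<mu> (\<lambda>x. (f x)\<^sup>2)}"

lemma L2D: "f \<in> L2 \<Longrightarrow> f \<in> borel_measurable \<mu>" "f \<in> L2 \<Longrightarrow> integrable \<mu> (\<lambda>x. (f x)\<^sup>2)"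
  by (auto simp: L2_def)

lemma L2_mult: "f \<in> L2 \<Longrightarrow> g \<in> L2 \<Longrightarrow> integrable \<mu> (\<lambda>x. f x * g x)"
proof -
  assume f: "f \<in> L2" and g: "g \<in> L2"
  show ?thesis
  proof (rule Bochner_Integration.integrable_bound)
    show "integrable \<mu> (\<lambda>x. (f x)\<^sup>2 + (g x)\<^sup>2)" using L2D f g by auto
    have "norm (f x * g x) \<le> norm ((f x)\<^sup>2 + (g x)\<^sup>2)" for x
    proof -
      have "0 \<le> (\<bar>f x\<bar> - \<bar>g x\<bar>)\<^sup>2" by simp
      then have "2 * \<bar>f x * g x\<bar> \<le> (f x)\<^sup>2 + (g x)\<^sup>2" by (simp add: power2_diff abs_mult)
      then show ?thesis by simp
    qed
    then show "AE x in \<mu>. norm (f x * g x) \<le> norm ((f x)\<^sup>2 + (g x)\<^sup>2)" by simp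
  qed (use L2D(1) f g in auto)
qed

lemma L2_bound:
  assumes "g \<in> L2" "f \<in> borel_measurable \<mu>" "AE x in \<mu>. \<bar>f x\<bar> \<le> \<bar>g x\<bar>"
  shows "f \<in> L2"
proof -
  have "integrable \<mu> (\<lambda>x. (f x)\<^sup>2)"
    by (rule Bochner_Integration.integrable_bound[OF L2D(2)[OF assms(1)]])
      (use assms(2,3) in \<open>auto elim!: eventually_mono simp: abs_le_square_iff\<close>)
  then show ?thesis using assms by (simp add: L2_def)
qed

lemma L2_cmult: "f \<in> L2 \<Longrightarrow> (\<lambda>x. c * f x) \<in> L2"
  by (auto simp: L2_def power_mult_distrib)

lemma L2_add: "f \<in> L2 \<Longrightarrow> g \<in> L2 \<Longrightarrow> (\<lambda>x. f x + g x) \<in> L2"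
proof -
  assume f: "f \<in> L2" and g: "g \<in> L2"
  have "integrable \<mu> (\<lambda>x. (f x)\<^sup>2 + (g x)\<^sup>2 + 2 * (f x * g x))"
    by (intro Bochner_Integration.integrable_add integrable_mult_right L2D f g L2_mult)
  then show ?thesis using f g by (auto simp: L2_def power2_sum mult.assoc)
qed

lemma L2_diff: "f \<in> L2 \<Longrightarrow> g \<in> L2 \<Longrightarrow> (\<lambda>x. f x - g x) \<in> L2"
  using L2_add[of f "\<lambda>x. (-1) * g x"] L2_cmult[of g "-1"] by simp

lemma L2_abs: "f \<in> L2 \<Longrightarrow> (\<lambda>x. \<bar>f x\<bar>) \<in> L2"
  by (rule L2_bound) (auto dest: L2D)

lemma integrable_L1loc: "integrable \<mu> f \<Longrightarrow> f \<in> L1loc" for f :: "'g \<Rightarrow> real"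
  unfolding L1loc_iff set_integrable_def
proof (intro conjI allI impI)
  assume f: "integrable \<mu> f"
  show "f \<in> borel_measurable \<mu>" using f by auto
  fix K :: "'g set" assume K: "compact K"
  have "K \<in> sets \<mu>" using compact_imp_closed[OF K] by auto
  then show "integrable \<mu> (\<lambda>x. indicator K x *\<^sub>R f x)"
    using f by (rule integrable_mult_indicator)
qed

lemma compact_limit:
  assumes "compact K" "f \<in> borel_measurable \<mu>" "\<And>n. fn n \<in> borel_measurable \<mu>"
    "AE x in \<mu>. (\<lambda>n. fn n x) \<longlonglongrightarrow> f x" "M \<in> L1loc" "AE x in \<mu>. \<forall>n. \<bar>fn n x :: real\<bar> \<le> indicator K x * M x"
  shows "(\<lambda>n. \<integral>x. fn n x \<partial>\<mu>) \<longlonglongrightarrow> (\<integral>x. f x \<partial>\<mu>)"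
proof (rule integral_dominated_convergence[OF assms(2,3)])
  show "integrable \<mu> (\<lambda>x. indicator K x * M x)"
    using L1locD(2)[OF assms(5,1)] by (simp add: set_integrable_def)
  show "AE x in \<mu>. norm (fn n x) \<le> indicator K x * M x" for n
    using assms(6) by eventually_elim simp
qed (use assms in auto)

end

context weighted_lie
begin

text \<open>The logarithmic equation is tested with the square of the mollified \<open>F\<close>,
  which is a test function. The bound \<open>C\<close> survives the mollification, and the product
  of gradient and \<open>q j\<close> is dominated by the sum of the squares.\<close>

lemma energy_bounded:
  assumes K: "compact K" "\<And>x. x \<notin> K \<Longrightarrow> F x = 0" and C: "\<And>x. \<bar>F x\<bar> \<le> C"
    and b: "\<And>j. j < \<nu> \<Longrightarrow> wd (X j) F (b j)" "\<And>j. j < \<nu> \<Longrightarrow> b j \<in> L2" and F: "F \<in> L1loc"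
  shows "(\<Sum>j<\<nu>. \<integral>x. 2 * (F x * b j x * q j x) \<partial>\<mu>) = (\<integral>x. (F x)\<^sup>2 * lv x \<partial>\<mu>)"
proof -
  have C0: "C \<ge> 0" using C[of \<one>] by auto
  \<comment> \<open>Mollified along with \<open>F\<close> and \<open>b j\<close>: by Cauchy-Schwarz
    against the constant 1 the square of the mollified \<open>b j\<close> is at most the mollified
    square, for which a majorant is at hand.\<close>
  define s where "s j x = (b j x)\<^sup>2" for j x
  have sL: "s j \<in> L1loc" if "j < \<nu>" for j
    unfolding s_def[abs_def] by (rule integrable_L1loc[OF L2D(2)[OF b(2)[OF that]]])
  have bL: "b j \<in> L1loc" if "j < \<nu>" for j using b(1)[OF that] by (simp add: wd_iff)
  define FF where "FF = insert F (b ` {..<\<nu>} \<union> s ` {..<\<nu>})"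
  have FF: "finite FF" "FF \<subseteq> L1loc" using F bL sL by (auto simp: FF_def)
  obtain \<rho> L where \<rho>: "\<And>n. mollifier (\<rho> n)" "compact L" "\<And>n x. x \<notin> L \<Longrightarrow> \<rho> n x = 0"
    "\<And>u. u \<in> FF \<Longrightarrow> AE x in \<mu>. (\<lambda>n. conv (\<rho> n) u x) \<longlonglongrightarrow> u x"
    "\<And>u. u \<in> FF \<Longrightarrow> \<exists>M\<in>L1loc. AE x in \<mu>. \<forall>n. \<bar>conv (\<rho> n) u x\<bar> \<le> M x"
    using mollifier_sequence[OF FF] by blast
  have "\<exists>M. \<forall>u\<in>FF. M u \<in> L1loc \<and> (AE x in \<mu>. \<forall>n. \<bar>conv (\<rho> n) u x\<bar> \<le> M u x)"
    by (rule bchoice) (use \<rho>(5) in blast)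
  then obtain M where M: "\<And>u. u \<in> FF \<Longrightarrow> M u \<in> L1loc" "\<And>u. u \<in> FF \<Longrightarrow> AE x in \<mu>. \<forall>n. \<bar>conv (\<rho> n) u x\<bar> \<le> M u x"
    by blast
  note \<rho>t = mollifier_test[OF \<rho>(1)]
  have inFF: "F \<in> FF" "\<And>j. j < \<nu> \<Longrightarrow> b j \<in> FF" "\<And>j. j < \<nu> \<Longrightarrow> s j \<in> FF" by (auto simp: FF_def)
  let ?F = "\<lambda>n. conv (\<rho> n) F"
  let ?J = "(\<lambda>q. fst q \<otimes> snd q) ` (L \<times> K)"
  have J: "compact ?J" by (intro compact_mult \<rho> K)
  have F0: "?F n x = 0" if "x \<notin> ?J" for n x by (rule conv_support[OF K(2) \<rho>(3) that])
  have Fs: "?F n \<in> smooth_funs A" for n by (rule conv_smooth[OF F \<rho>t])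
  have Ft: "?F n \<in> test_funs A" for n unfolding test_funs_iff using Fs J F0 by blast
  have Fb: "\<bar>?F n x\<bar> \<le> C" for n x by (rule conv_bound[OF F C \<rho>(1)])
  have cm: "conv (\<rho> n) u \<in> borel_measurable \<mu>" if "u \<in> FF" for n u
    using smooth_measurable[OF conv_smooth[OF _ \<rho>t]] FF(2) that by blast
  have one: "conv (\<rho> n) (\<lambda>_. 1) x = 1" for n x using \<rho>(1)[of n] by (simp add: conv_def mollifier_def)
  have eqn: "(\<Sum>j<\<nu>. \<integral>x. 2 * (?F n x * conv (\<rho> n) (b j) x * q j x) \<partial>\<mu>) = (\<integral>x. (?F n x)\<^sup>2 * lv x \<partial>\<mu>)" for n
  proof -
    have "(\<Sum>j<\<nu>. \<integral>x. X j (\<lambda>x. ?F n x * ?F n x) x * q j x \<partial>\<mu>) = (\<integral>x. (?F n x * ?F n x) * lv x \<partial>\<mu>)"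
      by (rule log_equation[OF test_mult_left[OF Fs Ft]])
    moreover have "X j (\<lambda>x. ?F n x * ?F n x) x * q j x = 2 * (?F n x * conv (\<rho> n) (b j) x * q j x)" if j: "j < \<nu>" for j x
      unfolding vector_fieldsD(4)[OF Xv[OF j] Fs Fs] wd_conv[OF X[OF j] b(1)[OF j] \<rho>t] by simp
    ultimately show ?thesis by (simp add: power2_eq_square)
  qed
  have lim1: "(\<lambda>n. \<Sum>j<\<nu>. \<integral>x. 2 * (?F n x * conv (\<rho> n) (b j) x * q j x) \<partial>\<mu>) \<longlonglongrightarrow> (\<Sum>j<\<nu>. \<integral>x. 2 * (F x * b j x * q j x) \<partial>\<mu>)"
  proof (rule tendsto_sum)
    fix j assume "j \<in> {..<\<nu>}"
    then have j: "j < \<nu>" by simp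
    note [measurable] = q_meas[OF j] cm[OF inFF(1)] cm[OF inFF(2)[OF j]] L1locD(1)[OF F] L1locD(1)[OF bL[OF j]]
    show "(\<lambda>n. \<integral>x. 2 * (?F n x * conv (\<rho> n) (b j) x * q j x) \<partial>\<mu>) \<longlonglongrightarrow> (\<integral>x. 2 * (F x * b j x * q j x) \<partial>\<mu>)"
    proof (rule compact_limit[OF J])
      show "AE x in \<mu>. (\<lambda>n. 2 * (?F n x * conv (\<rho> n) (b j) x * q j x)) \<longlonglongrightarrow> 2 * (F x * b j x * q j x)"
        using \<rho>(4)[OF inFF(1)] \<rho>(4)[OF inFF(2)[OF j]] by eventually_elim (intro tendsto_intros)
      show "(\<lambda>x. C * (M (s j) x + (q j x)\<^sup>2)) \<in> L1loc"
        by (intro L1loc_cmult L1loc_add M inFF j q_sq)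
      show "AE x in \<mu>. \<forall>n. \<bar>2 * (?F n x * conv (\<rho> n) (b j) x * q j x)\<bar> \<le> indicator ?J x * (C * (M (s j) x + (q j x)\<^sup>2))"
        using M(2)[OF inFF(3)[OF j]]
      proof eventually_elim
        case (elim x)
        show ?case
        proof
          fix n
          show "\<bar>2 * (?F n x * conv (\<rho> n) (b j) x * q j x)\<bar> \<le> indicator ?J x * (C * (M (s j) x + (q j x)\<^sup>2))"
          proof (cases "x \<in> ?J")
            case True
            have "(conv (\<rho> n) (b j) x)\<^sup>2 \<le> conv (\<rho> n) (\<lambda>_. 1) x * conv (\<rho> n) (s j) x"
              by (rule conv_Cauchy_Schwarz[OF bL[OF j] smooth_L1loc[OF smooth_funs_const] sL[OF j] \<rho>(1)]) (auto simp: s_def)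
            then have "(conv (\<rho> n) (b j) x)\<^sup>2 \<le> M (s j) x" using elim[rule_format, of n] by (simp add: one)
            moreover have "2 * \<bar>conv (\<rho> n) (b j) x * q j x\<bar> \<le> (conv (\<rho> n) (b j) x)\<^sup>2 + (q j x)\<^sup>2"
            proof -
              have "0 \<le> (\<bar>conv (\<rho> n) (b j) x\<bar> - \<bar>q j x\<bar>)\<^sup>2" by simp
              then show ?thesis by (simp add: power2_diff abs_mult)
            qed
            ultimately have "\<bar>?F n x\<bar> * (2 * \<bar>conv (\<rho> n) (b j) x * q j x\<bar>) \<le> C * (M (s j) x + (q j x)\<^sup>2)"
              using Fb[of n x] C0 by (intro mult_mono) auto
            then show ?thesis using True by (simp add: abs_mult mult.assoc mult.left_commute)
          qed (simp add: F0)
        qed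
      qed
    qed measurable
  qed
  have lim2: "(\<lambda>n. \<integral>x. (?F n x)\<^sup>2 * lv x \<partial>\<mu>) \<longlonglongrightarrow> (\<integral>x. (F x)\<^sup>2 * lv x \<partial>\<mu>)"
  proof (rule compact_limit[OF J])
    note [measurable] = cm[OF inFF(1)] L1locD(1)[OF F] L1locD(1)[OF lv_loc]
    show "(\<lambda>x. (F x)\<^sup>2 * lv x) \<in> borel_measurable \<mu>" "(\<lambda>x. (?F n x)\<^sup>2 * lv x) \<in> borel_measurable \<mu>" for n by measurable
    show "AE x in \<mu>. (\<lambda>n. (?F n x)\<^sup>2 * lv x) \<longlonglongrightarrow> (F x)\<^sup>2 * lv x"
      using \<rho>(4)[OF inFF(1)] by eventually_elim (intro tendsto_intros)
    show "(\<lambda>x. C\<^sup>2 * \<bar>lv x\<bar>) \<in> L1loc" by (intro L1loc_cmult L1loc_abs lv_loc)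
    have "\<bar>(?F n x)\<^sup>2 * lv x\<bar> \<le> indicator ?J x * (C\<^sup>2 * \<bar>lv x\<bar>)" for n x
    proof (cases "x \<in> ?J")
      case True
      have "(?F n x)\<^sup>2 \<le> C\<^sup>2" using Fb[of n x] C0 by (simp add: abs_le_square_iff[symmetric])
      then show ?thesis using True by (simp add: abs_mult mult_right_mono)
    qed (simp add: F0)
    then show "AE x in \<mu>. \<forall>n. \<bar>(?F n x)\<^sup>2 * lv x\<bar> \<le> indicator ?J x * (C\<^sup>2 * \<bar>lv x\<bar>)" by blast
  qed
  show ?thesis using LIMSEQ_unique[OF lim1 lim2[folded eqn]] .
qed

definition pot :: "'g \<Rightarrow> real" where "pot x = qq x / 4 - lv x / 2"

lemma pot_meas [measurable]: "pot \<in> borel_measurable \<mu>"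
  using L1locD(1)[OF qq_loc] L1locD(1)[OF lv_loc] unfolding pot_def[abs_def] by auto

text \<open>\<open>F\<close> may be unbounded here, so the tested equation is first obtained for its
  truncations; the assumptions \<open>i\<close> provide the dominating functions for the limit. The
  identity then follows by completing the square.\<close>

lemma energy_identity:
  assumes K: "compact K" "\<And>x. x \<notin> K \<Longrightarrow> F x = 0"
    and b: "\<And>j. j < \<nu> \<Longrightarrow> wd (X j) F (b j)" "\<And>j. j < \<nu> \<Longrightarrow> b j \<in> L2" and F: "F \<in> L1loc"
    and i: "\<And>j. j < \<nu> \<Longrightarrow> (\<lambda>x. F x * q j x) \<in> L2" "integrable \<mu> (\<lambda>x. (F x)\<^sup>2 * lv x)"
  shows "integrable \<mu> (\<lambda>x. pot x * (F x)\<^sup>2)"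
    "(\<integral>x. (\<Sum>j<\<nu>. (b j x)\<^sup>2) + pot x * (F x)\<^sup>2 \<partial>\<mu>) = (\<integral>x. (\<Sum>j<\<nu>. (b j x - F x * q j x / 2)\<^sup>2) \<partial>\<mu>)"
proof -
  note [measurable] = L1locD(1)[OF F] L1locD(1)[OF lv_loc]
  have ii: "integrable \<mu> (\<lambda>x. F x * b j x * q j x)" if j: "j < \<nu>" for j
    using L2_mult[OF i(1)[OF j] b(2)[OF j]] by (simp add: mult.commute mult.left_commute)
  have eqn: "(\<Sum>j<\<nu>. \<integral>x. 2 * (trunc n (F x) * (trunc' n (F x) * b j x) * q j x) \<partial>\<mu>) = (\<integral>x. (trunc n (F x))\<^sup>2 * lv x \<partial>\<mu>)" for n
  proof (rule energy_bounded[OF K(1)])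
    show "trunc n (F x) = 0" if "x \<notin> K" for x using K(2)[OF that] trunc_bounds(4) by simp
    show "\<bar>trunc n (F x)\<bar> \<le> real (Suc n)" for x by (rule trunc_bounds(3))
    show "wd (X j) (\<lambda>x. trunc n (F x)) (\<lambda>x. trunc' n (F x) * b j x)" if j: "j < \<nu>" for j
      by (rule wd_chain[OF X[OF j] b(1)[OF j] trunc_smooth trunc_deriv trunc'_continuous trunc_bounds(1)])
    show "(\<lambda>x. trunc' n (F x) * b j x) \<in> L2" if j: "j < \<nu>" for j
    proof (rule L2_bound[OF b(2)[OF j]])
      note [measurable] = L2D(1)[OF b(2)[OF j]]
      show "(\<lambda>x. trunc' n (F x) * b j x) \<in> borel_measurable \<mu>" by measurable
      show "AE x in \<mu>. \<bar>trunc' n (F x) * b j x\<bar> \<le> \<bar>b j x\<bar>"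
        using trunc_bounds(1) by (auto simp: abs_mult intro!: mult_left_le_one_le)
    qed
    show "(\<lambda>x. trunc n (F x)) \<in> L1loc" by (rule L1loc_bound[OF F]) (auto simp: trunc_bounds(2))
  qed
  have lim1: "(\<lambda>n. \<Sum>j<\<nu>. \<integral>x. 2 * (trunc n (F x) * (trunc' n (F x) * b j x) * q j x) \<partial>\<mu>) \<longlonglongrightarrow> (\<Sum>j<\<nu>. \<integral>x. 2 * (F x * (1 * b j x) * q j x) \<partial>\<mu>)"
  proof (rule tendsto_sum)
    fix j assume "j \<in> {..<\<nu>}"
    then have j: "j < \<nu>" by simp
    note [measurable] = q_meas[OF j] L2D(1)[OF b(2)[OF j]]
    show "(\<lambda>n. \<integral>x. 2 * (trunc n (F x) * (trunc' n (F x) * b j x) * q j x) \<partial>\<mu>) \<longlonglongrightarrow> (\<integral>x. 2 * (F x * (1 * b j x) * q j x) \<partial>\<mu>)"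
    proof (rule integral_dominated_convergence)
      show "integrable \<mu> (\<lambda>x. 2 * \<bar>F x * b j x * q j x\<bar>)" using ii[OF j] by (intro integrable_mult_right integrable_abs)
      show "AE x in \<mu>. (\<lambda>n. 2 * (trunc n (F x) * (trunc' n (F x) * b j x) * q j x)) \<longlonglongrightarrow> 2 * (F x * (1 * b j x) * q j x)"
        by (intro AE_I2 tendsto_intros trunc_limit trunc'_limit)
      have "norm (2 * (trunc n (F x) * (trunc' n (F x) * b j x) * q j x)) \<le> 2 * \<bar>F x * b j x * q j x\<bar>" for n x
      proof -
        have "\<bar>trunc n (F x)\<bar> * (\<bar>trunc' n (F x)\<bar> * \<bar>b j x\<bar>) * \<bar>q j x\<bar> \<le> \<bar>F x\<bar> * (1 * \<bar>b j x\<bar>) * \<bar>q j x\<bar>"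
          by (intro mult_right_mono mult_mono trunc_bounds) auto
        then show ?thesis by (simp add: abs_mult)
      qed
      then show "AE x in \<mu>. norm (2 * (trunc n (F x) * (trunc' n (F x) * b j x) * q j x)) \<le> 2 * \<bar>F x * b j x * q j x\<bar>" for n by blast
    qed measurable
  qed
  have lim2: "(\<lambda>n. \<integral>x. (trunc n (F x))\<^sup>2 * lv x \<partial>\<mu>) \<longlonglongrightarrow> (\<integral>x. (F x)\<^sup>2 * lv x \<partial>\<mu>)"
  proof (rule integral_dominated_convergence)
    show "integrable \<mu> (\<lambda>x. \<bar>(F x)\<^sup>2 * lv x\<bar>)" using i(2) by (rule integrable_abs)
    show "AE x in \<mu>. (\<lambda>n. (trunc n (F x))\<^sup>2 * lv x) \<longlonglongrightarrow> (F x)\<^sup>2 * lv x"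
      by (intro AE_I2 tendsto_intros trunc_limit)
    have "norm ((trunc n (F x))\<^sup>2 * lv x) \<le> \<bar>(F x)\<^sup>2 * lv x\<bar>" for n x
      using trunc_bounds(2)[of n "F x"] by (simp add: abs_mult abs_le_square_iff mult_right_mono)
    then show "AE x in \<mu>. norm ((trunc n (F x))\<^sup>2 * lv x) \<le> \<bar>(F x)\<^sup>2 * lv x\<bar>" for n by blast
  qed measurable
  have E: "(\<Sum>j<\<nu>. \<integral>x. 2 * (F x * b j x * q j x) \<partial>\<mu>) = (\<integral>x. (F x)\<^sup>2 * lv x \<partial>\<mu>)"
    using LIMSEQ_unique[OF lim1 lim2[folded eqn]] by simp
  have qi: "integrable \<mu> (\<lambda>x. (F x)\<^sup>2 * qq x)"
  proof -
    have "integrable \<mu> (\<lambda>x. \<Sum>j<\<nu>. (F x * q j x)\<^sup>2)"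
      by (intro Bochner_Integration.integrable_sum) (use L2D(2)[OF i(1)] in auto)
    then show ?thesis by (simp add: qq_def sum_distrib_left power_mult_distrib)
  qed
  have "integrable \<mu> (\<lambda>x. ((F x)\<^sup>2 * qq x) / 4 - ((F x)\<^sup>2 * lv x) / 2)" using qi i(2) by simp
  then show "integrable \<mu> (\<lambda>x. pot x * (F x)\<^sup>2)" by (simp add: pot_def algebra_simps)
  \<comment> \<open>Expanding the square produces \<open>F\<^sup>2\<close> times
    \<open>qq / 4\<close>, which cancels against the first part of \<open>pot\<close>; what remains
    is half the difference of the integrands in \<open>E\<close> and integrates to 0.\<close>
  have pt: "(\<Sum>j<\<nu>. (b j x)\<^sup>2) + pot x * (F x)\<^sup>2 = (\<Sum>j<\<nu>. (b j x - F x * q j x / 2)\<^sup>2) +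
     ((\<Sum>j<\<nu>. 2 * (F x * b j x * q j x)) / 2 - (F x)\<^sup>2 * lv x / 2)" for x
  proof -
    have "(\<Sum>j<\<nu>. (b j x)\<^sup>2) = (\<Sum>j<\<nu>. (b j x - F x * q j x / 2)\<^sup>2 + F x * b j x * q j x - (F x)\<^sup>2 * (q j x)\<^sup>2 / 4)"
      by (rule sum.cong) (auto simp: power2_diff power_mult_distrib power_divide)
    also have "\<dots> = (\<Sum>j<\<nu>. (b j x - F x * q j x / 2)\<^sup>2) + (\<Sum>j<\<nu>. F x * b j x * q j x) - (F x)\<^sup>2 * qq x / 4"
      by (simp add: sum.distrib sum_subtractf qq_def sum_distrib_left sum_divide_distrib)
    moreover have "(\<Sum>j<\<nu>. 2 * (F x * b j x * q j x)) = 2 * (\<Sum>j<\<nu>. F x * b j x * q j x)"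
      by (simp add: sum_distrib_left)
    ultimately show ?thesis by (simp add: pot_def algebra_simps)
  qed
  have Bi: "integrable \<mu> (\<lambda>x. \<Sum>j<\<nu>. (b j x - F x * q j x / 2)\<^sup>2)"
  proof (rule Bochner_Integration.integrable_sum)
    fix j assume "j \<in> {..<\<nu>}"
    then have j: "j < \<nu>" by simp
    show "integrable \<mu> (\<lambda>x. (b j x - F x * q j x / 2)\<^sup>2)"
      using L2D(2)[OF L2_diff[OF b(2)[OF j] L2_cmult[OF i(1)[OF j], of "1/2"]]] by simp
  qed
  have Ci: "integrable \<mu> (\<lambda>x. \<Sum>j<\<nu>. 2 * (F x * b j x * q j x))"
    by (intro Bochner_Integration.integrable_sum integrable_mult_right) (use ii in auto)
  have "(\<integral>x. (\<Sum>j<\<nu>. 2 * (F x * b j x * q j x)) \<partial>\<mu>) = (\<Sum>j<\<nu>. \<integral>x. 2 * (F x * b j x * q j x) \<partial>\<mu>)"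
    by (rule Bochner_Integration.integral_sum) (use ii in auto)
  then show "(\<integral>x. (\<Sum>j<\<nu>. (b j x)\<^sup>2) + pot x * (F x)\<^sup>2 \<partial>\<mu>) = (\<integral>x. (\<Sum>j<\<nu>. (b j x - F x * q j x / 2)\<^sup>2) \<partial>\<mu>)"
    unfolding pt using Bi Ci i(2) E by simp
qed

text \<open>The function 1/(exp(-rt) + e) is bounded by 1/e and increases to exp(rt) as
  \<open>e\<close> decreases to 0, while its derivative is dominated by that of the limit. With r =
  1/2 and r = -1/2 it regularizes the square root of the weight and the inverse of that
  root.\<close>

lemma exp_reg:
  fixes r t e :: real
  assumes e: "e > 0"
  shows "((\<lambda>t. 1 / (exp (- r * t) + e)) has_real_derivative r * exp (- r * t) / (exp (- r * t) + e)\<^sup>2) (at t)"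
    "\<bar>1 / (exp (- r * t) + e)\<bar> \<le> 1 / e" "\<bar>1 / (exp (- r * t) + e)\<bar> \<le> exp (r * t)"
    "\<bar>r * exp (- r * t) / (exp (- r * t) + e)\<^sup>2\<bar> \<le> \<bar>r\<bar> / e"
    "\<bar>r * exp (- r * t) / (exp (- r * t) + e)\<^sup>2\<bar> \<le> \<bar>r\<bar> * exp (r * t)"
proof -
  have p: "exp (- r * t) + e > 0" "exp (- r * t) > 0" using e by (auto intro: add_pos_pos)
  show "((\<lambda>t. 1 / (exp (- r * t) + e)) has_real_derivative r * exp (- r * t) / (exp (- r * t) + e)\<^sup>2) (at t)"
    using p(1) by (auto intro!: derivative_eq_intros simp: power2_eq_square)
  have inv1: "1 / (exp (- r * t) + e) \<le> 1 / e" using p e by (intro divide_left_mono) auto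
  have "1 / (exp (- r * t) + e) \<le> 1 / exp (- r * t)" using p e by (intro divide_left_mono) auto
  then have inv2: "1 / (exp (- r * t) + e) \<le> exp (r * t)" by (simp add: exp_minus field_simps)
  show "\<bar>1 / (exp (- r * t) + e)\<bar> \<le> 1 / e" "\<bar>1 / (exp (- r * t) + e)\<bar> \<le> exp (r * t)"
    using inv1 inv2 p by auto
  have "exp (- r * t) / (exp (- r * t) + e)\<^sup>2 \<le> (exp (- r * t) + e) / (exp (- r * t) + e)\<^sup>2"
    using e by (intro divide_right_mono) auto
  also have "\<dots> = 1 / (exp (- r * t) + e)" using p by (simp add: power2_eq_square)
  finally have d: "exp (- r * t) / (exp (- r * t) + e)\<^sup>2 \<le> 1 / (exp (- r * t) + e)" .
  have a: "\<bar>r * exp (- r * t) / (exp (- r * t) + e)\<^sup>2\<bar> = \<bar>r\<bar> * (exp (- r * t) / (exp (- r * t) + e)\<^sup>2)"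
    by (simp add: abs_mult abs_divide)
  have "\<bar>r\<bar> * (exp (- r * t) / (exp (- r * t) + e)\<^sup>2) \<le> \<bar>r\<bar> * (1 / e)"
    using d inv1 by (intro mult_left_mono) auto
  then show "\<bar>r * exp (- r * t) / (exp (- r * t) + e)\<^sup>2\<bar> \<le> \<bar>r\<bar> / e" unfolding a by simp
  show "\<bar>r * exp (- r * t) / (exp (- r * t) + e)\<^sup>2\<bar> \<le> \<bar>r\<bar> * exp (r * t)"
    unfolding a using d inv2 by (intro mult_left_mono) auto
qed

lemma exp_reg_smooth:
  fixes r e :: real
  assumes e: "e > 0"
  shows "smooth_on UNIV (\<lambda>t. 1 / (exp (- r * t) + e))"
    "continuous_on UNIV (\<lambda>t. r * exp (- r * t) / (exp (- r * t) + e)\<^sup>2)"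
proof -
  have p: "exp (- r * t) + e \<noteq> 0" for t using e by (metis add_pos_pos exp_gt_zero less_irrefl)
  have l: "smooth_on UNIV (\<lambda>t. - r * t)" by (intro smooth_on_mult smooth_on_const smooth_on_id open_UNIV)
  have "smooth_on UNIV (\<lambda>t. exp (- r * t))"
    by (rule smooth_on_compose[OF open_UNIV open_UNIV l smooth_on_exp]) simp
  then have "smooth_on UNIV (\<lambda>t. inverse (exp (- r * t) + e))"
    by (intro smooth_on_inverse_fun smooth_on_add smooth_on_const open_UNIV p)
  then show "smooth_on UNIV (\<lambda>t. 1 / (exp (- r * t) + e))" by (simp add: divide_inverse)
  show "continuous_on UNIV (\<lambda>t. r * exp (- r * t) / (exp (- r * t) + e)\<^sup>2)"
    by (intro continuous_intros) (use p in auto)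
qed

text \<open>The exponential factor may be unbounded, so \<open>wd_prod\<close> is applied to its
  regularizations. The parameter \<open>r\<close> lets one rule cover multiplication by the square
  root of \<open>w\<close> and division by it.\<close>

lemma wd_mult_exp:
  fixes r :: real
  assumes j: "j < \<nu>" and g: "wd (X j) g k" "\<And>x. \<bar>g x\<bar> \<le> C"
    and E: "(\<lambda>x. exp (r * v x)) \<in> L1loc" "(\<lambda>x. exp (r * v x) * k x) \<in> L1loc" "(\<lambda>x. exp (r * v x) * q j x) \<in> L1loc"
  shows "wd (X j) (\<lambda>x. g x * exp (r * v x)) (\<lambda>x. exp (r * v x) * k x + r * (g x * exp (r * v x) * q j x))"
proof -
  define e where "e n = 1 / real (Suc n)" for n
  have e: "e n > 0" for n by (simp add: e_def)
  have e0: "e \<longlonglongrightarrow> 0" unfolding e_def using LIMSEQ_inverse_real_of_nat by (simp add: inverse_eq_divide)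
  define S where "S n t = 1 / (exp (- r * t) + e n)" for n t
  define S' where "S' n t = r * exp (- r * t) / (exp (- r * t) + e n)\<^sup>2" for n t
  have S: "(S n has_real_derivative S' n t) (at t)" "\<bar>S n t\<bar> \<le> 1 / e n" "\<bar>S n t\<bar> \<le> exp (r * t)" "\<bar>S' n t\<bar> \<le> \<bar>r\<bar> / e n"
    "\<bar>S' n t\<bar> \<le> \<bar>r\<bar> * exp (r * t)" "smooth_on UNIV (S n)" "continuous_on UNIV (S' n)" for n t
    using exp_reg[OF e[of n], of r t] exp_reg_smooth[OF e[of n], of r] unfolding S_def[abs_def] S'_def[abs_def] by simp_all
  have Sl: "(\<lambda>n. S n t) \<longlonglongrightarrow> exp (r * t)" for t
  proof -
    have "(\<lambda>n. S n t) \<longlonglongrightarrow> 1 / (exp (- r * t) + 0)"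
      unfolding S_def by (intro tendsto_intros e0) auto
    then show ?thesis by (simp add: exp_minus field_simps)
  qed
  have S'l: "(\<lambda>n. S' n t) \<longlonglongrightarrow> r * exp (r * t)" for t
  proof -
    have "(\<lambda>n. S' n t) \<longlonglongrightarrow> r * exp (- r * t) / (exp (- r * t) + 0)\<^sup>2"
      unfolding S'_def by (intro tendsto_intros e0) auto
    then show ?thesis by (simp add: exp_minus field_simps power2_eq_square)
  qed
  have C: "C \<ge> 0" using g(2)[of \<one>] by auto
  have gL: "g \<in> L1loc" "k \<in> L1loc" using g(1) by (auto simp: wd_iff)
  have vm: "v \<in> borel_measurable \<mu>" unfolding v_def[abs_def] by measurable
  note [measurable] = q_meas[OF j] L1locD(1)[OF gL(1)] L1locD(1)[OF gL(2)] vm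
  show ?thesis
  proof (rule wd_limit[OF Xv[OF j]])
    show "wd (X j) (\<lambda>x. g x * S n (v x)) (\<lambda>x. g x * (S' n (v x) * q j x) + k x * S n (v x))" for n
      by (rule wd_prod[OF X[OF j] g(1) wd_chain[OF X[OF j] wd_v[OF j] S(6) S(1) S(7) S(4)] g(2) S(2)])
    show "(\<lambda>x. g x * exp (r * v x)) \<in> borel_measurable \<mu>"
      "(\<lambda>x. exp (r * v x) * k x + r * (g x * exp (r * v x) * q j x)) \<in> borel_measurable \<mu>" by measurable
    show "AE x in \<mu>. (\<lambda>n. g x * S n (v x)) \<longlonglongrightarrow> g x * exp (r * v x)"
      by (intro AE_I2 tendsto_intros Sl)
    show "(\<lambda>x. C * exp (r * v x)) \<in> L1loc" by (intro L1loc_cmult E)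
    have "\<bar>g x * S n (v x)\<bar> \<le> C * exp (r * v x)" for n x
      unfolding abs_mult by (intro mult_mono g S) (use C in auto)
    then show "AE x in \<mu>. \<forall>n. \<bar>g x * S n (v x)\<bar> \<le> C * exp (r * v x)" by blast
    have "(\<lambda>n. g x * (S' n (v x) * q j x) + k x * S n (v x)) \<longlonglongrightarrow> g x * ((r * exp (r * v x)) * q j x) + k x * exp (r * v x)" for x
      by (intro tendsto_intros Sl S'l)
    then show "AE x in \<mu>. (\<lambda>n. g x * (S' n (v x) * q j x) + k x * S n (v x)) \<longlonglongrightarrow> exp (r * v x) * k x + r * (g x * exp (r * v x) * q j x)"
      by (simp add: algebra_simps)
    show "(\<lambda>x. C * \<bar>r\<bar> * \<bar>exp (r * v x) * q j x\<bar> + \<bar>exp (r * v x) * k x\<bar>) \<in> L1loc"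
      by (intro L1loc_add L1loc_cmult L1loc_abs E)
    have "\<bar>g x * (S' n (v x) * q j x) + k x * S n (v x)\<bar> \<le> C * \<bar>r\<bar> * \<bar>exp (r * v x) * q j x\<bar> + \<bar>exp (r * v x) * k x\<bar>" for n x
    proof -
      have "\<bar>g x\<bar> * (\<bar>S' n (v x)\<bar> * \<bar>q j x\<bar>) \<le> C * ((\<bar>r\<bar> * exp (r * v x)) * \<bar>q j x\<bar>)"
        by (intro mult_mono mult_right_mono g S) (use C in auto)
      then have 1: "\<bar>g x * (S' n (v x) * q j x)\<bar> \<le> C * \<bar>r\<bar> * \<bar>exp (r * v x) * q j x\<bar>"
        by (simp add: abs_mult mult.assoc)
      have "\<bar>k x\<bar> * \<bar>S n (v x)\<bar> \<le> \<bar>k x\<bar> * exp (r * v x)" by (intro mult_left_mono S) auto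
      then have 2: "\<bar>k x * S n (v x)\<bar> \<le> \<bar>exp (r * v x) * k x\<bar>" by (simp add: abs_mult mult.commute)
      show ?thesis using 1 2 by linarith
    qed
    then show "AE x in \<mu>. \<forall>n. \<bar>g x * (S' n (v x) * q j x) + k x * S n (v x)\<bar> \<le> C * \<bar>r\<bar> * \<bar>exp (r * v x) * q j x\<bar> + \<bar>exp (r * v x) * k x\<bar>"
      by blast
  qed
qed

end

section \<open>The two energy spaces of real functions\<close>

locale weighted_pot = weighted_lie G A \<mu> \<delta> \<nu> X w l h
  for G :: "('g::{t2_space, second_countable_topology}) monoid" (structure)
    and A :: "('g, 'e::euclidean_space) chart set"
    and \<mu> :: "'g measure" and \<delta> :: "'g \<Rightarrow> real"
    and \<nu> :: nat and X :: "nat \<Rightarrow> 'g vfield" and w l :: "'g \<Rightarrow> real" and h :: "nat \<Rightarrow> 'g \<Rightarrow> real" +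
  fixes m :: real
  assumes m_pos: "m > 0" and pot_ge: "AE x in \<mu>. pot x \<ge> - m + 1"
begin

lemma exp_half: "exp ((1/2) * v x) = sqrt (w x)"
  using w_pos[of x] by (simp add: v_def ln_sqrt[symmetric])

lemma exp_minus_half: "exp ((- (1/2)) * v x) = 1 / sqrt (w x)"
proof -
  have "(- (1/2)) * v x = - ((1/2) * v x)" by simp
  then show ?thesis by (simp only: exp_minus exp_half inverse_eq_divide)
qed

lemma sqrt_sq: "(sqrt (w x))\<^sup>2 = w x"
  using w_pos[of x] by simp

lemma sqrt_loc: "(\<lambda>x. sqrt (w x)) \<in> L1loc"
  by (rule L1loc_of_sq) (use w_loc w_pos in \<open>auto simp: less_imp_le\<close>)

lemma inv_sqrt_sq: "(\<lambda>x. (1 / sqrt (w x))\<^sup>2) \<in> L1loc"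
  using w_inv w_pos by (simp add: power_divide less_imp_le inverse_eq_divide)

lemma inv_sqrt_loc: "(\<lambda>x. 1 / sqrt (w x)) \<in> L1loc"
  by (rule L1loc_of_sq[OF _ inv_sqrt_sq]) measurable

lemma sqrt_q_sq: "(sqrt (w x) * q j x)\<^sup>2 = (h j x)\<^sup>2 / w x"
proof -
  have "(sqrt (w x) * q j x)\<^sup>2 = w x * (h j x)\<^sup>2 / (w x)\<^sup>2"
    by (simp add: power_mult_distrib q_def power_divide sqrt_sq)
  also have "\<dots> = (h j x)\<^sup>2 / w x" using w_pos[of x] by (simp add: power2_eq_square)
  finally show ?thesis .
qed

lemma sqrt_q_sq_loc: "j < \<nu> \<Longrightarrow> (\<lambda>x. (sqrt (w x) * q j x)\<^sup>2) \<in> L1loc"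
  unfolding sqrt_q_sq by (rule h_sqrt)

lemma sqrt_q_loc: "j < \<nu> \<Longrightarrow> (\<lambda>x. sqrt (w x) * q j x) \<in> L1loc"
  by (rule L1loc_of_sq[OF _ sqrt_q_sq_loc]) (use q_meas in measurable)

lemma bounded_support_L2:
  assumes "f \<in> borel_measurable \<mu>" "compact K" "\<And>x. x \<notin> K \<Longrightarrow> f x = 0" "\<And>x. \<bar>f x\<bar> \<le> C"
    and u: "u \<in> borel_measurable \<mu>" "(\<lambda>x. (u x)\<^sup>2) \<in> L1loc"
  shows "(\<lambda>x. f x * u x) \<in> L2"
proof -
  have "integrable \<mu> (\<lambda>x. (f x * u x)\<^sup>2)"
  proof (rule L1loc_integrable[OF u(2) _ assms(2)])
    show "(\<lambda>x. (f x * u x)\<^sup>2) \<in> borel_measurable \<mu>" using assms by auto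
    have "\<bar>(f x * u x)\<^sup>2\<bar> \<le> C\<^sup>2 * indicator K x * \<bar>(u x)\<^sup>2\<bar>" for x
    proof (cases "x \<in> K")
      case True
      have "C \<ge> 0" using assms(4)[of x] by linarith
      then have "(f x)\<^sup>2 \<le> C\<^sup>2" using assms(4)[of x] by (simp add: abs_le_square_iff[symmetric])
      then show ?thesis using True by (simp add: power_mult_distrib mult_right_mono)
    qed (simp add: assms(3))
    then show "AE x in \<mu>. \<bar>(f x * u x)\<^sup>2\<bar> \<le> C\<^sup>2 * indicator K x * \<bar>(u x)\<^sup>2\<bar>" by blast
  qed
  then show ?thesis using assms by (auto simp: L2_def)
qed

text \<open>All estimates are pointwise, so they stay valid after multiplication by any weight; both
  directions can therefore use the same bounded, compactly supported approximations.\<close>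

definition truncating_sequence where
  "truncating_sequence f a fn an K C \<longleftrightarrow>
    (\<forall>n. \<forall>j<\<nu>. wd (X j) (fn n) (an n j)) \<and> (\<forall>n. fn n \<in> L1loc) \<and>
    (\<forall>n x. \<bar>fn n x\<bar> \<le> real (Suc n)) \<and> (\<forall>n x. \<bar>fn n x\<bar> \<le> \<bar>f x\<bar>) \<and>
    (\<forall>n. compact (K n)) \<and> (\<forall>n x. x \<notin> K n \<longrightarrow> fn n x = 0) \<and>
    (\<forall>n x. \<forall>j<\<nu>. \<bar>an n j x\<bar> \<le> \<bar>a j x\<bar> + C * \<bar>f x\<bar>) \<and> C \<ge> 0 \<and>
    (\<forall>x. (\<lambda>n. fn n x) \<longlonglongrightarrow> f x) \<and> (\<forall>x. \<forall>j<\<nu>. (\<lambda>n. an n j x) \<longlonglongrightarrow> a j x)"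

lemma truncating_sequenceD:
  assumes "truncating_sequence f a fn an K C"
  shows "j < \<nu> \<Longrightarrow> wd (X j) (fn n) (an n j)" "fn n \<in> L1loc"
    "\<bar>fn n x\<bar> \<le> real (Suc n)" "\<bar>fn n x\<bar> \<le> \<bar>f x\<bar>"
    "compact (K n)" "x \<notin> K n \<Longrightarrow> fn n x = 0"
    "j < \<nu> \<Longrightarrow> \<bar>an n j x\<bar> \<le> \<bar>a j x\<bar> + C * \<bar>f x\<bar>" "C \<ge> 0"
    "(\<lambda>n. fn n x) \<longlonglongrightarrow> f x" "j < \<nu> \<Longrightarrow> (\<lambda>n. an n j x) \<longlonglongrightarrow> a j x"
  using assms unfolding truncating_sequence_def by (elim conjE; blast)+

text \<open>The values are truncated by a chain rule with derivative at most 1, then the support is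
  cut off by a smooth factor; \<open>C\<close> is the uniform bound for the derivatives of the
  cutoffs.\<close>

lemma truncation:
  assumes f: "f \<in> L1loc" "\<And>j. j < \<nu> \<Longrightarrow> wd (X j) f (a j)"
  shows "\<exists>fn an K C. truncating_sequence f a fn an K C"
proof -
  have "\<exists>\<eta> C. (\<forall>n. \<eta> n \<in> test_funs A) \<and> (\<forall>n x. 0 \<le> \<eta> n x) \<and> (\<forall>n x. \<eta> n x \<le> 1) \<and>
    (\<forall>n x. \<forall>j<\<nu>. \<bar>X j (\<eta> n) x\<bar> \<le> C) \<and>
    (\<forall>x. \<forall>\<^sub>F n in sequentially. \<eta> n x = 1 \<and> (\<forall>j<\<nu>. X j (\<eta> n) x = 0))"
    by (rule cutoffs[OF X])
  then obtain \<eta> C where \<eta>: "\<And>n. \<eta> n \<in> test_funs A" "\<And>n x. 0 \<le> \<eta> n x" "\<And>n x. \<eta> n x \<le> 1"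
    "\<And>n j x. j < \<nu> \<Longrightarrow> \<bar>X j (\<eta> n) x\<bar> \<le> C"
    "\<And>x. \<forall>\<^sub>F n in sequentially. \<eta> n x = 1 \<and> (\<forall>j<\<nu>. X j (\<eta> n) x = 0)"
    by blast
  have "\<forall>n. \<exists>K. compact K \<and> (\<forall>x. x \<notin> K \<longrightarrow> \<eta> n x = 0)" using test_support[OF \<eta>(1)] by blast
  then obtain K where K: "\<And>n. compact (K n)" "\<And>n x. x \<notin> K n \<Longrightarrow> \<eta> n x = 0" by metis
  have \<eta>s: "\<eta> n \<in> smooth_funs A" for n by (rule test_smooth[OF \<eta>(1)])
  define fn where "fn n x = \<eta> n x * trunc n (f x)" for n x
  define an where "an n j x = \<eta> n x * (trunc' n (f x) * a j x) + X j (\<eta> n) x * trunc n (f x)" for n j x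
  have w: "wd (X j) (fn n) (an n j)" if j: "j < \<nu>" for n j
    unfolding fn_def[abs_def] an_def[abs_def]
    by (rule wd_mult_smooth[OF Xv[OF j] \<eta>s wd_chain[OF X[OF j] f(2)[OF j] trunc_smooth trunc_deriv trunc'_continuous trunc_bounds(1)]])
  have b1: "\<bar>fn n x\<bar> \<le> \<bar>trunc n (f x)\<bar>" for n x
    using \<eta>(2,3)[of n x] by (simp add: fn_def abs_mult mult_left_le_one_le)
  have b2: "\<bar>fn n x\<bar> \<le> \<bar>f x\<bar>" for n x using b1 trunc_bounds(2) order_trans by blast
  have loc: "fn n \<in> L1loc" for n
  proof (rule L1loc_bound[OF f(1)])
    note [measurable] = L1locD(1)[OF f(1)] smooth_measurable[OF \<eta>s[of n]]
    show "fn n \<in> borel_measurable \<mu>" unfolding fn_def[abs_def] by measurable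
  qed (use b2 in auto)
  have C: "\<bar>an n j x\<bar> \<le> \<bar>a j x\<bar> + max C 0 * \<bar>f x\<bar>" if j: "j < \<nu>" for n j x
  proof -
    have "\<bar>\<eta> n x\<bar> * (\<bar>trunc' n (f x)\<bar> * \<bar>a j x\<bar>) \<le> 1 * (1 * \<bar>a j x\<bar>)"
      using \<eta>(2,3)[of n x] by (intro mult_mono mult_right_mono trunc_bounds) auto
    moreover have "\<bar>X j (\<eta> n) x\<bar> * \<bar>trunc n (f x)\<bar> \<le> max C 0 * \<bar>f x\<bar>"
      using \<eta>(4)[OF j, of n x] by (intro mult_mono trunc_bounds) auto
    ultimately show ?thesis unfolding an_def
      by (intro order_trans[OF abs_triangle_ineq] add_mono) (simp_all add: abs_mult)
  qed
  \<comment> \<open>At a fixed point the cutoff is eventually 1 with vanishing derivatives, so only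
    the truncation of the values is left.\<close>
  have l1: "(\<lambda>n. fn n x) \<longlonglongrightarrow> f x" for x
  proof (rule Lim_transform_eventually[OF trunc_limit])
    show "\<forall>\<^sub>F n in sequentially. trunc n (f x) = fn n x"
      using \<eta>(5)[of x] by eventually_elim (simp add: fn_def)
  qed
  have l2: "(\<lambda>n. an n j x) \<longlonglongrightarrow> a j x" if j: "j < \<nu>" for j x
  proof (rule Lim_transform_eventually)
    show "(\<lambda>n. trunc' n (f x) * a j x) \<longlonglongrightarrow> a j x"
      using tendsto_mult[OF trunc'_limit tendsto_const] by force
    show "\<forall>\<^sub>F n in sequentially. trunc' n (f x) * a j x = an n j x"
      using \<eta>(5)[of x] by eventually_elim (simp add: an_def j)
  qed
  have "\<bar>fn n x\<bar> \<le> real (Suc n)" for n x using b1 trunc_bounds(3) order_trans by blast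
  moreover have "fn n x = 0" if "x \<notin> K n" for n x using K(2)[OF that] by (simp add: fn_def)
  ultimately have "truncating_sequence f a fn an K (max C 0)"
    unfolding truncating_sequence_def by (intro conjI allI impI w loc b2 K(1) C l1 l2) auto
  then show ?thesis by blast
qed

lemma sq_bound: "\<bar>u\<bar> \<le> \<bar>p\<bar> + C * \<bar>q\<bar> \<Longrightarrow> C \<ge> 0 \<Longrightarrow> u\<^sup>2 \<le> 2 * p\<^sup>2 + 2 * C\<^sup>2 * q\<^sup>2" for u p q C :: real
proof -
  assume u: "\<bar>u\<bar> \<le> \<bar>p\<bar> + C * \<bar>q\<bar>" and C: "C \<ge> 0"
  have "u\<^sup>2 \<le> (\<bar>p\<bar> + C * \<bar>q\<bar>)\<^sup>2" using u by (simp add: abs_le_square_iff[symmetric])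
  also have "\<dots> \<le> 2 * p\<^sup>2 + 2 * C\<^sup>2 * q\<^sup>2"
  proof -
    have "0 \<le> (\<bar>p\<bar> - C * \<bar>q\<bar>)\<^sup>2" by simp
    then show ?thesis by (simp add: power2_sum power2_diff power_mult_distrib)
  qed
  finally show ?thesis .
qed

lemma pot_nonneg: "AE x in \<mu>. pot x + m \<ge> 0"
  using pot_ge by eventually_elim simp

text \<open>Passing to the limit in the energy identity: the truncated energies are bounded, so Fatou's lemma
  gives the missing integrability, after which dominated convergence applies.\<close>

lemma weighted_to_schroedinger:
  assumes f: "f \<in> L1loc" "integrable \<mu> (\<lambda>x. w x * (f x)\<^sup>2)"
    and a: "\<And>j. j < \<nu> \<Longrightarrow> wd (X j) f (a j)" "\<And>j. j < \<nu> \<Longrightarrow> integrable \<mu> (\<lambda>x. w x * (a j x)\<^sup>2)"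
  defines "F \<equiv> \<lambda>x. f x * sqrt (w x)"
    and "b \<equiv> \<lambda>j x. sqrt (w x) * a j x + f x * sqrt (w x) * q j x / 2"
  shows "F \<in> L2" "\<And>j. j < \<nu> \<Longrightarrow> wd (X j) F (b j)" "\<And>j. j < \<nu> \<Longrightarrow> b j \<in> L2"
    "integrable \<mu> (\<lambda>x. (pot x + m) * (F x)\<^sup>2)"
    "(\<integral>x. (\<Sum>j<\<nu>. (b j x)\<^sup>2) + (pot x + m) * (F x)\<^sup>2 \<partial>\<mu>) = (\<integral>x. (\<Sum>j<\<nu>. w x * (a j x)\<^sup>2) + m * (w x * (f x)\<^sup>2) \<partial>\<mu>)"
proof -
  have aL: "a j \<in> L1loc" if "j < \<nu>" for j using a(1)[OF that] by (simp add: wd_iff)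
  have am: "a j \<in> borel_measurable \<mu>" if "j < \<nu>" for j using L1locD(1)[OF aL[OF that]] .
  note [measurable] = L1locD(1)[OF f(1)]
  obtain fn an K C where "truncating_sequence f a fn an K C"
    using truncation[OF f(1) a(1)] by blast
  note tr = truncating_sequenceD[OF this]
  have anm: "an n j \<in> borel_measurable \<mu>" if "j < \<nu>" for n j using tr(1)[OF that, of n] by (auto simp: wd_iff L1locD(1))
  have fnm [measurable]: "fn n \<in> borel_measurable \<mu>" for n by (rule L1locD(1)[OF tr(2)])
  have Fm [measurable]: "F \<in> borel_measurable \<mu>" unfolding F_def by measurable
  have Fsq: "(F x)\<^sup>2 = w x * (f x)\<^sup>2" for x by (simp add: F_def power_mult_distrib sqrt_sq mult.commute)
  show F2: "F \<in> L2" using f(2) Fm by (simp add: L2_def Fsq)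
  \<comment> \<open>\<open>B j\<close> is the weighted gradient of \<open>f\<close>; it differs from
    the derivative \<open>b j\<close> of \<open>F\<close> by \<open>F q / 2\<close>.\<close>
  define B where "B j x = sqrt (w x) * a j x" for j x
  have Bsq: "(B j x)\<^sup>2 = w x * (a j x)\<^sup>2" for j x by (simp add: B_def power_mult_distrib sqrt_sq)
  have B2: "B j \<in> L2" if j: "j < \<nu>" for j
  proof -
    note [measurable] = am[OF j]
    have "B j \<in> borel_measurable \<mu>" unfolding B_def[abs_def] by measurable
    then show ?thesis using a(2)[OF j] by (simp add: L2_def Bsq)
  qed
  define Fn where "Fn n x = fn n x * sqrt (w x)" for n x
  define Bn where "Bn n j x = sqrt (w x) * an n j x" for n j x
  define bn where "bn n j x = Bn n j x + Fn n x * q j x / 2" for n j x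
  have Fnm [measurable]: "Fn n \<in> borel_measurable \<mu>" for n unfolding Fn_def[abs_def] by measurable
  have Fn_le: "\<bar>Fn n x\<bar> \<le> \<bar>F x\<bar>" for n x
    using w_pos[of x] tr(4)[of n x] by (simp add: Fn_def F_def abs_mult mult_right_mono)
  have Fn2: "Fn n \<in> L2" for n by (rule L2_bound[OF F2 Fnm]) (use Fn_le in auto)
  have Bn_le: "\<bar>Bn n j x\<bar> \<le> \<bar>B j x\<bar> + C * \<bar>F x\<bar>" if "j < \<nu>" for n j x
  proof -
    have "sqrt (w x) * \<bar>an n j x\<bar> \<le> sqrt (w x) * (\<bar>a j x\<bar> + C * \<bar>f x\<bar>)"
      by (intro mult_left_mono tr(7) that) (use w_pos[of x] in auto)
    then show ?thesis using w_pos[of x] by (simp add: Bn_def B_def F_def abs_mult algebra_simps)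
  qed
  have Bn2: "Bn n j \<in> L2" if j: "j < \<nu>" for n j
  proof (rule L2_bound[OF L2_add[OF L2_abs[OF B2[OF j]] L2_cmult[OF L2_abs[OF F2], of C]]])
    note [measurable] = anm[OF j]
    show "Bn n j \<in> borel_measurable \<mu>" unfolding Bn_def[abs_def] by measurable
    show "AE x in \<mu>. \<bar>Bn n j x\<bar> \<le> \<bar>\<bar>B j x\<bar> + C * \<bar>F x\<bar>\<bar>" using Bn_le[OF j] order_trans[OF _ abs_ge_self] by blast
  qed
  \<comment> \<open>With \<open>fn n\<close> bounded, what is used is local square integrability of
    the gradient of \<open>w\<close> divided by its square root.\<close>
  have Fq: "(\<lambda>x. Fn n x * q j x) \<in> L2" if j: "j < \<nu>" for n j
  proof -
    note [measurable] = q_meas[OF j]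
    have "(\<lambda>x. fn n x * (sqrt (w x) * q j x)) \<in> L2"
      by (rule bounded_support_L2[OF fnm tr(5) tr(6) tr(3) _ sqrt_q_sq_loc[OF j]]) measurable
    then show ?thesis by (simp add: Fn_def mult.assoc)
  qed
  have bn2: "bn n j \<in> L2" if j: "j < \<nu>" for n j
    unfolding bn_def[abs_def] using L2_add[OF Bn2[OF j] L2_cmult[OF Fq[OF j], of "1/2"]] by simp
  have wdn: "wd (X j) (Fn n) (bn n j)" if j: "j < \<nu>" for n j
  proof -
    have "wd (X j) (\<lambda>x. fn n x * exp ((1/2) * v x)) (\<lambda>x. exp ((1/2) * v x) * an n j x + 1/2 * (fn n x * exp ((1/2) * v x) * q j x))"
    proof (rule wd_mult_exp[OF j tr(1)[OF j] tr(3)])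
      show "(\<lambda>x. exp ((1/2) * v x)) \<in> L1loc" unfolding exp_half by (rule sqrt_loc)
      show "(\<lambda>x. exp ((1/2) * v x) * an n j x) \<in> L1loc"
        unfolding exp_half using Bn2[OF j, of n] L1loc_of_sq[OF L2D(1) integrable_L1loc[OF L2D(2)]]
        by (simp add: Bn_def[abs_def])
      show "(\<lambda>x. exp ((1/2) * v x) * q j x) \<in> L1loc" unfolding exp_half by (rule sqrt_q_loc[OF j])
    qed
    then show ?thesis unfolding exp_half by (simp add: Fn_def[abs_def] bn_def[abs_def] Bn_def[abs_def])
  qed
  \<comment> \<open>The weight contained in the square of \<open>Fn\<close> turns \<open>lv\<close>
    into \<open>l\<close> plus the sum of the \<open>(h j)\<^sup>2 / w\<close>, all of them locally
    integrable.\<close>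
  have lvi: "integrable \<mu> (\<lambda>x. (Fn n x)\<^sup>2 * lv x)" for n
  proof -
    have L: "(\<lambda>x. \<bar>l x\<bar> + (\<Sum>j<\<nu>. (h j x)\<^sup>2 / w x)) \<in> L1loc"
      by (intro L1loc_add L1loc_abs l_loc L1loc_sum h_sqrt) auto
    have [measurable]: "lv \<in> borel_measurable \<mu>" using L1locD(1)[OF lv_loc] .
    show ?thesis
    proof (rule L1loc_integrable[OF L _ tr(5)[of n]])
      have "\<bar>(Fn n x)\<^sup>2 * lv x\<bar> \<le> (real (Suc n))\<^sup>2 * indicator (K n) x * \<bar>\<bar>l x\<bar> + (\<Sum>j<\<nu>. (h j x)\<^sup>2 / w x)\<bar>" for x
      proof (cases "x \<in> K n")
        case True
        have nn: "(\<Sum>j<\<nu>. (h j x)\<^sup>2 / w x) \<ge> 0" using w_pos[of x] by (intro sum_nonneg) auto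
        have "w x * lv x = l x + (\<Sum>j<\<nu>. (h j x)\<^sup>2 / w x)"
          using w_pos[of x] by (simp add: lv_def qq_def q_def distrib_left sum_distrib_left power_divide power2_eq_square)
        then have "\<bar>w x * lv x\<bar> \<le> \<bar>l x\<bar> + (\<Sum>j<\<nu>. (h j x)\<^sup>2 / w x)" using nn by linarith
        moreover have "(fn n x)\<^sup>2 \<le> (real (Suc n))\<^sup>2" using tr(3)[of n x] by (simp add: abs_le_square_iff[symmetric])
        ultimately have "(fn n x)\<^sup>2 * \<bar>w x * lv x\<bar> \<le> (real (Suc n))\<^sup>2 * (\<bar>l x\<bar> + (\<Sum>j<\<nu>. (h j x)\<^sup>2 / w x))"
          by (intro mult_mono) auto
        moreover have "\<bar>(Fn n x)\<^sup>2 * lv x\<bar> = (fn n x)\<^sup>2 * \<bar>w x * lv x\<bar>"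
          using w_pos[of x] by (simp add: Fn_def power_mult_distrib abs_mult)
        ultimately show ?thesis using True nn by simp
      qed (simp add: Fn_def tr(6))
      then show "AE x in \<mu>. \<bar>(Fn n x)\<^sup>2 * lv x\<bar> \<le> (real (Suc n))\<^sup>2 * indicator (K n) x * \<bar>\<bar>l x\<bar> + (\<Sum>j<\<nu>. (h j x)\<^sup>2 / w x)\<bar>" by blast
    qed measurable
  qed
  have FnL: "Fn n \<in> L1loc" for n by (rule L1loc_of_sq[OF Fnm integrable_L1loc[OF L2D(2)[OF Fn2]]])
  have Fn0: "Fn n x = 0" if "x \<notin> K n" for n x using tr(6)[OF that] by (simp add: Fn_def)
  have en: "integrable \<mu> (\<lambda>x. pot x * (Fn n x)\<^sup>2)"
    "(\<integral>x. (\<Sum>j<\<nu>. (bn n j x)\<^sup>2) + pot x * (Fn n x)\<^sup>2 \<partial>\<mu>) = (\<integral>x. (\<Sum>j<\<nu>. (bn n j x - Fn n x * q j x / 2)\<^sup>2) \<partial>\<mu>)" for n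
    by (rule energy_identity[OF tr(5) Fn0 wdn bn2 FnL Fq lvi]; assumption)+
  have Fni: "integrable \<mu> (\<lambda>x. m * (Fn n x)\<^sup>2)" for n by (intro integrable_mult_right L2D Fn2)
  have sbn: "integrable \<mu> (\<lambda>x. \<Sum>j<\<nu>. (bn n j x)\<^sup>2)" for n
    by (intro Bochner_Integration.integrable_sum) (use L2D(2)[OF bn2] in auto)
  have sBn: "integrable \<mu> (\<lambda>x. \<Sum>j<\<nu>. (Bn n j x)\<^sup>2)" for n
    by (intro Bochner_Integration.integrable_sum) (use L2D(2)[OF Bn2] in auto)
  define gn where "gn n x = (\<Sum>j<\<nu>. (bn n j x)\<^sup>2) + (pot x + m) * (Fn n x)\<^sup>2" for n x
  define g where "g x = (\<Sum>j<\<nu>. (b j x)\<^sup>2) + (pot x + m) * (F x)\<^sup>2" for x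
  have gni: "integrable \<mu> (gn n)" for n
  proof -
    have "integrable \<mu> (\<lambda>x. (\<Sum>j<\<nu>. (bn n j x)\<^sup>2) + (pot x * (Fn n x)\<^sup>2 + m * (Fn n x)\<^sup>2))"
      by (intro Bochner_Integration.integrable_add sbn en(1) Fni)
    then show ?thesis by (simp add: gn_def[abs_def] distrib_right)
  qed
  have gneq: "(\<integral>x. gn n x \<partial>\<mu>) = (\<integral>x. (\<Sum>j<\<nu>. (Bn n j x)\<^sup>2) + m * (Fn n x)\<^sup>2 \<partial>\<mu>)" for n
  proof -
    have "(\<integral>x. gn n x \<partial>\<mu>) = (\<integral>x. ((\<Sum>j<\<nu>. (bn n j x)\<^sup>2) + pot x * (Fn n x)\<^sup>2) + m * (Fn n x)\<^sup>2 \<partial>\<mu>)"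
      by (simp add: gn_def distrib_right add.assoc)
    also have "\<dots> = (\<integral>x. (\<Sum>j<\<nu>. (bn n j x)\<^sup>2) + pot x * (Fn n x)\<^sup>2 \<partial>\<mu>) + (\<integral>x. m * (Fn n x)\<^sup>2 \<partial>\<mu>)"
      by (intro Bochner_Integration.integral_add Bochner_Integration.integrable_add sbn en(1) Fni)
    also have "(\<integral>x. (\<Sum>j<\<nu>. (bn n j x)\<^sup>2) + pot x * (Fn n x)\<^sup>2 \<partial>\<mu>) = (\<integral>x. (\<Sum>j<\<nu>. (Bn n j x)\<^sup>2) \<partial>\<mu>)"
      unfolding en(2) by (simp add: bn_def)
    also have "\<dots> + (\<integral>x. m * (Fn n x)\<^sup>2 \<partial>\<mu>) = (\<integral>x. (\<Sum>j<\<nu>. (Bn n j x)\<^sup>2) + m * (Fn n x)\<^sup>2 \<partial>\<mu>)"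
      by (intro Bochner_Integration.integral_add[symmetric] sBn Fni)
    finally show ?thesis .
  qed
  \<comment> \<open>The coefficients come from \<open>sq_bound\<close>. Only \<open>B j\<close> and
    \<open>F\<close> occur, whose square integrability is known from the start.\<close>
  define dom where "dom x = (\<Sum>j<\<nu>. 2 * (B j x)\<^sup>2 + 2 * C\<^sup>2 * (F x)\<^sup>2) + m * (F x)\<^sup>2" for x
  have domi: "integrable \<mu> dom"
    unfolding dom_def[abs_def]
    by (intro Bochner_Integration.integrable_add Bochner_Integration.integrable_sum integrable_mult_right L2D F2 B2) auto
  have Fn_sq: "(Fn n x)\<^sup>2 \<le> (F x)\<^sup>2" for n x using Fn_le[of n x] by (simp add: abs_le_square_iff)
  have dom_le: "(\<Sum>j<\<nu>. (Bn n j x)\<^sup>2) + m * (Fn n x)\<^sup>2 \<le> dom x" for n x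
    unfolding dom_def
  proof (intro add_mono sum_mono mult_left_mono Fn_sq)
    fix j assume "j \<in> {..<\<nu>}"
    then show "(Bn n j x)\<^sup>2 \<le> 2 * (B j x)\<^sup>2 + 2 * C\<^sup>2 * (F x)\<^sup>2" by (intro sq_bound Bn_le tr(8)) auto
  qed (use m_pos in auto)
  have gn_le: "(\<integral>x. gn n x \<partial>\<mu>) \<le> (\<integral>x. dom x \<partial>\<mu>)" for n
    unfolding gneq using dom_le by (intro integral_mono Bochner_Integration.integrable_add sBn Fni domi) auto
  have lF: "(\<lambda>n. Fn n x) \<longlonglongrightarrow> F x" for x unfolding Fn_def F_def by (intro tendsto_intros tr)
  have lB: "(\<lambda>n. Bn n j x) \<longlonglongrightarrow> B j x" if "j < \<nu>" for j x unfolding Bn_def B_def by (intro tendsto_intros tr that)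
  have b_eq: "b j x = B j x + F x * q j x / 2" for j x by (simp add: b_def B_def F_def)
  have lb: "(\<lambda>n. bn n j x) \<longlonglongrightarrow> b j x" if "j < \<nu>" for j x unfolding bn_def b_eq by (intro tendsto_intros lB lF that) auto
  have bm: "b j \<in> borel_measurable \<mu>" if j: "j < \<nu>" for j
  proof -
    note [measurable] = am[OF j] q_meas[OF j]
    show ?thesis unfolding b_def by measurable
  qed
  have sbm: "(\<lambda>x. \<Sum>j<\<nu>. (b j x)\<^sup>2) \<in> borel_measurable \<mu>"
    by (intro borel_measurable_sum borel_measurable_power) (use bm in auto)
  have gm: "g \<in> borel_measurable \<mu>"
    using sbm unfolding g_def[abs_def] by measurable
  have lg: "(\<lambda>n. gn n x) \<longlonglongrightarrow> g x" for x
    unfolding gn_def g_def by (intro tendsto_intros lF lb) auto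
  have gi: "integrable \<mu> g"
  proof (rule fatou_integrable[where gn=gn, OF gm gni _ _ gn_le])
    show "AE x in \<mu>. gn n x \<ge> 0" for n
      using pot_nonneg by eventually_elim (auto simp: gn_def intro!: add_nonneg_nonneg sum_nonneg)
  qed (use lg in auto)
  show pF: "integrable \<mu> (\<lambda>x. (pot x + m) * (F x)\<^sup>2)"
  proof (rule Bochner_Integration.integrable_bound[OF gi])
    show "AE x in \<mu>. norm ((pot x + m) * (F x)\<^sup>2) \<le> norm (g x)"
      using pot_nonneg
    proof eventually_elim
      case (elim x)
      have "(\<Sum>j<\<nu>. (b j x)\<^sup>2) \<ge> 0" by (simp add: sum_nonneg)
      then show ?case using elim by (simp add: g_def)
    qed
  qed measurable
  show b2: "b j \<in> L2" if j: "j < \<nu>" for j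
  proof -
    have "integrable \<mu> (\<lambda>x. (b j x)\<^sup>2)"
    proof (rule Bochner_Integration.integrable_bound[OF gi])
      show "AE x in \<mu>. norm ((b j x)\<^sup>2) \<le> norm (g x)"
        using pot_nonneg
      proof eventually_elim
        case (elim x)
        have "(b j x)\<^sup>2 \<le> (\<Sum>j<\<nu>. (b j x)\<^sup>2)" by (rule member_le_sum) (use j in auto)
        moreover have "(pot x + m) * (F x)\<^sup>2 \<ge> 0" using elim by simp
        ultimately show ?case by (simp add: g_def)
      qed
    qed (use bm[OF j] in measurable)
    then show ?thesis using bm[OF j] by (simp add: L2_def)
  qed
  have Fq2: "(\<lambda>x. F x * q j x) \<in> L2" if j: "j < \<nu>" for j
    using L2_cmult[OF L2_diff[OF b2[OF j] B2[OF j]], of 2] by (simp add: b_eq)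
  have bn_le: "\<bar>bn n j x\<bar> \<le> \<bar>B j x\<bar> + C * \<bar>F x\<bar> + \<bar>F x * q j x\<bar>" if j: "j < \<nu>" for n j x
  proof -
    have "\<bar>Fn n x * q j x\<bar> \<le> \<bar>F x * q j x\<bar>" using Fn_le[of n x] by (simp add: abs_mult mult_right_mono)
    then show ?thesis using Bn_le[OF j, of n x] unfolding bn_def by linarith
  qed
  \<comment> \<open>With \<open>Fq2\<close> the derivatives \<open>bn n j\<close> have a
    square-integrable majorant, which upgrades bounded energies to convergent ones.\<close>
  define dj where "dj j x = \<bar>B j x\<bar> + C * \<bar>F x\<bar> + \<bar>F x * q j x\<bar>" for j x
  have dj2: "dj j \<in> L2" if j: "j < \<nu>" for j
    unfolding dj_def[abs_def] by (intro L2_add L2_cmult L2_abs B2 F2 Fq2 j)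
  show "wd (X j) F (b j)" if j: "j < \<nu>" for j
  proof (rule wd_limit[OF Xv[OF j] wdn[OF j] Fm _ _ _ bm[OF j]])
    show "AE x in \<mu>. (\<lambda>n. Fn n x) \<longlonglongrightarrow> F x" "AE x in \<mu>. (\<lambda>n. bn n j x) \<longlonglongrightarrow> b j x" using lF lb[OF j] by auto
    show "(\<lambda>x. \<bar>F x\<bar>) \<in> L1loc" by (intro L1loc_abs L1loc_of_sq[OF Fm integrable_L1loc[OF L2D(2)[OF F2]]])
    show "AE x in \<mu>. \<forall>n. \<bar>Fn n x\<bar> \<le> \<bar>F x\<bar>" using Fn_le by blast
    show "dj j \<in> L1loc" by (rule L1loc_of_sq[OF L2D(1) integrable_L1loc[OF L2D(2)]]) (rule dj2[OF j])+
    show "AE x in \<mu>. \<forall>n. \<bar>bn n j x\<bar> \<le> dj j x" using bn_le[OF j] by (simp add: dj_def)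
  qed
  have lim1: "(\<lambda>n. \<integral>x. gn n x \<partial>\<mu>) \<longlonglongrightarrow> (\<integral>x. g x \<partial>\<mu>)"
  proof (rule integral_dominated_convergence[OF gm])
    show "integrable \<mu> (\<lambda>x. (\<Sum>j<\<nu>. (dj j x)\<^sup>2) + (pot x + m) * (F x)\<^sup>2)"
      by (intro Bochner_Integration.integrable_add Bochner_Integration.integrable_sum pF) (use L2D(2)[OF dj2] in auto)
    show "AE x in \<mu>. norm (gn n x) \<le> (\<Sum>j<\<nu>. (dj j x)\<^sup>2) + (pot x + m) * (F x)\<^sup>2" for n
      using pot_nonneg
    proof eventually_elim
      case (elim x)
      have "gn n x \<ge> 0" using elim by (auto simp: gn_def intro!: add_nonneg_nonneg sum_nonneg)
      moreover have "gn n x \<le> (\<Sum>j<\<nu>. (dj j x)\<^sup>2) + (pot x + m) * (F x)\<^sup>2"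
        unfolding gn_def
      proof (intro add_mono sum_mono mult_left_mono Fn_sq elim)
        fix j assume "j \<in> {..<\<nu>}"
        then have "\<bar>bn n j x\<bar> \<le> \<bar>dj j x\<bar>" using bn_le[of j n x] by (simp add: dj_def)
        then show "(bn n j x)\<^sup>2 \<le> (dj j x)\<^sup>2" by (simp add: abs_le_square_iff)
      qed
      ultimately show ?case by simp
    qed
  qed (use lg borel_measurable_integrable[OF gni] in auto)
  have lim2: "(\<lambda>n. \<integral>x. (\<Sum>j<\<nu>. (Bn n j x)\<^sup>2) + m * (Fn n x)\<^sup>2 \<partial>\<mu>) \<longlonglongrightarrow> (\<integral>x. (\<Sum>j<\<nu>. (B j x)\<^sup>2) + m * (F x)\<^sup>2 \<partial>\<mu>)"
  proof (rule integral_dominated_convergence[OF _ _ domi])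
    show "AE x in \<mu>. (\<lambda>n. (\<Sum>j<\<nu>. (Bn n j x)\<^sup>2) + m * (Fn n x)\<^sup>2) \<longlonglongrightarrow> (\<Sum>j<\<nu>. (B j x)\<^sup>2) + m * (F x)\<^sup>2"
      by (intro AE_I2 tendsto_intros lB lF) auto
    have "norm ((\<Sum>j<\<nu>. (Bn n j x)\<^sup>2) + m * (Fn n x)\<^sup>2) \<le> dom x" for n x
    proof -
      have "(\<Sum>j<\<nu>. (Bn n j x)\<^sup>2) + m * (Fn n x)\<^sup>2 \<ge> 0" using m_pos by (intro add_nonneg_nonneg sum_nonneg) auto
      then show ?thesis using dom_le[of n x] by simp
    qed
    then show "AE x in \<mu>. norm ((\<Sum>j<\<nu>. (Bn n j x)\<^sup>2) + m * (Fn n x)\<^sup>2) \<le> dom x" for n by blast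
    show "(\<lambda>x. (\<Sum>j<\<nu>. (B j x)\<^sup>2) + m * (F x)\<^sup>2) \<in> borel_measurable \<mu>"
      by (intro borel_measurable_add borel_measurable_sum borel_measurable_power borel_measurable_times) (use L2D(1)[OF B2] in auto)
    show "(\<lambda>x. (\<Sum>j<\<nu>. (Bn n j x)\<^sup>2) + m * (Fn n x)\<^sup>2) \<in> borel_measurable \<mu>" for n
      using sBn Fni by auto
  qed
  have "(\<integral>x. g x \<partial>\<mu>) = (\<integral>x. (\<Sum>j<\<nu>. (B j x)\<^sup>2) + m * (F x)\<^sup>2 \<partial>\<mu>)"
    using LIMSEQ_unique[OF lim1 lim2[folded gneq]] .
  then show "(\<integral>x. (\<Sum>j<\<nu>. (b j x)\<^sup>2) + (pot x + m) * (F x)\<^sup>2 \<partial>\<mu>) = (\<integral>x. (\<Sum>j<\<nu>. w x * (a j x)\<^sup>2) + m * (w x * (f x)\<^sup>2) \<partial>\<mu>)"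
    by (simp add: g_def Bsq Fsq)
qed

text \<open>The energy identity read the other way: the Schroedinger energy is finite now and bounds
  the weighted gradients of the truncations. Since \<open>F\<close> itself is truncated, local
  integrability of the squares of \<open>q j\<close> and of \<open>lv\<close> takes the place of the
  weighted bounds.\<close>

lemma schroedinger_to_weighted:
  assumes F: "F \<in> L2" and b: "\<And>j. j < \<nu> \<Longrightarrow> wd (X j) F (b j)" "\<And>j. j < \<nu> \<Longrightarrow> b j \<in> L2"
    and p: "integrable \<mu> (\<lambda>x. (pot x + m) * (F x)\<^sup>2)"
  defines "f \<equiv> \<lambda>x. F x / sqrt (w x)"
    and "a \<equiv> \<lambda>j x. (b j x - F x * q j x / 2) / sqrt (w x)"
  shows "f \<in> L1loc" "integrable \<mu> (\<lambda>x. w x * (f x)\<^sup>2)" "\<And>j. j < \<nu> \<Longrightarrow> wd (X j) f (a j)"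
    "\<And>j. j < \<nu> \<Longrightarrow> integrable \<mu> (\<lambda>x. w x * (a j x)\<^sup>2)"
proof -
  note [measurable] = L2D(1)[OF F]
  have L1: "u \<in> L1loc" if "u \<in> L2" for u by (rule L1loc_of_sq[OF L2D(1)[OF that] integrable_L1loc[OF L2D(2)[OF that]]])
  \<comment> \<open>Local integrability of \<open>1 / w\<close> says that \<open>E\<close> is
    locally square integrable, so \<open>E\<close> times a function in \<open>L2\<close> is locally
    integrable.\<close>
  define E where "E x = 1 / sqrt (w x)" for x
  have Em [measurable]: "E \<in> borel_measurable \<mu>" unfolding E_def[abs_def] by measurable
  have E2: "(\<lambda>x. (E x)\<^sup>2) \<in> L1loc" unfolding E_def by (rule inv_sqrt_sq)
  have Eu: "(\<lambda>x. E x * u x) \<in> L1loc" if "u \<in> L2" for u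
    by (rule L1loc_mult_sq[OF Em E2 L2D(1)[OF that] integrable_L1loc[OF L2D(2)[OF that]]])
  have fE: "f x = F x * E x" for x by (simp add: f_def E_def)
  show "f \<in> L1loc" using Eu[OF F] unfolding fE[abs_def] by (simp add: mult.commute)
  have Esq: "w x * (E x)\<^sup>2 = 1" for x using w_pos[of x] by (simp add: E_def power_divide)
  have wsq: "w x * (u * E x)\<^sup>2 = u\<^sup>2" for x u using Esq[of x] by (simp add: power_mult_distrib mult.left_commute)
  show "integrable \<mu> (\<lambda>x. w x * (f x)\<^sup>2)" using L2D(2)[OF F] by (simp add: fE wsq)
  obtain fn an K C where "truncating_sequence F b fn an K C"
    using truncation[OF L1[OF F] b(1)] by blast
  note tr = truncating_sequenceD[OF this]
  have fnm [measurable]: "fn n \<in> borel_measurable \<mu>" for n by (rule L1locD(1)[OF tr(2)])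
  have anm: "an n j \<in> borel_measurable \<mu>" if "j < \<nu>" for n j using tr(1)[OF that, of n] by (auto simp: wd_iff L1locD(1))
  have an2: "an n j \<in> L2" if j: "j < \<nu>" for n j
  proof (rule L2_bound[OF L2_add[OF L2_abs[OF b(2)[OF j]] L2_cmult[OF L2_abs[OF F], of C]] anm[OF j]])
    show "AE x in \<mu>. \<bar>an n j x\<bar> \<le> \<bar>\<bar>b j x\<bar> + C * \<bar>F x\<bar>\<bar>" using tr(7)[OF j] order_trans[OF _ abs_ge_self] by blast
  qed
  have fq: "(\<lambda>x. fn n x * q j x) \<in> L2" if j: "j < \<nu>" for n j
    by (rule bounded_support_L2[OF fnm tr(5) tr(6) tr(3) q_meas[OF j] q_sq[OF j]])
  have lvi: "integrable \<mu> (\<lambda>x. (fn n x)\<^sup>2 * lv x)" for n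
  proof (rule L1loc_integrable[OF lv_loc _ tr(5)[of n]])
    have [measurable]: "lv \<in> borel_measurable \<mu>" using L1locD(1)[OF lv_loc] .
    show "(\<lambda>x. (fn n x)\<^sup>2 * lv x) \<in> borel_measurable \<mu>" by measurable
    have "\<bar>(fn n x)\<^sup>2 * lv x\<bar> \<le> (real (Suc n))\<^sup>2 * indicator (K n) x * \<bar>lv x\<bar>" for x
    proof (cases "x \<in> K n")
      case True
      have "(fn n x)\<^sup>2 \<le> (real (Suc n))\<^sup>2" using tr(3)[of n x] by (simp add: abs_le_square_iff[symmetric])
      then show ?thesis using True by (simp add: abs_mult mult_right_mono)
    qed (simp add: tr(6))
    then show "AE x in \<mu>. \<bar>(fn n x)\<^sup>2 * lv x\<bar> \<le> (real (Suc n))\<^sup>2 * indicator (K n) x * \<bar>lv x\<bar>" by blast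
  qed
  have en: "integrable \<mu> (\<lambda>x. pot x * (fn n x)\<^sup>2)"
    "(\<integral>x. (\<Sum>j<\<nu>. (an n j x)\<^sup>2) + pot x * (fn n x)\<^sup>2 \<partial>\<mu>) = (\<integral>x. (\<Sum>j<\<nu>. (an n j x - fn n x * q j x / 2)\<^sup>2) \<partial>\<mu>)" for n
    by (rule energy_identity[OF tr(5) tr(6) tr(1) an2 tr(2) fq lvi]; assumption)+
  define Bn where "Bn n j x = an n j x - fn n x * q j x / 2" for n j x
  define B where "B j x = b j x - F x * q j x / 2" for j x
  have Bn2: "Bn n j \<in> L2" if j: "j < \<nu>" for n j
    unfolding Bn_def[abs_def] using L2_diff[OF an2[OF j] L2_cmult[OF fq[OF j], of "1/2"]] by simp
  have Bm: "B j \<in> borel_measurable \<mu>" if j: "j < \<nu>" for j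
  proof -
    note [measurable] = q_meas[OF j] L2D(1)[OF b(2)[OF j]]
    show ?thesis unfolding B_def[abs_def] by measurable
  qed
  define dom where "dom x = (\<Sum>j<\<nu>. 2 * (b j x)\<^sup>2 + 2 * C\<^sup>2 * (F x)\<^sup>2) + (pot x + m) * (F x)\<^sup>2" for x
  have domi: "integrable \<mu> dom"
    unfolding dom_def[abs_def]
    by (intro Bochner_Integration.integrable_add Bochner_Integration.integrable_sum integrable_mult_right L2D F b p) auto
  have fn_sq: "(fn n x)\<^sup>2 \<le> (F x)\<^sup>2" for n x using tr(4)[of n x] by (simp add: abs_le_square_iff)
  have san: "integrable \<mu> (\<lambda>x. \<Sum>j<\<nu>. (an n j x)\<^sup>2)" for n
    by (intro Bochner_Integration.integrable_sum) (use L2D(2)[OF an2] in auto)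
  have bound: "(\<integral>x. (\<Sum>j<\<nu>. (Bn n j x)\<^sup>2) \<partial>\<mu>) \<le> (\<integral>x. dom x \<partial>\<mu>)" for n
  proof -
    have "(\<integral>x. (\<Sum>j<\<nu>. (Bn n j x)\<^sup>2) \<partial>\<mu>) = (\<integral>x. (\<Sum>j<\<nu>. (an n j x)\<^sup>2) + pot x * (fn n x)\<^sup>2 \<partial>\<mu>)"
      unfolding en(2) by (simp add: Bn_def)
    also have "\<dots> \<le> (\<integral>x. dom x \<partial>\<mu>)"
    proof (rule integral_mono_AE[OF Bochner_Integration.integrable_add[OF san en(1)] domi])
      show "AE x in \<mu>. (\<Sum>j<\<nu>. (an n j x)\<^sup>2) + pot x * (fn n x)\<^sup>2 \<le> dom x"
        using pot_nonneg
      proof eventually_elim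
        case (elim x)
        \<comment> \<open>Adding \<open>m\<close> first makes the coefficient nonnegative, and only
          then may \<open>fn n\<close> be replaced by the larger \<open>F\<close>.\<close>
        have "pot x * (fn n x)\<^sup>2 \<le> (pot x + m) * (fn n x)\<^sup>2" using m_pos by (intro mult_right_mono) auto
        also have "\<dots> \<le> (pot x + m) * (F x)\<^sup>2" using elim by (intro mult_left_mono fn_sq)
        finally have 1: "pot x * (fn n x)\<^sup>2 \<le> (pot x + m) * (F x)\<^sup>2" .
        have "(\<Sum>j<\<nu>. (an n j x)\<^sup>2) \<le> (\<Sum>j<\<nu>. 2 * (b j x)\<^sup>2 + 2 * C\<^sup>2 * (F x)\<^sup>2)"
          by (intro sum_mono sq_bound tr(7,8)) auto
        then show ?case using 1 unfolding dom_def by linarith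
      qed
    qed
    finally show ?thesis .
  qed
  have lB: "(\<lambda>n. Bn n j x) \<longlonglongrightarrow> B j x" if "j < \<nu>" for j x
    unfolding Bn_def B_def by (intro tendsto_intros tr that) auto
  have sBi: "integrable \<mu> (\<lambda>x. \<Sum>j<\<nu>. (B j x)\<^sup>2)"
  proof (rule fatou_integrable[OF _ _ _ _ bound])
    show "(\<lambda>x. \<Sum>j<\<nu>. (B j x)\<^sup>2) \<in> borel_measurable \<mu>"
      by (intro borel_measurable_sum borel_measurable_power) (use Bm in auto)
    show "integrable \<mu> (\<lambda>x. \<Sum>j<\<nu>. (Bn n j x)\<^sup>2)" for n
      by (intro Bochner_Integration.integrable_sum) (use L2D(2)[OF Bn2] in auto)
    show "AE x in \<mu>. (\<lambda>n. \<Sum>j<\<nu>. (Bn n j x)\<^sup>2) \<longlonglongrightarrow> (\<Sum>j<\<nu>. (B j x)\<^sup>2)"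
      by (intro AE_I2 tendsto_intros lB) auto
  qed (simp add: sum_nonneg)
  have B2: "B j \<in> L2" if j: "j < \<nu>" for j
  proof -
    have "integrable \<mu> (\<lambda>x. (B j x)\<^sup>2)"
    proof (rule Bochner_Integration.integrable_bound[OF sBi])
      have "norm ((B j x)\<^sup>2) \<le> norm (\<Sum>j<\<nu>. (B j x)\<^sup>2)" for x
      proof -
        have "(B j x)\<^sup>2 \<le> (\<Sum>j<\<nu>. (B j x)\<^sup>2)" by (rule member_le_sum) (use j in auto)
        then show ?thesis by simp
      qed
      then show "AE x in \<mu>. norm ((B j x)\<^sup>2) \<le> norm (\<Sum>j<\<nu>. (B j x)\<^sup>2)" by blast
    qed (use Bm[OF j] in measurable)
    then show ?thesis using Bm[OF j] by (simp add: L2_def)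
  qed
  have aE: "a j x = B j x * E x" for j x by (simp add: a_def B_def E_def)
  show "integrable \<mu> (\<lambda>x. w x * (a j x)\<^sup>2)" if j: "j < \<nu>" for j
    using L2D(2)[OF B2[OF j]] by (simp add: aE wsq)
  have Fq2: "(\<lambda>x. F x * q j x) \<in> L2" if j: "j < \<nu>" for j
    using L2_cmult[OF L2_diff[OF b(2)[OF j] B2[OF j]], of 2] by (simp add: B_def)
  show "wd (X j) f (a j)" if j: "j < \<nu>" for j
  proof (rule wd_limit[OF Xv[OF j]])
    note [measurable] = q_meas[OF j] Bm[OF j] anm[OF j] L2D(1)[OF b(2)[OF j]]
    show "wd (X j) (\<lambda>x. fn n x * E x) (\<lambda>x. E x * an n j x + (- (1/2)) * (fn n x * E x * q j x))" for n
    proof -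
      have "wd (X j) (\<lambda>x. fn n x * exp ((- (1/2)) * v x)) (\<lambda>x. exp ((- (1/2)) * v x) * an n j x + (- (1/2)) * (fn n x * exp ((- (1/2)) * v x) * q j x))"
      proof (rule wd_mult_exp[OF j tr(1)[OF j] tr(3)])
        show "(\<lambda>x. exp ((- (1/2)) * v x)) \<in> L1loc" unfolding exp_minus_half by (rule inv_sqrt_loc)
        show "(\<lambda>x. exp ((- (1/2)) * v x) * an n j x) \<in> L1loc"
          using Eu[OF an2[OF j]] unfolding exp_minus_half E_def .
        show "(\<lambda>x. exp ((- (1/2)) * v x) * q j x) \<in> L1loc"
          using L1loc_mult_sq[OF Em E2 q_meas[OF j] q_sq[OF j]] unfolding exp_minus_half E_def .
      qed
      then show ?thesis unfolding exp_minus_half E_def .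
    qed
    show "f \<in> borel_measurable \<mu>" unfolding fE[abs_def] by measurable
    show "a j \<in> borel_measurable \<mu>" unfolding aE[abs_def] by measurable
    have "(\<lambda>n. fn n x * E x) \<longlonglongrightarrow> F x * E x" for x by (intro tendsto_intros tr)
    then show "AE x in \<mu>. (\<lambda>n. fn n x * E x) \<longlonglongrightarrow> f x" by (simp add: fE)
    show "(\<lambda>x. \<bar>E x * F x\<bar>) \<in> L1loc" by (intro L1loc_abs Eu F)
    show "AE x in \<mu>. \<forall>n. \<bar>fn n x * E x\<bar> \<le> \<bar>E x * F x\<bar>"
      using tr(4) by (auto simp: abs_mult mult.commute[of "\<bar>E _\<bar>"] intro!: mult_right_mono)
    have "(\<lambda>n. E x * an n j x + (- (1/2)) * (fn n x * E x * q j x)) \<longlonglongrightarrow> E x * b j x + (- (1/2)) * (F x * E x * q j x)" for x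
      by (intro tendsto_intros tr j)
    moreover have "E x * b j x + (- (1/2)) * (F x * E x * q j x) = a j x" for x
      by (simp add: aE B_def algebra_simps)
    ultimately show "AE x in \<mu>. (\<lambda>n. E x * an n j x + (- (1/2)) * (fn n x * E x * q j x)) \<longlonglongrightarrow> a j x" by simp
    show "(\<lambda>x. \<bar>E x * (\<bar>b j x\<bar> + C * \<bar>F x\<bar>)\<bar> + \<bar>E x * (F x * q j x)\<bar>) \<in> L1loc"
      by (intro L1loc_add L1loc_abs Eu L2_add L2_cmult L2_abs b(2) F Fq2 j)
    have "\<bar>E x * an n j x + (- (1/2)) * (fn n x * E x * q j x)\<bar> \<le> \<bar>E x * (\<bar>b j x\<bar> + C * \<bar>F x\<bar>)\<bar> + \<bar>E x * (F x * q j x)\<bar>" for n x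
    proof -
      have 1: "\<bar>E x * an n j x\<bar> \<le> \<bar>E x * (\<bar>b j x\<bar> + C * \<bar>F x\<bar>)\<bar>"
        unfolding abs_mult[of "E x"] using order_trans[OF tr(7)[OF j] abs_ge_self] by (rule mult_left_mono) auto
      have "\<bar>fn n x\<bar> * (\<bar>E x\<bar> * \<bar>q j x\<bar>) \<le> \<bar>F x\<bar> * (\<bar>E x\<bar> * \<bar>q j x\<bar>)" by (intro mult_right_mono tr(4)) auto
      then have 2: "\<bar>fn n x * E x * q j x\<bar> \<le> \<bar>E x * (F x * q j x)\<bar>" by (simp add: abs_mult ac_simps)
      show ?thesis using 1 2 by linarith
    qed
    then show "AE x in \<mu>. \<forall>n. \<bar>E x * an n j x + (- (1/2)) * (fn n x * E x * q j x)\<bar> \<le> \<bar>E x * (\<bar>b j x\<bar> + C * \<bar>F x\<bar>)\<bar> + \<bar>E x * (F x * q j x)\<bar>"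
      by blast
  qed
qed

end

subsection \<open>Complex-valued functions and the intertwining property\<close>

lemma complex_split: "f = (\<lambda>x. complex_of_real (Re (f x)) + \<i> * complex_of_real (Im (f x)))"
  by (simp add: fun_eq_iff complex_eq[symmetric])

lemma complex_integrable_iff:
  "integrable M f \<longleftrightarrow> integrable M (\<lambda>x. Re (f x)) \<and> integrable M (\<lambda>x. Im (f x))" for f :: "'a \<Rightarrow> complex"
proof
  assume "integrable M (\<lambda>x. Re (f x)) \<and> integrable M (\<lambda>x. Im (f x))"
  then have "integrable M (\<lambda>x. complex_of_real (Re (f x)) + \<i> * complex_of_real (Im (f x)))"
    by (intro Bochner_Integration.integrable_add integrable_mult_right integrable_of_real) auto
  then show "integrable M f" using complex_split[of f] by simp
qed auto

context lie_haar
begin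

lemma complex_L1loc_iff:
  fixes f :: "'g \<Rightarrow> complex"
  shows "f \<in> Lp_loc 1 \<mu> \<longleftrightarrow> (\<lambda>x. Re (f x)) \<in> L1loc \<and> (\<lambda>x. Im (f x)) \<in> L1loc"
proof -
  have "set_integrable \<mu> K (\<lambda>x. norm (f x) ^ 1) \<longleftrightarrow> set_integrable \<mu> K (\<lambda>x. Re (f x)) \<and> set_integrable \<mu> K (\<lambda>x. Im (f x))"
    if f: "f \<in> borel_measurable \<mu>" and K: "compact K" for K
  proof -
    note [measurable] = f
    have [measurable]: "K \<in> sets borel" using compact_imp_closed[OF K] by auto
    have "set_integrable \<mu> K (\<lambda>x. norm (f x) ^ 1) \<longleftrightarrow> integrable \<mu> (\<lambda>x. norm (indicator K x *\<^sub>R f x))"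
      by (simp add: set_integrable_def)
    also have "\<dots> \<longleftrightarrow> integrable \<mu> (\<lambda>x. indicator K x *\<^sub>R f x)" by (rule integrable_norm_iff) measurable
    also have "\<dots> \<longleftrightarrow> set_integrable \<mu> K (\<lambda>x. Re (f x)) \<and> set_integrable \<mu> K (\<lambda>x. Im (f x))"
      unfolding complex_integrable_iff[of \<mu> "\<lambda>x. indicator K x *\<^sub>R f x"] by (simp add: set_integrable_def)
    finally show ?thesis .
  qed
  then show ?thesis unfolding L1loc_iff Lp_loc_def mem_Collect_eq borel_measurable_complex_iff by blast
qed

text \<open>Test functions and \<open>vf_adjoint\<close> are real, so real and imaginary parts
  decouple.\<close>

lemma complex_wd_iff:
  fixes f h :: "'g \<Rightarrow> complex"
  assumes X: "X \<in> vector_fields A"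
  shows "has_weak_deriv G A \<mu> \<delta> X f h \<longleftrightarrow> wd X (\<lambda>x. Re (f x)) (\<lambda>x. Re (h x)) \<and> wd X (\<lambda>x. Im (f x)) (\<lambda>x. Im (h x))"
proof -
  have i: "integrable \<mu> (\<lambda>x. \<psi> x *\<^sub>R u x)" if "\<psi> \<in> test_funs A" "u \<in> Lp_loc 1 \<mu>" for \<psi> and u :: "'g \<Rightarrow> complex"
    using that test_integrable_mult unfolding complex_integrable_iff[of \<mu> "\<lambda>x. \<psi> x *\<^sub>R u x"] complex_L1loc_iff by simp
  have e: "(\<integral>x. \<psi> x *\<^sub>R u x \<partial>\<mu>) = (\<integral>x. \<phi> x *\<^sub>R k x \<partial>\<mu>) \<longleftrightarrow>
     (\<integral>x. \<psi> x * Re (u x) \<partial>\<mu>) = (\<integral>x. \<phi> x * Re (k x) \<partial>\<mu>) \<and> (\<integral>x. \<psi> x * Im (u x) \<partial>\<mu>) = (\<integral>x. \<phi> x * Im (k x) \<partial>\<mu>)"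
    if "\<psi> \<in> test_funs A" "u \<in> Lp_loc 1 \<mu>" "\<phi> \<in> test_funs A" "k \<in> Lp_loc 1 \<mu>" for \<psi> \<phi> and u k :: "'g \<Rightarrow> complex"
    using integral_Re[OF i[OF that(1,2)]] integral_Im[OF i[OF that(1,2)]]
      integral_Re[OF i[OF that(3,4)]] integral_Im[OF i[OF that(3,4)]]
    by (simp add: complex_eq_iff)
  show ?thesis
  proof (cases "f \<in> Lp_loc 1 \<mu> \<and> h \<in> Lp_loc 1 \<mu>")
    case True
    then have "has_weak_deriv G A \<mu> \<delta> X f h \<longleftrightarrow> (\<forall>\<phi>\<in>test_funs A.
       (\<integral>x. vf_adjoint G \<delta> X \<phi> x * Re (f x) \<partial>\<mu>) = (\<integral>x. \<phi> x * Re (h x) \<partial>\<mu>) \<and>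
       (\<integral>x. vf_adjoint G \<delta> X \<phi> x * Im (f x) \<partial>\<mu>) = (\<integral>x. \<phi> x * Im (h x) \<partial>\<mu>))"
      using e[OF vf_adjoint_test[OF X]] unfolding has_weak_deriv_def dist_rep_def by blast
    then show ?thesis using True unfolding complex_L1loc_iff wd_iff by blast
  next
    case False
    then show ?thesis unfolding has_weak_deriv_def[of _ _ _ _ _ f] dist_rep_def[of _ _ _ f] wd_iff complex_L1loc_iff by blast
  qed
qed

lemma complex_wd_unique:
  fixes f :: "'g \<Rightarrow> complex"
  assumes X: "X \<in> vector_fields A" and "has_weak_deriv G A \<mu> \<delta> X f h" "has_weak_deriv G A \<mu> \<delta> X f h'"
  shows "AE x in \<mu>. h x = h' x"
proof -
  have "AE x in \<mu>. Re (h x) = Re (h' x)" "AE x in \<mu>. Im (h x) = Im (h' x)"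
    using assms(2,3) wd_unique unfolding complex_wd_iff[OF X] by blast+
  then show ?thesis by eventually_elim (simp add: complex_eq_iff)
qed

lemma complex_weak_deriv:
  fixes f :: "'g \<Rightarrow> complex"
  assumes X: "X \<in> vector_fields A" and w: "has_weak_deriv G A \<mu> \<delta> X f h"
  shows "weak_deriv G A \<mu> \<delta> X f \<in> borel_measurable \<mu>" "AE x in \<mu>. weak_deriv G A \<mu> \<delta> X f x = h x"
proof -
  have s: "has_weak_deriv G A \<mu> \<delta> X f (weak_deriv G A \<mu> \<delta> X f)"
    unfolding weak_deriv_def by (rule someI[where x = h]) (rule w)
  then show "weak_deriv G A \<mu> \<delta> X f \<in> borel_measurable \<mu>"
    by (simp add: has_weak_deriv_def dist_rep_def Lp_loc_def)
  show "AE x in \<mu>. weak_deriv G A \<mu> \<delta> X f x = h x" by (rule complex_wd_unique[OF X s w])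
qed

lemma complex_L2_iff:
  fixes f :: "'g \<Rightarrow> complex"
  shows "f \<in> Lp 2 \<mu> \<longleftrightarrow> (\<lambda>x. Re (f x)) \<in> L2 \<and> (\<lambda>x. Im (f x)) \<in> L2"
proof
  assume "f \<in> Lp 2 \<mu>"
  then have f: "f \<in> borel_measurable \<mu>" "integrable \<mu> (\<lambda>x. (norm (f x))\<^sup>2)" by (auto simp: Lp_def)
  note [measurable] = f(1)
  have "integrable \<mu> (\<lambda>x. (Re (f x))\<^sup>2)" "integrable \<mu> (\<lambda>x. (Im (f x))\<^sup>2)"
    by (rule Bochner_Integration.integrable_bound[OF f(2)]; simp add: cmod_power2)+
  then show "(\<lambda>x. Re (f x)) \<in> L2 \<and> (\<lambda>x. Im (f x)) \<in> L2" by (simp add: L2_def)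
next
  assume "(\<lambda>x. Re (f x)) \<in> L2 \<and> (\<lambda>x. Im (f x)) \<in> L2"
  then show "f \<in> Lp 2 \<mu>" by (auto simp: L2_def Lp_def cmod_power2 borel_measurable_complex_iff)
qed

end

context weighted_pot
begin

text \<open>Carrying gradient representatives as an explicit second argument makes the domain
  visibly linear and keeps the choice operator of \<open>weak_deriv\<close> out of the real-valued
  argument.\<close>

definition wdom :: "('g \<Rightarrow> real) \<Rightarrow> (nat \<Rightarrow> 'g \<Rightarrow> real) \<Rightarrow> bool" where
  "wdom f a \<longleftrightarrow> f \<in> borel_measurable \<mu> \<and> integrable \<mu> (\<lambda>x. w x * (f x)\<^sup>2) \<and>
     (\<forall>j<\<nu>. wd (X j) f (a j) \<and> integrable \<mu> (\<lambda>x. w x * (a j x)\<^sup>2))"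

definition sdom :: "('g \<Rightarrow> real) \<Rightarrow> (nat \<Rightarrow> 'g \<Rightarrow> real) \<Rightarrow> bool" where
  "sdom F b \<longleftrightarrow> F \<in> L2 \<and> (\<forall>j<\<nu>. wd (X j) F (b j) \<and> b j \<in> L2) \<and> integrable \<mu> (\<lambda>x. (pot x + m) * (F x)\<^sup>2)"

text \<open>The gradient of \<open>f\<close> times the square root of \<open>w\<close>, by the
  product rule: the logarithmic derivative of that root is \<open>q j / 2\<close>.\<close>

definition conj_deriv :: "('g \<Rightarrow> real) \<Rightarrow> (nat \<Rightarrow> 'g \<Rightarrow> real) \<Rightarrow> nat \<Rightarrow> 'g \<Rightarrow> real" where
  "conj_deriv f a j x = sqrt (w x) * a j x + f x * sqrt (w x) * q j x / 2"

lemma sqrt_weight_L2: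
  assumes "f \<in> borel_measurable \<mu>"
  shows "(\<lambda>x. f x * sqrt (w x)) \<in> L2 \<longleftrightarrow> integrable \<mu> (\<lambda>x. w x * (f x)\<^sup>2)"
proof -
  have "(\<lambda>x. f x * sqrt (w x)) \<in> borel_measurable \<mu>" using assms by measurable
  then show ?thesis by (simp add: L2_def power_mult_distrib sqrt_sq mult.commute)
qed

text \<open>Writing \<open>f\<close> as the product of \<open>f x * sqrt (w x)\<close>, which is in
  \<open>L2\<close>, and \<open>1 / sqrt (w x)\<close>, which is locally square integrable, reduces
  the claim to a product of two such functions.\<close>

lemma weighted_L1loc:
  assumes f: "f \<in> borel_measurable \<mu>" "integrable \<mu> (\<lambda>x. w x * (f x)\<^sup>2)"
  shows "f \<in> L1loc"
proof -
  have F: "(\<lambda>x. f x * sqrt (w x)) \<in> L2" using sqrt_weight_L2[OF f(1)] f(2) by blast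
  have "(\<lambda>x. (f x * sqrt (w x)) * (1 / sqrt (w x))) \<in> L1loc"
    by (rule L1loc_mult_sq[OF L2D(1)[OF F] integrable_L1loc[OF L2D(2)[OF F]] _ inv_sqrt_sq]) measurable
  moreover have "(f x * sqrt (w x)) * (1 / sqrt (w x)) = f x" for x using w_pos[of x] by simp
  ultimately show ?thesis by simp
qed

lemma wdom_sdom:
  assumes "wdom f a"
  shows "sdom (\<lambda>x. f x * sqrt (w x)) (conj_deriv f a)"
    "(\<integral>x. (\<Sum>j<\<nu>. (conj_deriv f a j x)\<^sup>2) + (pot x + m) * (f x * sqrt (w x))\<^sup>2 \<partial>\<mu>)
      = (\<integral>x. (\<Sum>j<\<nu>. w x * (a j x)\<^sup>2) + m * (w x * (f x)\<^sup>2) \<partial>\<mu>)"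
proof -
  have f: "f \<in> borel_measurable \<mu>" "integrable \<mu> (\<lambda>x. w x * (f x)\<^sup>2)"
    and a: "\<And>j. j < \<nu> \<Longrightarrow> wd (X j) f (a j)" "\<And>j. j < \<nu> \<Longrightarrow> integrable \<mu> (\<lambda>x. w x * (a j x)\<^sup>2)"
    using assms by (auto simp: wdom_def)
  have c: "conj_deriv f a = (\<lambda>j x. sqrt (w x) * a j x + f x * sqrt (w x) * q j x / 2)"
    by (simp add: conj_deriv_def fun_eq_iff)
  show "sdom (\<lambda>x. f x * sqrt (w x)) (conj_deriv f a)"
    unfolding sdom_def c
    by (intro conjI allI impI; rule weighted_to_schroedinger[OF weighted_L1loc[OF f] f(2) a]; assumption)
  show "(\<integral>x. (\<Sum>j<\<nu>. (conj_deriv f a j x)\<^sup>2) + (pot x + m) * (f x * sqrt (w x))\<^sup>2 \<partial>\<mu>)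
      = (\<integral>x. (\<Sum>j<\<nu>. w x * (a j x)\<^sup>2) + m * (w x * (f x)\<^sup>2) \<partial>\<mu>)"
    unfolding c by (rule weighted_to_schroedinger[OF weighted_L1loc[OF f] f(2) a]; assumption)
qed

lemma sdom_wdom:
  assumes "sdom F b"
  shows "\<exists>a. wdom (\<lambda>x. F x / sqrt (w x)) a"
proof -
  have F: "F \<in> L2" "integrable \<mu> (\<lambda>x. (pot x + m) * (F x)\<^sup>2)"
    and b: "\<And>j. j < \<nu> \<Longrightarrow> wd (X j) F (b j)" "\<And>j. j < \<nu> \<Longrightarrow> b j \<in> L2"
    using assms by (auto simp: sdom_def)
  note r = schroedinger_to_weighted[OF F(1) b F(2)]
  have "(\<lambda>x. F x / sqrt (w x)) \<in> L1loc" by (rule r; assumption)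
  then have m: "(\<lambda>x. F x / sqrt (w x)) \<in> borel_measurable \<mu>" by (rule L1locD(1))
  have "wdom (\<lambda>x. F x / sqrt (w x)) (\<lambda>j x. (b j x - F x * q j x / 2) / sqrt (w x))"
    unfolding wdom_def by (intro conjI allI impI m; rule r; assumption)
  then show ?thesis by blast
qed

lemma wdom_L2:
  assumes "wdom f a"
  shows "(\<lambda>x. f x * sqrt (w x)) \<in> L2" "j < \<nu> \<Longrightarrow> (\<lambda>x. a j x * sqrt (w x)) \<in> L2"
proof -
  show "(\<lambda>x. f x * sqrt (w x)) \<in> L2" using assms sqrt_weight_L2 by (auto simp: wdom_def)
  assume j: "j < \<nu>"
  have "a j \<in> borel_measurable \<mu>" using assms j by (auto simp: wdom_def wd_iff L1locD(1))
  then show "(\<lambda>x. a j x * sqrt (w x)) \<in> L2" using assms sqrt_weight_L2 j by (auto simp: wdom_def)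
qed

lemma wdom_comb:
  assumes f: "wdom f a" and g: "wdom g c"
  shows "wdom (\<lambda>x. f x + t * g x) (\<lambda>j x. a j x + t * c j x)"
proof -
  have m: "f \<in> borel_measurable \<mu>" "g \<in> borel_measurable \<mu>" using f g by (auto simp: wdom_def)
  have am: "a j \<in> borel_measurable \<mu>" "c j \<in> borel_measurable \<mu>" if "j < \<nu>" for j
    using f g that by (auto simp: wdom_def wd_iff L1locD(1))
  have 1: "(\<lambda>x. (f x + t * g x) * sqrt (w x)) \<in> L2"
    using L2_add[OF wdom_L2(1)[OF f] L2_cmult[OF wdom_L2(1)[OF g], of t]] by (simp add: algebra_simps)
  have 2: "(\<lambda>x. (a j x + t * c j x) * sqrt (w x)) \<in> L2" if "j < \<nu>" for j
    using L2_add[OF wdom_L2(2)[OF f that] L2_cmult[OF wdom_L2(2)[OF g that], of t]] by (simp add: algebra_simps)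
  have 3: "wd (X j) (\<lambda>x. f x + t * g x) (\<lambda>x. a j x + t * c j x)" if "j < \<nu>" for j
    using wd_add[OF _ wd_cmult Xv[OF that]] f g that by (auto simp: wdom_def)
  have m1: "(\<lambda>x. f x + t * g x) \<in> borel_measurable \<mu>" using m by measurable
  have m2: "(\<lambda>x. a j x + t * c j x) \<in> borel_measurable \<mu>" if "j < \<nu>" for j
    using am[OF that] by measurable
  show ?thesis
    unfolding wdom_def
    by (intro conjI allI impI m1 3 iffD1[OF sqrt_weight_L2[OF m1] 1] iffD1[OF sqrt_weight_L2[OF m2] 2])
qed

text \<open>Difference of the bilinear integrands of the Schroedinger and the weighted form; its
  vanishing integral is the intertwining property for real functions.\<close>

definition defect :: "('g \<Rightarrow> real) \<Rightarrow> (nat \<Rightarrow> 'g \<Rightarrow> real) \<Rightarrow> ('g \<Rightarrow> real) \<Rightarrow> (nat \<Rightarrow> 'g \<Rightarrow> real) \<Rightarrow> 'g \<Rightarrow> real" where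
  "defect f a g c x = (\<Sum>j<\<nu>. conj_deriv f a j x * conj_deriv g c j x) + pot x * (w x * (f x * g x))
     - w x * (\<Sum>j<\<nu>. a j x * c j x)"

lemma defect_diag:
  assumes "wdom f a"
  shows "integrable \<mu> (defect f a f a)" "(\<integral>x. defect f a f a x \<partial>\<mu>) = 0"
proof -
  note r = wdom_sdom[OF assms]
  have F: "(\<lambda>x. f x * sqrt (w x)) \<in> L2" "integrable \<mu> (\<lambda>x. (pot x + m) * (f x * sqrt (w x))\<^sup>2)"
    and b: "\<And>j. j < \<nu> \<Longrightarrow> conj_deriv f a j \<in> L2"
    using r(1) by (auto simp: sdom_def)
  have i: "integrable \<mu> (\<lambda>x. w x * (f x)\<^sup>2)" "\<And>j. j < \<nu> \<Longrightarrow> integrable \<mu> (\<lambda>x. w x * (a j x)\<^sup>2)"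
    using assms by (auto simp: wdom_def)
  let ?P = "\<lambda>x. (\<Sum>j<\<nu>. (conj_deriv f a j x)\<^sup>2) + (pot x + m) * (f x * sqrt (w x))\<^sup>2"
  let ?Q = "\<lambda>x. (\<Sum>j<\<nu>. w x * (a j x)\<^sup>2) + m * (w x * (f x)\<^sup>2)"
  have P: "integrable \<mu> ?P"
    by (intro Bochner_Integration.integrable_add Bochner_Integration.integrable_sum F) (use L2D(2)[OF b] in auto)
  have Q: "integrable \<mu> ?Q"
    by (intro Bochner_Integration.integrable_add Bochner_Integration.integrable_sum integrable_mult_right i) auto
  \<comment> \<open>The terms with \<open>m\<close> cancel, since the square of
    \<open>f x * sqrt (w x)\<close> is \<open>w x * (f x)\<^sup>2\<close>.\<close>
  have e: "defect f a f a x = ?P x - ?Q x" for x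
    by (simp add: defect_def power_mult_distrib sqrt_sq power2_eq_square[symmetric] sum_distrib_left algebra_simps)
  show "integrable \<mu> (defect f a f a)" unfolding e[abs_def] using P Q by simp
  show "(\<integral>x. defect f a f a x \<partial>\<mu>) = 0" unfolding e using P Q r(2) by simp
qed

lemma conj_deriv_comb: "conj_deriv (\<lambda>x. f x + t * g x) (\<lambda>j x. a j x + t * c j x) j x = conj_deriv f a j x + t * conj_deriv g c j x"
  by (simp add: conj_deriv_def field_simps)

text \<open>The diagonal case is the equality of the quadratic forms; the mixed one follows by polarization.\<close>

lemma defect_zero:
  assumes f: "wdom f a" and g: "wdom g c"
  shows "integrable \<mu> (defect f a g c)" "(\<integral>x. defect f a g c x \<partial>\<mu>) = 0"
proof -
  let ?D = "\<lambda>t. defect (\<lambda>x. f x + t * g x) (\<lambda>j x. a j x + t * c j x) (\<lambda>x. f x + t * g x) (\<lambda>j x. a j x + t * c j x)"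
  note p = defect_diag[OF wdom_comb[OF f g, of 1]] and n = defect_diag[OF wdom_comb[OF f g, of "-1"]]
  have ex: "?D t x = defect f a f a x + 2 * t * defect f a g c x + t\<^sup>2 * defect g c g c x" for t x
    unfolding defect_def conj_deriv_comb
    by (simp add: algebra_simps power2_eq_square sum.distrib sum_distrib_left)
  have e: "defect f a g c x = (?D 1 x - ?D (-1) x) / 4" for x
    unfolding ex by simp
  show "integrable \<mu> (defect f a g c)" unfolding e[abs_def] using p(1) n(1) by simp
  show "(\<integral>x. defect f a g c x \<partial>\<mu>) = 0" unfolding e using p n by simp
qed

lemma weighted_Lp2_iff:
  fixes f :: "'g \<Rightarrow> complex"
  shows "f \<in> Lp 2 (weighted \<mu> w) \<longleftrightarrow> f \<in> borel_measurable \<mu> \<and> integrable \<mu> (\<lambda>x. w x * (Re (f x))\<^sup>2) \<and> integrable \<mu> (\<lambda>x. w x * (Im (f x))\<^sup>2)"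
proof (cases "f \<in> borel_measurable \<mu>")
  case True
  note [measurable] = True
  have w0: "AE x in \<mu>. 0 \<le> w x" using w_pos by (auto simp: less_imp_le)
  have "integrable (weighted \<mu> w) (\<lambda>x. (norm (f x))\<^sup>2) \<longleftrightarrow> integrable \<mu> (\<lambda>x. w x * (norm (f x))\<^sup>2)"
    unfolding weighted_def by (subst integrable_density[OF _ _ w0]) auto
  also have "\<dots> \<longleftrightarrow> integrable \<mu> (\<lambda>x. w x * (Re (f x))\<^sup>2) \<and> integrable \<mu> (\<lambda>x. w x * (Im (f x))\<^sup>2)"
  proof
    assume i: "integrable \<mu> (\<lambda>x. w x * (norm (f x))\<^sup>2)"
    have "w x * (Re (f x))\<^sup>2 \<le> w x * (norm (f x))\<^sup>2" "w x * (Im (f x))\<^sup>2 \<le> w x * (norm (f x))\<^sup>2" for x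
      using w_pos[of x] by (auto simp: cmod_power2 intro!: mult_left_mono)
    then have le: "norm (w x * (Re (f x))\<^sup>2) \<le> norm (w x * (norm (f x))\<^sup>2)" "norm (w x * (Im (f x))\<^sup>2) \<le> norm (w x * (norm (f x))\<^sup>2)" for x
      using w_pos[of x] by (auto simp: abs_mult)
    show "integrable \<mu> (\<lambda>x. w x * (Re (f x))\<^sup>2) \<and> integrable \<mu> (\<lambda>x. w x * (Im (f x))\<^sup>2)"
      by (intro conjI; rule Bochner_Integration.integrable_bound[OF i]) (use le in auto)
  next
    assume "integrable \<mu> (\<lambda>x. w x * (Re (f x))\<^sup>2) \<and> integrable \<mu> (\<lambda>x. w x * (Im (f x))\<^sup>2)"
    then have "integrable \<mu> (\<lambda>x. w x * (Re (f x))\<^sup>2 + w x * (Im (f x))\<^sup>2)" by auto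
    then show "integrable \<mu> (\<lambda>x. w x * (norm (f x))\<^sup>2)" by (simp add: cmod_power2 distrib_left)
  qed
  finally show ?thesis using True by (simp add: Lp_def weighted_def)
next
  case False
  then show ?thesis by (simp add: Lp_def weighted_def)
qed

lemma Dom_w_iff:
  "f \<in> Dom_w G A \<mu> \<delta> \<nu> X w \<longleftrightarrow> (\<exists>a c. wdom (\<lambda>x. Re (f x)) a \<and> wdom (\<lambda>x. Im (f x)) c)"
proof
  assume f: "f \<in> Dom_w G A \<mu> \<delta> \<nu> X w"
  then have "\<forall>j\<in>{..<\<nu>}. \<exists>k. has_weak_deriv G A \<mu> \<delta> (X j) f k \<and> k \<in> Lp 2 (weighted \<mu> w)"
    by (auto simp: Dom_w_def)
  then obtain k where k: "\<forall>j\<in>{..<\<nu>}. has_weak_deriv G A \<mu> \<delta> (X j) f (k j) \<and> k j \<in> Lp 2 (weighted \<mu> w)"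
    by (rule bchoice[THEN exE])
  have f2: "f \<in> Lp 2 (weighted \<mu> w)" using f by (simp add: Dom_w_def)
  have "wdom (\<lambda>x. Re (f x)) (\<lambda>j x. Re (k j x)) \<and> wdom (\<lambda>x. Im (f x)) (\<lambda>j x. Im (k j x))"
    using f2 k Xv unfolding wdom_def weighted_Lp2_iff by (auto simp: complex_wd_iff borel_measurable_complex_iff)
  then show "\<exists>a c. wdom (\<lambda>x. Re (f x)) a \<and> wdom (\<lambda>x. Im (f x)) c" by blast
next
  assume "\<exists>a c. wdom (\<lambda>x. Re (f x)) a \<and> wdom (\<lambda>x. Im (f x)) c"
  then obtain a c where ac: "wdom (\<lambda>x. Re (f x)) a" "wdom (\<lambda>x. Im (f x)) c" by blast
  have "has_weak_deriv G A \<mu> \<delta> (X j) f (\<lambda>x. Complex (a j x) (c j x)) \<and> (\<lambda>x. Complex (a j x) (c j x)) \<in> Lp 2 (weighted \<mu> w)"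
    if j: "j < \<nu>" for j
  proof
    show "has_weak_deriv G A \<mu> \<delta> (X j) f (\<lambda>x. Complex (a j x) (c j x))"
      using ac j by (simp add: complex_wd_iff[OF Xv[OF j]] wdom_def)
    then have "(\<lambda>x. Complex (a j x) (c j x)) \<in> borel_measurable \<mu>"
      by (simp add: has_weak_deriv_def dist_rep_def Lp_loc_def)
    then show "(\<lambda>x. Complex (a j x) (c j x)) \<in> Lp 2 (weighted \<mu> w)"
      using ac j by (simp add: weighted_Lp2_iff wdom_def)
  qed
  moreover have "f \<in> Lp 2 (weighted \<mu> w)"
    using ac by (auto simp: weighted_Lp2_iff wdom_def borel_measurable_complex_iff)
  ultimately show "f \<in> Dom_w G A \<mu> \<delta> \<nu> X w" unfolding Dom_w_def by blast
qed

lemma Dom_V_iff: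
  assumes V: "V \<in> borel_measurable \<mu>" "AE x in \<mu>. V x = pot x"
  shows "F \<in> Dom_V G A \<mu> \<delta> \<nu> X V m \<longleftrightarrow> (\<exists>a c. sdom (\<lambda>x. Re (F x)) a \<and> sdom (\<lambda>x. Im (F x)) c)"
proof -
  note [measurable] = V(1)
  \<comment> \<open>In HOL the square root of a negative number is negative, so its square is an
    absolute value; the lower bound on the potential identifies it with \<open>pot x + m\<close>
    almost everywhere.\<close>
  have s: "(\<lambda>x. u x * sqrt (V x + m)) \<in> L2 \<longleftrightarrow> integrable \<mu> (\<lambda>x. (pot x + m) * (u x)\<^sup>2)" if u: "u \<in> borel_measurable \<mu>" for u
  proof -
    note [measurable] = u
    have m: "(\<lambda>x. u x * sqrt (V x + m)) \<in> borel_measurable \<mu>" by measurable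
    have "AE x in \<mu>. (u x * sqrt (V x + m))\<^sup>2 = (pot x + m) * (u x)\<^sup>2"
      using V(2) pot_nonneg by eventually_elim (simp add: power_mult_distrib mult.commute)
    then have "integrable \<mu> (\<lambda>x. (u x * sqrt (V x + m))\<^sup>2) \<longleftrightarrow> integrable \<mu> (\<lambda>x. (pot x + m) * (u x)\<^sup>2)"
      by (intro integrable_cong_AE) measurable
    then show ?thesis using m by (simp add: L2_def)
  qed
  have main: "(\<lambda>x. F x * of_real (sqrt (V x + m))) \<in> Lp 2 \<mu> \<longleftrightarrow>
     integrable \<mu> (\<lambda>x. (pot x + m) * (Re (F x))\<^sup>2) \<and> integrable \<mu> (\<lambda>x. (pot x + m) * (Im (F x))\<^sup>2)" if "F \<in> Lp 2 \<mu>" for F :: "'g \<Rightarrow> complex"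
    using that s unfolding complex_L2_iff by (auto simp: L2D(1))
  show ?thesis
  proof
    assume F: "F \<in> Dom_V G A \<mu> \<delta> \<nu> X V m"
    then have "\<forall>j\<in>{..<\<nu>}. \<exists>k. has_weak_deriv G A \<mu> \<delta> (X j) F k \<and> k \<in> Lp 2 \<mu>"
      by (auto simp: Dom_V_def)
    then obtain k where k: "\<forall>j\<in>{..<\<nu>}. has_weak_deriv G A \<mu> \<delta> (X j) F (k j) \<and> k j \<in> Lp 2 \<mu>"
      by (rule bchoice[THEN exE])
    have F2: "F \<in> Lp 2 \<mu>" "(\<lambda>x. F x * of_real (sqrt (V x + m))) \<in> Lp 2 \<mu>" using F by (auto simp: Dom_V_def)
    have "sdom (\<lambda>x. Re (F x)) (\<lambda>j x. Re (k j x)) \<and> sdom (\<lambda>x. Im (F x)) (\<lambda>j x. Im (k j x))"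
      using F2(1) main[OF F2(1)] F2(2) k Xv unfolding sdom_def complex_L2_iff[of F] by (auto simp: complex_wd_iff complex_L2_iff)
    then show "\<exists>a c. sdom (\<lambda>x. Re (F x)) a \<and> sdom (\<lambda>x. Im (F x)) c" by blast
  next
    assume "\<exists>a c. sdom (\<lambda>x. Re (F x)) a \<and> sdom (\<lambda>x. Im (F x)) c"
    then obtain a c where ac: "sdom (\<lambda>x. Re (F x)) a" "sdom (\<lambda>x. Im (F x)) c" by blast
    have "has_weak_deriv G A \<mu> \<delta> (X j) F (\<lambda>x. Complex (a j x) (c j x)) \<and> (\<lambda>x. Complex (a j x) (c j x)) \<in> Lp 2 \<mu>"
      if j: "j < \<nu>" for j
      using ac j by (simp add: complex_wd_iff[OF Xv[OF j]] sdom_def complex_L2_iff)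
    moreover have F2: "F \<in> Lp 2 \<mu>" using ac by (simp add: complex_L2_iff sdom_def)
    ultimately show "F \<in> Dom_V G A \<mu> \<delta> \<nu> X V m"
      unfolding Dom_V_def using main[OF F2] ac by (auto simp: sdom_def)
  qed
qed

text \<open>As \<open>w\<close> is positive everywhere, division by its square root inverts the map
  pointwise; the two sides therefore agree as sets of functions and not only up to null
  sets.\<close>

lemma image_Dom:
  assumes V: "V \<in> borel_measurable \<mu>" "AE x in \<mu>. V x = pot x"
  shows "mult_sqrt w ` Dom_w G A \<mu> \<delta> \<nu> X w = Dom_V G A \<mu> \<delta> \<nu> X V m"
proof
  show "mult_sqrt w ` Dom_w G A \<mu> \<delta> \<nu> X w \<subseteq> Dom_V G A \<mu> \<delta> \<nu> X V m"
  proof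
    fix F assume "F \<in> mult_sqrt w ` Dom_w G A \<mu> \<delta> \<nu> X w"
    then obtain f a c where f: "F = mult_sqrt w f" "wdom (\<lambda>x. Re (f x)) a" "wdom (\<lambda>x. Im (f x)) c"
      using Dom_w_iff by auto
    have "Re (F x) = Re (f x) * sqrt (w x)" "Im (F x) = Im (f x) * sqrt (w x)" for x
      by (simp_all add: f(1) mult_sqrt_def)
    then show "F \<in> Dom_V G A \<mu> \<delta> \<nu> X V m"
      using wdom_sdom(1)[OF f(2)] wdom_sdom(1)[OF f(3)] unfolding Dom_V_iff[OF V] by auto
  qed
  show "Dom_V G A \<mu> \<delta> \<nu> X V m \<subseteq> mult_sqrt w ` Dom_w G A \<mu> \<delta> \<nu> X w"
  proof
    fix F assume "F \<in> Dom_V G A \<mu> \<delta> \<nu> X V m"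
    then obtain a c where F: "sdom (\<lambda>x. Re (F x)) a" "sdom (\<lambda>x. Im (F x)) c"
      unfolding Dom_V_iff[OF V] by blast
    define f where "f x = F x / of_real (sqrt (w x))" for x
    have "Re (f x) = Re (F x) / sqrt (w x)" "Im (f x) = Im (F x) / sqrt (w x)" for x
      by (simp_all add: f_def)
    then have "f \<in> Dom_w G A \<mu> \<delta> \<nu> X w"
      using sdom_wdom[OF F(1)] sdom_wdom[OF F(2)] unfolding Dom_w_iff by auto
    moreover have "F = mult_sqrt w f"
    proof
      fix x show "F x = mult_sqrt w f x" using w_pos[of x] by (simp add: mult_sqrt_def f_def)
    qed
    ultimately show "F \<in> mult_sqrt w ` Dom_w G A \<mu> \<delta> \<nu> X w" by blast
  qed
qed

lemma forms_intertwined: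
  assumes V: "V \<in> borel_measurable \<mu>" "AE x in \<mu>. V x = pot x"
    and f: "f \<in> Dom_w G A \<mu> \<delta> \<nu> X w" and g: "g \<in> Dom_w G A \<mu> \<delta> \<nu> X w"
  shows "Q_V G A \<mu> \<delta> \<nu> X V (mult_sqrt w f) (mult_sqrt w g) = Q_w G A \<mu> \<delta> \<nu> X w f g"
proof -
  obtain a1 a2 where a: "wdom (\<lambda>x. Re (f x)) a1" "wdom (\<lambda>x. Im (f x)) a2" using f Dom_w_iff by auto
  obtain c1 c2 where c: "wdom (\<lambda>x. Re (g x)) c1" "wdom (\<lambda>x. Im (g x)) c2" using g Dom_w_iff by auto
  let ?f1 = "\<lambda>x. Re (f x)" and ?f2 = "\<lambda>x. Im (f x)" and ?g1 = "\<lambda>x. Re (g x)" and ?g2 = "\<lambda>x. Im (g x)"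
  define F where "F = mult_sqrt w f"
  define H where "H = mult_sqrt w g"
  note [measurable] = V(1)
  have fm [measurable]: "f \<in> borel_measurable \<mu>" "g \<in> borel_measurable \<mu>"
    using a c by (auto simp: wdom_def borel_measurable_complex_iff)
  have FH: "Re (F x) = ?f1 x * sqrt (w x)" "Im (F x) = ?f2 x * sqrt (w x)"
    "Re (H x) = ?g1 x * sqrt (w x)" "Im (H x) = ?g2 x * sqrt (w x)" for x
    by (simp_all add: F_def H_def mult_sqrt_def)
  have wdf: "has_weak_deriv G A \<mu> \<delta> (X j) f (\<lambda>x. Complex (a1 j x) (a2 j x))" if "j < \<nu>" for j
    using a that by (simp add: complex_wd_iff[OF Xv[OF that]] wdom_def)
  have wdg: "has_weak_deriv G A \<mu> \<delta> (X j) (\<lambda>y. cnj (g y)) (\<lambda>x. Complex (c1 j x) (- c2 j x))" if "j < \<nu>" for j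
    using c that wd_cmult[of "X j" ?g2 "c2 j" "-1"] by (simp add: complex_wd_iff[OF Xv[OF that]] wdom_def)
  have wdF: "has_weak_deriv G A \<mu> \<delta> (X j) F (\<lambda>x. Complex (conj_deriv ?f1 a1 j x) (conj_deriv ?f2 a2 j x))" if "j < \<nu>" for j
    using wdom_sdom(1)[OF a(1)] wdom_sdom(1)[OF a(2)] that
    by (simp add: complex_wd_iff[OF Xv[OF that]] sdom_def FH)
  have wdH: "has_weak_deriv G A \<mu> \<delta> (X j) (\<lambda>y. cnj (H y)) (\<lambda>x. Complex (conj_deriv ?g1 c1 j x) (- conj_deriv ?g2 c2 j x))" if "j < \<nu>" for j
    using wdom_sdom(1)[OF c(1)] wdom_sdom(1)[OF c(2)] that
      wd_cmult[of "X j" "\<lambda>x. ?g2 x * sqrt (w x)" "conj_deriv ?g2 c2 j" "-1"]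
    by (simp add: complex_wd_iff[OF Xv[OF that]] sdom_def FH)
  define Wi where "Wi x = complex_of_real (w x) * (\<Sum>j<\<nu>. Complex (a1 j x) (a2 j x) * Complex (c1 j x) (- c2 j x))" for x
  \<comment> \<open>Expanding (f1 + i f2)(g1 - i g2) into real and imaginary parts yields these four
    real defects.\<close>
  define Di where "Di x = complex_of_real (defect ?f1 a1 ?g1 c1 x + defect ?f2 a2 ?g2 c2 x)
     + \<i> * complex_of_real (defect ?f2 a2 ?g1 c1 x - defect ?f1 a1 ?g2 c2 x)" for x
  note d = defect_zero[OF a(1) c(1)] defect_zero[OF a(2) c(2)] defect_zero[OF a(2) c(1)] defect_zero[OF a(1) c(2)]
  have Di: "integrable \<mu> Di" "(\<integral>x. Di x \<partial>\<mu>) = 0"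
    using d unfolding Di_def[abs_def] by simp_all
  \<comment> \<open>Splitting the integral of \<open>Wi + Di\<close> requires integrability of
    \<open>Wi\<close> itself, which comes from the weighted L2 bounds on the gradients.\<close>
  have Wii: "integrable \<mu> Wi"
  proof -
    have p: "integrable \<mu> (\<lambda>x. complex_of_real (w x) * (Complex (a1 j x) (a2 j x) * Complex (c1 j x) (- c2 j x)))" if j: "j < \<nu>" for j
    proof -
      have pr: "integrable \<mu> (\<lambda>x. w x * (u x * u' x))" if "(\<lambda>x. u x * sqrt (w x)) \<in> L2" "(\<lambda>x. u' x * sqrt (w x)) \<in> L2" for u u'
      proof -
        have "(u x * sqrt (w x)) * (u' x * sqrt (w x)) = w x * (u x * u' x)" for x
          using sqrt_sq[of x] by (simp add: power2_eq_square algebra_simps)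
        then show ?thesis using L2_mult[OF that] by (simp only:)
      qed
      note L = wdom_L2(2)[OF a(1) j] wdom_L2(2)[OF a(2) j] wdom_L2(2)[OF c(1) j] wdom_L2(2)[OF c(2) j]
      have "integrable \<mu> (\<lambda>x. w x * (a1 j x * c1 j x) + w x * (a2 j x * c2 j x))"
        "integrable \<mu> (\<lambda>x. w x * (a2 j x * c1 j x) - w x * (a1 j x * c2 j x))"
        using pr L by auto
      then show ?thesis unfolding complex_integrable_iff[of \<mu> "\<lambda>x. complex_of_real (w x) * (Complex (a1 j x) (a2 j x) * Complex (c1 j x) (- c2 j x))"]
        by (simp add: algebra_simps)
    qed
    show ?thesis
      unfolding Wi_def[abs_def] sum_distrib_left by (intro Bochner_Integration.integrable_sum p) auto
  qed
  \<comment> \<open>The forms are defined with chosen representatives of the weak derivatives;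
    outside null sets these are exchanged for the explicit ones.\<close>
  have AEf: "AE x in \<mu>. \<forall>j\<in>{..<\<nu>}. weak_deriv G A \<mu> \<delta> (X j) f x = Complex (a1 j x) (a2 j x)"
    by (rule AE_finite_allI) (use complex_weak_deriv(2)[OF Xv wdf] in auto)
  have AEg: "AE x in \<mu>. \<forall>j\<in>{..<\<nu>}. weak_deriv G A \<mu> \<delta> (X j) (\<lambda>y. cnj (g y)) x = Complex (c1 j x) (- c2 j x)"
    by (rule AE_finite_allI) (use complex_weak_deriv(2)[OF Xv wdg] in auto)
  have AEF: "AE x in \<mu>. \<forall>j\<in>{..<\<nu>}. weak_deriv G A \<mu> \<delta> (X j) F x = Complex (conj_deriv ?f1 a1 j x) (conj_deriv ?f2 a2 j x)"
    by (rule AE_finite_allI) (use complex_weak_deriv(2)[OF Xv wdF] in auto)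
  have AEH: "AE x in \<mu>. \<forall>j\<in>{..<\<nu>}. weak_deriv G A \<mu> \<delta> (X j) (\<lambda>y. cnj (H y)) x = Complex (conj_deriv ?g1 c1 j x) (- conj_deriv ?g2 c2 j x)"
    by (rule AE_finite_allI) (use complex_weak_deriv(2)[OF Xv wdH] in auto)
  have gm: "grad_dot G A \<mu> \<delta> \<nu> X f (\<lambda>y. cnj (g y)) \<in> borel_measurable \<mu>"
    unfolding grad_dot_def[abs_def]
    by (intro borel_measurable_sum borel_measurable_times) (use complex_weak_deriv(1)[OF Xv wdf] complex_weak_deriv(1)[OF Xv wdg] in auto)
  have Gm: "grad_dot G A \<mu> \<delta> \<nu> X F (\<lambda>y. cnj (H y)) \<in> borel_measurable \<mu>"
    unfolding grad_dot_def[abs_def]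
    by (intro borel_measurable_sum borel_measurable_times) (use complex_weak_deriv(1)[OF Xv wdF] complex_weak_deriv(1)[OF Xv wdH] in auto)
  have w0: "AE x in \<mu>. 0 \<le> w x" using w_pos by (auto simp: less_imp_le)
  have "Q_w G A \<mu> \<delta> \<nu> X w f g = (\<integral>x. w x *\<^sub>R grad_dot G A \<mu> \<delta> \<nu> X f (\<lambda>y. cnj (g y)) x \<partial>\<mu>)"
    unfolding Q_w_def weighted_def by (rule integral_density[OF gm w_meas w0])
  also have "\<dots> = (\<integral>x. Wi x \<partial>\<mu>)"
  proof (rule integral_cong_AE)
    show "AE x in \<mu>. w x *\<^sub>R grad_dot G A \<mu> \<delta> \<nu> X f (\<lambda>y. cnj (g y)) x = Wi x"
      using AEf AEg by eventually_elim (simp add: grad_dot_def Wi_def scaleR_conv_of_real)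
  qed (use gm Wii in auto)
  finally have Qw: "Q_w G A \<mu> \<delta> \<nu> X w f g = (\<integral>x. Wi x \<partial>\<mu>)" .
  have "Q_V G A \<mu> \<delta> \<nu> X V F H = (\<integral>x. Wi x + Di x \<partial>\<mu>)"
    unfolding Q_V_def
  proof (rule integral_cong_AE)
    have [measurable]: "F \<in> borel_measurable \<mu>" "H \<in> borel_measurable \<mu>"
      unfolding F_def H_def mult_sqrt_def by measurable
    have [measurable]: "(\<lambda>x. cnj (H x)) \<in> borel_measurable \<mu>"
      by (rule measurable_compose[OF \<open>H \<in> borel_measurable \<mu>\<close> borel_measurable_continuous_onI]) (intro continuous_intros)
    show "(\<lambda>x. grad_dot G A \<mu> \<delta> \<nu> X F (\<lambda>y. cnj (H y)) x + of_real (V x) * F x * cnj (H x)) \<in> borel_measurable \<mu>"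
      by (intro borel_measurable_add Gm) measurable
    show "(\<lambda>x. Wi x + Di x) \<in> borel_measurable \<mu>" using Wii Di(1) by auto
    show "AE x in \<mu>. grad_dot G A \<mu> \<delta> \<nu> X F (\<lambda>y. cnj (H y)) x + of_real (V x) * F x * cnj (H x) = Wi x + Di x"
      using AEF AEH V(2)
    proof eventually_elim
      case (elim x)
      have s: "(a * sqrt (w x)) * (b * sqrt (w x)) = w x * (a * b)" for a b
        using sqrt_sq[of x] by (simp add: power2_eq_square mult.left_commute mult.commute)
      have g: "grad_dot G A \<mu> \<delta> \<nu> X F (\<lambda>y. cnj (H y)) x =
         (\<Sum>j<\<nu>. Complex (conj_deriv ?f1 a1 j x) (conj_deriv ?f2 a2 j x) * Complex (conj_deriv ?g1 c1 j x) (- conj_deriv ?g2 c2 j x))"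
        using elim(1,2) by (simp add: grad_dot_def)
      have 1: "Re (F x) * Re (H x) + Im (F x) * Im (H x) = w x * (?f1 x * ?g1 x) + w x * (?f2 x * ?g2 x)"
        by (simp only: FH s)
      have 2: "Im (F x) * Re (H x) - Re (F x) * Im (H x) = w x * (?f2 x * ?g1 x) - w x * (?f1 x * ?g2 x)"
        by (simp only: FH s)
      have R: "Re (of_real (V x) * F x * cnj (H x)) = pot x * (w x * (?f1 x * ?g1 x)) + pot x * (w x * (?f2 x * ?g2 x))"
        using arg_cong[OF 1, of "\<lambda>t. pot x * t"] elim(3) by (simp add: algebra_simps)
      have I: "Im (of_real (V x) * F x * cnj (H x)) = pot x * (w x * (?f2 x * ?g1 x)) - pot x * (w x * (?f1 x * ?g2 x))"
        using arg_cong[OF 2, of "\<lambda>t. pot x * t"] elim(3) by (simp add: algebra_simps)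
      show ?case
      proof (rule complex_eqI)
        show "Re (grad_dot G A \<mu> \<delta> \<nu> X F (\<lambda>y. cnj (H y)) x + of_real (V x) * F x * cnj (H x)) = Re (Wi x + Di x)"
          unfolding plus_complex.sel R g Wi_def Di_def defect_def
          by (simp add: Re_sum sum.distrib sum_distrib_left distrib_left)
        show "Im (grad_dot G A \<mu> \<delta> \<nu> X F (\<lambda>y. cnj (H y)) x + of_real (V x) * F x * cnj (H x)) = Im (Wi x + Di x)"
          unfolding plus_complex.sel I g Wi_def Di_def defect_def
          by (simp add: Im_sum sum.distrib sum_subtractf sum_negf sum_distrib_left distrib_left right_diff_distrib)
      qed
    qed
  qed
  also have "\<dots> = (\<integral>x. Wi x \<partial>\<mu>)" using Wii Di by simp
  finally show ?thesis using Qw by (simp add: F_def H_def)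
qed

lemma norms_preserved:
  assumes V: "V \<in> borel_measurable \<mu>" "AE x in \<mu>. V x = pot x" and f: "f \<in> Dom_w G A \<mu> \<delta> \<nu> X w"
  shows "form_norm m \<mu> (Q_V G A \<mu> \<delta> \<nu> X V) (mult_sqrt w f) = form_norm m (weighted \<mu> w) (Q_w G A \<mu> \<delta> \<nu> X w) f"
proof -
  have [measurable]: "f \<in> borel_measurable \<mu>" using f by (simp add: Dom_w_def Lp_def weighted_def)
  have w0: "AE x in \<mu>. 0 \<le> w x" using w_pos by (auto simp: less_imp_le)
  have "(norm (mult_sqrt w f x))\<^sup>2 = w x * (norm (f x))\<^sup>2" for x
    using w_pos[of x] by (simp add: mult_sqrt_def norm_mult power_mult_distrib)
  then have "(\<integral>x. (norm (mult_sqrt w f x))\<^sup>2 \<partial>\<mu>) = (\<integral>x. (norm (f x))\<^sup>2 \<partial>(weighted \<mu> w))"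
    unfolding weighted_def by (subst integral_density[OF _ _ w0]) auto
  then show ?thesis using forms_intertwined[OF V f f] by (simp add: form_norm_def)
qed

text \<open>A positive density has the same null sets as the original measure; on classes of
  functions the map is thereby well defined and injective.\<close>

lemma AE_weighted_iff:
  "(AE x in weighted \<mu> w. f x = g x) \<longleftrightarrow> (AE x in \<mu>. mult_sqrt w f x = mult_sqrt w g x)"
proof -
  have "mult_sqrt w f x = mult_sqrt w g x \<longleftrightarrow> f x = g x" for x using w_pos[of x] by (simp add: mult_sqrt_def)
  then show ?thesis unfolding weighted_def using w_pos by (subst AE_density) auto
qed

end

text \<open>Elements of the spaces are functions and not classes, so bijectivity on classes is
  expressed by two conjuncts: equality of the sets of functions and equivalence of the two notions
  of equality almost everywhere.\<close>

theorem proposition7p2: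
  fixes G :: "('g::{t2_space, second_countable_topology}) monoid"
    and A :: "('g, 'e::euclidean_space) chart set"
    and ip :: "'g vfield \<Rightarrow> 'g vfield \<Rightarrow> real"
    and H :: "'g vfield set"
    and \<nu> :: nat
    and X :: "nat \<Rightarrow> 'g vfield"
    and \<mu> :: "'g measure"
    and \<delta> w V :: "'g \<Rightarrow> real"
    and m :: real
  assumes "lie_group G A"
    and "connected (UNIV :: 'g set)"
    and "\<not> compact (UNIV :: 'g set)"
    and "sub_riemannian G A ip H \<nu> X"
    and "left_haar_measure G \<mu>"
    and "modular_function G \<mu> \<delta>"
    and "\<forall>x. w x > 0"
    and "w \<in> Lp_loc 1 \<mu>"
    and "(\<lambda>x. inverse (w x)) \<in> Lp_loc 1 \<mu>"
    and "\<forall>j<\<nu>. \<exists>h. has_weak_deriv G A \<mu> \<delta> (X j) w h \<and>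
           h \<in> times_space (\<lambda>x. sqrt (w x)) (Lp_loc 2 \<mu>) \<inter> times_space w (Lp_loc 2 \<mu>)"
    and "\<exists>h. has_weak_laplacian G A \<mu> \<delta> \<nu> X w h \<and>
           h \<in> Lp_loc 1 \<mu> \<inter> times_space w (Lp_loc 1 \<mu>)"
    and "V = potential G A \<mu> \<delta> \<nu> X w"
    and "m > 0"
    and "AE x in \<mu>. V x \<ge> - m + 1"
  shows "(mult_sqrt w ` Dom_w G A \<mu> \<delta> \<nu> X w = Dom_V G A \<mu> \<delta> \<nu> X V m) \<and>
     (\<forall>f \<in> Dom_w G A \<mu> \<delta> \<nu> X w. \<forall>g \<in> Dom_w G A \<mu> \<delta> \<nu> X w.
           (AE x in weighted \<mu> w. f x = g x) \<longleftrightarrow> (AE x in \<mu>. mult_sqrt w f x = mult_sqrt w g x)) \<and>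
     (\<forall>f \<in> Dom_w G A \<mu> \<delta> \<nu> X w.
           form_norm m \<mu> (Q_V G A \<mu> \<delta> \<nu> X V) (mult_sqrt w f)
             = form_norm m (weighted \<mu> w) (Q_w G A \<mu> \<delta> \<nu> X w) f) \<and>
     (\<forall>f \<in> Dom_w G A \<mu> \<delta> \<nu> X w. \<forall>g \<in> Dom_w G A \<mu> \<delta> \<nu> X w.
           Q_V G A \<mu> \<delta> \<nu> X V (mult_sqrt w f) (mult_sqrt w g) = Q_w G A \<mu> \<delta> \<nu> X w f g)"
proof -
  interpret lie_haar G A \<mu> \<delta>
    by unfold_locales (use assms in auto)
  have Xl: "X j \<in> lie_algebra G A" if "j < \<nu>" for j
  proof -
    have "X j \<in> vf.span (X ` {..<\<nu>})" using that by (intro vf.span_base) auto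
    then show ?thesis using assms(4) by (auto simp: sub_riemannian_def)
  qed
  have wp: "w x > 0" for x using assms(7) by simp
  have "\<forall>j\<in>{..<\<nu>}. \<exists>h. has_weak_deriv G A \<mu> \<delta> (X j) w h \<and>
           h \<in> times_space (\<lambda>x. sqrt (w x)) (Lp_loc 2 \<mu>) \<inter> times_space w (Lp_loc 2 \<mu>)"
    using assms(10) by auto
  then obtain h where h: "\<forall>j\<in>{..<\<nu>}. has_weak_deriv G A \<mu> \<delta> (X j) w (h j) \<and>
           h j \<in> times_space (\<lambda>x. sqrt (w x)) (Lp_loc 2 \<mu>) \<inter> times_space w (Lp_loc 2 \<mu>)"
    by (rule bchoice[THEN exE])
  obtain l where l: "has_weak_laplacian G A \<mu> \<delta> \<nu> X w l" "l \<in> times_space w (Lp_loc 1 \<mu>)"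
    using assms(11) by auto
  have sq: "(\<lambda>x. (F x)\<^sup>2) \<in> L1loc" if "F \<in> Lp_loc 2 \<mu>" for F :: "'g \<Rightarrow> real"
    using that by (auto simp: L1loc_iff Lp_loc_def)
  interpret weighted_lie G A \<mu> \<delta> \<nu> X w l h
  proof unfold_locales
    show "(\<lambda>x. inverse (w x)) \<in> L1loc" using assms(9) by (simp add: L1loc_def)
    show "(\<lambda>x. l x / w x) \<in> L1loc"
    proof -
      obtain F where F: "l = (\<lambda>x. w x * F x)" "F \<in> Lp_loc 1 \<mu>" using l(2) by (auto simp: times_space_def)
      have "(\<lambda>x. l x / w x) = F" using wp by (auto simp: F(1) fun_eq_iff less_imp_neq[THEN not_sym])
      then show ?thesis using F(2) by (simp add: L1loc_def)
    qed
    fix j assume j: "j < \<nu>"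
    show "wd (X j) w (h j)" using h j by auto
    obtain F where F: "h j = (\<lambda>x. sqrt (w x) * F x)" "F \<in> Lp_loc 2 \<mu>" using h j by (auto simp: times_space_def)
    have "(h j x)\<^sup>2 / w x = (F x)\<^sup>2" for x using wp[of x] by (simp add: F(1) power_mult_distrib)
    then show "(\<lambda>x. (h j x)\<^sup>2 / w x) \<in> L1loc" using sq[OF F(2)] by simp
    obtain F where F: "h j = (\<lambda>x. w x * F x)" "F \<in> Lp_loc 2 \<mu>" using h j by (auto simp: times_space_def)
    have "(h j x / w x)\<^sup>2 = (F x)\<^sup>2" for x using wp[of x] by (simp add: F(1))
    then show "(\<lambda>x. (h j x / w x)\<^sup>2) \<in> L1loc" using sq[OF F(2)] by simp
  qed (use Xl wp l in auto)
  \<comment> \<open>\<open>V\<close> is built from representatives picked by the choice operator.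
    They represent the same distributions as \<open>h\<close> and \<open>l\<close>, and uniqueness
    makes \<open>V\<close> equal to \<open>pot\<close> almost everywhere.\<close>
  have wds: "wd (X j) w (weak_deriv G A \<mu> \<delta> (X j) w)" if "j < \<nu>" for j
    unfolding weak_deriv_def by (rule someI[of _ "h j"]) (rule wd_w[OF that])
  have ls: "has_weak_laplacian G A \<mu> \<delta> \<nu> X w (weak_laplacian G A \<mu> \<delta> \<nu> X w)"
    unfolding weak_laplacian_def by (rule someI[of _ l]) (rule l(1))
  have Vm: "V \<in> borel_measurable \<mu>"
  proof -
    have [measurable]: "weak_laplacian G A \<mu> \<delta> \<nu> X w \<in> borel_measurable \<mu>"
      using ls L1locD(1) by (auto simp: weak_laplacian_iff)
    have [measurable]: "(\<lambda>x. \<Sum>j<\<nu>. \<bar>weak_deriv G A \<mu> \<delta> (X j) w x\<bar>\<^sup>2) \<in> borel_measurable \<mu>"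
      by (intro borel_measurable_sum borel_measurable_power borel_measurable_abs) (use wds L1locD(1) in \<open>auto simp: wd_iff\<close>)
    show ?thesis unfolding assms(12) potential_def by measurable
  qed
  have "AE x in \<mu>. \<forall>j\<in>{..<\<nu>}. weak_deriv G A \<mu> \<delta> (X j) w x = h j x"
    by (rule AE_finite_allI) (use wd_unique[OF wds wd_w] in auto)
  moreover have "AE x in \<mu>. weak_laplacian G A \<mu> \<delta> \<nu> X w x = l x"
    by (rule weak_laplacian_unique[OF ls l(1)])
  ultimately have Vp: "AE x in \<mu>. V x = pot x"
  proof eventually_elim
    case (elim x)
    have "(\<Sum>j<\<nu>. \<bar>weak_deriv G A \<mu> \<delta> (X j) w x\<bar>\<^sup>2) = (\<Sum>j<\<nu>. (h j x)\<^sup>2)"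
      by (rule sum.cong) (use elim(1) in auto)
    also have "\<dots> = (w x)\<^sup>2 * qq x"
      using wp[of x] by (simp add: qq_def q_def sum_distrib_left power_divide)
    finally show ?case using wp[of x] elim(2)
      unfolding assms(12) potential_def pot_def lv_def by (simp add: field_simps)
  qed
  interpret weighted_pot G A \<mu> \<delta> \<nu> X w l h m
  proof unfold_locales
    show "AE x in \<mu>. pot x \<ge> - m + 1" using assms(14) Vp by eventually_elim simp
  qed (use assms(13) in auto)
  show ?thesis
    using image_Dom[OF Vm Vp] AE_weighted_iff norms_preserved[OF Vm Vp] forms_intertwined[OF Vm Vp] by blast
qed

end
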